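(* Let $s,\sigma>0$ be such that $s+\sigma\ge1$, and let $t\in\mathbf R$. If $a\in\Gamma_{s,\sigma;0}^{\sigma,s}(\mathbf R^{2d})$, then $\operatorname{Op}_{\mathrm{BJ}}(a)=\operatorname{Op}_t(b)$ for some $b\in\Gamma_{s,\sigma;0}^{\sigma,s}(\mathbf R^{2d})$. If in addition $(s,\sigma)\ne(\frac12,\frac12)$, then the same holds true with $\Gamma_{s,\sigma}^{\sigma,s;0}(\mathbf R^{2d})$ or $\Gamma_{s,\sigma;0}^{\sigma,s;0}(\mathbf R^{2d})$ in place of $\Gamma_{s,\sigma;0}^{\sigma,s}(\mathbf R^{2d})$ at each occurrence.
   Context: Gelfand-Shilov spaces: $\mathcal S_s^\sigma(\mathbf R^d)$ (respectively $\Sigma_s^\sigma(\mathbf R^d)$) consists of all $f\in C^\infty(\mathbf R^d)$ with $\sup_{\alpha,\beta,x}\frac{|x^\alpha\partial^\beta f(x)|}{h^{|\alpha+\beta|}\alpha!^s\beta!^\sigma}<\infty$ for some $h>0$ (respectively every $h>0$), with the inductive (respectively projective) limit topology. The space $\mathcal S_{s,\sigma}^{\sigma,s}(\mathbf R^{2d})$ (respectively $\Sigma_{s,\sigma}^{\sigma,s}(\mathbf R^{2d})$) consists of all $F\in C^\infty(\mathbf R^{2d})$ with $|x^{\alpha_1}\xi^{\alpha_2}\partial_x^{\beta_1}\partial_\xi^{\beta_2}F(x,\xi)|\le Ch^{|\alpha_1+\beta_1|+|\alpha_2+\beta_2|}\alpha_1!^s\alpha_2!^\sigma\beta_1!^\sigma\beta_2!^s$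 for some $C,h>0$ (respectively for every $h>0$ and some $C=C_h$). Duals are denoted by a prime. Symbol classes: for $h,r>0$ and $f\in C^\infty(\mathbf R^{2d})$ let $$\|f\|_{(h,r)}=\sup\frac{|\partial_x^{\alpha_1}\partial_\xi^{\alpha_2}f(x,\xi)|}{h^{|\alpha_1+\alpha_2|}\alpha_1!^{\sigma}\alpha_2!^{s}e^{r(|x|^{1/s}+|\xi|^{1/\sigma})}},$$ the supremum being over all $\alpha_1,\alpha_2\in\mathbf N^d$ and $x,\xi\in\mathbf R^d$. Then $\Gamma_{s,\sigma;0}^{\sigma,s}(\mathbf R^{2d})$ is the set of $f$ such that for some $h>0$, $\|f\|_{(h,r)}<\infty$ for every $r>0$; $\Gamma_{s,\sigma}^{\sigma,s;0}(\mathbf R^{2d})$ is the set of $f$ such that for some $r>0$, $\|f\|_{(h,r)}<\infty$ for every $h>0$; $\Gamma_{s,\sigma;0}^{\sigma,s;0}(\mathbf R^{2d})$ is the set of $f$ such that $\|f\|_{(h,r)}<\infty$ for every $h,r>0$. Operators: $W_t(f,\phi)(x,\xi)=(2\pi)^{-d/2}\int_{\mathbf R^d}f(x+ty)\overline{\phi(x-(1-t)y)}e^{-i\langle y,\xi\rangle}\,dy$ and $W_{\mathrm{BJ}}(f,\phi)=\int_0^1W_t(f,\phi)\,dt$. For $a\in(\mathcal S_{s,\sigma}^{\sigma,s})'(\mathbf R^{2d})$ (respectively $(\Sigma_{s,\sigma}^{\sigma,s})'(\mathbf R^{2d})$), $\operatorname{Op}_t(a)$ and $\operatorname{Op}_{\mathrm{BJ}}(a)$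 are the operators from $\mathcal S_s^\sigma(\mathbf R^d)$ to $(\mathcal S_s^\sigma)'(\mathbf R^d)$ (respectively $\Sigma_s^\sigma$ to $(\Sigma_s^\sigma)'$) with $(\operatorname{Op}_t(a)f,g)=(2\pi)^{-d/2}(a,W_t(g,f))$ and $(\operatorname{Op}_{\mathrm{BJ}}(a)f,g)=(2\pi)^{-d/2}(a,W_{\mathrm{BJ}}(g,f))$ for test functions $f,g$, where $(\cdot,\cdot)$ is the extension of the $L^2$ scalar product; formally $\operatorname{Op}_t(a)f(x)=(2\pi)^{-d}\iint a((1-t)x+ty,\xi)f(y)e^{i\langle x-y,\xi\rangle}\,dy\,d\xi$ and $\operatorname{Op}_{\mathrm{BJ}}(a)=\int_0^1\operatorname{Op}_t(a)\,dt$. *)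

theory Defs
  imports "HOL-Analysis.Analysis"
begin

section \<open>Multi-indices, partial derivatives, smooth functions\<close>

text \<open>
  \<open>\<real>\<^sup>d\<close> is \<open>real ^ 'd\<close> with \<open>d = CARD('d)\<close>, the phase space has points
  \<open>(x, \<xi>)\<close> of type \<open>(real ^ 'd) \<times> (real ^ 'd)\<close>, and a multi-index in \<open>\<nat>\<^sup>d\<close> is a function \<open>'d \<Rightarrow> nat\<close>.
\<close>

definition mabs :: "('d::finite \<Rightarrow> nat) \<Rightarrow> nat" where
  "mabs \<alpha> = (\<Sum>i\<in>UNIV. \<alpha> i)"

definition mfact :: "('d::finite \<Rightarrow> nat) \<Rightarrow> real" where
  "mfact \<alpha> = (\<Prod>i\<in>UNIV. fact (\<alpha> i))"

definition mpow :: "real ^ 'd::finite \<Rightarrow> ('d \<Rightarrow> nat) \<Rightarrow> real" where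
  "mpow x \<alpha> = (\<Prod>i\<in>UNIV. (x $ i) ^ \<alpha> i)"

definition dir_deriv :: "'v::euclidean_space \<Rightarrow> ('v \<Rightarrow> complex) \<Rightarrow> 'v \<Rightarrow> complex" where
  "dir_deriv v f = (\<lambda>x. vector_derivative (\<lambda>\<tau>. f (x + \<tau> *\<^sub>R v)) (at 0))"

text \<open>
  \<open>f \<in> C\<^sup>\<infinity>\<close>: all iterated partial derivatives, in any order, exist and are continuous.
\<close>

definition smooth :: "('v::euclidean_space \<Rightarrow> complex) \<Rightarrow> bool" where
  "smooth f \<longleftrightarrow> (\<forall>bs. set bs \<subseteq> Basis \<longrightarrow>
     continuous_on UNIV (foldr dir_deriv bs f) \<and>
     (\<forall>b\<in>Basis. \<forall>x. (\<lambda>\<tau>::real. foldr dir_deriv bs f (x + \<tau> *\<^sub>R b)) differentiable (at 0)))"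

text \<open>
  The derivative of multi-order \<open>\<alpha>\<close> along the directions \<open>e i\<close>. The index type carries no
  order, so the one-dimensional derivatives are applied along an arbitrary enumeration of it;
  by symmetry of mixed partial derivatives the enumeration does not matter for smooth functions,
  which are the only ones it is used for below.
\<close>

definition index_list :: "'d::finite list" where
  "index_list = (SOME is. distinct is \<and> set is = UNIV)"

definition multi_deriv ::
  "('d::finite \<Rightarrow> 'v::euclidean_space) \<Rightarrow> ('d \<Rightarrow> nat) \<Rightarrow> ('v \<Rightarrow> complex) \<Rightarrow> 'v \<Rightarrow> complex" where
  "multi_deriv e \<alpha> f = foldr (\<lambda>i. dir_deriv (e i) ^^ \<alpha> i) index_list f"

definition pderivs :: "('d::finite \<Rightarrow> nat) \<Rightarrow> (real ^ 'd \<Rightarrow> complex) \<Rightarrow> real ^ 'd \<Rightarrow> complex" where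
  "pderivs = multi_deriv (\<lambda>i. axis i 1)"

definition pderivs_x ::
  "('d::finite \<Rightarrow> nat) \<Rightarrow> ((real ^ 'd) \<times> (real ^ 'd) \<Rightarrow> complex) \<Rightarrow> (real ^ 'd) \<times> (real ^ 'd) \<Rightarrow> complex" where
  "pderivs_x = multi_deriv (\<lambda>i. (axis i 1, 0))"

definition pderivs_xi ::
  "('d::finite \<Rightarrow> nat) \<Rightarrow> ((real ^ 'd) \<times> (real ^ 'd) \<Rightarrow> complex) \<Rightarrow> (real ^ 'd) \<times> (real ^ 'd) \<Rightarrow> complex" where
  "pderivs_xi = multi_deriv (\<lambda>i. (0, axis i 1))"


section \<open>Gelfand-Shilov spaces\<close>

definition gs_norm :: "real \<Rightarrow> real \<Rightarrow> real \<Rightarrow> (real ^ 'd::finite \<Rightarrow> complex) \<Rightarrow> ennreal" where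
  "gs_norm s \<sigma> h f = (SUP (\<alpha>, \<beta>, x) \<in> UNIV.
     ennreal (cmod (of_real (mpow x \<alpha>) * pderivs \<beta> f x) /
       (h ^ (mabs \<alpha> + mabs \<beta>) * mfact \<alpha> powr s * mfact \<beta> powr \<sigma>)))"

definition GS_S :: "real \<Rightarrow> real \<Rightarrow> (real ^ 'd::finite \<Rightarrow> complex) set" where
  "GS_S s \<sigma> = {f. smooth f \<and> (\<exists>h>0. gs_norm s \<sigma> h f < \<infinity>)}"

definition GS_Sigma :: "real \<Rightarrow> real \<Rightarrow> (real ^ 'd::finite \<Rightarrow> complex) set" where
  "GS_Sigma s \<sigma> = {f. smooth f \<and> (\<forall>h>0. gs_norm s \<sigma> h f < \<infinity>)}"


section \<open>Symbol classes\<close>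

definition symb_norm ::
  "real \<Rightarrow> real \<Rightarrow> real \<Rightarrow> real \<Rightarrow> ((real ^ 'd::finite) \<times> (real ^ 'd) \<Rightarrow> complex) \<Rightarrow> ennreal" where
  "symb_norm s \<sigma> h r f = (SUP (\<alpha>\<^sub>1, \<alpha>\<^sub>2, x, \<xi>) \<in> UNIV.
     ennreal (cmod (pderivs_x \<alpha>\<^sub>1 (pderivs_xi \<alpha>\<^sub>2 f) (x, \<xi>)) /
       (h ^ (mabs \<alpha>\<^sub>1 + mabs \<alpha>\<^sub>2) * mfact \<alpha>\<^sub>1 powr \<sigma> * mfact \<alpha>\<^sub>2 powr s *
        exp (r * (norm x powr (1 / s) + norm \<xi> powr (1 / \<sigma>))))))"

text \<open>
  The three classes \<open>\<Gamma>\<close>: with a lower index 0 only, an upper index 0 only, and both.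
\<close>

definition Gamma_lower :: "real \<Rightarrow> real \<Rightarrow> ((real ^ 'd::finite) \<times> (real ^ 'd) \<Rightarrow> complex) set" where
  "Gamma_lower s \<sigma> = {f. smooth f \<and> (\<exists>h>0. \<forall>r>0. symb_norm s \<sigma> h r f < \<infinity>)}"

definition Gamma_upper :: "real \<Rightarrow> real \<Rightarrow> ((real ^ 'd::finite) \<times> (real ^ 'd) \<Rightarrow> complex) set" where
  "Gamma_upper s \<sigma> = {f. smooth f \<and> (\<exists>r>0. \<forall>h>0. symb_norm s \<sigma> h r f < \<infinity>)}"

definition Gamma_both :: "real \<Rightarrow> real \<Rightarrow> ((real ^ 'd::finite) \<times> (real ^ 'd) \<Rightarrow> complex) set" where
  "Gamma_both s \<sigma> = {f. smooth f \<and> (\<forall>h>0. \<forall>r>0. symb_norm s \<sigma> h r f < \<infinity>)}"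


section \<open>Wigner distributions and pseudo-differential operators\<close>

definition wigner :: "real \<Rightarrow> (real ^ 'd::finite \<Rightarrow> complex) \<Rightarrow> (real ^ 'd \<Rightarrow> complex) \<Rightarrow>
    (real ^ 'd) \<times> (real ^ 'd) \<Rightarrow> complex" where
  "wigner t f \<phi> = (\<lambda>(x, \<xi>).
     of_real ((2 * pi) powr (- (real CARD('d) / 2))) *
     (LINT y|lborel. f (x + t *\<^sub>R y) * cnj (\<phi> (x - (1 - t) *\<^sub>R y)) * exp (- \<i> * of_real (y \<bullet> \<xi>))))"

definition wigner_BJ :: "(real ^ 'd::finite \<Rightarrow> complex) \<Rightarrow> (real ^ 'd \<Rightarrow> complex) \<Rightarrow>
    (real ^ 'd) \<times> (real ^ 'd) \<Rightarrow> complex" where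
  "wigner_BJ f \<phi> = (\<lambda>z. LINT t:{0..1}|lborel. wigner t f \<phi> z)"

text \<open>
  Distributions are functionals \<open>\<phi> \<mapsto> (u, \<phi>)\<close>, conjugate linear in the test function because
  \<open>(\<cdot>,\<cdot>)\<close> extends the \<open>L\<^sup>2\<close> scalar product. A function \<open>a\<close> is identified with the functional
  \<open>\<phi> \<mapsto> \<integral> a \<phi>\<^sup>*\<close> (\<open>\<phi>\<^sup>*\<close> the complex conjugate).
\<close>

definition distribution_of :: "('v::euclidean_space \<Rightarrow> complex) \<Rightarrow> ('v \<Rightarrow> complex) \<Rightarrow> complex" where
  "distribution_of a \<phi> = (LINT z|lborel. a z * cnj (\<phi> z))"

text \<open>
  \<open>V\<close> is the space of test functions on \<open>\<real>\<^sup>d\<close>. The operators send \<open>f \<in> V\<close> to the functional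
  \<open>g \<mapsto> (Op(u) f, g)\<close> on \<open>V\<close>; \<open>restrict\<close> makes equality of operators mean equality for all
  \<open>f, g \<in> V\<close>.
\<close>

definition Op :: "(real ^ 'd::finite \<Rightarrow> complex) set \<Rightarrow> real \<Rightarrow>
    (((real ^ 'd) \<times> (real ^ 'd) \<Rightarrow> complex) \<Rightarrow> complex) \<Rightarrow>
    (real ^ 'd \<Rightarrow> complex) \<Rightarrow> (real ^ 'd \<Rightarrow> complex) \<Rightarrow> complex" where
  "Op V t u = (\<lambda>f\<in>V. \<lambda>g\<in>V.
     of_real ((2 * pi) powr (- (real CARD('d) / 2))) * u (wigner t g f))"

definition Op_BJ :: "(real ^ 'd::finite \<Rightarrow> complex) set \<Rightarrow>
    (((real ^ 'd) \<times> (real ^ 'd) \<Rightarrow> complex) \<Rightarrow> complex) \<Rightarrow>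
    (real ^ 'd \<Rightarrow> complex) \<Rightarrow> (real ^ 'd \<Rightarrow> complex) \<Rightarrow> complex" where
  "Op_BJ V u = (\<lambda>f\<in>V. \<lambda>g\<in>V.
     of_real ((2 * pi) powr (- (real CARD('d) / 2))) * u (wigner_BJ g f))"

end

theory Submission
  imports Defs "HOL-Library.Multiset" "HOL-Probability.Characteristic_Functions" "HOL-Probability.Sinc_Integral"
    "HOL-Complex_Analysis.Cauchy_Integral_Formula"
begin

text \<open>
  Formally \<open>Op\<^sub>\<tau>(a) = Op\<^sub>t(exp (i (\<tau> - t) \<langle>D\<^sub>x, D\<^sub>\<xi>\<rangle>) a)\<close>, so \<open>b\<close> is the average of \<open>exp (i (\<tau> - t) \<langle>D\<^sub>x, D\<^sub>\<xi>\<rangle>) a\<close> over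
  \<open>0 \<le> \<tau> \<le> 1\<close>. The multiplier is made absolutely convergent with a Gelfand--Shilov window \<open>\<phi>\<close> of integral 1:
  regularity of \<open>a\<close> in \<open>\<xi>\<close> and \<open>x\<close> turns into subexponential decay in the two integration variables, which beats
  the growth of \<open>a\<close> because either the growth rate is arbitrarily small (lower index 0) or the scale of \<open>a\<close> and of
  the window is (upper index 0). The multiplier commutes with translations, hence with derivatives, so bounds
  on its values give the symbol estimates. The identity of operators is dual to
  Fubini and Fourier inversion in the Wigner distribution. Windows are built from the entire function
  \<open>\<Prod>\<^sub>k (1 - sin\<^sup>n (z / k\<^sup>1\<^sup>/\<^sup>p))\<close>. They exist at every scale if \<open>s + \<sigma> > 1\<close>; at \<open>s + \<sigma> = 1\<close> the projective space
  contains only \<open>0\<close>, and the upper class needs no window.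
\<close>

section \<open>Directional derivatives\<close>

text \<open>Formally the multiplier at 0 is (2 pi)^(-d) times the integral of v (\<mu> y, \<zeta>)
  exp (- i <y, \<zeta>>) over y and \<zeta>. Writing \<zeta> = w + \<eta> and inserting \<phi>
  \<eta>, whose integral is 1, splits \<zeta> into a localised variable \<eta> and a free centre w.
  The \<eta>-integral gives decay in y, and then the y-integral gives decay in w. In the second step
  a derivative in y also falls on the inner kernel and brings down powers of \<eta>, so a window
  must bound \<eta>^l \<phi> by the factor l!^\<sigma> that l derivatives of the symbol in x carry.

  The indices may lie below 1, where functions of the given regularity are analytic and no compactly
  supported window exists; this forces the construction by entire functions.

  Differentiability of the averaged symbol does not come from differentiating under nested
  integrals. The first-order Taylor remainder of a symbol satisfies the same kind of bounds with a
  constant of order \<epsilon>^2, so linearity and one uniform bound suffice.\<close>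

definition has_dd :: "'v::euclidean_space \<Rightarrow> ('v \<Rightarrow> complex) \<Rightarrow> ('v \<Rightarrow> complex) \<Rightarrow> bool" where
  "has_dd e F F' \<longleftrightarrow> (\<forall>x. ((\<lambda>\<tau>. F (x + \<tau> *\<^sub>R e)) has_vector_derivative F' x) (at 0))"

text \<open>\<open>has_dd\<close> records derivatives at parameter 0 only, but at every base point;
  sliding the base point along the line gives the derivative at every parameter, as the mean value
  theorem and the fundamental theorem of calculus require.\<close>

lemma has_dd_line:
  assumes "has_dd e F F'"
  shows "((\<lambda>\<tau>. F (x + \<tau> *\<^sub>R e)) has_vector_derivative F' (x + t *\<^sub>R e)) (at t)"
proof -
  have "((\<lambda>\<tau>. F (x + t *\<^sub>R e + \<tau> *\<^sub>R e)) has_vector_derivative F' (x + t *\<^sub>R e)) (at (t - t))"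
    using assms unfolding has_dd_def by simp
  moreover have "((\<lambda>\<tau>. \<tau> - t) has_vector_derivative 1) (at t)"
    by (auto intro!: derivative_eq_intros)
  ultimately have "((\<lambda>\<tau>. F (x + t *\<^sub>R e + \<tau> *\<^sub>R e)) \<circ> (\<lambda>\<tau>. \<tau> - t) has_vector_derivative 1 *\<^sub>R F' (x + t *\<^sub>R e)) (at t)"
    using vector_diff_chain_at by blast
  then show ?thesis by (simp add: o_def algebra_simps)
qed

text \<open>\<open>dir_deriv\<close> is total and certifies no existence. The calculus below
  therefore works with the relation \<open>has_dd\<close> and returns to \<open>dir_deriv\<close>
  through this lemma.\<close>

lemma has_dd_dir_deriv: "has_dd e F F' \<Longrightarrow> dir_deriv e F = F'"
  unfolding has_dd_def dir_deriv_def by (auto intro: vector_derivative_at)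

lemma smooth_has_dd:
  assumes "smooth f" "e \<in> Basis"
  shows "has_dd e f (dir_deriv e f)"
proof -
  have "(\<lambda>\<tau>::real. f (x + \<tau> *\<^sub>R e)) differentiable (at 0)" for x
    using assms unfolding smooth_def by (auto dest!: spec[of _ "[]"])
  from this[THEN vector_derivative_works[THEN iffD1]] show ?thesis
    unfolding has_dd_def dir_deriv_def by blast
qed

lemma smooth_dir_deriv:
  assumes "smooth f" "e \<in> Basis"
  shows "smooth (dir_deriv e f)"
  unfolding smooth_def
proof (intro allI impI)
  fix bs assume "set bs \<subseteq> (Basis :: 'a set)"
  then show "continuous_on UNIV (foldr dir_deriv bs (dir_deriv e f)) \<and>
     (\<forall>b\<in>Basis. \<forall>x. (\<lambda>\<tau>::real. foldr dir_deriv bs (dir_deriv e f) (x + \<tau> *\<^sub>R b)) differentiable (at 0))"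
    using assms unfolding smooth_def by (auto dest!: spec[of _ "bs @ [e]"])
qed

lemma smooth_continuous: "smooth f \<Longrightarrow> continuous_on UNIV f"
  unfolding smooth_def by (auto dest!: spec[of _ "[]"])

lemma smooth_foldr: "smooth f \<Longrightarrow> set bs \<subseteq> Basis \<Longrightarrow> smooth (foldr dir_deriv bs f)"
  by (induction bs) (auto intro: smooth_dir_deriv)

text \<open>Smoothness is coinductive: in a set of continuous functions closed under derivatives
  along basis vectors, iterated derivatives never leave the set. The set will consist of translates,
  of linear combinations, and finally of the averaged symbols of a whole class.\<close>

lemma smooth_coinduct:
  assumes f: "f \<in> \<C>"
    and cont: "\<And>u. u \<in> \<C> \<Longrightarrow> continuous_on UNIV u"
    and dd: "\<And>u b. u \<in> \<C> \<Longrightarrow> b \<in> Basis \<Longrightarrow> \<exists>u'\<in>\<C>. has_dd b u u'"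
  shows "smooth f"
proof -
  have closed: "foldr dir_deriv bs f \<in> \<C>" if "set bs \<subseteq> Basis" for bs
    using that
  proof (induction bs)
    case (Cons b bs)
    then obtain u' where "u' \<in> \<C>" "has_dd b (foldr dir_deriv bs f) u'"
      using dd[of "foldr dir_deriv bs f" b] by auto
    then show ?case using has_dd_dir_deriv by auto
  qed (use f in auto)
  show ?thesis unfolding smooth_def
  proof (intro allI impI conjI ballI)
    fix bs assume bs: "set bs \<subseteq> (Basis :: 'a set)"
    show "continuous_on UNIV (foldr dir_deriv bs f)" using cont closed bs by blast
    fix b x assume "b \<in> (Basis :: 'a set)"
    then obtain u' where "has_dd b (foldr dir_deriv bs f) u'" using dd closed bs by blast
    then show "(\<lambda>\<tau>. foldr dir_deriv bs f (x + \<tau> *\<^sub>R b)) differentiable at 0"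
      unfolding has_dd_def by (meson differentiableI_vector)
  qed
qed

lemma has_dd_mult:
  assumes "has_dd e F F'" "has_dd e G G'"
  shows "has_dd e (\<lambda>x. F x * G x) (\<lambda>x. F' x * G x + F x * G' x)"
  unfolding has_dd_def
proof
  fix x
  show "((\<lambda>\<tau>. F (x + \<tau> *\<^sub>R e) * G (x + \<tau> *\<^sub>R e)) has_vector_derivative F' x * G x + F x * G' x) (at 0)"
    using has_vector_derivative_mult[OF assms[unfolded has_dd_def, THEN spec, of x]]
    by (simp add: add.commute)
qed

lemma has_dd_add:
  assumes "has_dd e F F'" "has_dd e G G'"
  shows "has_dd e (\<lambda>x. F x + G x) (\<lambda>x. F' x + G' x)"
  unfolding has_dd_def
  by (rule allI, rule has_vector_derivative_add) (rule assms[unfolded has_dd_def, THEN spec])+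

lemma has_dd_cmult:
  assumes "has_dd e F F'"
  shows "has_dd e (\<lambda>x. c * F x) (\<lambda>x. c * F' x)"
  unfolding has_dd_def
  by (rule allI, rule has_vector_derivative_mult_right) (rule assms[unfolded has_dd_def, THEN spec])

lemma has_dd_translate:
  assumes "has_dd e F F'"
  shows "has_dd e (\<lambda>x. F (a + x)) (\<lambda>x. F' (a + x))"
  using assms unfolding has_dd_def by (simp add: add.assoc[symmetric])

lemma has_dd_cnj:
  assumes "has_dd e F F'"
  shows "has_dd e (\<lambda>x. cnj (F x)) (\<lambda>x. cnj (F' x))"
  unfolding has_dd_def
  by (rule allI, rule has_vector_derivative_cnj) (rule assms[unfolded has_dd_def, THEN spec])

text \<open>Chain rule for a map \<open>A\<close> that carries lines in direction \<open>e\<close>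
  to lines in direction \<open>e'\<close> at speed \<open>c\<close>. \<open>A\<close> may change the
  space, as for slices through phase space.\<close>

lemma has_dd_scale:
  assumes "has_dd e' F F'" "\<And>x. A (x + e) = A x + c *\<^sub>R e'" "\<And>x \<tau>. A (x + \<tau> *\<^sub>R e) = A x + (\<tau> * c) *\<^sub>R e'"
  shows "has_dd e (\<lambda>x. F (A x)) (\<lambda>x. c *\<^sub>R F' (A x))"
  unfolding has_dd_def
proof
  fix x
  have "((\<lambda>\<tau>. F (A x + \<tau> *\<^sub>R e')) has_vector_derivative F' (A x)) (at (0 * c))"
    using assms(1) unfolding has_dd_def by simp
  moreover have "((\<lambda>\<tau>. \<tau> * c) has_vector_derivative c) (at 0)"
    by (auto intro!: derivative_eq_intros)
  ultimately have "((\<lambda>\<tau>. F (A x + \<tau> *\<^sub>R e')) \<circ> (\<lambda>\<tau>. \<tau> * c) has_vector_derivative c *\<^sub>R F' (A x)) (at 0)"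
    using vector_diff_chain_at by blast
  then show "((\<lambda>\<tau>. F (A (x + \<tau> *\<^sub>R e))) has_vector_derivative c *\<^sub>R F' (A x)) (at 0)"
    by (simp add: o_def assms(3))
qed

lemma smooth_translate:
  fixes u :: "'v::euclidean_space \<Rightarrow> complex"
  assumes "smooth u" shows "smooth (\<lambda>z. u (a + z))"
proof (rule smooth_coinduct[where \<C> = "{\<lambda>z. u (a + z) |u. smooth u}"])
  show "(\<lambda>z. u (a + z)) \<in> {\<lambda>z. u (a + z) |u. smooth u}" using assms by auto
next
  fix v assume "v \<in> {\<lambda>z. u (a + z) |u. smooth u}"
  then obtain w where w: "v = (\<lambda>z. w (a + z))" "smooth w" by auto
  show "continuous_on UNIV v"
    unfolding w by (rule continuous_on_compose2[OF smooth_continuous[OF w(2)]]) (auto intro!: continuous_intros)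
  fix b :: 'v assume b: "b \<in> Basis"
  show "\<exists>u'\<in>{\<lambda>z. u (a + z) |u. smooth u}. has_dd b v u'"
    unfolding w using has_dd_translate[OF smooth_has_dd[OF w(2) b]] smooth_dir_deriv[OF w(2) b] by blast
qed

lemma smooth_lincomb:
  fixes u v :: "'v::euclidean_space \<Rightarrow> complex"
  assumes "smooth u" "smooth v" shows "smooth (\<lambda>z. u z + c * v z)"
proof (rule smooth_coinduct[where \<C> = "{\<lambda>z. u z + c * v z |u v. smooth u \<and> smooth v}"])
  show "(\<lambda>z. u z + c * v z) \<in> {\<lambda>z. u z + c * v z |u v. smooth u \<and> smooth v}" using assms by auto
next
  fix f :: "'v \<Rightarrow> complex" assume "f \<in> {\<lambda>z. u z + c * v z |u v. smooth u \<and> smooth v}"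
  then obtain u v where w: "f = (\<lambda>z. u z + c * v z)" "smooth u" "smooth v" by auto
  show "continuous_on UNIV f"
    unfolding w using smooth_continuous[OF w(2)] smooth_continuous[OF w(3)] by (auto intro!: continuous_intros)
  fix b :: 'v assume b: "b \<in> Basis"
  show "\<exists>u'\<in>{\<lambda>z. u z + c * v z |u v. smooth u \<and> smooth v}. has_dd b f u'"
    unfolding w using smooth_dir_deriv[OF w(2) b] smooth_dir_deriv[OF w(3) b]
      has_dd_add[OF smooth_has_dd[OF w(2) b] has_dd_cmult[OF smooth_has_dd[OF w(3) b]]] by blast
qed

lemma foldr_dir_deriv_translate:
  assumes "smooth u" "set bs \<subseteq> Basis"
  shows "foldr dir_deriv bs (\<lambda>z. u (a + z)) = (\<lambda>z. foldr dir_deriv bs u (a + z))"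
  using assms(2)
  by (induction bs) (auto intro!: has_dd_dir_deriv has_dd_translate smooth_has_dd smooth_foldr assms(1))

lemma foldr_dir_deriv_lincomb:
  assumes "smooth u" "smooth v" "set bs \<subseteq> Basis"
  shows "foldr dir_deriv bs (\<lambda>z. u z + c * v z) = (\<lambda>z. foldr dir_deriv bs u z + c * foldr dir_deriv bs v z)"
  using assms(3)
  by (induction bs) (auto intro!: has_dd_dir_deriv has_dd_add has_dd_cmult smooth_has_dd smooth_foldr assms(1,2))

section \<open>Symmetry of mixed partial derivatives\<close>

text \<open>The second difference quotient attains the values of both mixed derivatives nearby.\<close>

lemma second_difference_mean_value:
  fixes f :: "'v::euclidean_space \<Rightarrow> complex"
  assumes "smooth f" "a \<in> Basis" "b \<in> Basis" "h > 0"
  shows "\<exists>p\<in>{0..h}. \<exists>q\<in>{0..h}.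
    Re (c * (f (x + h *\<^sub>R a + h *\<^sub>R b) - f (x + h *\<^sub>R a) - f (x + h *\<^sub>R b) + f x)) =
    h * h * Re (c * dir_deriv b (dir_deriv a f) (x + p *\<^sub>R a + q *\<^sub>R b))"
proof -
  let ?fa = "dir_deriv a f" and ?fba = "dir_deriv b (dir_deriv a f)"
  have da: "has_dd a f ?fa" and dba: "has_dd b ?fa ?fba"
    using assms smooth_has_dd smooth_dir_deriv by blast+
  \<comment> \<open>The mean value theorem fails for complex values. Multiplying by \<open>c\<close>
    and taking real parts makes it scalar; \<open>c = 1\<close> and \<open>c = \<i>\<close> later
    recover both components.\<close>
  have reder: "((\<lambda>\<tau>. Re (c * F (z + \<tau> *\<^sub>R e))) has_real_derivative Re (c * F' (z + t *\<^sub>R e))) (at t)"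
    if "has_dd e F F'" for e F F' z t
  proof -
    have "((\<lambda>\<tau>. c * F (z + \<tau> *\<^sub>R e)) has_vector_derivative c * F' (z + t *\<^sub>R e)) (at t)"
      by (intro has_vector_derivative_mult_right has_dd_line that)
    then have "((\<lambda>\<tau>. Re (c * F (z + \<tau> *\<^sub>R e))) has_vector_derivative Re (c * F' (z + t *\<^sub>R e))) (at t)"
      by (rule bounded_linear.has_vector_derivative[OF bounded_linear_Re])
    then show ?thesis by (simp add: has_real_derivative_iff_has_vector_derivative)
  qed
  have d1: "((\<lambda>\<tau>. Re (c * f ((x + h *\<^sub>R b) + \<tau> *\<^sub>R a)) - Re (c * f (x + \<tau> *\<^sub>R a))) has_real_derivative
       (Re (c * ?fa ((x + h *\<^sub>R b) + t *\<^sub>R a)) - Re (c * ?fa (x + t *\<^sub>R a)))) (at t)" for t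
    by (intro DERIV_diff reder da)
  from MVT2[OF assms(4), OF d1] obtain p where p: "0 < p" "p < h"
    "(Re (c * f ((x + h *\<^sub>R b) + h *\<^sub>R a)) - Re (c * f (x + h *\<^sub>R a))) - (Re (c * f ((x + h *\<^sub>R b) + 0 *\<^sub>R a)) - Re (c * f (x + 0 *\<^sub>R a)))
      = (h - 0) * (Re (c * ?fa ((x + h *\<^sub>R b) + p *\<^sub>R a)) - Re (c * ?fa (x + p *\<^sub>R a)))"
    by blast
  have d2: "((\<lambda>\<tau>. Re (c * ?fa ((x + p *\<^sub>R a) + \<tau> *\<^sub>R b))) has_real_derivative Re (c * ?fba ((x + p *\<^sub>R a) + t *\<^sub>R b))) (at t)" for t
    by (intro reder dba)
  from MVT2[OF assms(4), OF d2] obtain q where q: "0 < q" "q < h"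
    "Re (c * ?fa ((x + p *\<^sub>R a) + h *\<^sub>R b)) - Re (c * ?fa ((x + p *\<^sub>R a) + 0 *\<^sub>R b)) = (h - 0) * Re (c * ?fba ((x + p *\<^sub>R a) + q *\<^sub>R b))"
    by blast
  have "Re (c * (f (x + h *\<^sub>R a + h *\<^sub>R b) - f (x + h *\<^sub>R a) - f (x + h *\<^sub>R b) + f x)) =
     h * (Re (c * ?fa ((x + h *\<^sub>R b) + p *\<^sub>R a)) - Re (c * ?fa (x + p *\<^sub>R a)))"
    using p(3) by (simp add: algebra_simps)
  also have "\<dots> = h * h * Re (c * ?fba (x + p *\<^sub>R a + q *\<^sub>R b))"
    using q(3) by (simp add: ac_simps)
  finally show ?thesis using p(1,2) q(1,2)
    by (intro bexI[of _ p] bexI[of _ q]) auto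
qed

text \<open>The second difference is symmetric in \<open>a\<close> and \<open>b\<close>, so both
  mixed derivatives, each taken at some point within \<open>2 * h\<close> of \<open>x\<close>, have
  equal real parts after multiplication by \<open>c\<close>. Continuity of both lets
  \<open>h\<close> tend to 0.\<close>

lemma dir_deriv_commute:
  fixes f :: "'v::euclidean_space \<Rightarrow> complex"
  assumes f: "smooth f" and ab: "a \<in> Basis" "b \<in> Basis"
  shows "dir_deriv a (dir_deriv b f) = dir_deriv b (dir_deriv a f)"
proof
  fix x
  let ?ab = "dir_deriv a (dir_deriv b f)" and ?ba = "dir_deriv b (dir_deriv a f)"
  have near: "\<exists>y z. norm (y - x) \<le> 2 * h \<and> norm (z - x) \<le> 2 * h \<and> Re (c * ?ba y) = Re (c * ?ab z)"
    if h: "h > 0" for c :: complex and h :: real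
  proof -
    obtain p q where pq: "p \<in> {0..h}" "q \<in> {0..h}"
      "Re (c * (f (x + h *\<^sub>R a + h *\<^sub>R b) - f (x + h *\<^sub>R a) - f (x + h *\<^sub>R b) + f x)) = h * h * Re (c * ?ba (x + p *\<^sub>R a + q *\<^sub>R b))"
      using second_difference_mean_value[OF f ab h] by blast
    obtain p' q' where pq': "p' \<in> {0..h}" "q' \<in> {0..h}"
      "Re (c * (f (x + h *\<^sub>R b + h *\<^sub>R a) - f (x + h *\<^sub>R b) - f (x + h *\<^sub>R a) + f x)) = h * h * Re (c * ?ab (x + p' *\<^sub>R b + q' *\<^sub>R a))"
      using second_difference_mean_value[OF f ab(2,1) h] by blast
    have "h * h * Re (c * ?ba (x + p *\<^sub>R a + q *\<^sub>R b)) = h * h * Re (c * ?ab (x + p' *\<^sub>R b + q' *\<^sub>R a))"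
      unfolding pq(3)[symmetric] pq'(3)[symmetric] by (simp add: algebra_simps)
    then have eq: "Re (c * ?ba (x + p *\<^sub>R a + q *\<^sub>R b)) = Re (c * ?ab (x + p' *\<^sub>R b + q' *\<^sub>R a))"
      using h by simp
    have "norm (r *\<^sub>R a' + s *\<^sub>R b') \<le> 2 * h" if "r \<in> {0..h}" "s \<in> {0..h}" "a' \<in> Basis" "b' \<in> Basis" for r s a' b'
      using norm_triangle_ineq[of "r *\<^sub>R a'" "s *\<^sub>R b'"] that by simp
    from this[OF pq(1,2) ab] this[OF pq'(1,2) ab(2,1)] eq show ?thesis
      by (intro exI[of _ "x + p *\<^sub>R a + q *\<^sub>R b"] exI[of _ "x + p' *\<^sub>R b + q' *\<^sub>R a"] conjI)
        (simp_all only: add.assoc add_diff_cancel_left')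
  qed
  have eq: "Re (c * ?ba x) = Re (c * ?ab x)" for c
  proof -
    have "\<forall>n. \<exists>y z. norm (y - x) \<le> 2 * inverse (Suc n) \<and> norm (z - x) \<le> 2 * inverse (Suc n) \<and> Re (c * ?ba y) = Re (c * ?ab z)"
      using near by simp
    then obtain Y Z where YZ: "\<And>n. norm (Y n - x) \<le> 2 * inverse (Suc n)" "\<And>n. norm (Z n - x) \<le> 2 * inverse (Suc n)"
      "\<And>n. Re (c * ?ba (Y n)) = Re (c * ?ab (Z n))" by metis
    have lim0: "(\<lambda>n. 2 * inverse (real (Suc n))) \<longlonglongrightarrow> 0"
      using tendsto_mult[OF tendsto_const LIMSEQ_inverse_real_of_nat, of 2] by simp
    have Y: "Y \<longlonglongrightarrow> x" and Z: "Z \<longlonglongrightarrow> x"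
      using Lim_null_comparison[OF always_eventually lim0, of "\<lambda>n. Y n - x"]
        Lim_null_comparison[OF always_eventually lim0, of "\<lambda>n. Z n - x"] YZ LIM_zero_cancel by blast+
    have ct: "isCont ?ba x" "isCont ?ab x"
      using smooth_continuous[OF smooth_dir_deriv[OF smooth_dir_deriv]] f ab
      by (auto simp: continuous_on_eq_continuous_at)
    have "(\<lambda>n. Re (c * ?ba (Y n))) \<longlonglongrightarrow> Re (c * ?ba x)" "(\<lambda>n. Re (c * ?ab (Z n))) \<longlonglongrightarrow> Re (c * ?ab x)"
      by (intro tendsto_intros isCont_tendsto_compose[OF ct(1)] isCont_tendsto_compose[OF ct(2)] Y Z)+
    then show ?thesis unfolding YZ(3) by (rule LIMSEQ_unique)
  qed
  show "?ab x = ?ba x"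
    using eq[of 1] eq[of "\<i>"] by (simp add: complex_eq_iff)
qed

lemma foldr_dir_deriv_extract:
  assumes "smooth f" "set bs \<subseteq> Basis" "x \<in> set bs"
  shows "foldr dir_deriv bs f = dir_deriv x (foldr dir_deriv (remove1 x bs) f)"
  using assms(2,3)
proof (induction bs)
  case (Cons b bs)
  show ?case
  proof (cases "b = x")
    case False
    then have "foldr dir_deriv (b # bs) f = dir_deriv b (dir_deriv x (foldr dir_deriv (remove1 x bs) f))"
      using Cons by auto
    also have "\<dots> = dir_deriv x (dir_deriv b (foldr dir_deriv (remove1 x bs) f))"
      using Cons.prems False set_remove1_subset[of x bs]
      by (intro dir_deriv_commute smooth_foldr assms(1)) auto
    finally show ?thesis using False by simp
  qed simp
qed simp

text \<open>Only the multiset of directions matters. All later reorderings of derivatives are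
  reduced to an equality of multisets by this lemma.\<close>

lemma foldr_dir_deriv_mset_cong:
  assumes "smooth f" "set bs \<subseteq> Basis" "mset bs = mset cs"
  shows "foldr dir_deriv bs f = foldr dir_deriv cs f"
  using assms(2,3)
proof (induction cs arbitrary: bs)
  case (Cons c cs)
  then have "c \<in> set bs" by (metis list.set_intros(1) mset_eq_setD)
  moreover have "mset (remove1 c bs) = mset cs" using Cons.prems by simp
  ultimately show ?case
    using Cons foldr_dir_deriv_extract[OF assms(1), of bs c] set_remove1_subset[of c bs] by auto
qed simp

section \<open>Multi-index derivatives as lists of directions\<close>

lemma foldr_replicate_dir_deriv: "foldr dir_deriv (replicate n e) f = (dir_deriv e ^^ n) f"
  by (induction n) auto

text \<open>Flattening a multi-index turns \<open>multi_deriv\<close> into a plain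
  \<open>foldr dir_deriv\<close>, so that concatenation of lists replaces addition of multi-indices
  up to order.\<close>

definition dirs :: "('d::finite \<Rightarrow> 'v) \<Rightarrow> ('d \<Rightarrow> nat) \<Rightarrow> 'v list" where
  "dirs e \<alpha> = concat (map (\<lambda>i. replicate (\<alpha> i) (e i)) index_list)"

lemma index_list: "distinct (index_list :: 'd::finite list)" "set (index_list :: 'd list) = UNIV"
proof -
  have "distinct (index_list :: 'd list) \<and> set (index_list :: 'd list) = UNIV"
    unfolding index_list_def by (rule someI_ex) (use finite_distinct_list[OF finite[of UNIV]] in blast)
  then show "distinct (index_list :: 'd list)" "set (index_list :: 'd list) = UNIV" by auto
qed

lemma multi_deriv_eq_foldr: "multi_deriv e \<alpha> f = foldr dir_deriv (dirs e \<alpha>) f"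
proof -
  have "foldr (\<lambda>i. dir_deriv (e i) ^^ \<alpha> i) is f = foldr dir_deriv (concat (map (\<lambda>i. replicate (\<alpha> i) (e i)) is)) f" for "is"
    by (induction "is") (simp_all add: foldr_replicate_dir_deriv)
  then show ?thesis unfolding multi_deriv_def dirs_def by simp
qed

lemma set_dirs: "set (dirs e \<alpha>) \<subseteq> range e"
  unfolding dirs_def by auto

lemma replicate_mset_add: "replicate_mset (m + n) x = replicate_mset m x + replicate_mset n x"
  by (rule multiset_eqI) simp

lemma mset_dirs_upd:
  "mset (dirs e (\<alpha>(j := \<alpha> j + n))) = replicate_mset n (e j) + mset (dirs e \<alpha>)"
proof -
  have "mset (concat (map (\<lambda>i. replicate ((\<alpha>(j := \<alpha> j + n)) i) (e i)) is)) =
     (if j \<in> set is then replicate_mset n (e j) else {#}) + mset (concat (map (\<lambda>i. replicate (\<alpha> i) (e i)) is))"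
    if "distinct is" for "is"
    using that by (induction "is") (auto simp: replicate_mset_add)
  from this[of index_list] show ?thesis unfolding dirs_def by (simp add: index_list)
qed

abbreviation mderiv :: "('d::finite \<Rightarrow> nat) \<Rightarrow> ('d \<Rightarrow> nat) \<Rightarrow> ((real ^ 'd) \<times> (real ^ 'd) \<Rightarrow> complex) \<Rightarrow> (real ^ 'd) \<times> (real ^ 'd) \<Rightarrow> complex" where
  "mderiv \<alpha> \<beta> f \<equiv> pderivs_x \<alpha> (pderivs_xi \<beta> f)"

abbreviation ex :: "'d::finite \<Rightarrow> (real ^ 'd) \<times> (real ^ 'd)" where "ex j \<equiv> (axis j 1, 0)"
abbreviation exi :: "'d::finite \<Rightarrow> (real ^ 'd) \<times> (real ^ 'd)" where "exi j \<equiv> (0, axis j 1)"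

lemma ex_Basis [simp]: "ex j \<in> Basis" "exi j \<in> Basis"
  by (auto simp: Basis_prod_def axis_in_Basis_iff)

lemma mderiv_eq_foldr: "mderiv \<alpha> \<beta> f = foldr dir_deriv (dirs ex \<alpha> @ dirs exi \<beta>) f"
  unfolding pderivs_x_def pderivs_xi_def multi_deriv_eq_foldr by simp

lemma mderiv_dirs: "set (dirs ex \<alpha> @ dirs exi \<beta>) \<subseteq> Basis"
  using set_dirs[of ex \<alpha>] set_dirs[of exi \<beta>] by auto

text \<open>Integration by parts produces only powers of one x-derivative and one \<xi>-derivative;
  this identifies them among the multi-index derivatives for which symbol estimates are
  stated.\<close>

lemma dir_deriv_powers_mderiv:
  assumes "smooth f"
  shows "(dir_deriv (exi i) ^^ n) ((dir_deriv (ex j) ^^ m) (mderiv \<alpha> \<beta> f)) =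
    mderiv (\<alpha>(j := \<alpha> j + m)) (\<beta>(i := \<beta> i + n)) f"
proof -
  have "(dir_deriv (exi i) ^^ n) ((dir_deriv (ex j) ^^ m) (mderiv \<alpha> \<beta> f)) =
      foldr dir_deriv (replicate n (exi i) @ replicate m (ex j) @ dirs ex \<alpha> @ dirs exi \<beta>) f"
    by (simp add: mderiv_eq_foldr foldr_replicate_dir_deriv)
  also have "\<dots> = mderiv (\<alpha>(j := \<alpha> j + m)) (\<beta>(i := \<beta> i + n)) f"
    unfolding mderiv_eq_foldr using mderiv_dirs[of \<alpha> \<beta>]
    by (intro foldr_dir_deriv_mset_cong assms) (auto simp: mset_dirs_upd)
  finally show ?thesis .
qed

lemma dirs_0: "dirs e (\<lambda>_. 0) = []"
proof -
  have "concat (map (\<lambda>i. replicate 0 (e i)) is) = []" for "is" by (induction "is") auto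
  then show ?thesis unfolding dirs_def .
qed

lemma mderiv_0: "mderiv (\<lambda>_. 0) (\<lambda>_. 0) f = f"
  by (simp add: mderiv_eq_foldr dirs_0)

lemma mderiv_mderiv:
  assumes "smooth f"
  shows "mderiv \<alpha> \<beta> (mderiv \<alpha>' \<beta>' f) = mderiv (\<lambda>i. \<alpha> i + \<alpha>' i) (\<lambda>i. \<beta> i + \<beta>' i) f"
proof -
  have *: "mset (dirs e (\<lambda>i. \<alpha> i + \<alpha>' i)) = mset (dirs e \<alpha>) + mset (dirs e \<alpha>')" for e :: "'a \<Rightarrow> 'v" and \<alpha> \<alpha>'
  proof -
    have "mset (concat (map (\<lambda>i. replicate (\<alpha> i + \<alpha>' i) (e i)) is)) =
      mset (concat (map (\<lambda>i. replicate (\<alpha> i) (e i)) is)) + mset (concat (map (\<lambda>i. replicate (\<alpha>' i) (e i)) is))" for "is"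
      by (induction "is") (auto simp: replicate_mset_add)
    then show ?thesis unfolding dirs_def by auto
  qed
  have "mderiv \<alpha> \<beta> (mderiv \<alpha>' \<beta>' f) = foldr dir_deriv ((dirs ex \<alpha> @ dirs exi \<beta>) @ (dirs ex \<alpha>' @ dirs exi \<beta>')) f"
    by (simp add: mderiv_eq_foldr)
  also have "\<dots> = mderiv (\<lambda>i. \<alpha> i + \<alpha>' i) (\<lambda>i. \<beta> i + \<beta>' i) f"
    unfolding mderiv_eq_foldr using mderiv_dirs[of \<alpha> \<beta>] mderiv_dirs[of \<alpha>' \<beta>']
    by (intro foldr_dir_deriv_mset_cong assms) (auto simp: *)
  finally show ?thesis .
qed

section \<open>Integration and Fourier inversion\<close>

lemma integral_affine:
  fixes f :: "'a::euclidean_space \<Rightarrow> complex"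
  assumes [measurable]: "f \<in> borel_measurable borel" and c: "c \<noteq> 0"
  shows "(LINT x|lborel. f x) = of_real (\<bar>c\<bar> ^ DIM('a)) * (LINT x|lborel. f (a + c *\<^sub>R x))"
proof -
  have "(LINT x|lborel. f x) = integral\<^sup>L (density (distr lborel borel (\<lambda>x. a + c *\<^sub>R x)) (\<lambda>_. ennreal (\<bar>c\<bar>^DIM('a)))) f"
    using lborel_affine[OF c, of a] by simp
  also have "\<dots> = of_real (\<bar>c\<bar> ^ DIM('a)) * (LINT x|lborel. f (a + c *\<^sub>R x))"
    by (subst integral_density) (auto simp: integral_distr scaleR_conv_of_real)
  finally show ?thesis .
qed

lemma integrable_affine:
  fixes f :: "'a::euclidean_space \<Rightarrow> 'b::{banach, second_countable_topology}"
  assumes f: "integrable lborel f" and c: "c \<noteq> 0"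
  shows "integrable lborel (\<lambda>x. f (a + c *\<^sub>R x))"
proof -
  have [measurable]: "f \<in> borel_measurable borel" using borel_measurable_integrable[OF f] by simp
  have "integrable (density (distr lborel borel (\<lambda>x. a + c *\<^sub>R x)) (\<lambda>_. ennreal (\<bar>c\<bar>^DIM('a)))) f"
    using f lborel_affine[OF c, of a] by simp
  then have "integrable lborel (\<lambda>x. \<bar>c\<bar>^DIM('a) *\<^sub>R f (a + c *\<^sub>R x))"
    by (subst (asm) integrable_density) (auto simp: integrable_distr_eq)
  then have "integrable lborel (\<lambda>x. inverse (\<bar>c\<bar>^DIM('a)) *\<^sub>R (\<bar>c\<bar>^DIM('a) *\<^sub>R f (a + c *\<^sub>R x)))"
    by (rule integrable_scaleR_right)
  then show ?thesis using c by simp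
qed

lemma integral_translate:
  fixes f :: "'a::euclidean_space \<Rightarrow> complex"
  assumes [measurable]: "f \<in> borel_measurable borel"
  shows "(LINT x|lborel. f (a + x)) = (LINT x|lborel. f x)"
  using integral_affine[OF assms, of 1 a] by simp

lemma integrable_translate:
  fixes f :: "'a::euclidean_space \<Rightarrow> 'b::{banach, second_countable_topology}"
  assumes "integrable lborel f"
  shows "integrable lborel (\<lambda>x. f (a + x))"
  using integrable_affine[OF assms, of 1 a] by simp

lemma integral_uminus:
  fixes f :: "'a::euclidean_space \<Rightarrow> complex"
  assumes [measurable]: "f \<in> borel_measurable borel"
  shows "(LINT x|lborel. f (- x)) = (LINT x|lborel. f x)"
  using integral_affine[OF assms, of "-1" 0] by simp

lemma borel_measurable_LINT:
  fixes f :: "'a::euclidean_space \<Rightarrow> 'b::euclidean_space \<Rightarrow> complex"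
  assumes "(\<lambda>z. f (fst z) (snd z)) \<in> borel_measurable borel"
  shows "(\<lambda>x. LINT y|lborel. f x y) \<in> borel_measurable borel"
proof -
  have "(\<lambda>z. f (fst z) (snd z)) \<in> borel_measurable (lborel \<Otimes>\<^sub>M lborel)"
    using assms by (simp add: lborel_prod)
  then have [measurable]: "(\<lambda>(x, y). f x y) \<in> borel_measurable (lborel \<Otimes>\<^sub>M lborel)"
    by (simp add: case_prod_unfold)
  have "(\<lambda>x. LINT y|lborel. f x y) \<in> borel_measurable lborel" by measurable
  then show ?thesis by simp
qed

lemma integrable_bound:
  fixes f :: "'a::euclidean_space \<Rightarrow> complex"
  assumes "integrable lborel g" "f \<in> borel_measurable borel" "\<And>x. norm (f x) \<le> g x"
  shows "integrable lborel f"
proof (rule Bochner_Integration.integrable_bound[OF assms(1)])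
  show "AE x in lborel. norm (f x) \<le> norm (g x)"
    using assms(3) by (auto intro!: AE_I2 order_trans[OF _ abs_ge_self])
qed (use assms(2) in simp)

lemma norm_integral_bound:
  fixes f :: "'a::euclidean_space \<Rightarrow> complex"
  assumes "integrable lborel g" "f \<in> borel_measurable borel" "\<And>x. norm (f x) \<le> g x"
  shows "norm (LINT x|lborel. f x) \<le> (LINT x|lborel. g x)"
proof -
  have "norm (LINT x|lborel. f x) \<le> (LINT x|lborel. norm (f x))"
    by (rule integral_norm_bound)
  also have "\<dots> \<le> (LINT x|lborel. g x)"
    using integrable_bound[OF assms] assms by (intro integral_mono) auto
  finally show ?thesis .
qed

text \<open>Every later estimate has a product majorant \<open>g x * h y\<close>. It yields
  integrability on the product and of both iterated integrals, and, since the bound holds pointwise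
  and slices of a Borel function are Borel, integrability on every single slice rather than almost
  every one.\<close>

lemma fubini_dominated:
  fixes f :: "'a::euclidean_space \<Rightarrow> 'b::euclidean_space \<Rightarrow> complex"
  assumes m: "(\<lambda>z. f (fst z) (snd z)) \<in> borel_measurable borel"
    and b: "\<And>x y. norm (f x y) \<le> g x * h y"
    and g: "integrable lborel g" and h: "integrable lborel h"
  shows "integrable lborel (\<lambda>z. f (fst z) (snd z))"
    "(LINT z|lborel. f (fst z) (snd z)) = (LINT x|lborel. LINT y|lborel. f x y)"
    "(LINT x|lborel. LINT y|lborel. f x y) = (LINT y|lborel. LINT x|lborel. f x y)"
    "integrable lborel (\<lambda>x. LINT y|lborel. f x y)"
    "integrable lborel (\<lambda>y. LINT x|lborel. f x y)"
    "integrable lborel (f x)"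
    "integrable lborel (\<lambda>x. f x y)"
proof -
  have m': "(\<lambda>z. f (fst z) (snd z)) \<in> borel_measurable (lborel \<Otimes>\<^sub>M lborel)"
    using m by (simp add: lborel_prod)
  have "(\<lambda>y. (x, y)) \<in> borel \<rightarrow>\<^sub>M borel" "(\<lambda>y. (y, y')) \<in> borel \<rightarrow>\<^sub>M borel" for x :: 'a and y' :: 'b
    by (auto intro!: borel_measurable_continuous_onI continuous_intros)
  from measurable_compose[OF this(1) m] measurable_compose[OF this(2) m]
  have mx: "f x \<in> borel_measurable borel" and my: "(\<lambda>x. f x y) \<in> borel_measurable borel" for x y
    by simp_all
  have int_gh: "integrable (lborel \<Otimes>\<^sub>M lborel) (\<lambda>z. g (fst z) * h (snd z))"
  proof (rule lborel_pair.Fubini_integrable)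
    show "(\<lambda>z. g (fst z) * h (snd z)) \<in> borel_measurable (lborel \<Otimes>\<^sub>M lborel)"
      using borel_measurable_integrable[OF g] borel_measurable_integrable[OF h] by measurable
    show "integrable lborel (\<lambda>x. LINT y|lborel. norm (g (fst (x, y)) * h (snd (x, y))))"
      using g h by (simp add: abs_mult)
  qed (use h in simp)
  have int: "integrable (lborel \<Otimes>\<^sub>M lborel) (\<lambda>z. f (fst z) (snd z))"
    by (rule Bochner_Integration.integrable_bound[OF int_gh m'])
      (auto intro!: AE_I2 order_trans[OF b] simp del: abs_mult)
  then have int': "integrable (lborel \<Otimes>\<^sub>M lborel) (case_prod f)"
    by (simp add: case_prod_unfold)
  show "integrable lborel (\<lambda>z. f (fst z) (snd z))"
    using int by (simp add: lborel_prod)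
  show "(LINT z|lborel. f (fst z) (snd z)) = (LINT x|lborel. LINT y|lborel. f x y)"
    using lborel_pair.integral_fst[OF int'] by (simp add: lborel_prod case_prod_unfold)
  show "(LINT x|lborel. LINT y|lborel. f x y) = (LINT y|lborel. LINT x|lborel. f x y)"
    using lborel_pair.Fubini_integral[OF int'] by simp
  show "integrable lborel (\<lambda>x. LINT y|lborel. f x y)"
    by (rule lborel_pair.integrable_fst[OF int'])
  show "integrable lborel (\<lambda>y. LINT x|lborel. f x y)"
    by (rule lborel_pair.integrable_snd[OF int'])
  show "integrable lborel (f x)"
    by (rule integrable_bound[OF _ mx b]) (use h in simp)
  show "integrable lborel (\<lambda>x. f x y)"
    by (rule integrable_bound[OF _ my b]) (use g in simp)
qed

section \<open>Integration by parts through translation invariance\<close>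

text \<open>The integral of \<open>H (x + e) - H x\<close> vanishes by translation invariance, and
  by Fubini it is the integral of \<open>H'\<close>; no boundary terms occur. The hypothesis is the
  increment identity rather than a derivative, so that the lemma applies to an \<open>H\<close> that
  is itself a parameter integral, with no differentiation under the integral sign.\<close>

lemma integral_increment_zero:
  fixes H H' :: "'a::euclidean_space \<Rightarrow> complex"
  assumes H: "integrable lborel H" and H': "integrable lborel H'"
    and incr: "\<And>x. H (x + e) - H x = (LINT \<tau>:{0..1}|lborel. H' (x + \<tau> *\<^sub>R e))"
  shows "(LINT x|lborel. H' x) = 0"
proof -
  have [measurable]: "H \<in> borel_measurable borel" "H' \<in> borel_measurable borel"
    using borel_measurable_integrable[OF H] borel_measurable_integrable[OF H'] by simp_all
  let ?f = "\<lambda>\<tau> x. indicator {0..1::real} \<tau> *\<^sub>R H' (x + \<tau> *\<^sub>R e)"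
  have tr: "integrable lborel (\<lambda>x. H' (x + \<tau> *\<^sub>R e))" "(LINT x|lborel. H' (x + \<tau> *\<^sub>R e)) = (LINT x|lborel. H' x)"
     "(LINT x|lborel. norm (H' (x + \<tau> *\<^sub>R e))) = (LINT x|lborel. norm (H' x))" for \<tau>
    using integrable_translate[OF H', of "\<tau> *\<^sub>R e"] integral_translate[of H' "\<tau> *\<^sub>R e"]
      integral_translate[of "\<lambda>x. complex_of_real (norm (H' x))" "\<tau> *\<^sub>R e"]
    by (simp_all add: add.commute)
  have "integrable (lborel \<Otimes>\<^sub>M lborel) (\<lambda>(\<tau>, x). ?f \<tau> x)"
  proof (rule lborel_pair.Fubini_integrable)
    show "(\<lambda>(\<tau>, x). ?f \<tau> x) \<in> borel_measurable (lborel \<Otimes>\<^sub>M lborel)" by measurable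
    show "integrable lborel (\<lambda>\<tau>. LINT x|lborel. norm (case (\<tau>, x) of (\<tau>, x) \<Rightarrow> ?f \<tau> x))"
      by (simp add: tr)
    show "AE x in lborel. integrable lborel (\<lambda>y. case (x, y) of (\<tau>, x) \<Rightarrow> ?f \<tau> x)"
      by (simp add: tr)
  qed
  from lborel_pair.Fubini_integral[OF this]
  have "(LINT x|lborel. LINT \<tau>|lborel. ?f \<tau> x) = (LINT \<tau>|lborel. LINT x|lborel. ?f \<tau> x)" .
  also have "\<dots> = (LINT x|lborel. H' x)"
    by (simp add: tr)
  also have "(LINT x|lborel. LINT \<tau>|lborel. ?f \<tau> x) = (LINT x|lborel. H (x + e) - H x)"
    using incr by (simp add: set_lebesgue_integral_def)
  also have "\<dots> = 0"
    using integrable_translate[OF H, of e] integral_translate[of H e] H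
    by (simp add: add.commute)
  finally show ?thesis by simp
qed

lemma has_dd_increment:
  assumes "has_dd e F F'" "continuous_on UNIV F'"
  shows "F (x + e) - F x = (LINT \<tau>:{0..1}|lborel. F' (x + \<tau> *\<^sub>R e))"
proof -
  have "(LINT \<tau>|lborel. indicator {0..1} \<tau> *\<^sub>R F' (x + \<tau> *\<^sub>R e)) = F (x + 1 *\<^sub>R e) - F (x + 0 *\<^sub>R e)"
    by (intro integral_FTC_atLeastAtMost has_vector_derivative_at_within[OF has_dd_line[OF assms(1)]]
        continuous_on_compose2[OF assms(2)] continuous_intros) auto
  then show ?thesis by (simp add: set_lebesgue_integral_def)
qed

lemma integral_has_dd_zero:
  assumes "has_dd e F F'" "continuous_on UNIV F'" "integrable lborel F" "integrable lborel F'"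
  shows "(LINT x|lborel. F' x) = 0"
  using integral_increment_zero[OF assms(3,4) has_dd_increment[OF assms(1,2)]] by simp

section \<open>Tensor products and integrability of subexponential weights\<close>

lemma vec_Basis: "(Basis :: (real ^ 'd) set) = range (\<lambda>i. axis i 1)" "inj (\<lambda>i::'d::finite. axis i (1::real))"
  by (auto simp: Basis_vec_def inj_on_def axis_eq_axis)

lemma
  fixes f :: "'d::finite \<Rightarrow> real \<Rightarrow> 'b::{real_normed_field, banach, second_countable_topology}"
  assumes f: "\<And>k. integrable lborel (f k)"
  shows integrable_vec_prod: "integrable lborel (\<lambda>y::real^'d. \<Prod>k\<in>UNIV. f k (y $ k))"
    and integral_vec_prod: "(LINT y|lborel. (\<Prod>k\<in>UNIV. f k ((y::real^'d) $ k))) = (\<Prod>k\<in>UNIV. (LINT x|lborel. f k x))"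
proof -
  interpret product_sigma_finite "\<lambda>_::real^'d. lborel :: real measure" ..
  \<comment> \<open>Lebesgue measure is available as a product over \<open>Basis\<close>; the
    inverse of \<open>axis\<close> relabels the factors, which are indexed by coordinates.\<close>
  let ?g = "\<lambda>b::real^'d. f (the_inv (\<lambda>i. axis i 1) b)"
  let ?G = "\<lambda>y::real^'d. \<Prod>k\<in>UNIV. f k (y $ k)"
  have [measurable]: "f k \<in> borel_measurable borel" for k
    using borel_measurable_integrable[OF f] by simp
  have g_axis: "?g (axis k 1) = f k" for k
    by (simp add: the_inv_f_f[OF vec_Basis(2)])
  have eq: "?G (\<Sum>b\<in>Basis. x b *\<^sub>R b) = (\<Prod>b\<in>Basis. ?g b (x b))" for x
  proof -
    have "(\<Sum>b\<in>Basis. x b *\<^sub>R b) $ k = x (axis k 1)" for k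
    proof -
      have "(\<Sum>b\<in>Basis. x b *\<^sub>R b) $ k = (\<Sum>b\<in>Basis. x b *\<^sub>R b) \<bullet> axis k 1"
        by (simp add: inner_axis)
      also have "\<dots> = x (axis k 1)"
        by (simp add: inner_sum_left_Basis axis_in_Basis_iff)
      finally show ?thesis .
    qed
    then show ?thesis
      unfolding vec_Basis(1) by (simp add: prod.reindex[OF vec_Basis(2)] g_axis)
  qed
  have M: "?G \<in> borel_measurable borel"
  proof -
    have "(\<lambda>y::real^'d. y $ k) \<in> borel_measurable borel" for k
      by (intro borel_measurable_continuous_onI continuous_intros)
    then show ?thesis by measurable
  qed
  have D: "(\<lambda>x. \<Sum>b\<in>Basis. x b *\<^sub>R b) \<in> measurable (Pi\<^sub>M Basis (\<lambda>_::real^'d. lborel :: real measure)) (borel :: (real^'d) measure)"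
    by measurable
  have int: "integrable (Pi\<^sub>M Basis (\<lambda>_. lborel)) (\<lambda>x. \<Prod>b\<in>Basis. ?g b (x b))"
    using f by (intro product_integrable_prod) auto
  show "integrable lborel ?G"
    by (subst lborel_eq, subst integrable_distr_eq[OF D M]) (unfold eq, rule int)
  have "(LINT y|lborel. ?G y) = (LINT x|Pi\<^sub>M Basis (\<lambda>_. lborel). (\<Prod>b\<in>Basis. ?g b (x b)))"
    by (subst lborel_eq, subst integral_distr[OF D M]) (unfold eq, rule refl)
  also have "\<dots> = (\<Prod>b\<in>Basis. (LINT x|lborel. ?g b x))"
    using f by (intro product_integral_prod) auto
  also have "\<dots> = (\<Prod>k\<in>UNIV. (LINT x|lborel. f k x))"
    unfolding vec_Basis(1) by (simp add: prod.reindex[OF vec_Basis(2)] g_axis)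
  finally show "(LINT y|lborel. ?G y) = (\<Prod>k\<in>UNIV. (LINT x|lborel. f k x))" .
qed

lemma power_div_fact_le_exp:
  assumes "(x::real) \<ge> 0"
  shows "x ^ n / fact n \<le> exp x"
proof -
  have "(\<Sum>k\<in>{n}. x ^ k /\<^sub>R fact k) \<le> (\<Sum>k. x ^ k /\<^sub>R fact k)"
    using assms by (intro sum_le_suminf summable_exp_generic) auto
  then show ?thesis by (simp add: exp_def divide_inverse mult.commute)
qed

lemma integrable_exp_powr_real:
  fixes c p :: real
  assumes c: "c > 0" and p: "p > 0"
  shows "integrable lborel (\<lambda>x::real. exp (- c * \<bar>x\<bar> powr p))"
proof -
  \<comment> \<open>With \<open>N * p \<ge> 2\<close> a single term of the exponential series
    already dominates \<open>x\<^sup>2\<close> outside the unit interval.\<close>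
  obtain N :: nat where N: "N * p \<ge> 2"
    using real_arch_simple[of "2 / p"] p by (auto simp: field_simps)
  \<comment> \<open>The summand \<open>fact N / c ^ N\<close> serves
    \<open>\<bar>x\<bar> > 1\<close>, the summand 1 serves \<open>\<bar>x\<bar> \<le> 1\<close>; the
    factor 2 in the majorant compares 1 or \<open>1 / x\<^sup>2\<close> with
    \<open>inverse (1 + x\<^sup>2)\<close>.\<close>
  let ?K = "fact N / c ^ N + 1"
  have "integrable lborel (\<lambda>x::real. inverse (1 + x\<^sup>2))"
    using integrable_inverse_1_plus_square by (simp add: set_integrable_def)
  then have int: "integrable lborel (\<lambda>x::real. (2 * ?K) * inverse (1 + x\<^sup>2))" by simp
  have bound: "exp (- c * \<bar>x\<bar> powr p) \<le> (2 * ?K) * inverse (1 + x\<^sup>2)" for x :: real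
  proof (cases "\<bar>x\<bar> \<le> 1")
    case True
    then have "x\<^sup>2 \<le> 1" by (simp add: abs_square_le_1)
    then have "1 \<le> 2 * inverse (1 + x\<^sup>2)" by (simp add: field_simps add_pos_nonneg)
    moreover have "exp (- c * \<bar>x\<bar> powr p) \<le> 1" using c by simp
    moreover have "1 \<le> ?K" using c by simp
    ultimately have "exp (- c * \<bar>x\<bar> powr p) \<le> ?K * (2 * inverse (1 + x\<^sup>2))"
      using mult_mono[of 1 ?K 1 "2 * inverse (1 + x\<^sup>2)"] c by linarith
    then show ?thesis by (simp only: mult.assoc mult.left_commute[of 2])
  next
    case False
    then have x: "\<bar>x\<bar> \<ge> 1" by simp
    have "x\<^sup>2 = \<bar>x\<bar> powr 2" using x by simp
    also have "\<dots> \<le> \<bar>x\<bar> powr (N * p)" using x N by (intro powr_mono) auto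
    also have "\<dots> = (\<bar>x\<bar> powr p) ^ N" using x by (simp add: powr_powr powr_realpow[symmetric] mult.commute)
    finally have x2: "x\<^sup>2 \<le> (\<bar>x\<bar> powr p) ^ N" .
    have "(c * \<bar>x\<bar> powr p) ^ N / fact N \<le> exp (c * \<bar>x\<bar> powr p)"
      using c by (intro power_div_fact_le_exp) simp
    moreover have "c ^ N * x\<^sup>2 / fact N \<le> (c * \<bar>x\<bar> powr p) ^ N / fact N"
      using x2 c by (simp add: power_mult_distrib divide_right_mono)
    ultimately have "c ^ N * x\<^sup>2 / fact N \<le> exp (c * \<bar>x\<bar> powr p)" by linarith
    then have "exp (- c * \<bar>x\<bar> powr p) \<le> fact N / (c ^ N * x\<^sup>2)"
      using c x by (simp add: exp_minus field_simps)
    also have "\<dots> = (fact N / c ^ N) * (1 / x\<^sup>2)" by simp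
    also have "\<dots> \<le> ?K * (2 * inverse (1 + x\<^sup>2))"
    proof (rule mult_mono)
      have "x\<^sup>2 \<ge> 1" using x abs_le_square_iff[of 1 x] by simp
      then show "1 / x\<^sup>2 \<le> 2 * inverse (1 + x\<^sup>2)"
        by (simp add: inverse_eq_divide frac_le_eq divide_simps)
    qed (use c in auto)
    finally show ?thesis by (simp only: mult_ac)
  qed
  show ?thesis
  proof (rule Bochner_Integration.integrable_bound[OF int])
    show "AE x in lborel. norm (exp (- c * \<bar>x\<bar> powr p)) \<le> norm ((2 * ?K) * inverse (1 + x\<^sup>2))"
    proof (rule AE_I2)
      fix x :: real
      show "norm (exp (- c * \<bar>x\<bar> powr p)) \<le> norm ((2 * ?K) * inverse (1 + x\<^sup>2))"
        using order_trans[OF bound[of x] abs_ge_self] by (simp only: real_norm_def abs_exp_cancel)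
    qed
  qed simp
qed

text \<open>Each coordinate is bounded by the norm, so giving every coordinate the share
  \<open>c / CARD('d)\<close> of the rate produces a tensor product majorant.\<close>

lemma integrable_exp_powr:
  assumes c: "c > 0" and p: "p > 0"
  shows "integrable lborel (\<lambda>y::real^'d::finite. exp (- c * norm y powr p))"
proof -
  let ?c = "c / CARD('d)"
  have "integrable lborel (\<lambda>y::real^'d. \<Prod>k\<in>UNIV. exp (- ?c * \<bar>y $ k\<bar> powr p))"
    by (rule integrable_vec_prod) (use integrable_exp_powr_real[of ?c p] c p in simp)
  then show ?thesis
  proof (rule Bochner_Integration.integrable_bound)
    show "AE y in lborel. norm (exp (- c * norm y powr p)) \<le> norm (\<Prod>k\<in>UNIV. exp (- ?c * \<bar>(y::real^'d) $ k\<bar> powr p))"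
    proof (rule AE_I2)
      fix y :: "real^'d"
      have "(\<Sum>k\<in>UNIV. ?c * \<bar>y $ k\<bar> powr p) \<le> (\<Sum>k\<in>(UNIV::'d set). ?c * norm y powr p)"
        using c p by (intro sum_mono mult_left_mono powr_mono2) (auto simp: component_le_norm_cart)
      also have "\<dots> = c * norm y powr p" by simp
      finally show "norm (exp (- c * norm y powr p)) \<le> norm (\<Prod>k\<in>UNIV. exp (- ?c * \<bar>y $ k\<bar> powr p))"
        by (simp add: sum_negf flip: exp_sum)
    qed
  qed simp
qed

section \<open>Fourier inversion by Gaussian regularisation\<close>

abbreviation kern :: "'a::real_inner \<Rightarrow> 'a \<Rightarrow> complex" where
  "kern y \<eta> \<equiv> exp (- \<i> * complex_of_real (y \<bullet> \<eta>))"

lemma norm_kern [simp]: "cmod (kern y \<eta>) = 1"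
  by (simp add: norm_exp_eq_Re)

lemma kern_add: "kern (x + y) \<eta> = kern x \<eta> * kern y \<eta>" "kern y (\<eta> + \<xi>) = kern y \<eta> * kern y \<xi>"
  by (simp_all add: inner_simps algebra_simps exp_add[symmetric])

lemma continuous_on_kern [continuous_intros]:
  "continuous_on S f \<Longrightarrow> continuous_on S g \<Longrightarrow> continuous_on S (\<lambda>x. kern (f x) (g x))"
  by (intro continuous_intros)

text \<open>A rescaling of the characteristic function of the standard normal distribution.\<close>

lemma gaussian_fourier_real:
  fixes \<epsilon> t :: real
  assumes "\<epsilon> > 0"
  shows "(LINT x|lborel. of_real (exp (- (\<epsilon> * x)\<^sup>2 / 2)) * exp (- \<i> * of_real (t * x))) =
    complex_of_real (sqrt (2 * pi) / \<epsilon> * exp (- (t / \<epsilon>)\<^sup>2 / 2))"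
    "integrable lborel (\<lambda>x. complex_of_real (exp (- (\<epsilon> * x)\<^sup>2 / 2)) * exp (- \<i> * of_real (t * x)))"
proof -
  let ?f = "\<lambda>a x. complex_of_real (exp (- x\<^sup>2 / 2)) * exp (\<i> * complex_of_real (a * x))"
  have int1: "integrable lborel (\<lambda>x::real. exp (- x\<^sup>2 / 2))"
    using integrable_exp_powr_real[of "1/2" 2] by simp
  have int: "integrable lborel (?f a)" for a
    by (rule Bochner_Integration.integrable_bound[OF int1]) (auto simp: norm_mult)
  have "char std_normal_distribution a = (LINT x|lborel. of_real (1 / sqrt (2 * pi)) * ?f a x)" for a
    unfolding char_def std_normal_density_def
    by (subst integral_density) (auto simp: scaleR_conv_of_real mult.assoc)
  then have F: "(LINT x|lborel. ?f a x) = of_real (sqrt (2 * pi) * exp (- a\<^sup>2 / 2))" for a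
    by (simp add: char_std_normal_distribution field_simps)
  have *: "of_real (exp (- (\<epsilon> * x)\<^sup>2 / 2)) * exp (- \<i> * of_real (t * x)) = ?f (- t / \<epsilon>) (0 + \<epsilon> * x)" for x
    using assms by simp
  show "integrable lborel (\<lambda>x. complex_of_real (exp (- (\<epsilon> * x)\<^sup>2 / 2)) * exp (- \<i> * of_real (t * x)))"
    unfolding * using assms by (intro lborel_integrable_real_affine int) auto
  have "(LINT x|lborel. ?f (- t / \<epsilon>) x) = \<bar>\<epsilon>\<bar> *\<^sub>R (LINT x|lborel. ?f (- t / \<epsilon>) (0 + \<epsilon> * x))"
    using assms by (intro lborel_integral_real_affine) auto
  then have "(LINT x|lborel. ?f (- t / \<epsilon>) (0 + \<epsilon> * x)) = of_real (sqrt (2 * pi) * exp (- (- t / \<epsilon>)\<^sup>2 / 2)) / of_real \<epsilon>"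
    unfolding F using assms by (simp add: scaleR_conv_of_real field_simps)
  then show "(LINT x|lborel. of_real (exp (- (\<epsilon> * x)\<^sup>2 / 2)) * exp (- \<i> * of_real (t * x))) =
    complex_of_real (sqrt (2 * pi) / \<epsilon> * exp (- (t / \<epsilon>)\<^sup>2 / 2))"
    unfolding * by simp
qed

lemma gaussian_fourier:
  fixes a :: "real^'d::finite"
  assumes "\<epsilon> > 0"
  shows "(LINT x|lborel. of_real (exp (- (\<epsilon> * norm x)\<^sup>2 / 2)) * kern a x) =
    complex_of_real ((sqrt (2 * pi) / \<epsilon>) ^ CARD('d) * exp (- (norm a / \<epsilon>)\<^sup>2 / 2))"
    "integrable lborel (\<lambda>x. complex_of_real (exp (- (\<epsilon> * norm x)\<^sup>2 / 2)) * kern a x)"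
proof -
  have n2: "(norm (x::real^'d))\<^sup>2 = (\<Sum>k\<in>UNIV. (x $ k)\<^sup>2)" for x
    by (simp only: power2_norm_eq_inner inner_vec_def) (simp add: power2_eq_square)
  have e1: "exp (- (c * norm (x::real^'d))\<^sup>2 / 2) = (\<Prod>k\<in>UNIV. exp (- (c * x $ k)\<^sup>2 / 2))" for x c
    by (simp add: power_mult_distrib n2 sum_distrib_left sum_divide_distrib flip: exp_sum sum_negf)
  have e2: "kern a x = (\<Prod>k\<in>UNIV. exp (- \<i> * of_real (a $ k * x $ k)))" for x
    by (simp add: inner_vec_def sum_distrib_left flip: exp_sum sum_negf)
  have *: "complex_of_real (exp (- (\<epsilon> * norm x)\<^sup>2 / 2)) * kern a x =
    (\<Prod>k\<in>UNIV. complex_of_real (exp (- (\<epsilon> * x $ k)\<^sup>2 / 2)) * exp (- \<i> * of_real (a $ k * x $ k)))" for x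
    unfolding e1 e2 of_real_prod prod.distrib ..
  show "integrable lborel (\<lambda>x. complex_of_real (exp (- (\<epsilon> * norm x)\<^sup>2 / 2)) * kern a x)"
    unfolding * by (intro integrable_vec_prod gaussian_fourier_real assms)
  have "(LINT x|lborel. of_real (exp (- (\<epsilon> * norm x)\<^sup>2 / 2)) * kern a x) =
    (\<Prod>k\<in>UNIV. complex_of_real (sqrt (2 * pi) / \<epsilon> * exp (- (a $ k / \<epsilon>)\<^sup>2 / 2)))"
    unfolding * by (subst integral_vec_prod) (auto simp only: gaussian_fourier_real[OF assms])
  also have "\<dots> = complex_of_real ((sqrt (2 * pi) / \<epsilon>) ^ CARD('d) * exp (- ((1 / \<epsilon>) * norm a)\<^sup>2 / 2))"
    unfolding e1 of_real_prod[symmetric] prod.distrib by simp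
  finally show "(LINT x|lborel. of_real (exp (- (\<epsilon> * norm x)\<^sup>2 / 2)) * kern a x) =
    complex_of_real ((sqrt (2 * pi) / \<epsilon>) ^ CARD('d) * exp (- (norm a / \<epsilon>)\<^sup>2 / 2))" by simp
qed

text \<open>A Gaussian factor makes the double integral absolutely convergent, and its width is then
  sent to infinity. Both kernels carry the same sign, hence the reflection
  \<open>B (- z)\<close>.\<close>

lemma fourier_inversion:
  fixes B :: "real^'d::finite \<Rightarrow> complex"
  assumes cont: "continuous_on UNIV B" and bdd: "\<And>y. cmod (B y) \<le> K"
    and int: "integrable lborel B"
    and int': "integrable lborel (\<lambda>\<xi>. LINT y|lborel. B y * kern y \<xi>)"
  shows "(LINT \<xi>|lborel. kern z \<xi> * (LINT y|lborel. B y * kern y \<xi>)) = of_real ((2 * pi) ^ CARD('d)) * B (- z)"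
proof -
  define F where "F \<xi> = (LINT y|lborel. B y * kern y \<xi>)" for \<xi>
  define \<epsilon> where "\<epsilon> n = inverse (real (Suc n))" for n
  have \<epsilon>: "\<epsilon> n > 0" for n by (simp add: \<epsilon>_def)
  have \<epsilon>0: "\<epsilon> \<longlonglongrightarrow> 0" unfolding \<epsilon>_def by (rule LIMSEQ_inverse_real_of_nat)
  have [measurable]: "B \<in> borel_measurable borel" "F \<in> borel_measurable borel"
    using borel_measurable_integrable[OF int] borel_measurable_integrable[OF int'] by (simp_all add: F_def[abs_def])
  have [measurable]: "kern z \<in> borel_measurable borel" for z :: "real^'d"
    by (intro borel_measurable_continuous_onI continuous_intros)
  define G where "G n \<xi> = complex_of_real (exp (- (\<epsilon> n * norm \<xi>)\<^sup>2 / 2))" for n and \<xi> :: "real^'d"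
  have [measurable]: "G n \<in> borel_measurable borel" for n
    unfolding G_def by (intro borel_measurable_continuous_onI continuous_intros) auto
  have intG: "integrable lborel (\<lambda>\<xi>. cmod (G n \<xi>))" for n
    using gaussian_fourier(2)[OF \<epsilon>, of n 0] unfolding G_def
    by (intro integrable_norm) simp
  have GB: "norm (G n \<xi> * kern (z + y) \<xi> * B y) \<le> cmod (G n \<xi>) * cmod (B y)" for n \<xi> y
    by (simp add: norm_mult)
  \<comment> \<open>Fubini replaces the Gaussian factor by its transform, a bump of width
    \<open>\<epsilon> n\<close> around \<open>- z\<close>. The substitution
    \<open>y = - z + \<epsilon> n *\<^sub>R v\<close> freezes the bump, so the limit can be taken
    under a fixed Gaussian majorant.\<close>
  have approx: "(LINT \<xi>|lborel. G n \<xi> * (kern z \<xi> * F \<xi>)) =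
     of_real (sqrt (2 * pi) ^ CARD('d)) * (LINT v|lborel. B (- z + \<epsilon> n *\<^sub>R v) * of_real (exp (- (norm v)\<^sup>2 / 2)))" for n
  proof -
    have m: "(\<lambda>w. G n (fst w) * kern (z + snd w) (fst w) * B (snd w)) \<in> borel_measurable borel"
      unfolding G_def by (intro borel_measurable_continuous_onI continuous_intros continuous_on_compose2[OF cont]) auto
    have "(LINT \<xi>|lborel. G n \<xi> * (kern z \<xi> * F \<xi>)) = (LINT \<xi>|lborel. LINT y|lborel. G n \<xi> * kern (z + y) \<xi> * B y)"
      unfolding F_def kern_add
      by (simp add: mult_ac flip: integral_mult_right_zero)
    also have "\<dots> = (LINT y|lborel. LINT \<xi>|lborel. G n \<xi> * kern (z + y) \<xi> * B y)"
      by (rule fubini_dominated(3)[where g="\<lambda>\<xi>. cmod (G n \<xi>)" and h="\<lambda>y. cmod (B y)", OF m GB intG]) (use int in simp)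
    also have "\<dots> = (LINT y|lborel. of_real ((sqrt (2 * pi) / \<epsilon> n) ^ CARD('d) * exp (- (norm (z + y) / \<epsilon> n)\<^sup>2 / 2)) * B y)"
      unfolding G_def by (simp only: integral_mult_left_zero gaussian_fourier(1)[OF \<epsilon>])
    also have "\<dots> = of_real (\<bar>\<epsilon> n\<bar> ^ DIM(real^'d)) * (LINT v|lborel. of_real ((sqrt (2 * pi) / \<epsilon> n) ^ CARD('d) *
       exp (- (norm (z + (- z + \<epsilon> n *\<^sub>R v)) / \<epsilon> n)\<^sup>2 / 2)) * B (- z + \<epsilon> n *\<^sub>R v))"
      using \<epsilon>[of n] by (intro integral_affine) auto
    also have "\<dots> = of_real (sqrt (2 * pi) ^ CARD('d)) * (LINT v|lborel. B (- z + \<epsilon> n *\<^sub>R v) * of_real (exp (- (norm v)\<^sup>2 / 2)))"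
    proof -
      have "(LINT v|lborel. of_real ((sqrt (2 * pi) / \<epsilon> n) ^ CARD('d) *
         exp (- (norm (z + (- z + \<epsilon> n *\<^sub>R v)) / \<epsilon> n)\<^sup>2 / 2)) * B (- z + \<epsilon> n *\<^sub>R v)) =
        (LINT v|lborel. of_real ((sqrt (2 * pi) / \<epsilon> n) ^ CARD('d)) * (B (- z + \<epsilon> n *\<^sub>R v) * of_real (exp (- (norm v)\<^sup>2 / 2))))"
        using \<epsilon>[of n] by (intro Bochner_Integration.integral_cong) (simp_all add: mult_ac)
      also have "\<dots> = of_real ((sqrt (2 * pi) / \<epsilon> n) ^ CARD('d)) * (LINT v|lborel. B (- z + \<epsilon> n *\<^sub>R v) * of_real (exp (- (norm v)\<^sup>2 / 2)))"
        by (rule integral_mult_right_zero)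
      also have "of_real (\<bar>\<epsilon> n\<bar> ^ DIM(real^'d)) * (of_real ((sqrt (2 * pi) / \<epsilon> n) ^ CARD('d)) * I) = of_real (sqrt (2 * pi) ^ CARD('d)) * I" for I :: complex
        using \<epsilon>[of n] by (simp add: power_divide)
      finally show ?thesis .
    qed
    finally show ?thesis .
  qed
  have "(\<lambda>n. LINT \<xi>|lborel. G n \<xi> * (kern z \<xi> * F \<xi>)) \<longlonglongrightarrow> (LINT \<xi>|lborel. 1 * (kern z \<xi> * F \<xi>))"
  proof (rule integral_dominated_convergence[where w="\<lambda>\<xi>. cmod (F \<xi>)"])
    show "integrable lborel (\<lambda>\<xi>. cmod (F \<xi>))" using int' by (simp add: F_def)
    show "AE \<xi> in lborel. (\<lambda>n. G n \<xi> * (kern z \<xi> * F \<xi>)) \<longlonglongrightarrow> 1 * (kern z \<xi> * F \<xi>)"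
    proof (rule AE_I2, rule tendsto_mult_right)
      fix \<xi> :: "real^'d"
      have "(\<lambda>n. G n \<xi>) \<longlonglongrightarrow> complex_of_real (exp (- (0 * norm \<xi>)\<^sup>2 / 2))"
        unfolding G_def by (intro tendsto_intros \<epsilon>0) auto
      then show "(\<lambda>n. G n \<xi>) \<longlonglongrightarrow> 1" by simp
    qed
    show "AE \<xi> in lborel. cmod (G n \<xi> * (kern z \<xi> * F \<xi>)) \<le> cmod (F \<xi>)" for n
      by (auto simp: norm_mult G_def intro!: mult_left_le_one_le AE_I2)
  qed simp_all
  moreover have "(\<lambda>n. LINT v|lborel. B (- z + \<epsilon> n *\<^sub>R v) * of_real (exp (- (norm v)\<^sup>2 / 2))) \<longlonglongrightarrow>
      (LINT v::real^'d|lborel. B (- z) * of_real (exp (- (norm v)\<^sup>2 / 2)))"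
  proof (rule integral_dominated_convergence[where w="\<lambda>v::real^'d. K * exp (- (norm v)\<^sup>2 / 2)"])
    show "integrable lborel (\<lambda>v::real^'d. K * exp (- (norm v)\<^sup>2 / 2))"
      using integrable_exp_powr[of "1/2" 2, where 'd='d] by simp
    show "AE v in lborel. (\<lambda>n. B (- z + \<epsilon> n *\<^sub>R v) * of_real (exp (- (norm v)\<^sup>2 / 2))) \<longlonglongrightarrow> B (- z) * of_real (exp (- (norm v)\<^sup>2 / 2))"
    proof (rule AE_I2, rule tendsto_mult_right)
      fix v :: "real^'d"
      have "(\<lambda>n. - z + \<epsilon> n *\<^sub>R v) \<longlonglongrightarrow> - z + 0 *\<^sub>R v" by (intro tendsto_intros \<epsilon>0)
      then show "(\<lambda>n. B (- z + \<epsilon> n *\<^sub>R v)) \<longlonglongrightarrow> B (- z)"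
        using cont by (intro isCont_tendsto_compose[of _ B]) (auto simp: continuous_on_eq_continuous_at)
    qed
    show "AE v in lborel. cmod (B (- z + \<epsilon> n *\<^sub>R v) * of_real (exp (- (norm v)\<^sup>2 / 2))) \<le> K * exp (- (norm v)\<^sup>2 / 2)" for n
      using bdd by (auto simp: norm_mult intro!: AE_I2 mult_right_mono)
  qed simp_all
  then have "(\<lambda>n. of_real (sqrt (2 * pi) ^ CARD('d)) * (LINT v|lborel. B (- z + \<epsilon> n *\<^sub>R v) * of_real (exp (- (norm v)\<^sup>2 / 2)))) \<longlonglongrightarrow>
      of_real (sqrt (2 * pi) ^ CARD('d)) * (LINT v::real^'d|lborel. B (- z) * of_real (exp (- (norm v)\<^sup>2 / 2)))"
    by (rule tendsto_mult_left)
  ultimately have "(LINT \<xi>|lborel. 1 * (kern z \<xi> * F \<xi>)) = of_real (sqrt (2 * pi) ^ CARD('d)) * (LINT v::real^'d|lborel. B (- z) * of_real (exp (- (norm v)\<^sup>2 / 2)))"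
    unfolding approx by (rule LIMSEQ_unique)
  \<comment> \<open>One factor \<open>sqrt (2 * pi) ^ CARD('d)\<close> comes from the transform of
    the Gaussian, the other from its total mass.\<close>
  also have "\<dots> = of_real (sqrt (2 * pi) ^ CARD('d)) * of_real (sqrt (2 * pi) ^ CARD('d)) * B (- z)"
    using gaussian_fourier(1)[of 1 "0::real^'d"] by (simp add: mult_ac)
  also have "\<dots> = of_real ((2 * pi) ^ CARD('d)) * B (- z)"
  proof -
    have "sqrt (2 * pi) ^ n * sqrt (2 * pi) ^ n = (2 * pi) ^ n" for n
      by (subst power_mult_distrib[symmetric]) simp
    then show ?thesis by (simp only: of_real_mult[symmetric])
  qed
  finally show ?thesis by (simp add: F_def)
qed

section \<open>Oscillatory integrals with a window\<close>

lemma fact_mult_fact_le: "fact n * fact m \<le> (fact (n + m) :: real)"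
proof -
  have "fact n * fact m \<le> (fact (n + m) :: nat)"
    by (intro dvd_imp_le fact_fact_dvd_fact) auto
  then show ?thesis by (metis of_nat_fact of_nat_le_iff of_nat_mult)
qed

lemma fact_add_le: "(fact (n + m) :: real) \<le> 2 ^ (n + m) * (fact n * fact m)"
proof -
  have "((n + m) choose n) \<le> (2::nat) ^ (n + m)" by (rule binomial_le_pow2)
  moreover have "real ((n + m) choose n) = fact (n + m) / (fact n * fact m)"
    by (simp add: binomial_fact)
  ultimately have "fact (n + m) / (fact n * fact m) \<le> (2::real) ^ (n + m)"
    by (metis of_nat_le_iff of_nat_numeral of_nat_power)
  then show ?thesis by (simp add: divide_le_eq)
qed

text \<open>Multiplication by \<open>w\<close> stands for an integration by parts that raises the
  order of one of two factors, at cost \<open>a\<close> or \<open>b\<close>. Bounding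
  \<open>J n m\<close> by the factorial of the total order \<open>n + m + k\<close> treats both
  branches alike, so each step loses only the factor \<open>a + b\<close> and no Leibniz sum
  appears.\<close>

lemma double_ladder_bound:
  fixes J :: "nat \<Rightarrow> nat \<Rightarrow> real"
  assumes step: "\<And>n m. w * J n m \<le> a * J (Suc n) m + b * J n (Suc m)"
    and symb_bound: "\<And>n m. J n m \<le> K * B ^ (n + m) * fact n powr \<theta> * fact m powr \<theta>"
    and pos: "\<theta> \<ge> 0" "a \<ge> 0" "b \<ge> 0" "B \<ge> 0" "K \<ge> 0" "w \<ge> 0"
  shows "w ^ k * J 0 0 \<le> K * ((a + b) * B) ^ k * fact k powr \<theta>"
proof -
  have "w ^ k * J n m \<le> K * (a + b) ^ k * B ^ (n + m + k) * fact (n + m + k) powr \<theta>" for n m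
  proof (induction k arbitrary: n m)
    case 0
    have "fact n powr \<theta> * fact m powr \<theta> \<le> (fact (n + m) :: real) powr \<theta>"
      using pos fact_mult_fact_le[of n m] by (subst powr_mult[symmetric]) (auto intro!: powr_mono2)
    then have "K * B ^ (n + m) * (fact n powr \<theta> * fact m powr \<theta>) \<le> K * B ^ (n + m) * fact (n + m) powr \<theta>"
      using pos by (intro mult_left_mono) auto
    then show ?case using symb_bound[of n m] by (simp add: mult.assoc)
  next
    case (Suc k)
    let ?C = "K * (a + b) ^ k * B ^ (n + m + Suc k) * fact (n + m + Suc k) powr \<theta>"
    have 1: "w ^ k * J (Suc n) m \<le> ?C" using Suc[of "Suc n" m] by simp
    have 2: "w ^ k * J n (Suc m) \<le> ?C" using Suc[of n "Suc m"] by simp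
    have "w ^ Suc k * J n m = w ^ k * (w * J n m)" by simp
    also have "\<dots> \<le> w ^ k * (a * J (Suc n) m + b * J n (Suc m))"
      using step pos by (intro mult_left_mono) auto
    also have "\<dots> = a * (w ^ k * J (Suc n) m) + b * (w ^ k * J n (Suc m))" by (simp add: algebra_simps)
    also have "\<dots> \<le> a * ?C + b * ?C"
      by (intro add_mono mult_left_mono 1 2 pos)
    finally show ?case by (simp add: algebra_simps)
  qed
  from this[of 0 0] show ?thesis by (simp add: power_mult_distrib mult.assoc)
qed

text \<open>The bounds hold for all \<open>k\<close>, so \<open>k\<close> can be chosen according to
  \<open>w\<close>. At the best choice every factor contributes about exp (-1), which gives decay of
  order \<open>1 / \<theta>\<close> in the exponent.\<close>

lemma power_fact_optimize:
  fixes w B \<theta> K X :: real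
  assumes symb_bound: "\<And>k. w ^ k * X \<le> K * B ^ k * fact k powr \<theta>"
    and pos: "w \<ge> 0" "B > 0" "\<theta> > 0" "K \<ge> 0"
  shows "X \<le> exp 1 * K * exp (- ((w / (exp 1 * B)) powr (1 / \<theta>)))"
proof (cases "w = 0")
  case True
  have "X \<le> K" using symb_bound[of 0] by simp
  moreover have "K * 1 \<le> K * exp 1" using pos by (intro mult_left_mono) auto
  ultimately show ?thesis using True by (simp add: mult.commute)
next
  case False
  \<comment> \<open>Chosen so that \<open>u powr \<theta> = w / (exp 1 * B)\<close>. Together with
    \<open>fact k \<le> u ^ k\<close> for \<open>k \<le> u\<close> the bound becomes
    \<open>K * exp (- real k)\<close>, and rounding \<open>u\<close> down costs the factor
    \<open>exp 1\<close>.\<close>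
  define u where "u = (w / (exp 1 * B)) powr (1 / \<theta>)"
  define k where "k = nat \<lfloor>u\<rfloor>"
  have w: "w > 0" using False pos by simp
  have u: "u \<ge> 0" by (simp add: u_def)
  have ku: "real k \<le> u" "u < k + 1" using u unfolding k_def by linarith+
  have "fact k powr \<theta> \<le> (u ^ k) powr \<theta>"
  proof (rule powr_mono2)
    have "(fact k :: real) \<le> real k ^ k" by (metis fact_le_power of_nat_fact of_nat_le_iff of_nat_power order_refl)
    also have "\<dots> \<le> u ^ k" using ku by (intro power_mono) auto
    finally show "fact k \<le> u ^ k" .
  qed (use pos in auto)
  also have "\<dots> = (u powr \<theta>) ^ k"
  proof (cases "k = 0")
    case False
    then have "u > 0" using ku by linarith
    then show ?thesis by (simp add: powr_powr mult.commute flip: powr_realpow)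
  qed simp
  also have "u powr \<theta> = w / (exp 1 * B)"
    using pos w by (simp add: u_def powr_powr)
  finally have f: "fact k powr \<theta> \<le> (w / (exp 1 * B)) ^ k" .
  have "w ^ k * X \<le> K * B ^ k * (w / (exp 1 * B)) ^ k"
    using symb_bound[of k] mult_left_mono[OF f, of "K * B ^ k"] pos by simp
  also have "\<dots> = w ^ k * (K * exp (- real k))"
    using pos by (simp add: power_divide power_mult_distrib exp_minus field_simps flip: exp_of_nat_mult)
  finally have "X \<le> K * exp (- real k)" using w by simp
  also have "\<dots> \<le> K * exp (1 - u)" using ku pos by (intro mult_left_mono) auto
  also have "\<dots> = exp 1 * K * exp (- u)" by (simp add: exp_diff exp_minus field_simps)
  finally show ?thesis unfolding u_def .
qed

text \<open>The decay rate that \<open>coordinate_decay\<close> extracts from factorial bounds of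
  scale \<open>B\<close>; the dimension enters because the norm is compared with its largest
  coordinate.\<close>

definition rate :: "nat \<Rightarrow> real \<Rightarrow> real \<Rightarrow> real" where
  "rate d \<theta> B = (1 / (exp 1 * real d * B)) powr (1 / \<theta>)"

lemma rate_pos: "d > 0 \<Longrightarrow> B > 0 \<Longrightarrow> rate d \<theta> B > 0"
  by (simp add: rate_def)

lemma rate_antimono: "d > 0 \<Longrightarrow> B > 0 \<Longrightarrow> B \<le> B' \<Longrightarrow> \<theta> > 0 \<Longrightarrow> rate d \<theta> B' \<le> rate d \<theta> B"
  unfolding rate_def by (intro powr_mono2) (auto intro!: divide_left_mono mult_left_mono)

text \<open>Small scales give arbitrarily fast decay. This is what lets a symbol with a fixed growth
  rate be beaten when its scale is free; \<open>B0\<close> solves the equation for the rate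
  \<open>max R 1\<close>.\<close>

lemma rate_unbounded:
  assumes "d > 0" "\<theta> > 0"
  shows "\<exists>B0>0. \<forall>B. 0 < B \<and> B \<le> B0 \<longrightarrow> rate d \<theta> B \<ge> R"
proof -
  define R' where "R' = max R 1"
  define B0 where "B0 = 1 / (exp 1 * real d * R' powr \<theta>)"
  have R': "R' > 0" by (simp add: R'_def)
  then have B0: "B0 > 0" using assms by (simp add: B0_def)
  have "rate d \<theta> B0 = (R' powr \<theta>) powr (1 / \<theta>)"
    using assms R' by (simp add: rate_def B0_def)
  also have "\<dots> = R'" using assms R' by (simp add: powr_powr)
  finally have "R \<le> rate d \<theta> B0" by (simp add: R'_def)
  then have "R \<le> rate d \<theta> B" if "0 < B" "B \<le> B0" for B
    using rate_antimono[OF assms(1) that assms(2)] by linarith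
  then show ?thesis using B0 by blast
qed

text \<open>Some coordinate satisfies \<open>norm y \<le> CARD('d) * \<bar>y $ j\<bar>\<close>,
  since otherwise the sum of the coordinates would be smaller than the norm. Bounds along each axis
  therefore give decay in the norm.\<close>

lemma coordinate_decay:
  fixes y :: "real^'d::finite"
  assumes symb_bound: "\<And>j k. \<bar>y $ j\<bar> ^ k * X \<le> K * B ^ k * fact k powr \<theta>"
    and pos: "B > 0" "\<theta> > 0" "K \<ge> 0" "X \<ge> 0"
  shows "X \<le> exp 1 * K * exp (- rate CARD('d) \<theta> B * norm y powr (1 / \<theta>))"
proof -
  let ?d = "real CARD('d)"
  have "\<exists>j. norm y \<le> ?d * \<bar>y $ j\<bar>"
  proof (rule ccontr)
    assume "\<nexists>j. norm y \<le> ?d * \<bar>y $ j\<bar>"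
    then have *: "\<bar>y $ j\<bar> < norm y / ?d" for j by (auto simp: not_le field_simps)
    have "(\<Sum>j\<in>UNIV. \<bar>y $ j\<bar>) < (\<Sum>j\<in>(UNIV::'d set). norm y / ?d)"
      by (intro sum_strict_mono *) auto
    then show False using norm_le_l1_cart[of y] by simp
  qed
  then obtain j where j: "norm y \<le> ?d * \<bar>y $ j\<bar>" ..
  have "norm y ^ k * X \<le> K * (?d * B) ^ k * fact k powr \<theta>" for k
  proof -
    have "norm y ^ k * X \<le> (?d * \<bar>y $ j\<bar>) ^ k * X"
      using j pos by (intro mult_right_mono power_mono) auto
    also have "\<dots> = ?d ^ k * (\<bar>y $ j\<bar> ^ k * X)" by (simp add: power_mult_distrib)
    also have "\<dots> \<le> ?d ^ k * (K * B ^ k * fact k powr \<theta>)" by (intro mult_left_mono symb_bound) auto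
    finally show ?thesis by (simp add: power_mult_distrib mult_ac)
  qed
  from power_fact_optimize[OF this] pos
  have "X \<le> exp 1 * K * exp (- ((norm y / (exp 1 * (?d * B))) powr (1 / \<theta>)))" by simp
  also have "(norm y / (exp 1 * (?d * B))) powr (1 / \<theta>) = rate CARD('d) \<theta> B * norm y powr (1 / \<theta>)"
    using pos unfolding rate_def by (subst powr_mult[symmetric]) (simp_all add: mult.assoc)
  finally show ?thesis by simp
qed

text \<open>The exponent may exceed 1, where powers of the norm are not subadditive; passing through
  twice the maximum works for every positive exponent.\<close>

lemma powr_norm_add:
  fixes a b :: "'a::real_normed_vector"
  assumes "p > 0"
  shows "norm (a + b) powr p \<le> 2 powr p * (norm a powr p + norm b powr p)"
proof -
  have "norm (a + b) \<le> 2 * max (norm a) (norm b)" using norm_triangle_ineq[of a b] by linarith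
  then have "norm (a + b) powr p \<le> (2 * max (norm a) (norm b)) powr p" using assms by (intro powr_mono2) auto
  also have "\<dots> = 2 powr p * max (norm a) (norm b) powr p" by (simp add: powr_mult)
  also have "\<dots> \<le> 2 powr p * (norm a powr p + norm b powr p)"
    by (intro mult_left_mono) (auto simp: max_def)
  finally show ?thesis .
qed

lemma has_dd_kern: "has_dd (axis i 1) (kern y) (\<lambda>\<eta>. - \<i> * of_real (y $ i) * kern y \<eta>)"
  unfolding has_dd_def
proof
  fix x :: "real^'a"
  let ?c = "- \<i> * of_real (y $ i)"
  have "((\<lambda>\<tau>. kern y x * exp (\<tau> *\<^sub>R ?c)) has_vector_derivative kern y x * (exp (0 *\<^sub>R ?c) * ?c)) (at 0)"
    by (intro has_vector_derivative_mult_right exp_scaleR_has_vector_derivative_right)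
  moreover have "kern y (x + \<tau> *\<^sub>R axis i 1) = kern y x * exp (\<tau> *\<^sub>R ?c)" for \<tau>
    by (simp add: inner_add_right inner_axis exp_add[symmetric] algebra_simps flip: scaleR_conv_of_real)
  ultimately show "((\<lambda>\<tau>. kern y (x + \<tau> *\<^sub>R axis i 1)) has_vector_derivative ?c * kern y x) (at 0)"
    by (simp add: mult_ac)
qed

text \<open>With \<open>n\<close> derivatives on \<open>F\<close> and \<open>m\<close> on
  \<open>\<Phi>\<close>, one integration by parts gives \<i> y_i J (n, m) = J (n + 1, m) + J (n, m +
  1), the recursion of \<open>double_ladder_bound\<close> with both costs 1. The two derivative
  sequences are abstract, so that the lemma serves symbol against window as well as the two
  functions in a Wigner distribution.\<close>

lemma fourier_decay:
  fixes F \<Phi> :: "nat \<Rightarrow> real^'d::finite \<Rightarrow> complex"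
  assumes F: "\<And>n. has_dd (axis i 1) (F n) (F (Suc n))" "\<And>n. continuous_on UNIV (F n)"
    and \<Phi>: "\<And>n. has_dd (axis i 1) (\<Phi> n) (\<Phi> (Suc n))" "\<And>n. continuous_on UNIV (\<Phi> n)"
    and symb_bound: "\<And>n m \<eta>. cmod (F n \<eta> * \<Phi> m \<eta>) \<le> M * B ^ (n + m) * fact n powr \<theta> * fact m powr \<theta> * \<omega> \<eta>"
    and \<omega>: "integrable lborel \<omega>" "\<And>\<eta>. \<omega> \<eta> \<ge> 0" and pos: "\<theta> \<ge> 0" "B \<ge> 0" "M \<ge> 0"
  shows "\<bar>y $ i\<bar> ^ k * cmod (LINT \<eta>|lborel. F 0 \<eta> * \<Phi> 0 \<eta> * kern y \<eta>) \<le>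
    (M * (LINT \<eta>|lborel. \<omega> \<eta>)) * (2 * B) ^ k * fact k powr \<theta>"
proof -
  let ?f = "\<lambda>n m \<eta>. F n \<eta> * \<Phi> m \<eta> * kern y \<eta>"
  define J where "J n m = (LINT \<eta>|lborel. ?f n m \<eta>)" for n m
  have cont: "continuous_on UNIV (?f n m)" for n m
    by (intro continuous_intros F \<Phi>)
  have meas: "?f n m \<in> borel_measurable borel" for n m
    by (rule borel_measurable_continuous_onI[OF cont])
  have b: "norm (?f n m \<eta>) \<le> M * B ^ (n + m) * fact n powr \<theta> * fact m powr \<theta> * \<omega> \<eta>" for n m \<eta>
    using symb_bound[of n \<eta> m] by (simp add: norm_mult)
  have int\<omega>: "integrable lborel (\<lambda>\<eta>. c * \<omega> \<eta>)" for c using \<omega> by simp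
  have int: "integrable lborel (?f n m)" for n m
    by (rule integrable_bound[OF int\<omega> meas b])
  have Jb: "cmod (J n m) \<le> (M * (LINT \<eta>|lborel. \<omega> \<eta>)) * B ^ (n + m) * fact n powr \<theta> * fact m powr \<theta>" for n m
    using norm_integral_bound[OF int\<omega> meas b, of n m] by (simp add: J_def mult_ac)
  have "(\<i> * of_real (y $ i)) * J n m = J (Suc n) m + J n (Suc m)" for n m
  proof -
    let ?f' = "\<lambda>\<eta>. ?f (Suc n) m \<eta> + ?f n (Suc m) \<eta> - (\<i> * of_real (y $ i)) * ?f n m \<eta>"
    have "has_dd (axis i 1) (?f n m) (\<lambda>\<eta>. (F (Suc n) \<eta> * \<Phi> m \<eta> + F n \<eta> * \<Phi> (Suc m) \<eta>) * kern y \<eta> +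
       (F n \<eta> * \<Phi> m \<eta>) * (- \<i> * of_real (y $ i) * kern y \<eta>))"
      by (intro has_dd_mult F \<Phi> has_dd_kern)
    then have dd: "has_dd (axis i 1) (?f n m) ?f'" by (simp add: algebra_simps)
    have "(LINT \<eta>|lborel. ?f' \<eta>) = 0"
      by (rule integral_has_dd_zero[OF dd]) (intro continuous_intros F \<Phi> int Bochner_Integration.integrable_add
          Bochner_Integration.integrable_diff integrable_mult_right)+
    then show ?thesis using int unfolding J_def by simp
  qed
  then have "cmod (\<i> * of_real (y $ i)) * cmod (J n m) = cmod (J (Suc n) m + J n (Suc m))" for n m
    by (metis norm_mult)
  then have step: "\<bar>y $ i\<bar> * cmod (J n m) \<le> 1 * cmod (J (Suc n) m) + 1 * cmod (J n (Suc m))" for n m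
    using norm_triangle_ineq[of "J (Suc n) m" "J n (Suc m)"] by (simp add: norm_mult)
  have "(LINT \<eta>|lborel. \<omega> \<eta>) \<ge> 0" using \<omega> by simp
  then show ?thesis
    using double_ladder_bound[OF step Jb, of k] pos unfolding J_def by simp
qed

section \<open>Weights, windows and the oscillatory integral\<close>

definition weight :: "real \<Rightarrow> real \<Rightarrow> real \<Rightarrow> (real^'d::finite) \<times> (real^'d) \<Rightarrow> real" where
  "weight s \<sigma> r z = exp (r * (norm (fst z) powr (1 / s) + norm (snd z) powr (1 / \<sigma>)))"

text \<open>A common constant for the quasi-triangle inequalities of both powers in
  \<open>weight\<close>; translating a symbol multiplies its growth rate by it.\<close>

definition cst :: "real \<Rightarrow> real \<Rightarrow> real" where
  "cst s \<sigma> = max (2 powr (1 / s)) (2 powr (1 / \<sigma>))"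

text \<open>Only derivatives along one x-axis and one \<xi>-axis are constrained. This is all that
  the oscillatory integral consumes, and it is easily checked for translates and for Taylor
  remainders.\<close>

definition slice_bound :: "real \<Rightarrow> real \<Rightarrow> real \<Rightarrow> real \<Rightarrow> real \<Rightarrow> ((real^'d::finite) \<times> (real^'d) \<Rightarrow> complex) \<Rightarrow> bool" where
  "slice_bound s \<sigma> H r M v \<longleftrightarrow> smooth v \<and> (\<forall>i j m n z. cmod ((dir_deriv (exi i) ^^ n) ((dir_deriv (ex j) ^^ m) v) z) \<le>
     M * H ^ (m + n) * fact m powr \<sigma> * fact n powr s * weight s \<sigma> r z)"

text \<open>\<open>\<Phi> l n\<close> plays the role of \<open>\<partial>\<^sub>i\<^sup>n (\<eta>\<^sub>j\<^sup>l \<phi>)\<close>.\<close>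

definition window :: "real \<Rightarrow> real \<Rightarrow> real \<Rightarrow> real \<Rightarrow> real \<Rightarrow> (real^'d::finite \<Rightarrow> complex) \<Rightarrow> bool" where
  "window s \<sigma> A \<rho> K \<phi> \<longleftrightarrow> (\<forall>i j. \<exists>\<Phi>. \<Phi> 0 0 = \<phi> \<and> (\<forall>l. \<Phi> (Suc l) 0 = (\<lambda>\<eta>. of_real (\<eta> $ j) * \<Phi> l 0 \<eta>)) \<and>
     (\<forall>l n. continuous_on UNIV (\<Phi> l n) \<and> has_dd (axis i 1) (\<Phi> l n) (\<Phi> l (Suc n)) \<and>
       (\<forall>\<eta>. cmod (\<Phi> l n \<eta>) \<le> K * A ^ (l + n) * fact l powr \<sigma> * fact n powr s * exp (- \<rho> * norm \<eta> powr (1 / \<sigma>)))))"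

text \<open>The three conditions say that the growth rate \<open>r\<close> of a symbol is beaten by the decay of the window,
  by the decay in \<open>y\<close> gained from regularity in \<open>\<xi>\<close> and by the decay in \<open>w\<close> gained from regularity in \<open>x\<close>.\<close>

definition gap :: "nat \<Rightarrow> real \<Rightarrow> real \<Rightarrow> real \<Rightarrow> real \<Rightarrow> real \<Rightarrow> real \<Rightarrow> real \<Rightarrow> bool" where
  "gap d s \<sigma> \<Lambda> A \<rho> H r \<longleftrightarrow> A > 0 \<and> \<rho> > 0 \<and> H > 0 \<and> r > 0 \<and> \<Lambda> \<ge> 1 \<and> r * cst s \<sigma> \<le> \<rho> / 2 \<and>
     r * \<Lambda> powr (1 / s) \<le> rate d s (2 * max H A) / 2 \<and> r * cst s \<sigma> \<le> rate d \<sigma> ((\<Lambda> + 1) * max H A) / 2"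

text \<open>Up to a phase and conjugation of the window, the short-time Fourier transform in the
  second variable of \<open>v (p, _)\<close>, at position \<open>w\<close> and frequency
  \<open>y\<close>.\<close>

definition inn :: "(real^'d::finite \<Rightarrow> complex) \<Rightarrow> ((real^'d) \<times> (real^'d) \<Rightarrow> complex) \<Rightarrow> real^'d \<Rightarrow> real^'d \<Rightarrow> real^'d \<Rightarrow> complex" where
  "inn \<phi> v p w y = (LINT \<eta>|lborel. v (p, w + \<eta>) * \<phi> \<eta> * kern y \<eta>)"

text \<open>\<open>osc \<mu> \<phi> v\<close> is the value at \<open>0\<close> of the Fourier multiplier \<open>v \<mapsto> exp (i \<mu> \<langle>D\<^sub>x, D\<^sub>\<xi>\<rangle>) v\<close> that turns
  a \<open>(t + \<mu>)\<close>-symbol into a \<open>t\<close>-symbol; averaging over translates of the window \<open>\<phi>\<close> makes it an iterated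
  absolutely convergent integral.\<close>

definition osc :: "real \<Rightarrow> (real^'d::finite \<Rightarrow> complex) \<Rightarrow> ((real^'d) \<times> (real^'d) \<Rightarrow> complex) \<Rightarrow> complex" where
  "osc \<mu> \<phi> v = of_real (inverse ((2 * pi) ^ CARD('d))) *
     (LINT w|lborel. LINT y|lborel. inn \<phi> v (\<mu> *\<^sub>R y) w y * kern y w)"

lemma weight_pos: "weight s \<sigma> r z > 0" "weight s \<sigma> r z \<ge> 0"
  by (simp_all add: weight_def)

lemma cst_ge1: "s > 0 \<Longrightarrow> \<sigma> > 0 \<Longrightarrow> cst s \<sigma> \<ge> 1"
  by (simp add: cst_def max.coboundedI1 ge_one_powr_ge_zero)

lemma powr_norm_add_cst:
  fixes a b :: "'a::real_normed_vector"
  assumes "s > 0" "\<sigma> > 0"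
  shows "norm (a + b) powr (1 / s) \<le> cst s \<sigma> * (norm a powr (1 / s) + norm b powr (1 / s))"
    "norm (a + b) powr (1 / \<sigma>) \<le> cst s \<sigma> * (norm a powr (1 / \<sigma>) + norm b powr (1 / \<sigma>))"
proof -
  have "2 powr (1 / s) * (norm a powr (1 / s) + norm b powr (1 / s)) \<le> cst s \<sigma> * (norm a powr (1 / s) + norm b powr (1 / s))"
    "2 powr (1 / \<sigma>) * (norm a powr (1 / \<sigma>) + norm b powr (1 / \<sigma>)) \<le> cst s \<sigma> * (norm a powr (1 / \<sigma>) + norm b powr (1 / \<sigma>))"
    by (intro mult_right_mono; simp add: cst_def)+
  then show "norm (a + b) powr (1 / s) \<le> cst s \<sigma> * (norm a powr (1 / s) + norm b powr (1 / s))"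
    "norm (a + b) powr (1 / \<sigma>) \<le> cst s \<sigma> * (norm a powr (1 / \<sigma>) + norm b powr (1 / \<sigma>))"
    using powr_norm_add[of "1/s" a b] powr_norm_add[of "1/\<sigma>" a b] assms by simp_all
qed

lemma weight_add:
  assumes "s > 0" "\<sigma> > 0" "r \<ge> 0"
  shows "weight s \<sigma> r (a + b) \<le> weight s \<sigma> (r * cst s \<sigma>) a * weight s \<sigma> (r * cst s \<sigma>) b"
proof -
  have "norm (fst a + fst b) powr (1 / s) + norm (snd a + snd b) powr (1 / \<sigma>) \<le>
     cst s \<sigma> * (norm (fst a) powr (1 / s) + norm (snd a) powr (1 / \<sigma>)) + cst s \<sigma> * (norm (fst b) powr (1 / s) + norm (snd b) powr (1 / \<sigma>))"
    using powr_norm_add_cst(1)[OF assms(1,2), of "fst a" "fst b"] powr_norm_add_cst(2)[OF assms(1,2), of "snd a" "snd b"]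
    by (simp add: algebra_simps)
  from mult_left_mono[OF this assms(3)] show ?thesis
    unfolding weight_def exp_add[symmetric] by (simp add: algebra_simps)
qed

lemma weight_mono: "r \<le> r' \<Longrightarrow> weight s \<sigma> r z \<le> weight s \<sigma> r' z"
  unfolding weight_def by (simp add: mult_right_mono)

lemma slice_bound_M_nonneg:
  fixes v :: "(real^'d::finite) \<times> (real^'d) \<Rightarrow> complex"
  assumes "slice_bound s \<sigma> H r M v"
  shows "M \<ge> 0"
proof -
  have "cmod (v 0) \<le> M * H ^ (0 + 0) * fact 0 powr \<sigma> * fact 0 powr s * weight s \<sigma> r (0 :: (real^'d) \<times> (real^'d))"
    using assms[unfolded slice_bound_def, THEN conjunct2, rule_format, where i=undefined and j=undefined and m=0 and n=0 and z=0] by simp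
  then have "0 \<le> M * weight s \<sigma> r (0 :: (real^'d) \<times> (real^'d))" using norm_ge_zero[of "v 0"] by (simp del: norm_ge_zero)
  then show ?thesis using weight_pos(1)[of s \<sigma> r "0 :: (real^'d) \<times> (real^'d)"] by (simp add: zero_le_mult_iff)
qed

lemma windowE:
  assumes "window s \<sigma> A \<rho> K \<phi>"
  obtains \<Phi> where "\<And>l. \<Phi> l 0 = (\<lambda>\<eta>. of_real (\<eta> $ j) ^ l * \<phi> \<eta>)"
    "\<And>l n. continuous_on UNIV (\<Phi> l n)" "\<And>l n. has_dd (axis i 1) (\<Phi> l n) (\<Phi> l (Suc n))"
    "\<And>l n \<eta>. cmod (\<Phi> l n \<eta>) \<le> K * A ^ (l + n) * fact l powr \<sigma> * fact n powr s * exp (- \<rho> * norm \<eta> powr (1 / \<sigma>))"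
proof -
  from assms[unfolded window_def, THEN spec, THEN spec, of j i] obtain \<Phi> where \<Phi>: "\<Phi> 0 0 = \<phi>"
    "\<forall>l. \<Phi> (Suc l) 0 = (\<lambda>\<eta>. of_real (\<eta> $ j) * \<Phi> l 0 \<eta>)"
    "\<forall>l n. continuous_on UNIV (\<Phi> l n) \<and> has_dd (axis i 1) (\<Phi> l n) (\<Phi> l (Suc n)) \<and>
       (\<forall>\<eta>. cmod (\<Phi> l n \<eta>) \<le> K * A ^ (l + n) * fact l powr \<sigma> * fact n powr s * exp (- \<rho> * norm \<eta> powr (1 / \<sigma>)))"
    by (elim exE conjE) rule
  have "\<Phi> l 0 = (\<lambda>\<eta>. of_real (\<eta> $ j) ^ l * \<phi> \<eta>)" for l
    by (induction l) (simp_all add: \<Phi>(1,2) mult.assoc)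
  then show ?thesis using \<Phi>(3) by (intro that[of \<Phi>]) auto
qed

lemma window_bounds:
  fixes \<phi> :: "real^'d::finite \<Rightarrow> complex"
  assumes win: "window s \<sigma> A \<rho> K \<phi>"
  shows "continuous_on UNIV \<phi>" "K \<ge> 0"
    "cmod (of_real (\<eta> $ j) ^ l * \<phi> \<eta>) \<le> K * A ^ l * fact l powr \<sigma> * exp (- \<rho> * norm \<eta> powr (1 / \<sigma>))"
proof -
  obtain \<Phi> where \<Phi>: "\<And>l. \<Phi> l 0 = (\<lambda>\<eta>. of_real (\<eta> $ j) ^ l * \<phi> \<eta>)" "\<And>l n. continuous_on UNIV (\<Phi> l n)"
    "\<And>l n. has_dd (axis undefined 1) (\<Phi> l n) (\<Phi> l (Suc n))"
    "\<And>l n \<eta>. cmod (\<Phi> l n \<eta>) \<le> K * A ^ (l + n) * fact l powr \<sigma> * fact n powr s * exp (- \<rho> * norm \<eta> powr (1 / \<sigma>))"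
    using that by (rule windowE[OF win, where i = undefined and j = j])
  show "continuous_on UNIV \<phi>" using \<Phi>(2)[of 0 0] by (simp add: \<Phi>(1))
  show b: "cmod (of_real (\<eta> $ j) ^ l * \<phi> \<eta>) \<le> K * A ^ l * fact l powr \<sigma> * exp (- \<rho> * norm \<eta> powr (1 / \<sigma>))" for \<eta> l
    using \<Phi>(4)[of l 0 \<eta>] by (simp add: \<Phi>(1))
  have "0 \<le> cmod (of_real ((0::real^'d) $ j) ^ 0 * \<phi> 0)" by (rule norm_ge_zero)
  also have "\<dots> \<le> K" using b[of 0 0] by simp
  finally show "K \<ge> 0" .
qed

lemma smooth_funpow: "smooth u \<Longrightarrow> e \<in> Basis \<Longrightarrow> smooth ((dir_deriv e ^^ n) u)"
  by (induction n) (auto intro: smooth_dir_deriv)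

lemma has_dd_slice_snd:
  assumes "smooth u"
  shows "has_dd (axis i 1) (\<lambda>\<eta>. u (p, w + \<eta>)) (\<lambda>\<eta>. dir_deriv (exi i) u (p, w + \<eta>))"
proof -
  have "has_dd (axis i 1) (\<lambda>\<eta>. u (p, w + \<eta>)) (\<lambda>\<eta>. 1 *\<^sub>R dir_deriv (exi i) u (p, w + \<eta>))"
    by (rule has_dd_scale[OF smooth_has_dd[OF assms ex_Basis(2)[of i]], of "\<lambda>\<eta>. (p, w + \<eta>)"]) auto
  then show ?thesis by simp
qed

lemma has_dd_slice_fst:
  assumes "smooth u"
  shows "has_dd (axis j 1) (\<lambda>y. u (\<mu> *\<^sub>R y, q)) (\<lambda>y. of_real \<mu> * dir_deriv (ex j) u (\<mu> *\<^sub>R y, q))"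
proof -
  have "has_dd (axis j 1) (\<lambda>y. u (\<mu> *\<^sub>R y, q)) (\<lambda>y. \<mu> *\<^sub>R dir_deriv (ex j) u (\<mu> *\<^sub>R y, q))"
    by (rule has_dd_scale[OF smooth_has_dd[OF assms ex_Basis(1)[of j]], of "\<lambda>y. (\<mu> *\<^sub>R y, q)"])
      (auto simp: scaleR_add_right mult.commute)
  then show ?thesis by (simp add: scaleR_conv_of_real)
qed

lemma continuous_on_smooth_comp:
  "smooth u \<Longrightarrow> continuous_on S f \<Longrightarrow> continuous_on S (\<lambda>x. u (f x))"
  using continuous_on_compose2[OF smooth_continuous] by blast

text \<open>The growth in \<eta> is charged to half of the decay of the window, which is why the
  rate condition reads \<open>r * cst s \<sigma> \<le> \<rho> / 2\<close>; the other half remains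
  for integrability. The growth in \<open>w\<close> is left for the decay in \<open>w\<close> that
  is gained later.\<close>

lemma slice_bound_bound:
  fixes v :: "(real^'d::finite) \<times> (real^'d) \<Rightarrow> complex"
  assumes s: "s > 0" "\<sigma> > 0" and slice_bound: "slice_bound s \<sigma> H r M v" and pos: "H > 0" "r > 0" "r * cst s \<sigma> \<le> \<rho> / 2"
  shows "cmod ((dir_deriv (exi i) ^^ n) ((dir_deriv (ex j) ^^ m) v) (p, w + \<eta>)) \<le>
    M * H ^ (m + n) * fact m powr \<sigma> * fact n powr s * (exp (r * norm p powr (1 / s)) *
         exp (r * cst s \<sigma> * norm w powr (1 / \<sigma>)) * exp ((\<rho> / 2) * norm \<eta> powr (1 / \<sigma>)))"
proof -
  have M: "M \<ge> 0" by (rule slice_bound_M_nonneg[OF slice_bound])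
  have "r * norm (w + \<eta>) powr (1 / \<sigma>) \<le> r * (cst s \<sigma> * (norm w powr (1 / \<sigma>) + norm \<eta> powr (1 / \<sigma>)))"
    using pos by (intro mult_left_mono powr_norm_add_cst s) auto
  also have "\<dots> = r * cst s \<sigma> * norm w powr (1 / \<sigma>) + r * cst s \<sigma> * norm \<eta> powr (1 / \<sigma>)"
    by (simp add: algebra_simps)
  also have "r * cst s \<sigma> * norm \<eta> powr (1 / \<sigma>) \<le> (\<rho> / 2) * norm \<eta> powr (1 / \<sigma>)"
    using pos by (intro mult_right_mono) auto
  finally have "weight s \<sigma> r (p, w + \<eta>) \<le> exp (r * norm p powr (1 / s)) *
     exp (r * cst s \<sigma> * norm w powr (1 / \<sigma>)) * exp ((\<rho> / 2) * norm \<eta> powr (1 / \<sigma>))"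
    unfolding weight_def exp_add[symmetric] by (simp add: distrib_left)
  then have "M * H ^ (m + n) * fact m powr \<sigma> * fact n powr s * weight s \<sigma> r (p, w + \<eta>) \<le>
    M * H ^ (m + n) * fact m powr \<sigma> * fact n powr s * (exp (r * norm p powr (1 / s)) *
     exp (r * cst s \<sigma> * norm w powr (1 / \<sigma>)) * exp ((\<rho> / 2) * norm \<eta> powr (1 / \<sigma>)))"
    using M pos by (intro mult_left_mono) auto
  moreover have "cmod ((dir_deriv (exi i) ^^ n) ((dir_deriv (ex j) ^^ m) v) (p, w + \<eta>)) \<le>
     M * H ^ (m + n) * fact m powr \<sigma> * fact n powr s * weight s \<sigma> r (p, w + \<eta>)"
    using slice_bound unfolding slice_bound_def by blast
  ultimately show ?thesis by linarith
qed

text \<open>\<open>fourier_decay\<close> for \<xi>-derivatives of the symbol against derivatives of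
  the window. The \<open>m\<close> derivatives in x and the factor \<eta>_j^l are carried along
  because the integration by parts in \<open>y\<close> will create them.\<close>

lemma inn_decay:
  fixes v :: "(real^'d::finite) \<times> (real^'d) \<Rightarrow> complex"
  assumes s: "s > 0" "\<sigma> > 0" and slice_bound: "slice_bound s \<sigma> H r M v" and win: "window s \<sigma> A \<rho> K \<phi>"
    and gap: "gap CARD('d) s \<sigma> \<Lambda> A \<rho> H r"
  shows "cmod (inn (\<lambda>\<eta>. of_real (\<eta> $ j) ^ l * \<phi> \<eta>) ((dir_deriv (ex j) ^^ m) v) p w y) \<le>
    exp 1 * (M * H ^ m * fact m powr \<sigma> * (K * A ^ l * fact l powr \<sigma>) * exp (r * norm p powr (1 / s)) *
      exp (r * cst s \<sigma> * norm w powr (1 / \<sigma>)) * (LINT \<eta>|lborel. exp (- (\<rho> / 2) * norm (\<eta>::real^'d) powr (1 / \<sigma>)))) *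
    exp (- rate CARD('d) s (2 * max H A) * norm y powr (1 / s))"
proof -
  let ?\<omega> = "\<lambda>\<eta>::real^'d. exp (- (\<rho> / 2) * norm \<eta> powr (1 / \<sigma>))"
  let ?u = "(dir_deriv (ex j) ^^ m) v"
  define C where "C = M * H ^ m * fact m powr \<sigma> * (K * A ^ l * fact l powr \<sigma>) * exp (r * norm p powr (1 / s)) *
      exp (r * cst s \<sigma> * norm w powr (1 / \<sigma>))"
  have sm: "smooth v" using slice_bound by (simp add: slice_bound_def)
  have pos: "A > 0" "\<rho> > 0" "H > 0" "r > 0" "r * cst s \<sigma> \<le> \<rho> / 2" using gap by (auto simp: gap_def)
  have M: "M \<ge> 0" by (rule slice_bound_M_nonneg[OF slice_bound])
  have K: "K \<ge> 0" by (rule window_bounds(2)[OF win])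
  have C: "C \<ge> 0" unfolding C_def using M K pos by simp
  have int\<omega>: "integrable lborel ?\<omega>" using pos s by (intro integrable_exp_powr) auto
  have main: "\<bar>y $ i\<bar> ^ k * cmod (inn (\<lambda>\<eta>. of_real (\<eta> $ j) ^ l * \<phi> \<eta>) ?u p w y) \<le>
    (C * (LINT \<eta>|lborel. ?\<omega> \<eta>)) * (2 * max H A) ^ k * fact k powr s" for i k
  proof -
    obtain \<Phi> where \<Phi>l: "\<And>l. \<Phi> l 0 = (\<lambda>\<eta>. of_real (\<eta> $ j) ^ l * \<phi> \<eta>)"
      and \<Phi>: "\<And>l n. continuous_on UNIV (\<Phi> l n)" "\<And>l n. has_dd (axis i 1) (\<Phi> l n) (\<Phi> l (Suc n))"
      "\<And>l n \<eta>. cmod (\<Phi> l n \<eta>) \<le> K * A ^ (l + n) * fact l powr \<sigma> * fact n powr s * exp (- \<rho> * norm \<eta> powr (1 / \<sigma>))"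
      using that by (rule windowE[OF win, where i = i and j = j])
    define F where "F n \<eta> = (dir_deriv (exi i) ^^ n) ?u (p, w + \<eta>)" for n \<eta>
    have smF: "smooth ((dir_deriv (exi i) ^^ n) ?u)" for n
      by (intro smooth_funpow sm) auto
    have ddF: "has_dd (axis i 1) (F n) (F (Suc n))" for n
      using has_dd_slice_snd[OF smF, of i n p w] unfolding F_def by simp
    have contF: "continuous_on UNIV (F n)" for n
      unfolding F_def by (intro continuous_on_smooth_comp[OF smF] continuous_intros)
    have bF: "cmod (F n \<eta>) \<le> M * H ^ (m + n) * fact m powr \<sigma> * fact n powr s * (exp (r * norm p powr (1 / s)) *
         exp (r * cst s \<sigma> * norm w powr (1 / \<sigma>)) * exp ((\<rho> / 2) * norm \<eta> powr (1 / \<sigma>)))" for n \<eta>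
      unfolding F_def by (rule slice_bound_bound[OF s slice_bound pos(3,4,5)])
    have b: "cmod (F n \<eta> * \<Phi> l n' \<eta>) \<le> C * max H A ^ (n + n') * fact n powr s * fact n' powr s * ?\<omega> \<eta>" for n n' \<eta>
    proof -
      have e: "exp ((\<rho> / 2) * norm \<eta> powr (1 / \<sigma>)) * exp (- \<rho> * norm \<eta> powr (1 / \<sigma>)) = ?\<omega> \<eta>"
        unfolding exp_add[symmetric] by (simp add: algebra_simps)
      have "cmod (F n \<eta> * \<Phi> l n' \<eta>) \<le> (M * H ^ (m + n) * fact m powr \<sigma> * fact n powr s * (exp (r * norm p powr (1 / s)) *
         exp (r * cst s \<sigma> * norm w powr (1 / \<sigma>)) * exp ((\<rho> / 2) * norm \<eta> powr (1 / \<sigma>)))) *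
         (K * A ^ (l + n') * fact l powr \<sigma> * fact n' powr s * exp (- \<rho> * norm \<eta> powr (1 / \<sigma>)))"
        unfolding norm_mult using M pos by (intro mult_mono bF \<Phi>(3)) auto
      also have "\<dots> = C * (H ^ n * A ^ n') * fact n powr s * fact n' powr s *
         (exp ((\<rho> / 2) * norm \<eta> powr (1 / \<sigma>)) * exp (- \<rho> * norm \<eta> powr (1 / \<sigma>)))"
        unfolding C_def by (simp only: power_add mult_ac)
      also have "\<dots> = C * (H ^ n * A ^ n') * fact n powr s * fact n' powr s * ?\<omega> \<eta>"
        unfolding e ..
      also have "\<dots> \<le> C * (max H A ^ n * max H A ^ n') * fact n powr s * fact n' powr s * ?\<omega> \<eta>"
        using C pos by (intro mult_right_mono mult_left_mono mult_mono power_mono) auto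
      finally show ?thesis by (simp add: power_add)
    qed
    have "\<bar>y $ i\<bar> ^ k * cmod (LINT \<eta>|lborel. F 0 \<eta> * \<Phi> l 0 \<eta> * kern y \<eta>) \<le>
      (C * (LINT \<eta>|lborel. ?\<omega> \<eta>)) * (2 * max H A) ^ k * fact k powr s"
      by (rule fourier_decay[OF ddF contF \<Phi>(2) \<Phi>(1) b int\<omega>]) (use s pos C in auto)
    then show ?thesis unfolding inn_def F_def \<Phi>l by simp
  qed
  have "(LINT \<eta>|lborel. ?\<omega> \<eta>) \<ge> 0" by simp
  then show ?thesis
    using coordinate_decay[OF main] C s pos unfolding C_def by auto
qed

lemma inn_integrand_bound:
  fixes v :: "(real^'d::finite) \<times> (real^'d) \<Rightarrow> complex"
  assumes s: "s > 0" "\<sigma> > 0" and slice_bound: "slice_bound s \<sigma> H r M v" and win: "window s \<sigma> A \<rho> K \<phi>"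
    and gap: "gap CARD('d) s \<sigma> \<Lambda> A \<rho> H r"
  shows "cmod ((dir_deriv (ex j) ^^ m) v (p, w + \<eta>) * (of_real (\<eta> $ j) ^ l * \<phi> \<eta>) * kern y \<eta>) \<le>
    M * H ^ m * fact m powr \<sigma> * (K * A ^ l * fact l powr \<sigma>) * exp (r * norm p powr (1 / s)) *
      exp (r * cst s \<sigma> * norm w powr (1 / \<sigma>)) * exp (- (\<rho> / 2) * norm \<eta> powr (1 / \<sigma>))"
proof -
  have pos: "A > 0" "\<rho> > 0" "H > 0" "r > 0" "r * cst s \<sigma> \<le> \<rho> / 2" using gap by (auto simp: gap_def)
  have M: "M \<ge> 0" by (rule slice_bound_M_nonneg[OF slice_bound])
  have e: "exp ((\<rho> / 2) * norm \<eta> powr (1 / \<sigma>)) * exp (- \<rho> * norm \<eta> powr (1 / \<sigma>)) = exp (- (\<rho> / 2) * norm \<eta> powr (1 / \<sigma>))"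
    unfolding exp_add[symmetric] by (simp add: algebra_simps)
  have "cmod ((dir_deriv (ex j) ^^ m) v (p, w + \<eta>)) \<le> M * H ^ m * fact m powr \<sigma> * (exp (r * norm p powr (1 / s)) *
         exp (r * cst s \<sigma> * norm w powr (1 / \<sigma>)) * exp ((\<rho> / 2) * norm \<eta> powr (1 / \<sigma>)))"
    using slice_bound_bound[OF s slice_bound pos(3,4,5), where i = undefined and n = 0 and j = j and m = m and p = p and w = w and \<eta> = \<eta>] by simp
  moreover have "cmod (of_real (\<eta> $ j) ^ l * \<phi> \<eta>) \<le> K * A ^ l * fact l powr \<sigma> * exp (- \<rho> * norm \<eta> powr (1 / \<sigma>))"
    by (rule window_bounds(3)[OF win])
  ultimately have "cmod ((dir_deriv (ex j) ^^ m) v (p, w + \<eta>)) * cmod (of_real (\<eta> $ j) ^ l * \<phi> \<eta>) \<le>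
     M * H ^ m * fact m powr \<sigma> * (exp (r * norm p powr (1 / s)) *
         exp (r * cst s \<sigma> * norm w powr (1 / \<sigma>)) * exp ((\<rho> / 2) * norm \<eta> powr (1 / \<sigma>))) *
     (K * A ^ l * fact l powr \<sigma> * exp (- \<rho> * norm \<eta> powr (1 / \<sigma>)))"
    using M pos by (intro mult_mono) auto
  moreover have "cmod ((dir_deriv (ex j) ^^ m) v (p, w + \<eta>) * (of_real (\<eta> $ j) ^ l * \<phi> \<eta>) * kern y \<eta>) =
     cmod ((dir_deriv (ex j) ^^ m) v (p, w + \<eta>)) * cmod (of_real (\<eta> $ j) ^ l * \<phi> \<eta>)"
    by (subst norm_mult, subst norm_mult, simp only: norm_kern mult_1_right)
  ultimately have "cmod ((dir_deriv (ex j) ^^ m) v (p, w + \<eta>) * (of_real (\<eta> $ j) ^ l * \<phi> \<eta>) * kern y \<eta>) \<le>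
     M * H ^ m * fact m powr \<sigma> * (exp (r * norm p powr (1 / s)) *
         exp (r * cst s \<sigma> * norm w powr (1 / \<sigma>)) * exp ((\<rho> / 2) * norm \<eta> powr (1 / \<sigma>))) *
     (K * A ^ l * fact l powr \<sigma> * exp (- \<rho> * norm \<eta> powr (1 / \<sigma>)))" by simp
  also have "\<dots> = M * H ^ m * fact m powr \<sigma> * (K * A ^ l * fact l powr \<sigma>) * exp (r * norm p powr (1 / s)) *
      exp (r * cst s \<sigma> * norm w powr (1 / \<sigma>)) *
      (exp ((\<rho> / 2) * norm \<eta> powr (1 / \<sigma>)) * exp (- \<rho> * norm \<eta> powr (1 / \<sigma>)))"
    by (simp only: mult_ac)
  finally show ?thesis unfolding e .
qed

lemma continuous_on_inn_integrand:
  fixes u :: "(real^'d::finite) \<times> (real^'d) \<Rightarrow> complex"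
  assumes "continuous_on UNIV u" "continuous_on UNIV \<phi>"
    "continuous_on UNIV X" "continuous_on UNIV p" "continuous_on UNIV w" "continuous_on UNIV y"
  shows "continuous_on UNIV (\<lambda>q. u (X (fst q) + (p (fst q), w (fst q) + snd q)) * \<phi> (snd q) * kern (y (fst q)) (snd q))"
  by (intro continuous_intros continuous_on_compose2[OF assms(1)] continuous_on_compose2[OF assms(2)]
      continuous_on_compose2[OF assms(3)] continuous_on_compose2[OF assms(4)] continuous_on_compose2[OF assms(5)]
      continuous_on_compose2[OF assms(6)]) auto

text \<open>Measurability is joint in all parameters, the translation \<open>X q\<close> of the
  symbol included, because Fubini will later exchange these integrals with the ones over phase space
  and over \<tau>.\<close>

lemma inn_measurable:
  fixes u :: "(real^'d::finite) \<times> (real^'d) \<Rightarrow> complex" and X :: "'q::euclidean_space \<Rightarrow> (real^'d) \<times> (real^'d)"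
  assumes "continuous_on UNIV u" "continuous_on UNIV \<phi>"
    "continuous_on UNIV X" "continuous_on UNIV p" "continuous_on UNIV w" "continuous_on UNIV y"
  shows "(\<lambda>q. inn \<phi> (\<lambda>z. u (X q + z)) (p q) (w q) (y q)) \<in> borel_measurable borel"
  unfolding inn_def
  by (rule borel_measurable_LINT, rule borel_measurable_continuous_onI, rule continuous_on_inn_integrand[OF assms])

lemma inn_kern_measurable:
  fixes u :: "(real^'d::finite) \<times> (real^'d) \<Rightarrow> complex" and X :: "'q::euclidean_space \<Rightarrow> (real^'d) \<times> (real^'d)"
  assumes "continuous_on UNIV u" "continuous_on UNIV \<phi>"
    "continuous_on UNIV X" "continuous_on UNIV p" "continuous_on UNIV w" "continuous_on UNIV y" "continuous_on UNIV w'"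
  shows "(\<lambda>q. inn \<phi> (\<lambda>z. u (X q + z)) (p q) (w q) (y q) * kern (y q) (w' q)) \<in> borel_measurable borel"
  by (intro borel_measurable_times inn_measurable assms borel_measurable_continuous_onI continuous_on_kern)

lemma osc_measurable:
  fixes u :: "(real^'d::finite) \<times> (real^'d) \<Rightarrow> complex" and X :: "'q::euclidean_space \<Rightarrow> (real^'d) \<times> (real^'d)"
  assumes "continuous_on UNIV u" "continuous_on UNIV \<phi>"
    "continuous_on UNIV X" "continuous_on UNIV \<mu>"
  shows "continuous_on UNIV w \<Longrightarrow> (\<lambda>q. LINT y|lborel. inn \<phi> (\<lambda>z. u (X q + z)) (\<mu> q *\<^sub>R y) (w q) y * kern y (w q)) \<in> borel_measurable borel"
    "(\<lambda>q. osc (\<mu> q) \<phi> (\<lambda>z. u (X q + z))) \<in> borel_measurable borel"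
proof -
  have comp: "continuous_on UNIV (\<lambda>q. f (fst q))" if "continuous_on UNIV f" for f :: "'a::topological_space \<Rightarrow> 'b::topological_space"
    by (rule continuous_on_compose2[OF that]) (auto intro: continuous_intros)
  have *: "(\<lambda>q. LINT y|lborel. inn \<phi> (\<lambda>z. u (X q + z)) (\<mu> q *\<^sub>R y) (w q) y * kern y (w q)) \<in> borel_measurable borel"
    if "continuous_on UNIV X" "continuous_on UNIV \<mu>" "continuous_on UNIV w"
    for X :: "'r::euclidean_space \<Rightarrow> (real^'d) \<times> (real^'d)" and \<mu> :: "'r \<Rightarrow> real" and w
    by (rule borel_measurable_LINT, rule inn_kern_measurable)
      (intro assms comp that continuous_on_scaleR continuous_on_snd continuous_on_id)+
  then show "continuous_on UNIV w \<Longrightarrow> (\<lambda>q. LINT y|lborel. inn \<phi> (\<lambda>z. u (X q + z)) (\<mu> q *\<^sub>R y) (w q) y * kern y (w q)) \<in> borel_measurable borel"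
    using assms by blast
  show "(\<lambda>q. osc (\<mu> q) \<phi> (\<lambda>z. u (X q + z))) \<in> borel_measurable borel"
    unfolding osc_def
    by (intro borel_measurable_times borel_measurable_const borel_measurable_LINT *)
      (intro assms comp continuous_on_snd continuous_on_id)+
qed

text \<open>The decay of \<open>inn\<close> in \<open>y\<close> absorbs the growth at the point
  \<open>\<mu> *\<^sub>R y\<close>. For the decay in \<open>w\<close>, a factor w_j is a
  y_j-derivative of \<open>kern y w\<close>. By parts it falls on the symbol, at cost
  \<open>\<bar>\<mu>\<bar>\<close>, or on the inner kernel, where it brings down \<eta>_j at cost 1.
  The total cost is at most \<open>\<Lambda> + 1\<close>, which explains the scale in
  \<open>R2\<close>.\<close>

lemma osc_middle_bound:
  fixes v :: "(real^'d::finite) \<times> (real^'d) \<Rightarrow> complex"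
  assumes s: "s > 0" "\<sigma> > 0" and slice_bound: "slice_bound s \<sigma> H r M v" and win: "window s \<sigma> A \<rho> K \<phi>"
    and gap: "gap CARD('d) s \<sigma> \<Lambda> A \<rho> H r" and \<mu>: "\<bar>\<mu>\<bar> \<le> \<Lambda>"
  defines "R1 \<equiv> rate CARD('d) s (2 * max H A)" and "R2 \<equiv> rate CARD('d) \<sigma> ((\<Lambda> + 1) * max H A)"
  defines "\<Omega>1 \<equiv> (LINT \<eta>|lborel. exp (- (\<rho> / 2) * norm (\<eta>::real^'d) powr (1 / \<sigma>)))"
    and "\<Omega>2 \<equiv> (LINT y|lborel. exp (- (R1 / 2) * norm (y::real^'d) powr (1 / s)))"
  shows "cmod (inn \<phi> v (\<mu> *\<^sub>R y) w y * kern y w) \<le>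
      (exp 1 * M * K * \<Omega>1 * exp (r * cst s \<sigma> * norm w powr (1 / \<sigma>))) * exp (- (R1 / 2) * norm y powr (1 / s))" (is ?A)
    "cmod (LINT y|lborel. inn \<phi> v (\<mu> *\<^sub>R y) w y * kern y w) \<le>
      exp 1 * exp 1 * M * K * \<Omega>1 * \<Omega>2 * exp (- (R2 / 2) * norm w powr (1 / \<sigma>))" (is ?B)
proof -
  define B where "B = max H A"
  have pos: "A > 0" "\<rho> > 0" "H > 0" "r > 0" "r * cst s \<sigma> \<le> \<rho> / 2" "\<Lambda> \<ge> 1" "B > 0"
    "r * \<Lambda> powr (1 / s) \<le> R1 / 2" "r * cst s \<sigma> \<le> R2 / 2"
    using gap by (auto simp: gap_def R1_def R2_def B_def)
  have R1: "R1 > 0" using pos unfolding R1_def by (intro rate_pos) auto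
  have M: "M \<ge> 0" by (rule slice_bound_M_nonneg[OF slice_bound])
  have K: "K \<ge> 0" by (rule window_bounds(2)[OF win])
  have \<Omega>: "\<Omega>1 \<ge> 0" "\<Omega>2 \<ge> 0" unfolding \<Omega>1_def \<Omega>2_def by simp_all
  have sm: "smooth v" using slice_bound by (simp add: slice_bound_def)
  define Kw where "Kw = exp 1 * M * K * \<Omega>1 * exp (r * cst s \<sigma> * norm w powr (1 / \<sigma>))"
  have Kw: "Kw \<ge> 0" using M K \<Omega> by (simp add: Kw_def)
  let ?\<omega> = "\<lambda>y::real^'d. exp (- (R1 / 2) * norm y powr (1 / s))"
  have int\<omega>: "integrable lborel (\<lambda>y. c * ?\<omega> y)" for c
    using R1 s by (intro integrable_mult_right integrable_exp_powr) auto
  \<comment> \<open>The index \<open>m\<close> counts x_j-derivatives of the symbol and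
    \<open>l\<close>, below, powers of \<eta>_j on the window; these are the two indices of the
    ladder.\<close>
  define V where "V j m = (dir_deriv (ex j) ^^ m) v" for j m
  define \<psi> where "\<psi> j l \<eta> = of_real (\<eta> $ j) ^ l * \<phi> \<eta>" for j l \<eta>
  have smV: "smooth (V j m)" for j m unfolding V_def by (intro smooth_funpow sm) auto
  have cont\<psi>: "continuous_on UNIV (\<psi> j l)" for j l
    unfolding \<psi>_def by (intro continuous_intros window_bounds(1)[OF win])
  define Q where "Q j m l y = inn (\<psi> j l) (V j m) (\<mu> *\<^sub>R y) w y * kern y w" for j m l y
  have Qb: "cmod (Q j m l y) \<le> Kw * B ^ (m + l) * fact m powr \<sigma> * fact l powr \<sigma> * ?\<omega> y" for j m l y
  proof -
    have "cmod (Q j m l y) \<le> exp 1 * (M * H ^ m * fact m powr \<sigma> * (K * A ^ l * fact l powr \<sigma>) * exp (r * norm (\<mu> *\<^sub>R y) powr (1 / s)) *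
      exp (r * cst s \<sigma> * norm w powr (1 / \<sigma>)) * \<Omega>1) * exp (- R1 * norm y powr (1 / s))"
      using inn_decay[OF s slice_bound win gap, where j = j and l = l and m = m and p = "\<mu> *\<^sub>R y" and w = w and y = y]
      unfolding Q_def V_def \<psi>_def[abs_def] norm_mult[of "inn _ _ _ _ _"] norm_kern R1_def \<Omega>1_def by simp
    also have "\<dots> = Kw * (H ^ m * A ^ l) * fact m powr \<sigma> * fact l powr \<sigma> * (exp (r * norm (\<mu> *\<^sub>R y) powr (1 / s)) * exp (- R1 * norm y powr (1 / s)))"
      unfolding Kw_def by (simp only: mult_ac)
    also have "\<dots> \<le> Kw * (B ^ m * B ^ l) * fact m powr \<sigma> * fact l powr \<sigma> * ?\<omega> y"
    proof (intro mult_mono mult_nonneg_nonneg)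
      have "r * norm (\<mu> *\<^sub>R y) powr (1 / s) = r * \<bar>\<mu>\<bar> powr (1 / s) * norm y powr (1 / s)" by (simp add: powr_mult)
      also have "\<dots> \<le> r * \<Lambda> powr (1 / s) * norm y powr (1 / s)"
        using pos \<mu> s by (intro mult_right_mono mult_left_mono powr_mono2) auto
      also have "\<dots> \<le> R1 / 2 * norm y powr (1 / s)" using pos by (intro mult_right_mono) auto
      finally show "exp (r * norm (\<mu> *\<^sub>R y) powr (1 / s)) * exp (- R1 * norm y powr (1 / s)) \<le> ?\<omega> y"
        unfolding exp_add[symmetric] by (simp add: algebra_simps)
    qed (use Kw pos in \<open>auto intro!: power_mono simp: B_def\<close>)
    finally show ?thesis by (simp add: power_add)
  qed
  show ?A using Qb[of undefined 0 0 y] unfolding Q_def V_def \<psi>_def Kw_def by simp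
  have Qm: "Q j m l \<in> borel_measurable borel" for j m l
    using inn_kern_measurable[OF smooth_continuous[OF smV[of j m]] cont\<psi>[of j l], of "\<lambda>_. 0" "\<lambda>y. \<mu> *\<^sub>R y" "\<lambda>_. w" "\<lambda>y. y" "\<lambda>_. w"]
    unfolding Q_def by (simp add: continuous_intros)
  have Qint: "integrable lborel (Q j m l)" for j m l
    by (rule integrable_bound[OF int\<omega> Qm Qb])
  define J where "J j m l = (LINT y|lborel. Q j m l y)" for j m l
  have Jb: "cmod (J j m l) \<le> (Kw * \<Omega>2) * B ^ (m + l) * fact m powr \<sigma> * fact l powr \<sigma>" for j m l
    using norm_integral_bound[OF int\<omega> Qm Qb, of j m l] by (simp add: J_def \<Omega>2_def mult_ac)
  \<comment> \<open>The integral of the y_j-derivative of \<open>Q j m l\<close> is zero.\<close>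
  have ident: "of_real \<mu> * J j (Suc m) l - \<i> * of_real (w $ j) * J j m l - \<i> * J j m (Suc l) = 0" for j m l
  proof -
    let ?e = "axis j 1 :: real^'d"
    let ?Q' = "\<lambda>y. of_real \<mu> * Q j (Suc m) l y - \<i> * of_real (w $ j) * Q j m l y - \<i> * Q j m (Suc l) y"
    \<comment> \<open>The integrand of \<open>Q\<close> at fixed \<eta>, with both kernels merged
      into \<open>kern (w + \<eta>) y\<close>, and below its y_j-derivative. Only increments are
      integrated over \<eta>, by Fubini, as \<open>integral_increment_zero\<close> permits.\<close>
    define h where "h \<eta> y = V j m (\<mu> *\<^sub>R y, w + \<eta>) * \<psi> j l \<eta> * kern (w + \<eta>) y" for \<eta> y
    define h' where "h' \<eta> y = of_real \<mu> * (V j (Suc m) (\<mu> *\<^sub>R y, w + \<eta>) * \<psi> j l \<eta> * kern (w + \<eta>) y)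
       - \<i> * of_real (w $ j) * (V j m (\<mu> *\<^sub>R y, w + \<eta>) * \<psi> j l \<eta> * kern (w + \<eta>) y)
       - \<i> * (V j m (\<mu> *\<^sub>R y, w + \<eta>) * \<psi> j (Suc l) \<eta> * kern (w + \<eta>) y)" for \<eta> y
    have kk: "kern (w + \<eta>) y = kern y \<eta> * kern y w" for y \<eta>
      by (simp add: inner_commute[of _ y] inner_simps algebra_simps exp_add[symmetric])
    define G where "G m l p \<eta> = M * H ^ m * fact m powr \<sigma> * (K * A ^ l * fact l powr \<sigma>) * exp (r * norm p powr (1 / s)) *
      exp (r * cst s \<sigma> * norm w powr (1 / \<sigma>)) * exp (- (\<rho> / 2) * norm \<eta> powr (1 / \<sigma>))" for m l and p \<eta> :: "real^'d"
    have int_G: "integrable lborel (G m l p)" for m l p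
      unfolding G_def using pos s by (intro integrable_mult_right integrable_exp_powr) auto
    have term_b: "cmod (V j m (p, w + \<eta>) * \<psi> j l \<eta> * kern (w + \<eta>) y) \<le> G m l p \<eta>" for m l p \<eta> y
      using inn_integrand_bound[OF s slice_bound win gap, where j = j and m = m and p = p and w = w and \<eta> = \<eta> and l = l and y = y]
      unfolding kk V_def \<psi>_def G_def by (simp add: norm_mult)
    have cont_t: "continuous_on UNIV (\<lambda>q. V j m (\<mu> *\<^sub>R (y + snd q *\<^sub>R ?e), w + fst q) * \<psi> j l (fst q) * kern (w + fst q) (y + snd q *\<^sub>R ?e))"
      for m l y
      by (intro continuous_intros continuous_on_smooth_comp[OF smV] continuous_on_compose2[OF cont\<psi>]) auto
    have int_t: "integrable lborel (\<lambda>\<eta>. V j m (\<mu> *\<^sub>R y, w + \<eta>) * \<psi> j l \<eta> * kern (w + \<eta>) y)" for m l y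
    proof (rule integrable_bound[OF int_G _ term_b])
      show "(\<lambda>\<eta>. V j m (\<mu> *\<^sub>R y, w + \<eta>) * \<psi> j l \<eta> * kern (w + \<eta>) y) \<in> borel_measurable borel"
        by (intro borel_measurable_continuous_onI continuous_intros continuous_on_smooth_comp[OF smV] continuous_on_compose2[OF cont\<psi>]) auto
    qed
    have Qh: "Q j m l y = (LINT \<eta>|lborel. V j m (\<mu> *\<^sub>R y, w + \<eta>) * \<psi> j l \<eta> * kern (w + \<eta>) y)" for m l y
      unfolding Q_def inn_def kk by (simp add: mult.assoc[symmetric])
    have Q'h: "?Q' y = (LINT \<eta>|lborel. h' \<eta> y)" for y
      unfolding h'_def Qh using int_t by (simp add: Bochner_Integration.integral_diff)
    have dd: "has_dd ?e (h \<eta>) (h' \<eta>)" for \<eta>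
    proof -
      have "has_dd ?e (\<lambda>y. (V j m (\<mu> *\<^sub>R y, w + \<eta>) * \<psi> j l \<eta>) * kern (w + \<eta>) y)
        (\<lambda>y. (\<psi> j l \<eta> * (of_real \<mu> * dir_deriv (ex j) (V j m) (\<mu> *\<^sub>R y, w + \<eta>))) * kern (w + \<eta>) y +
           (V j m (\<mu> *\<^sub>R y, w + \<eta>) * \<psi> j l \<eta>) * (- \<i> * of_real ((w + \<eta>) $ j) * kern (w + \<eta>) y))"
        using has_dd_cmult[OF has_dd_slice_fst[OF smV[of j m], of j \<mu> "w + \<eta>"], of "\<psi> j l \<eta>"]
        by (intro has_dd_mult has_dd_kern) (simp add: mult.commute)
      moreover have "dir_deriv (ex j) (V j m) = V j (Suc m)" by (simp add: V_def)
      moreover have "\<psi> j (Suc l) \<eta> = of_real (\<eta> $ j) * \<psi> j l \<eta>" by (simp add: \<psi>_def)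
      ultimately show ?thesis unfolding h_def h'_def by (simp add: algebra_simps)
    qed
    have cont_h': "continuous_on UNIV (h' \<eta>)" for \<eta>
      unfolding h'_def by (intro continuous_intros continuous_on_smooth_comp[OF smV])
    have incr: "Q j m l (y + ?e) - Q j m l y = (LINT \<tau>:{0..1}|lborel. ?Q' (y + \<tau> *\<^sub>R ?e))" for y
    proof -
      let ?f = "\<lambda>\<eta> \<tau>. indicator {0..1} \<tau> *\<^sub>R h' \<eta> (y + \<tau> *\<^sub>R ?e)"
      \<comment> \<open>A point whose norm exceeds that of every
        \<open>\<mu> *\<^sub>R (y + \<tau> *\<^sub>R ?e)\<close> with 0 \<le> \<tau> \<le> 1, so
        that the majorant in \<eta> is independent of \<tau>.\<close>
      define P where "P = (\<Lambda> * (norm y + 1)) *\<^sub>R ?e"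
      have normP: "norm P = \<Lambda> * (norm y + 1)" unfolding P_def using pos by simp
      define g where "g \<eta> = \<bar>\<mu>\<bar> * G (Suc m) l P \<eta> + \<bar>w $ j\<bar> * G m l P \<eta> + G m (Suc l) P \<eta>" for \<eta>
      have GP: "G m l (\<mu> *\<^sub>R (y + \<tau> *\<^sub>R ?e)) \<eta> \<le> G m l P \<eta>" if "\<tau> \<in> {0..1}" for m l \<tau> \<eta>
      proof -
        have "norm (y + \<tau> *\<^sub>R ?e) \<le> norm y + 1"
          using norm_triangle_ineq[of y "\<tau> *\<^sub>R ?e"] that by simp
        then have "norm (\<mu> *\<^sub>R (y + \<tau> *\<^sub>R ?e)) \<le> norm P"
          unfolding normP norm_scaleR using \<mu> by (intro mult_mono) auto
        then have "exp (r * norm (\<mu> *\<^sub>R (y + \<tau> *\<^sub>R ?e)) powr (1 / s)) \<le> exp (r * norm P powr (1 / s))"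
          using pos s by (auto intro!: mult_left_mono powr_mono2)
        then show ?thesis unfolding G_def using M K pos
          by (intro mult_right_mono mult_left_mono) auto
      qed
      have fb: "norm (?f \<eta> \<tau>) \<le> g \<eta> * indicator {0..1} \<tau>" for \<eta> \<tau>
      proof (cases "\<tau> \<in> {0..1::real}")
        case True
        have t: "cmod (V j m (\<mu> *\<^sub>R (y + \<tau> *\<^sub>R ?e), w + \<eta>) * \<psi> j l \<eta> * kern (w + \<eta>) (y + \<tau> *\<^sub>R ?e)) \<le> G m l P \<eta>" for m l
          using term_b GP[OF True] by (rule order_trans)
        have "cmod (h' \<eta> (y + \<tau> *\<^sub>R ?e)) \<le> g \<eta>"
          unfolding h'_def g_def
          by (intro order_trans[OF norm_triangle_ineq4] add_mono)
            (use t[of "Suc m" l] t[of m l] t[of m "Suc l"] in \<open>auto simp: norm_mult[of "of_real _"] norm_mult[of "\<i> * of_real _"] norm_mult[of "\<i>"] intro!: mult_left_mono\<close>)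
        then show ?thesis using True by simp
      qed simp
      have fm: "(\<lambda>q. ?f (fst q) (snd q)) \<in> borel_measurable borel"
      proof (intro borel_measurable_scaleR)
        have "indicator {0..1} \<in> borel_measurable (borel :: real measure)" by simp
        from measurable_compose[OF borel_measurable_continuous_onI[OF continuous_on_snd[OF continuous_on_id]] this]
        show "(\<lambda>q. indicator {0..1} (snd q) :: real) \<in> borel_measurable (borel :: ((real^'d) \<times> real) measure)" .
        show "(\<lambda>q. h' (fst q) (y + snd q *\<^sub>R ?e)) \<in> borel_measurable borel"
          unfolding h'_def by (rule borel_measurable_continuous_onI) (intro continuous_on_diff continuous_on_mult_left cont_t)
      qed
      have intg: "integrable lborel g"
        unfolding g_def by (intro Bochner_Integration.integrable_add integrable_mult_right int_G)
      have "Q j m l (y + ?e) - Q j m l y = (LINT \<eta>|lborel. h \<eta> (y + ?e) - h \<eta> y)"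
        unfolding Qh h_def using int_t by (subst Bochner_Integration.integral_diff) auto
      also have "\<dots> = (LINT \<eta>|lborel. LINT \<tau>|lborel. ?f \<eta> \<tau>)"
        using has_dd_increment[OF dd cont_h'] by (simp add: set_lebesgue_integral_def)
      also have "\<dots> = (LINT \<tau>|lborel. LINT \<eta>|lborel. ?f \<eta> \<tau>)"
        by (rule fubini_dominated(3)[OF fm fb intg]) simp
      also have "\<dots> = (LINT \<tau>:{0..1}|lborel. ?Q' (y + \<tau> *\<^sub>R ?e))"
        unfolding set_lebesgue_integral_def Q'h by simp
      finally show ?thesis .
    qed
    have "(LINT y|lborel. ?Q' y) = 0"
      by (rule integral_increment_zero[OF Qint _ incr]) (intro Qint Bochner_Integration.integrable_diff integrable_mult_right)
    then show ?thesis unfolding J_def using Qint by (simp add: Bochner_Integration.integral_diff)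
  qed
  have step: "\<bar>w $ j\<bar> * cmod (J j m l) \<le> \<bar>\<mu>\<bar> * cmod (J j (Suc m) l) + 1 * cmod (J j m (Suc l))" for j m l
  proof -
    have "\<i> * of_real (w $ j) * J j m l = of_real \<mu> * J j (Suc m) l - \<i> * J j m (Suc l)"
      using ident[of j m l] by (simp add: algebra_simps)
    from arg_cong[OF this, of cmod] norm_triangle_ineq4[of "of_real \<mu> * J j (Suc m) l" "\<i> * J j m (Suc l)"]
    show ?thesis by (simp add: norm_mult)
  qed
  have main: "\<bar>w $ j\<bar> ^ k * cmod (LINT y|lborel. inn \<phi> v (\<mu> *\<^sub>R y) w y * kern y w) \<le> (Kw * \<Omega>2) * ((\<Lambda> + 1) * B) ^ k * fact k powr \<sigma>" for j k
  proof -
    have "\<bar>w $ j\<bar> ^ k * cmod (J j 0 0) \<le> (Kw * \<Omega>2) * ((\<bar>\<mu>\<bar> + 1) * B) ^ k * fact k powr \<sigma>"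
      by (rule double_ladder_bound[OF step Jb]) (use s Kw \<Omega> pos in auto)
    also have "\<dots> \<le> (Kw * \<Omega>2) * ((\<Lambda> + 1) * B) ^ k * fact k powr \<sigma>"
      using Kw \<Omega> pos \<mu> by (intro mult_right_mono mult_left_mono power_mono) auto
    finally show ?thesis by (simp add: J_def Q_def \<psi>_def[abs_def] V_def)
  qed
  have "cmod (LINT y|lborel. inn \<phi> v (\<mu> *\<^sub>R y) w y * kern y w) \<le> exp 1 * (Kw * \<Omega>2) * exp (- R2 * norm w powr (1 / \<sigma>))"
    using coordinate_decay[OF main] Kw \<Omega> pos s unfolding R2_def B_def by auto
  also have "\<dots> = exp 1 * exp 1 * M * K * \<Omega>1 * \<Omega>2 * (exp (r * cst s \<sigma> * norm w powr (1 / \<sigma>)) * exp (- R2 * norm w powr (1 / \<sigma>)))"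
    unfolding Kw_def by (simp only: mult_ac)
  also have "\<dots> \<le> exp 1 * exp 1 * M * K * \<Omega>1 * \<Omega>2 * exp (- (R2 / 2) * norm w powr (1 / \<sigma>))"
  proof (intro mult_left_mono)
    have "r * cst s \<sigma> * norm w powr (1 / \<sigma>) \<le> R2 / 2 * norm w powr (1 / \<sigma>)" using pos by (intro mult_right_mono) auto
    then show "exp (r * cst s \<sigma> * norm w powr (1 / \<sigma>)) * exp (- R2 * norm w powr (1 / \<sigma>)) \<le> exp (- (R2 / 2) * norm w powr (1 / \<sigma>))"
      unfolding exp_add[symmetric] by (simp add: algebra_simps)
  qed (use M K \<Omega> in auto)
  finally show ?B .
qed

section \<open>The Born--Jordan symbol\<close>

text \<open>Integrability at each of the three levels of \<open>osc\<close>, bundled because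
  linearity of \<open>osc\<close> uses linearity of every one of the nested integrals.\<close>

definition oscint :: "real \<Rightarrow> (real^'d::finite \<Rightarrow> complex) \<Rightarrow> ((real^'d) \<times> (real^'d) \<Rightarrow> complex) \<Rightarrow> bool" where
  "oscint \<mu> \<phi> v \<longleftrightarrow> (\<forall>p w y. integrable lborel (\<lambda>\<eta>. v (p, w + \<eta>) * \<phi> \<eta> * kern y \<eta>)) \<and>
     (\<forall>w. integrable lborel (\<lambda>y. inn \<phi> v (\<mu> *\<^sub>R y) w y * kern y w)) \<and>
     integrable lborel (\<lambda>w. LINT y|lborel. inn \<phi> v (\<mu> *\<^sub>R y) w y * kern y w)"

lemma osc_lincomb:
  assumes "oscint \<mu> \<phi> u" "oscint \<mu> \<phi> v"
  shows "oscint \<mu> \<phi> (\<lambda>z. u z + c * v z)"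
    "osc \<mu> \<phi> (\<lambda>z. u z + c * v z) = osc \<mu> \<phi> u + c * osc \<mu> \<phi> v"
proof -
  have e: "(u z + c * v z) * x * y = u z * x * y + c * (v z * x * y)" for z x y
    by (simp add: algebra_simps)
  have i: "inn \<phi> (\<lambda>z. u z + c * v z) p w y = inn \<phi> u p w y + c * inn \<phi> v p w y" for p w y
    unfolding inn_def e using assms by (simp add: oscint_def)
  have e2: "(a + c * b) * k = a * k + c * (b * k)" for a b k :: complex
    by (simp add: algebra_simps)
  have m: "(LINT y|lborel. inn \<phi> (\<lambda>z. u z + c * v z) (\<mu> *\<^sub>R y) w y * kern y w) =
     (LINT y|lborel. inn \<phi> u (\<mu> *\<^sub>R y) w y * kern y w) + c * (LINT y|lborel. inn \<phi> v (\<mu> *\<^sub>R y) w y * kern y w)" for w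
    unfolding i e2 using assms by (simp add: oscint_def)
  show "oscint \<mu> \<phi> (\<lambda>z. u z + c * v z)"
    unfolding oscint_def m unfolding i e e2 using assms by (simp add: oscint_def)
  show "osc \<mu> \<phi> (\<lambda>z. u z + c * v z) = osc \<mu> \<phi> u + c * osc \<mu> \<phi> v"
    unfolding osc_def m using assms by (simp add: oscint_def algebra_simps)
qed

lemma slice_bound_oscint:
  fixes v :: "(real^'d::finite) \<times> (real^'d) \<Rightarrow> complex"
  assumes s: "s > 0" "\<sigma> > 0" and slice_bound: "slice_bound s \<sigma> H r M v" and win: "window s \<sigma> A \<rho> K \<phi>"
    and gap: "gap CARD('d) s \<sigma> \<Lambda> A \<rho> H r" and \<mu>: "\<bar>\<mu>\<bar> \<le> \<Lambda>"
  shows "oscint \<mu> \<phi> v"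
proof -
  have pos: "\<rho> > 0" "A > 0" "H > 0" "\<Lambda> \<ge> 1" using gap by (auto simp: gap_def)
  have cv: "continuous_on UNIV v" using slice_bound smooth_continuous by (auto simp: slice_bound_def)
  note c\<phi> = window_bounds(1)[OF win]
  have R: "rate CARD('d) s (2 * max H A) > 0" "rate CARD('d) \<sigma> ((\<Lambda> + 1) * max H A) > 0"
    using pos by (intro rate_pos; simp add: less_max_iff_disj)+
  show ?thesis
    unfolding oscint_def
  proof (intro conjI allI)
    fix p w y :: "real^'d"
    show "integrable lborel (\<lambda>\<eta>. v (p, w + \<eta>) * \<phi> \<eta> * kern y \<eta>)"
    proof (rule integrable_bound)
      show "integrable lborel (\<lambda>\<eta>. M * K * exp (r * norm p powr (1 / s)) *
         exp (r * cst s \<sigma> * norm w powr (1 / \<sigma>)) * exp (- (\<rho> / 2) * norm (\<eta>::real^'d) powr (1 / \<sigma>)))"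
        using pos s by (intro integrable_mult_right integrable_exp_powr) auto
      show "cmod (v (p, w + \<eta>) * \<phi> \<eta> * kern y \<eta>) \<le> M * K * exp (r * norm p powr (1 / s)) *
         exp (r * cst s \<sigma> * norm w powr (1 / \<sigma>)) * exp (- (\<rho> / 2) * norm (\<eta>::real^'d) powr (1 / \<sigma>))" for \<eta>
        using inn_integrand_bound[OF s slice_bound win gap, where m = 0 and l = 0 and p = p and w = w and \<eta> = \<eta> and y = y] by simp
      show "(\<lambda>\<eta>. v (p, w + \<eta>) * \<phi> \<eta> * kern y \<eta>) \<in> borel_measurable borel"
        by (intro borel_measurable_continuous_onI continuous_intros continuous_on_compose2[OF cv] c\<phi>) auto
    qed
    show "integrable lborel (\<lambda>y. inn \<phi> v (\<mu> *\<^sub>R y) w y * kern y w)"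
    proof (rule integrable_bound[OF _ _ osc_middle_bound(1)[OF s slice_bound win gap \<mu>]])
      show "(\<lambda>y. inn \<phi> v (\<mu> *\<^sub>R y) w y * kern y w) \<in> borel_measurable borel"
        using inn_kern_measurable[OF cv c\<phi>, of "\<lambda>_. 0" "\<lambda>y. \<mu> *\<^sub>R y" "\<lambda>_. w" "\<lambda>y. y" "\<lambda>_. w"]
        by (simp add: continuous_intros)
    qed (use s R in \<open>intro integrable_mult_right integrable_exp_powr; simp\<close>)
    show "integrable lborel (\<lambda>w. LINT y|lborel. inn \<phi> v (\<mu> *\<^sub>R y) w y * kern y w)"
    proof (rule integrable_bound[OF _ _ osc_middle_bound(2)[OF s slice_bound win gap \<mu>]])
      show "(\<lambda>w. LINT y|lborel. inn \<phi> v (\<mu> *\<^sub>R y) w y * kern y w) \<in> borel_measurable borel"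
        using osc_measurable(1)[OF cv c\<phi>, of "\<lambda>_. 0" "\<lambda>_. \<mu>" "\<lambda>w. w"] by (simp add: continuous_intros)
    qed (use s R in \<open>intro integrable_mult_right integrable_exp_powr; simp\<close>)
  qed
qed

text \<open>The constant depends neither on \<mu> nor on the symbol. Uniformity in \<mu> permits
  averaging over \<tau>, and proportionality to \<open>M\<close> drives both the symbol estimates
  and differentiability.\<close>

lemma osc_bound:
  fixes \<phi> :: "real^'d::finite \<Rightarrow> complex"
  assumes s: "s > 0" "\<sigma> > 0" and win: "window s \<sigma> A \<rho> K \<phi>" and gap: "gap CARD('d) s \<sigma> \<Lambda> A \<rho> H r"
  shows "\<exists>C\<ge>0. \<forall>\<mu> M v. \<bar>\<mu>\<bar> \<le> \<Lambda> \<longrightarrow> slice_bound s \<sigma> H r M v \<longrightarrow> cmod (osc \<mu> \<phi> v) \<le> C * M"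
proof -
  define R1 where "R1 = rate CARD('d) s (2 * max H A)"
  define R2 where "R2 = rate CARD('d) \<sigma> ((\<Lambda> + 1) * max H A)"
  define \<Omega>1 where "\<Omega>1 = (LINT \<eta>|lborel. exp (- (\<rho> / 2) * norm (\<eta>::real^'d) powr (1 / \<sigma>)))"
  define \<Omega>2 where "\<Omega>2 = (LINT y|lborel. exp (- (R1 / 2) * norm (y::real^'d) powr (1 / s)))"
  define \<Omega>3 where "\<Omega>3 = (LINT w|lborel. exp (- (R2 / 2) * norm (w::real^'d) powr (1 / \<sigma>)))"
  define C where "C = inverse ((2 * pi) ^ CARD('d)) * (exp 1 * exp 1 * K * \<Omega>1 * \<Omega>2 * \<Omega>3)"
  have K: "K \<ge> 0" by (rule window_bounds(2)[OF win])
  have "C \<ge> 0" unfolding C_def \<Omega>1_def \<Omega>2_def \<Omega>3_def using K by (intro mult_nonneg_nonneg) simp_all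
  have pos: "A > 0" "H > 0" "\<Lambda> \<ge> 1" using gap by (auto simp: gap_def)
  have R2: "R2 > 0" unfolding R2_def using pos by (intro rate_pos; simp add: less_max_iff_disj)
  have "cmod (osc \<mu> \<phi> v) \<le> C * M" if \<mu>: "\<bar>\<mu>\<bar> \<le> \<Lambda>" and slice_bound: "slice_bound s \<sigma> H r M v" for \<mu> M v
  proof -
    have cv: "continuous_on UNIV v" using slice_bound smooth_continuous by (auto simp: slice_bound_def)
    have "cmod (LINT w|lborel. LINT y|lborel. inn \<phi> v (\<mu> *\<^sub>R y) w y * kern y w) \<le>
       (LINT w|lborel. (exp 1 * exp 1 * M * K * \<Omega>1 * \<Omega>2) * exp (- (R2 / 2) * norm (w::real^'d) powr (1 / \<sigma>)))"
    proof (rule norm_integral_bound)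
      show "integrable lborel (\<lambda>w::real^'d. (exp 1 * exp 1 * M * K * \<Omega>1 * \<Omega>2) * exp (- (R2 / 2) * norm w powr (1 / \<sigma>)))"
        using s R2 by (intro integrable_mult_right integrable_exp_powr) auto
      show "(\<lambda>w. LINT y|lborel. inn \<phi> v (\<mu> *\<^sub>R y) w y * kern y w) \<in> borel_measurable borel"
        using osc_measurable(1)[OF cv window_bounds(1)[OF win], of "\<lambda>_. 0" "\<lambda>_. \<mu>" "\<lambda>w. w"] by (simp add: continuous_intros)
    qed (unfold R1_def R2_def \<Omega>1_def \<Omega>2_def, rule osc_middle_bound(2)[OF s slice_bound win gap \<mu>])
    also have "\<dots> = (exp 1 * exp 1 * M * K * \<Omega>1 * \<Omega>2) * \<Omega>3" unfolding \<Omega>3_def by (rule integral_mult_right_zero)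
    finally have "cmod (LINT w|lborel. LINT y|lborel. inn \<phi> v (\<mu> *\<^sub>R y) w y * kern y w) \<le> (exp 1 * exp 1 * M * K * \<Omega>1 * \<Omega>2) * \<Omega>3" .
    from mult_left_mono[OF this, of "inverse ((2 * pi) ^ CARD('d))"]
    moreover have "cmod (complex_of_real (inverse ((2 * pi) ^ CARD('d)))) = inverse ((2 * pi) ^ CARD('d))"
      unfolding norm_of_real by simp
    ultimately show ?thesis unfolding osc_def norm_mult C_def by (simp add: mult_ac)
  qed
  then show ?thesis using \<open>C \<ge> 0\<close> by blast
qed

section \<open>Symbol estimates under derivatives and translations\<close>

definition symb_bound :: "real \<Rightarrow> real \<Rightarrow> real \<Rightarrow> real \<Rightarrow> real \<Rightarrow> ((real^'d::finite) \<times> (real^'d) \<Rightarrow> complex) \<Rightarrow> bool" where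
  "symb_bound s \<sigma> H r M u \<longleftrightarrow> smooth u \<and> (\<forall>\<alpha> \<beta> z. cmod (mderiv \<alpha> \<beta> u z) \<le>
     M * (H ^ (mabs \<alpha> + mabs \<beta>) * mfact \<alpha> powr \<sigma> * mfact \<beta> powr s * weight s \<sigma> r z))"

lemma mfact_pos: "mfact \<alpha> > 0"
  by (simp add: mfact_def prod_pos)

lemma mabs_mfact_upd: "mabs ((\<lambda>_. 0)(j := m)) = m" "mfact ((\<lambda>_. 0)(j := m)) = fact m"
proof -
  have "(\<Sum>i\<in>UNIV. ((\<lambda>_. 0)(j := m)) i) = (\<Sum>i\<in>UNIV. if i = j then m else 0)"
    by (intro sum.cong) auto
  then show "mabs ((\<lambda>_. 0)(j := m)) = m" by (simp add: mabs_def)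
  have "(\<Prod>i\<in>UNIV. fact (((\<lambda>_. 0)(j := m)) i) :: real) = (\<Prod>i\<in>UNIV. if i = j then fact m else 1)"
    by (intro prod.cong) auto
  then show "mfact ((\<lambda>_. 0)(j := m)) = fact m" by (simp add: mfact_def)
qed

lemma mabs_0: "mabs (\<lambda>_. 0) = 0" and mfact_0: "mfact (\<lambda>_. 0) = 1"
  by (simp_all add: mabs_def mfact_def)

lemma mabs_add: "mabs (\<lambda>i. \<alpha> i + \<beta> i) = mabs \<alpha> + mabs \<beta>"
  by (simp add: mabs_def sum.distrib)

lemma mfact_add: "mfact (\<lambda>i. \<alpha> i + \<beta> i) \<le> 2 ^ (mabs \<alpha> + mabs \<beta>) * (mfact \<alpha> * mfact \<beta>)"
proof -
  have "mfact (\<lambda>i. \<alpha> i + \<beta> i) \<le> (\<Prod>i\<in>UNIV. 2 ^ (\<alpha> i + \<beta> i) * (fact (\<alpha> i) * fact (\<beta> i)))"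
    unfolding mfact_def by (intro prod_mono) (auto intro: fact_add_le)
  also have "\<dots> = 2 ^ (mabs \<alpha> + mabs \<beta>) * (mfact \<alpha> * mfact \<beta>)"
    by (simp add: prod.distrib mfact_def mabs_def power_sum power_add)
  finally show ?thesis .
qed

lemma mfact_add_powr:
  assumes "\<theta> > 0"
  shows "mfact (\<lambda>i. \<alpha> i + \<beta> i) powr \<theta> \<le> (2 powr \<theta>) ^ (mabs \<alpha> + mabs \<beta>) * (mfact \<alpha> powr \<theta> * mfact \<beta> powr \<theta>)"
proof -
  have "mfact (\<lambda>i. \<alpha> i + \<beta> i) powr \<theta> \<le> (2 ^ (mabs \<alpha> + mabs \<beta>) * (mfact \<alpha> * mfact \<beta>)) powr \<theta>"
    using assms mfact_pos[of "\<lambda>i. \<alpha> i + \<beta> i"] by (intro powr_mono2 mfact_add) auto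
  also have "\<dots> = (2 ^ (mabs \<alpha> + mabs \<beta>)) powr \<theta> * (mfact \<alpha> powr \<theta> * mfact \<beta> powr \<theta>)"
    using mfact_pos[of \<alpha>] mfact_pos[of \<beta>] by (simp add: powr_mult)
  also have "((2::real) ^ (mabs \<alpha> + mabs \<beta>)) powr \<theta> = (2 powr \<theta>) ^ (mabs \<alpha> + mabs \<beta>)"
    by (simp add: powr_powr mult.commute flip: powr_realpow)
  finally show ?thesis .
qed

lemma symb_bound_M_nonneg:
  fixes u :: "(real^'d::finite) \<times> (real^'d) \<Rightarrow> complex"
  assumes "symb_bound s \<sigma> H r M u"
  shows "M \<ge> 0"
proof -
  have "cmod (u 0) \<le> M * weight s \<sigma> r (0 :: (real^'d) \<times> (real^'d))"
    using assms[unfolded symb_bound_def, THEN conjunct2, rule_format, where \<alpha>="\<lambda>_. 0" and \<beta>="\<lambda>_. 0" and z=0]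
    by (simp add: mabs_0 mfact_0 mderiv_0)
  then have "0 \<le> M * weight s \<sigma> r (0 :: (real^'d) \<times> (real^'d))" using norm_ge_zero[of "u 0"] by (simp del: norm_ge_zero)
  then show ?thesis using weight_pos(1)[of s \<sigma> r "0 :: (real^'d) \<times> (real^'d)"] by (simp add: zero_le_mult_iff)
qed

text \<open>Factorials of a sum of orders split up to powers of 2, so a derivative of a symbol is a
  symbol at the scale enlarged by \<open>2 powr (s + \<sigma>)\<close>. The new constant already has
  the size demanded of the derivative of that order, so bounds on values alone will yield full
  symbol estimates.\<close>

lemma symb_bound_mderiv:
  fixes u :: "(real^'d::finite) \<times> (real^'d) \<Rightarrow> complex"
  assumes s: "s > 0" "\<sigma> > 0" and H: "H > 0" and u: "symb_bound s \<sigma> H r M u"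
  defines "H' \<equiv> H * 2 powr (s + \<sigma>)"
  shows "symb_bound s \<sigma> H' r (M * (H' ^ (mabs \<alpha> + mabs \<beta>) * mfact \<alpha> powr \<sigma> * mfact \<beta> powr s)) (mderiv \<alpha> \<beta> u)"
  unfolding symb_bound_def
proof (intro conjI allI)
  have sm: "smooth u" using u by (simp add: symb_bound_def)
  show "smooth (mderiv \<alpha> \<beta> u)"
    unfolding mderiv_eq_foldr by (intro smooth_foldr sm mderiv_dirs)
  have M: "M \<ge> 0" by (rule symb_bound_M_nonneg[OF u])
  fix \<gamma> \<delta> :: "'d \<Rightarrow> nat" and z
  let ?a = "mabs \<gamma> + mabs \<alpha>" and ?b = "mabs \<delta> + mabs \<beta>"
  have "cmod (mderiv \<gamma> \<delta> (mderiv \<alpha> \<beta> u) z) = cmod (mderiv (\<lambda>i. \<gamma> i + \<alpha> i) (\<lambda>i. \<delta> i + \<beta> i) u z)"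
    by (simp only: mderiv_mderiv[OF sm])
  also have "\<dots> \<le> M * (H ^ (?a + ?b) * mfact (\<lambda>i. \<gamma> i + \<alpha> i) powr \<sigma> * mfact (\<lambda>i. \<delta> i + \<beta> i) powr s * weight s \<sigma> r z)"
    using u[unfolded symb_bound_def, THEN conjunct2, rule_format, where \<alpha>="\<lambda>i. \<gamma> i + \<alpha> i" and \<beta>="\<lambda>i. \<delta> i + \<beta> i" and z=z]
    by (simp only: mabs_add)
  also have "\<dots> \<le> M * (H ^ (?a + ?b) * ((2 powr \<sigma>) ^ ?a * (mfact \<gamma> powr \<sigma> * mfact \<alpha> powr \<sigma>)) *
      ((2 powr s) ^ ?b * (mfact \<delta> powr s * mfact \<beta> powr s)) * weight s \<sigma> r z)"
    using M H weight_pos(2)[of s \<sigma> r z] by (intro mult_left_mono mult_right_mono mult_mono mfact_add_powr s) auto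
  also have "\<dots> = M * weight s \<sigma> r z * (mfact \<gamma> powr \<sigma> * mfact \<alpha> powr \<sigma> * (mfact \<delta> powr s * mfact \<beta> powr s)) * (H ^ (?a + ?b) * ((2 powr \<sigma>) ^ ?a * (2 powr s) ^ ?b))"
    by (simp only: mult_ac)
  also have "\<dots> \<le> M * weight s \<sigma> r z * (mfact \<gamma> powr \<sigma> * mfact \<alpha> powr \<sigma> * (mfact \<delta> powr s * mfact \<beta> powr s)) * H' ^ (?a + ?b)"
  proof (intro mult_left_mono)
    have "(2 powr \<sigma>) ^ ?a * (2 powr s) ^ ?b \<le> (2 powr (s + \<sigma>)) ^ ?a * (2 powr (s + \<sigma>)) ^ ?b"
      using s by (intro mult_mono power_mono powr_mono) auto
    then show "H ^ (?a + ?b) * ((2 powr \<sigma>) ^ ?a * (2 powr s) ^ ?b) \<le> H' ^ (?a + ?b)"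
      using H unfolding H'_def power_mult_distrib by (intro mult_left_mono) (auto simp: power_add)
  qed (use M weight_pos(2)[of s \<sigma> r z] in auto)
  also have "\<dots> = M * (H' ^ (mabs \<alpha> + mabs \<beta>) * mfact \<alpha> powr \<sigma> * mfact \<beta> powr s) *
      (H' ^ (mabs \<gamma> + mabs \<delta>) * mfact \<gamma> powr \<sigma> * mfact \<delta> powr s * weight s \<sigma> r z)"
    by (simp only: power_add mult_ac)
  finally show "cmod (mderiv \<gamma> \<delta> (mderiv \<alpha> \<beta> u) z) \<le> M * (H' ^ (mabs \<alpha> + mabs \<beta>) * mfact \<alpha> powr \<sigma> * mfact \<beta> powr s) *
      (H' ^ (mabs \<gamma> + mabs \<delta>) * mfact \<gamma> powr \<sigma> * mfact \<delta> powr s * weight s \<sigma> r z)" .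
qed

lemma dir_deriv_eq_mderiv:
  fixes u :: "(real^'d::finite) \<times> (real^'d) \<Rightarrow> complex"
  assumes "smooth u" "e \<in> Basis"
  obtains \<alpha> \<beta> where "dir_deriv e u = mderiv \<alpha> \<beta> u"
proof -
  from assms(2) consider j where "e = ex j" | i where "e = exi i"
    by (auto simp: Basis_prod_def Basis_vec_def)
  then show ?thesis
  proof cases
    case 1
    show ?thesis
      by (rule that[of "(\<lambda>_. 0)(j := 0 + 1)" "(\<lambda>_. 0)(undefined := 0 + 0)"])
        (use dir_deriv_powers_mderiv[OF assms(1), where j=j and m=1 and \<alpha>="\<lambda>_. 0" and \<beta>="\<lambda>_. 0" and n=0 and i=undefined] 1 in \<open>simp add: mderiv_0\<close>)
  next
    case 2
    show ?thesis
      by (rule that[of "(\<lambda>_. 0)(undefined := 0 + 0)" "(\<lambda>_. 0)(i := 0 + 1)"])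
        (use dir_deriv_powers_mderiv[OF assms(1), where i=i and m=0 and \<alpha>="\<lambda>_. 0" and \<beta>="\<lambda>_. 0" and n=1 and j=undefined] 2 in \<open>simp add: mderiv_0\<close>)
  qed
qed

lemma symb_bound_power:
  fixes u :: "(real^'d::finite) \<times> (real^'d) \<Rightarrow> complex"
  assumes "symb_bound s \<sigma> H r M u"
  shows "cmod ((dir_deriv (exi i) ^^ n) ((dir_deriv (ex j) ^^ m) u) z) \<le>
    M * H ^ (m + n) * fact m powr \<sigma> * fact n powr s * weight s \<sigma> r z"
proof -
  have sm: "smooth u" using assms by (simp add: symb_bound_def)
  have "(dir_deriv (exi i) ^^ n) ((dir_deriv (ex j) ^^ m) u) = mderiv ((\<lambda>_. 0)(j := m)) ((\<lambda>_. 0)(i := n)) u"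
    using dir_deriv_powers_mderiv[OF sm, where i=i and j=j and m=m and n=n and \<alpha>="\<lambda>_. 0" and \<beta>="\<lambda>_. 0"]
    by (simp add: mderiv_0)
  then show ?thesis
    using assms[unfolded symb_bound_def, THEN conjunct2, rule_format, where \<alpha>="(\<lambda>_. 0)(j := m)" and \<beta>="(\<lambda>_. 0)(i := n)" and z=z]
    by (simp add: mabs_mfact_upd mult.assoc)
qed

lemma dir_deriv_powers_foldr:
  "(dir_deriv (exi i) ^^ n) ((dir_deriv (ex j) ^^ m) u) = foldr dir_deriv (replicate n (exi i) @ replicate m (ex j)) u"
  "set (replicate n (exi i) @ replicate m (ex j)) \<subseteq> Basis"
  by (auto simp: foldr_replicate_dir_deriv)

text \<open>The weight at the new origin \<open>X\<close> moves into the constant. This is where the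
  growth of the resulting symbol at \<open>X\<close> comes from.\<close>

lemma slice_bound_translate:
  fixes u :: "(real^'d::finite) \<times> (real^'d) \<Rightarrow> complex"
  assumes s: "s > 0" "\<sigma> > 0" and u: "symb_bound s \<sigma> H r M u" and pos: "H > 0" "r > 0"
  shows "slice_bound s \<sigma> H (r * cst s \<sigma>) (M * weight s \<sigma> (r * cst s \<sigma>) X) (\<lambda>z. u (X + z))"
  unfolding slice_bound_def
proof (intro conjI allI)
  have sm: "smooth u" using u by (simp add: symb_bound_def)
  show "smooth (\<lambda>z. u (X + z))" by (rule smooth_translate[OF sm])
  have M: "M \<ge> 0" by (rule symb_bound_M_nonneg[OF u])
  fix i j m n z
  have "(dir_deriv (exi i) ^^ n) ((dir_deriv (ex j) ^^ m) (\<lambda>z. u (X + z))) z = (dir_deriv (exi i) ^^ n) ((dir_deriv (ex j) ^^ m) u) (X + z)"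
    unfolding dir_deriv_powers_foldr(1) by (subst foldr_dir_deriv_translate[OF sm dir_deriv_powers_foldr(2)]) rule
  also have "cmod \<dots> \<le> M * H ^ (m + n) * fact m powr \<sigma> * fact n powr s * weight s \<sigma> r (X + z)"
    by (rule symb_bound_power[OF u])
  also have "\<dots> \<le> M * H ^ (m + n) * fact m powr \<sigma> * fact n powr s * (weight s \<sigma> (r * cst s \<sigma>) X * weight s \<sigma> (r * cst s \<sigma>) z)"
    using M pos s by (intro mult_left_mono weight_add) auto
  finally show "cmod ((dir_deriv (exi i) ^^ n) ((dir_deriv (ex j) ^^ m) (\<lambda>z. u (X + z))) z) \<le>
    M * weight s \<sigma> (r * cst s \<sigma>) X * H ^ (m + n) * fact m powr \<sigma> * fact n powr s * weight s \<sigma> (r * cst s \<sigma>) z"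
    by (simp only: mult_ac)
qed

text \<open>The mean value inequality applied twice, first to \<open>g'\<close> and then to
  \<open>g\<close> minus its linear part; this gives \<open>K\<close> instead of the sharp constant
  K / 2.\<close>

lemma taylor2_bound:
  fixes g :: "real \<Rightarrow> complex"
  assumes d1: "\<And>t. (g has_vector_derivative g' t) (at t)" and d2: "\<And>t. (g' has_vector_derivative g'' t) (at t)"
    and b: "\<And>t. \<bar>t\<bar> \<le> 1 \<Longrightarrow> cmod (g'' t) \<le> K" and \<epsilon>: "\<bar>\<epsilon>\<bar> \<le> 1"
  shows "cmod (g \<epsilon> - g 0 - of_real \<epsilon> * g' 0) \<le> K * \<epsilon>\<^sup>2"
proof -
  have mvt: "cmod (f x - f 0) \<le> B * \<bar>x\<bar>"
    if "\<And>t. (f has_vector_derivative f' t) (at t)" "\<And>t. \<bar>t\<bar> \<le> \<bar>x\<bar> \<Longrightarrow> cmod (f' t) \<le> B" for f f' :: "real \<Rightarrow> complex" and x B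
  proof -
    have "norm (f x - f 0) \<le> B * norm (x - 0)"
    proof (rule differentiable_bound[where S="{-\<bar>x\<bar>..\<bar>x\<bar>}" and f'="\<lambda>t h. h *\<^sub>R f' t"])
      fix t assume t: "t \<in> {-\<bar>x\<bar>..\<bar>x\<bar>}"
      show "(f has_derivative (\<lambda>h. h *\<^sub>R f' t)) (at t within {-\<bar>x\<bar>..\<bar>x\<bar>})"
        using that(1)[of t] unfolding has_vector_derivative_def by (rule has_derivative_at_withinI)
      show "onorm (\<lambda>h. h *\<^sub>R f' t) \<le> B"
      proof (rule onorm_le)
        fix h :: real
        have "\<bar>h\<bar> * cmod (f' t) \<le> \<bar>h\<bar> * B" using t by (intro mult_left_mono that(2)) auto
        then show "norm (h *\<^sub>R f' t) \<le> B * norm h" by (simp add: mult.commute)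
      qed
    qed auto
    then show ?thesis by simp
  qed
  have K: "K \<ge> 0" using b[of 0] norm_ge_zero[of "g'' 0"] by linarith
  define f where "f t = g t - of_real t * g' 0" for t
  have "(f has_vector_derivative (g' t - g' 0)) (at t)" for t
  proof -
    have "((\<lambda>t. g t - t *\<^sub>R g' 0) has_vector_derivative (g' t - 1 *\<^sub>R g' 0)) (at t)"
      by (intro has_vector_derivative_diff d1) (auto intro!: derivative_eq_intros)
    then show ?thesis unfolding f_def by (simp add: scaleR_conv_of_real)
  qed
  moreover have "cmod (g' t - g' 0) \<le> K * \<bar>\<epsilon>\<bar>" if "\<bar>t\<bar> \<le> \<bar>\<epsilon>\<bar>" for t
  proof -
    have "cmod (g' t - g' 0) \<le> K * \<bar>t\<bar>" using \<epsilon> that by (intro mvt[OF d2] b) auto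
    also have "\<dots> \<le> K * \<bar>\<epsilon>\<bar>" using K that by (intro mult_left_mono) auto
    finally show ?thesis .
  qed
  ultimately have "cmod (f \<epsilon> - f 0) \<le> (K * \<bar>\<epsilon>\<bar>) * \<bar>\<epsilon>\<bar>" by (rule mvt)
  then show ?thesis unfolding f_def by (simp add: power2_eq_square mult.assoc algebra_simps)
qed

section \<open>Smoothness and bounds of the averaged symbol\<close>

text \<open>\<open>osc\<close> evaluates the multiplier at the origin only; its value at
  \<open>X\<close> is obtained by translating the symbol. The parameter \<open>\<tau> - t\<close> is
  the change of quantisation from \<tau> to \<open>t\<close>.\<close>

definition bj_symbol :: "real \<Rightarrow> (real^'d::finite \<Rightarrow> complex) \<Rightarrow> ((real^'d) \<times> (real^'d) \<Rightarrow> complex) \<Rightarrow> (real^'d) \<times> (real^'d) \<Rightarrow> complex" where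
  "bj_symbol t \<phi> u X = (LINT \<tau>:{0..1}|lborel. osc (\<tau> - t) \<phi> (\<lambda>z. u (X + z)))"

text \<open>The rate in \<open>gap\<close> is \<open>r * cst s \<sigma>\<close> because
  \<open>osc\<close> acts on translates of a symbol of rate \<open>r\<close>;
  \<open>1 + \<bar>t\<bar>\<close> bounds \<open>\<tau> - t\<close> for 0 \<le> \<tau> \<le>
  1.\<close>

definition osc_admissible :: "real \<Rightarrow> real \<Rightarrow> real \<Rightarrow> (real^'d::finite \<Rightarrow> complex) \<Rightarrow> real \<Rightarrow> real \<Rightarrow> bool" where
  "osc_admissible s \<sigma> t \<phi> H r \<longleftrightarrow> (\<exists>A \<rho> K. window s \<sigma> A \<rho> K \<phi> \<and> gap CARD('d) s \<sigma> (1 + \<bar>t\<bar>) A \<rho> H (r * cst s \<sigma>))"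

lemma osc_admissibleE:
  fixes \<phi> :: "real^'d::finite \<Rightarrow> complex"
  assumes s: "s > 0" "\<sigma> > 0" and "osc_admissible s \<sigma> t \<phi> H r"
  obtains A \<rho> K where "window s \<sigma> A \<rho> K \<phi>" "gap CARD('d) s \<sigma> (1 + \<bar>t\<bar>) A \<rho> H (r * cst s \<sigma>)" "H > 0" "r > 0"
proof -
  obtain A \<rho> K where *: "window s \<sigma> A \<rho> K \<phi>" "gap CARD('d) s \<sigma> (1 + \<bar>t\<bar>) A \<rho> H (r * cst s \<sigma>)"
    using assms(3) unfolding osc_admissible_def by blast
  moreover have "H > 0" "r * cst s \<sigma> > 0" using * by (auto simp: gap_def)
  moreover have "cst s \<sigma> > 0" using cst_ge1[OF s] by linarith
  ultimately show ?thesis using that by (simp add: zero_less_mult_iff)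
qed

lemma set_integral_bound01:
  fixes f :: "real \<Rightarrow> complex"
  assumes [measurable]: "f \<in> borel_measurable borel" and b: "\<And>\<tau>. \<tau> \<in> {0..1} \<Longrightarrow> cmod (f \<tau>) \<le> C"
  shows "set_integrable lborel {0..1} f" "cmod (LINT \<tau>:{0..1}|lborel. f \<tau>) \<le> C"
proof -
  have i: "integrable lborel (\<lambda>\<tau>::real. C * indicator {0..1} \<tau>)" by simp
  have m: "(\<lambda>\<tau>. indicator {0..1} \<tau> *\<^sub>R f \<tau>) \<in> borel_measurable borel" by measurable
  have bb: "norm (indicator {0..1} \<tau> *\<^sub>R f \<tau>) \<le> C * indicator {0..1} \<tau>" for \<tau>
    using b[of \<tau>] by (auto simp: indicator_def)
  show "set_integrable lborel {0..1} f"
    unfolding set_integrable_def by (rule integrable_bound[OF i m bb])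
  show "cmod (LINT \<tau>:{0..1}|lborel. f \<tau>) \<le> C"
    using norm_integral_bound[OF i m bb] by (simp add: set_lebesgue_integral_def)
qed

lemma osc_tau_measurable:
  fixes \<phi> :: "real^'d::finite \<Rightarrow> complex"
  assumes "continuous_on UNIV v" "continuous_on UNIV \<phi>"
  shows "(\<lambda>\<tau>. osc (\<tau> - t) \<phi> v) \<in> borel_measurable borel"
  using osc_measurable(2)[OF assms, of "\<lambda>_::real. 0" "\<lambda>\<tau>. \<tau> - t"]
  by (simp add: continuous_on_diff continuous_on_id)

lemma osc_average_bound:
  fixes \<phi> :: "real^'d::finite \<Rightarrow> complex"
  assumes s: "s > 0" "\<sigma> > 0" and win: "window s \<sigma> A \<rho> K \<phi>" and gap: "gap CARD('d) s \<sigma> (1 + \<bar>t\<bar>) A \<rho> H r"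
  shows "\<exists>C\<ge>0. \<forall>M v. slice_bound s \<sigma> H r M v \<longrightarrow> set_integrable lborel {0..1} (\<lambda>\<tau>. osc (\<tau> - t) \<phi> v) \<and>
    cmod (LINT \<tau>:{0..1}|lborel. osc (\<tau> - t) \<phi> v) \<le> C * M"
proof -
  obtain C where C: "C \<ge> 0" "\<And>\<mu> M v. \<bar>\<mu>\<bar> \<le> 1 + \<bar>t\<bar> \<Longrightarrow> slice_bound s \<sigma> H r M v \<Longrightarrow> cmod (osc \<mu> \<phi> v) \<le> C * M"
    using osc_bound[OF s win gap] by blast
  show ?thesis
  proof (intro exI[of _ C] conjI allI impI)
    fix M and v :: "(real^'d) \<times> (real^'d) \<Rightarrow> complex" assume v: "slice_bound s \<sigma> H r M v"
    then have "continuous_on UNIV v" by (auto simp: slice_bound_def intro: smooth_continuous)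
    note m = osc_tau_measurable[OF this window_bounds(1)[OF win], of t]
    have "cmod (osc (\<tau> - t) \<phi> v) \<le> C * M" if "\<tau> \<in> {0..1}" for \<tau>
      using that by (intro C(2) v) auto
    from set_integral_bound01[OF m this]
    show "set_integrable lborel {0..1} (\<lambda>\<tau>. osc (\<tau> - t) \<phi> v)" "cmod (LINT \<tau>:{0..1}|lborel. osc (\<tau> - t) \<phi> v) \<le> C * M"
      by auto
  qed (rule C(1))
qed

lemma bj_symbol_bound:
  fixes \<phi> :: "real^'d::finite \<Rightarrow> complex"
  assumes s: "s > 0" "\<sigma> > 0" and t: "osc_admissible s \<sigma> t \<phi> H r"
  shows "\<exists>C\<ge>0. \<forall>M u X. symb_bound s \<sigma> H r M u \<longrightarrow> cmod (bj_symbol t \<phi> u X) \<le> C * M * weight s \<sigma> (r * cst s \<sigma>) X"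
proof -
  obtain A \<rho> K where A: "window s \<sigma> A \<rho> K \<phi>" "gap CARD('d) s \<sigma> (1 + \<bar>t\<bar>) A \<rho> H (r * cst s \<sigma>)" "H > 0" "r > 0"
    by (rule osc_admissibleE[OF s t])
  obtain C where C: "C \<ge> 0" "\<And>M v. slice_bound s \<sigma> H (r * cst s \<sigma>) M v \<Longrightarrow> cmod (LINT \<tau>:{0..1}|lborel. osc (\<tau> - t) \<phi> v) \<le> C * M"
    using osc_average_bound[OF s A(1,2)] by blast
  show ?thesis
  proof (intro exI[of _ C] conjI allI impI C(1))
    fix M X and u :: "(real^'d) \<times> (real^'d) \<Rightarrow> complex" assume "symb_bound s \<sigma> H r M u"
    from C(2)[OF slice_bound_translate[OF s this A(3,4), of X]]
    show "cmod (bj_symbol t \<phi> u X) \<le> C * M * weight s \<sigma> (r * cst s \<sigma>) X" by (simp only: bj_symbol_def mult.assoc)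
  qed
qed

text \<open>The second derivative along \<open>e\<close> is a symbol, and derivatives commute with
  Taylor expansion, so the first-order remainder obeys all slice estimates with an additional
  \<epsilon>^2. \<open>W\<close> dominates the weights at the points between \<open>X\<close> and
  its displacement. The remainder is written with sums and scalar factors only, to match
  \<open>osc_lincomb\<close>.\<close>

lemma remainder_adm:
  fixes u :: "(real^'d::finite) \<times> (real^'d) \<Rightarrow> complex" and X :: "(real^'d) \<times> (real^'d)"
  assumes s: "s > 0" "\<sigma> > 0" and sm: "smooth u" and e: "e \<in> Basis"
    and u2: "symb_bound s \<sigma> H r M (dir_deriv e (dir_deriv e u))" and pos: "H > 0" "r > 0" and \<epsilon>: "\<bar>\<epsilon>\<bar> \<le> 1"
  defines "W \<equiv> exp (r * cst s \<sigma> * ((norm X + 1) powr (1 / s) + (norm X + 1) powr (1 / \<sigma>)))"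
  shows "slice_bound s \<sigma> H (r * cst s \<sigma>) (M * W * \<epsilon>\<^sup>2)
    (\<lambda>z. (u ((X + \<epsilon> *\<^sub>R e) + z) + (- 1) * u (X + z)) + (- of_real \<epsilon>) * dir_deriv e u (X + z))"
  unfolding slice_bound_def
proof (intro conjI allI)
  let ?u' = "dir_deriv e u"
  have sm': "smooth ?u'" "smooth (dir_deriv e ?u')" by (intro smooth_dir_deriv sm e)+
  have st: "smooth (\<lambda>z. u (Y + z))" "smooth (\<lambda>z. ?u' (Y + z))" for Y by (intro smooth_translate sm sm')+
  note sl = smooth_lincomb[OF st(1)[of "X + \<epsilon> *\<^sub>R e"] st(1)[of X], of "- 1"]
  show "smooth (\<lambda>z. (u ((X + \<epsilon> *\<^sub>R e) + z) + (- 1) * u (X + z)) + (- of_real \<epsilon>) * ?u' (X + z))"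
    by (rule smooth_lincomb[OF sl st(2)])
  have M: "M \<ge> 0" by (rule symb_bound_M_nonneg[OF u2])
  fix i j :: 'd and m n z
  define bs where "bs = replicate n (exi i) @ replicate m (ex j)"
  have bs: "set bs \<subseteq> Basis" unfolding bs_def by (rule dir_deriv_powers_foldr(2))
  \<comment> \<open>The slice derivative is taken first and the Taylor expansion along
    \<open>e\<close> afterwards; commutation of derivatives identifies the second-order term with a
    slice derivative of the second derivative of \<open>u\<close>.\<close>
  define D where "D = foldr dir_deriv bs u"
  have smD: "smooth D" unfolding D_def by (rule smooth_foldr[OF sm bs])
  have D1: "foldr dir_deriv bs ?u' = dir_deriv e D"
    using foldr_dir_deriv_mset_cong[OF sm, of "bs @ [e]" "e # bs"] bs e by (simp add: D_def)
  have D2: "foldr dir_deriv bs (dir_deriv e ?u') = dir_deriv e (dir_deriv e D)"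
    using foldr_dir_deriv_mset_cong[OF sm, of "bs @ [e, e]" "e # e # bs"] bs e by (simp add: D_def)
  define g where "g \<theta> = D (X + z + \<theta> *\<^sub>R e)" for \<theta>
  have D2b: "cmod (dir_deriv e (dir_deriv e D) (X + z + \<theta> *\<^sub>R e)) \<le>
     M * H ^ (m + n) * fact m powr \<sigma> * fact n powr s * (W * weight s \<sigma> (r * cst s \<sigma>) z)" if "\<bar>\<theta>\<bar> \<le> 1" for \<theta>
  proof -
    have "cmod (dir_deriv e (dir_deriv e D) (X + z + \<theta> *\<^sub>R e)) \<le> M * H ^ (m + n) * fact m powr \<sigma> * fact n powr s * weight s \<sigma> r (X + z + \<theta> *\<^sub>R e)"
      unfolding D2[symmetric] bs_def dir_deriv_powers_foldr(1)[symmetric] by (rule symb_bound_power[OF u2])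
    also have "\<dots> \<le> M * H ^ (m + n) * fact m powr \<sigma> * fact n powr s * (W * weight s \<sigma> (r * cst s \<sigma>) z)"
    proof (intro mult_left_mono)
      have "weight s \<sigma> r (X + z + \<theta> *\<^sub>R e) = weight s \<sigma> r ((X + \<theta> *\<^sub>R e) + z)" by (simp add: ac_simps)
      also have "\<dots> \<le> weight s \<sigma> (r * cst s \<sigma>) (X + \<theta> *\<^sub>R e) * weight s \<sigma> (r * cst s \<sigma>) z"
        using pos by (intro weight_add s) auto
      finally have 1: "weight s \<sigma> r (X + z + \<theta> *\<^sub>R e) \<le> weight s \<sigma> (r * cst s \<sigma>) (X + \<theta> *\<^sub>R e) * weight s \<sigma> (r * cst s \<sigma>) z" .
      have "weight s \<sigma> (r * cst s \<sigma>) (X + \<theta> *\<^sub>R e) \<le> W"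
      proof -
        have "norm (X + \<theta> *\<^sub>R e) \<le> norm X + 1"
          using norm_triangle_ineq[of X "\<theta> *\<^sub>R e"] e that by simp
        then have "norm (fst (X + \<theta> *\<^sub>R e)) \<le> norm X + 1" "norm (snd (X + \<theta> *\<^sub>R e)) \<le> norm X + 1"
          using norm_fst_le[of "fst (X + \<theta> *\<^sub>R e)" "snd (X + \<theta> *\<^sub>R e)"] norm_snd_le[of "snd (X + \<theta> *\<^sub>R e)" "fst (X + \<theta> *\<^sub>R e)"]
          by (simp_all only: prod.collapse)
        then show ?thesis unfolding W_def weight_def using s pos cst_ge1[OF s]
          by (auto intro!: mult_left_mono add_mono powr_mono2)
      qed
      then show "weight s \<sigma> r (X + z + \<theta> *\<^sub>R e) \<le> W * weight s \<sigma> (r * cst s \<sigma>) z"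
        using 1 mult_right_mono[OF _ weight_pos(2)] by (meson order_trans)
    qed (use M pos in auto)
    finally show ?thesis .
  qed
  have "foldr dir_deriv bs (\<lambda>z. (u ((X + \<epsilon> *\<^sub>R e) + z) + (- 1) * u (X + z)) + (- of_real \<epsilon>) * ?u' (X + z)) z =
      (D ((X + \<epsilon> *\<^sub>R e) + z) + (- 1) * D (X + z)) + (- of_real \<epsilon>) * dir_deriv e D (X + z)"
    unfolding foldr_dir_deriv_lincomb[OF sl st(2) bs] foldr_dir_deriv_lincomb[OF st(1) st(1) bs]
      foldr_dir_deriv_translate[OF sm bs] foldr_dir_deriv_translate[OF sm'(1) bs] D1 D_def ..
  also have "\<dots> = g \<epsilon> - g 0 - of_real \<epsilon> * dir_deriv e D (X + z + 0 *\<^sub>R e)"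
    unfolding g_def by (simp add: ac_simps)
  finally have "cmod (foldr dir_deriv bs (\<lambda>z. (u ((X + \<epsilon> *\<^sub>R e) + z) + (- 1) * u (X + z)) + (- of_real \<epsilon>) * ?u' (X + z)) z) =
     cmod (g \<epsilon> - g 0 - of_real \<epsilon> * dir_deriv e D (X + z + 0 *\<^sub>R e))" by simp
  also have "\<dots> \<le> (M * H ^ (m + n) * fact m powr \<sigma> * fact n powr s * (W * weight s \<sigma> (r * cst s \<sigma>) z)) * \<epsilon>\<^sup>2"
    unfolding g_def
    by (rule taylor2_bound[OF has_dd_line[OF smooth_has_dd[OF smD e]] has_dd_line[OF smooth_has_dd[OF smooth_dir_deriv[OF smD e] e]] D2b \<epsilon>])
  finally show "cmod ((dir_deriv (exi i) ^^ n) ((dir_deriv (ex j) ^^ m)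
      (\<lambda>z. (u ((X + \<epsilon> *\<^sub>R e) + z) + (- 1) * u (X + z)) + (- of_real \<epsilon>) * ?u' (X + z))) z) \<le>
    M * W * \<epsilon>\<^sup>2 * H ^ (m + n) * fact m powr \<sigma> * fact n powr s * weight s \<sigma> (r * cst s \<sigma>) z"
    unfolding dir_deriv_powers_foldr(1) bs_def[symmetric] by (simp only: mult_ac)
qed

lemma has_vector_derivative_quadratic:
  fixes f :: "real \<Rightarrow> complex"
  assumes "\<And>\<epsilon>. \<bar>\<epsilon>\<bar> \<le> 1 \<Longrightarrow> cmod (f \<epsilon> - f 0 - of_real \<epsilon> * D) \<le> C * \<epsilon>\<^sup>2"
  shows "(f has_vector_derivative D) (at 0)"
  unfolding has_vector_derivative_def has_derivative_at
proof (intro conjI)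
  show "bounded_linear (\<lambda>x. x *\<^sub>R D)" by (rule bounded_linear_scaleR_left)
  have "((\<lambda>h. C * \<bar>h\<bar>) \<longlongrightarrow> C * \<bar>0\<bar>) (at (0::real))" by (intro tendsto_intros)
  then have lim: "((\<lambda>h. C * \<bar>h\<bar>) \<longlongrightarrow> 0) (at (0::real))" by simp
  have "\<forall>\<^sub>F h in at (0::real). norm (norm (f (0 + h) - f 0 - h *\<^sub>R D) / norm h) \<le> C * \<bar>h\<bar>"
    unfolding eventually_at
  proof (intro exI[of _ 1] conjI ballI impI)
    fix h :: real assume "h \<noteq> 0 \<and> dist h 0 < 1"
    then have h: "h \<noteq> 0" "\<bar>h\<bar> \<le> 1" by auto
    have "cmod (f h - f 0 - of_real h * D) / \<bar>h\<bar> \<le> C * h\<^sup>2 / \<bar>h\<bar>"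
      using h by (intro divide_right_mono assms) auto
    also have "\<dots> = C * \<bar>h\<bar>" using h by (simp add: power2_eq_square abs_if field_simps)
    finally show "norm (norm (f (0 + h) - f 0 - h *\<^sub>R D) / norm h) \<le> C * \<bar>h\<bar>" by (simp add: scaleR_conv_of_real)
  qed simp
  from Lim_null_comparison[OF this lim]
  show "(\<lambda>h. norm (f (0 + h) - f 0 - h *\<^sub>R D) / norm h) \<midarrow>0\<rightarrow> 0" .
qed

text \<open>Scale and rate may vary with the member: a derivative lives at a larger scale than the
  symbol itself and may need a smaller rate to remain admissible.\<close>

definition osc_class :: "real \<Rightarrow> real \<Rightarrow> real \<Rightarrow> (real^'d::finite \<Rightarrow> complex) \<Rightarrow> ((real^'d) \<times> (real^'d) \<Rightarrow> complex) set \<Rightarrow> bool" where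
  "osc_class s \<sigma> t \<phi> \<C> \<longleftrightarrow> (\<forall>u\<in>\<C>. (\<forall>e\<in>Basis. dir_deriv e u \<in> \<C>) \<and> (\<exists>H r M. osc_admissible s \<sigma> t \<phi> H r \<and> symb_bound s \<sigma> H r M u))"

text \<open>By linearity the error of the first-order expansion of \<open>bj_symbol\<close> is the
  averaged \<open>osc\<close> of the Taylor remainder. The bound linear in \<open>M\<close> makes it
  quadratic in \<epsilon>.\<close>

lemma bj_symbol_has_dd:
  fixes \<phi> :: "real^'d::finite \<Rightarrow> complex"
  assumes s: "s > 0" "\<sigma> > 0" and cl: "osc_class s \<sigma> t \<phi> \<C>" and u: "u \<in> \<C>" and e: "e \<in> Basis"
  shows "has_dd e (bj_symbol t \<phi> u) (bj_symbol t \<phi> (dir_deriv e u))"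
  unfolding has_dd_def
proof
  fix X :: "(real^'d) \<times> (real^'d)"
  let ?u' = "dir_deriv e u"
  have u': "?u' \<in> \<C>" "dir_deriv e ?u' \<in> \<C>" using cl u e unfolding osc_class_def by blast+
  have osc: "set_integrable lborel {0..1} (\<lambda>\<tau>. osc (\<tau> - t) \<phi> (\<lambda>z. v (Y + z)))"
    "\<tau> \<in> {0..1} \<Longrightarrow> oscint (\<tau> - t) \<phi> (\<lambda>z. v (Y + z))" if v: "v \<in> \<C>" for v Y \<tau>
  proof -
    obtain H r M where H: "osc_admissible s \<sigma> t \<phi> H r" "symb_bound s \<sigma> H r M v" using cl v unfolding osc_class_def by blast
    obtain A \<rho> K where A: "window s \<sigma> A \<rho> K \<phi>" "gap CARD('d) s \<sigma> (1 + \<bar>t\<bar>) A \<rho> H (r * cst s \<sigma>)" "H > 0" "r > 0"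
      by (rule osc_admissibleE[OF s H(1)])
    note slice_bound = slice_bound_translate[OF s H(2) A(3,4), of Y]
    show "set_integrable lborel {0..1} (\<lambda>\<tau>. osc (\<tau> - t) \<phi> (\<lambda>z. v (Y + z)))"
      using osc_average_bound[OF s A(1,2)] slice_bound by blast
    show "oscint (\<tau> - t) \<phi> (\<lambda>z. v (Y + z))" if "\<tau> \<in> {0..1}"
      using that by (intro slice_bound_oscint[OF s slice_bound A(1,2)]) auto
  qed
  obtain H r M where H: "osc_admissible s \<sigma> t \<phi> H r" "symb_bound s \<sigma> H r M (dir_deriv e ?u')" using cl u' unfolding osc_class_def by blast
  obtain A \<rho> K where A: "window s \<sigma> A \<rho> K \<phi>" "gap CARD('d) s \<sigma> (1 + \<bar>t\<bar>) A \<rho> H (r * cst s \<sigma>)" "H > 0" "r > 0"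
    by (rule osc_admissibleE[OF s H(1)])
  obtain C where C: "\<And>M v. slice_bound s \<sigma> H (r * cst s \<sigma>) M v \<Longrightarrow> cmod (LINT \<tau>:{0..1}|lborel. osc (\<tau> - t) \<phi> v) \<le> C * M"
    using osc_average_bound[OF s A(1,2)] by blast
  have sm: "smooth u" using cl u unfolding osc_class_def symb_bound_def by blast
  define W where "W = exp (r * cst s \<sigma> * ((norm X + 1) powr (1 / s) + (norm X + 1) powr (1 / \<sigma>)))"
  show "((\<lambda>\<epsilon>. bj_symbol t \<phi> u (X + \<epsilon> *\<^sub>R e)) has_vector_derivative bj_symbol t \<phi> ?u' X) (at 0)"
  proof (rule has_vector_derivative_quadratic)
    fix \<epsilon> :: real assume \<epsilon>: "\<bar>\<epsilon>\<bar> \<le> 1"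
    let ?v = "\<lambda>z. (u ((X + \<epsilon> *\<^sub>R e) + z) + (- 1) * u (X + z)) + (- of_real \<epsilon>) * ?u' (X + z)"
    have lin: "osc (\<tau> - t) \<phi> ?v = (osc (\<tau> - t) \<phi> (\<lambda>z. u ((X + \<epsilon> *\<^sub>R e) + z)) + (- 1) * osc (\<tau> - t) \<phi> (\<lambda>z. u (X + z)))
        + (- of_real \<epsilon>) * osc (\<tau> - t) \<phi> (\<lambda>z. ?u' (X + z))" if \<tau>: "\<tau> \<in> {0..1}" for \<tau>
    proof -
      note o = osc_lincomb[OF osc(2)[OF u \<tau>] osc(2)[OF u \<tau>]]
      show ?thesis unfolding osc_lincomb(2)[OF o(1) osc(2)[OF u'(1) \<tau>]] o(2) ..
    qed
    have "bj_symbol t \<phi> u (X + \<epsilon> *\<^sub>R e) - bj_symbol t \<phi> u X - of_real \<epsilon> * bj_symbol t \<phi> ?u' X =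
      (LINT \<tau>:{0..1}|lborel. (osc (\<tau> - t) \<phi> (\<lambda>z. u ((X + \<epsilon> *\<^sub>R e) + z)) - osc (\<tau> - t) \<phi> (\<lambda>z. u (X + z)))
        - of_real \<epsilon> * osc (\<tau> - t) \<phi> (\<lambda>z. ?u' (X + z)))"
      unfolding bj_symbol_def set_integral_diff(2)[OF set_integral_diff(1)[OF osc(1)[OF u] osc(1)[OF u]] set_integrable_mult_right[OF osc(1)[OF u'(1)]]]
        set_integral_diff(2)[OF osc(1)[OF u] osc(1)[OF u]] set_integral_mult_right ..
    also have "\<dots> = (LINT \<tau>:{0..1}|lborel. osc (\<tau> - t) \<phi> ?v)"
    proof (rule set_lebesgue_integral_cong)
      show "\<forall>\<tau>. \<tau> \<in> {0..1} \<longrightarrow> (osc (\<tau> - t) \<phi> (\<lambda>z. u ((X + \<epsilon> *\<^sub>R e) + z)) - osc (\<tau> - t) \<phi> (\<lambda>z. u (X + z)))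
        - of_real \<epsilon> * osc (\<tau> - t) \<phi> (\<lambda>z. ?u' (X + z)) = osc (\<tau> - t) \<phi> ?v"
      proof (intro allI impI)
        fix \<tau> :: real assume \<tau>: "\<tau> \<in> {0..1}"
        show "(osc (\<tau> - t) \<phi> (\<lambda>z. u ((X + \<epsilon> *\<^sub>R e) + z)) - osc (\<tau> - t) \<phi> (\<lambda>z. u (X + z)))
          - of_real \<epsilon> * osc (\<tau> - t) \<phi> (\<lambda>z. ?u' (X + z)) = osc (\<tau> - t) \<phi> ?v"
          unfolding lin[OF \<tau>] by simp
      qed
    qed simp
    also have "cmod \<dots> \<le> C * (M * W * \<epsilon>\<^sup>2)"
      unfolding W_def by (intro C remainder_adm[OF s sm e H(2) A(3,4) \<epsilon>])
    finally show "cmod (bj_symbol t \<phi> u (X + \<epsilon> *\<^sub>R e) - bj_symbol t \<phi> u (X + 0 *\<^sub>R e) - of_real \<epsilon> * bj_symbol t \<phi> ?u' X) \<le> (C * M * W) * \<epsilon>\<^sup>2"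
      by (simp add: mult.assoc)
  qed
qed

text \<open>The point \<open>x + h\<close> is reached one coordinate at a time. Each move has length
  at most 1, so all intermediate points stay within \<open>DIM('v)\<close> of \<open>x\<close>,
  where the partial derivatives are bounded.\<close>

lemma increment_bound_sum:
  fixes f :: "'v::euclidean_space \<Rightarrow> complex"
  assumes dd: "\<And>b. b \<in> Basis \<Longrightarrow> has_dd b f (f' b)" and K: "\<And>b z. b \<in> Basis \<Longrightarrow> norm (z - x) \<le> real DIM('v) \<Longrightarrow> cmod (f' b z) \<le> K"
    and h: "norm h \<le> 1" and fin: "finite S" and S: "S \<subseteq> Basis"
  shows "cmod (f (x + (\<Sum>b\<in>S. (h \<bullet> b) *\<^sub>R b)) - f x) \<le> K * (\<Sum>b\<in>S. \<bar>h \<bullet> b\<bar>)"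
  using fin S
proof (induction S rule: finite_induct)
  case (insert b S)
  define y where "y = x + (\<Sum>b\<in>S. (h \<bullet> b) *\<^sub>R b)"
  have b: "b \<in> Basis" using insert by auto
  have hb: "\<bar>h \<bullet> b'\<bar> \<le> 1" if "b' \<in> Basis" for b'
    using Basis_le_norm[OF that, of h] h by linarith
  have "norm (f (y + (h \<bullet> b) *\<^sub>R b) - f (y + 0 *\<^sub>R b)) \<le> K * norm (h \<bullet> b - 0)"
  proof (rule differentiable_bound[where S="{-\<bar>h \<bullet> b\<bar>..\<bar>h \<bullet> b\<bar>}" and f'="\<lambda>t k. k *\<^sub>R f' b (y + t *\<^sub>R b)"])
    fix t assume t: "t \<in> {-\<bar>h \<bullet> b\<bar>..\<bar>h \<bullet> b\<bar>}"
    show "((\<lambda>t. f (y + t *\<^sub>R b)) has_derivative (\<lambda>k. k *\<^sub>R f' b (y + t *\<^sub>R b))) (at t within {-\<bar>h \<bullet> b\<bar>..\<bar>h \<bullet> b\<bar>})"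
      using has_dd_line[OF dd[OF b], of y t] unfolding has_vector_derivative_def by (rule has_derivative_at_withinI)
    have "norm ((y + t *\<^sub>R b) - x) \<le> norm (\<Sum>b\<in>S. (h \<bullet> b) *\<^sub>R b) + norm (t *\<^sub>R b)"
      unfolding y_def using norm_triangle_ineq[of "\<Sum>b\<in>S. (h \<bullet> b) *\<^sub>R b" "t *\<^sub>R b"] by (simp add: algebra_simps)
    also have "\<dots> \<le> real (card S) + 1"
    proof (intro add_mono)
      have "norm (\<Sum>b\<in>S. (h \<bullet> b) *\<^sub>R b) \<le> (\<Sum>b\<in>S. 1)"
        using insert.prems hb by (intro sum_norm_le) auto
      then show "norm (\<Sum>b\<in>S. (h \<bullet> b) *\<^sub>R b) \<le> real (card S)" by simp
    qed (use t b hb[OF b] in auto)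
    also have "\<dots> = real (card (insert b S))" using insert by simp
    also have "\<dots> \<le> real DIM('v)" using insert.prems by (intro of_nat_mono card_mono) auto
    finally have "cmod (f' b (y + t *\<^sub>R b)) \<le> K" by (rule K[OF b])
    then show "onorm (\<lambda>k. k *\<^sub>R f' b (y + t *\<^sub>R b)) \<le> K"
      by (intro onorm_le) (auto simp: mult.commute[of K] intro: mult_left_mono)
  qed auto
  moreover have "cmod (f y - f x) \<le> K * (\<Sum>b\<in>S. \<bar>h \<bullet> b\<bar>)"
    unfolding y_def by (rule insert.IH) (use insert in auto)
  ultimately have "cmod (f (y + (h \<bullet> b) *\<^sub>R b) - f x) \<le> K * \<bar>h \<bullet> b\<bar> + K * (\<Sum>b\<in>S. \<bar>h \<bullet> b\<bar>)"
    using norm_triangle_ineq[of "f (y + (h \<bullet> b) *\<^sub>R b) - f y" "f y - f x"] by simp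
  then show ?case using insert by (simp add: y_def algebra_simps)
qed simp

lemma continuous_if_partials_bounded:
  fixes f :: "'v::euclidean_space \<Rightarrow> complex"
  assumes dd: "\<And>b. b \<in> Basis \<Longrightarrow> has_dd b f (f' b)"
    and K: "\<And>x. \<exists>K. \<forall>b\<in>Basis. \<forall>z. norm (z - x) \<le> real DIM('v) \<longrightarrow> cmod (f' b z) \<le> K"
  shows "continuous_on UNIV f"
proof (unfold continuous_on_eq_continuous_at[OF open_UNIV], rule ballI)
  fix x
  obtain K where K: "\<And>b z. b \<in> Basis \<Longrightarrow> norm (z - x) \<le> real DIM('v) \<Longrightarrow> cmod (f' b z) \<le> K" using K by blast
  have *: "cmod (f y - f x) \<le> K * (\<Sum>b\<in>Basis. \<bar>(y - x) \<bullet> b\<bar>)" if "norm (y - x) \<le> 1" for y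
    using increment_bound_sum[where x=x and h="y - x" and S=Basis, OF dd K that finite_Basis order_refl] by (simp add: euclidean_representation)
  have "((\<lambda>y. K * (\<Sum>b\<in>Basis. \<bar>(y - x) \<bullet> b\<bar>)) \<longlongrightarrow> K * (\<Sum>b\<in>Basis. \<bar>(x - x) \<bullet> b\<bar>)) (at x)"
    by (intro tendsto_intros)
  then have lim: "((\<lambda>y. K * (\<Sum>b\<in>Basis. \<bar>(y - x) \<bullet> b\<bar>)) \<longlongrightarrow> 0) (at x)" by simp
  have "\<forall>\<^sub>F y in at x. norm (f y - f x) \<le> K * (\<Sum>b\<in>Basis. \<bar>(y - x) \<bullet> b\<bar>)"
    unfolding eventually_at using * by (intro exI[of _ 1]) (auto simp: dist_norm)
  from Lim_null_comparison[OF this lim] show "isCont f x"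
    unfolding isCont_def by (simp add: LIM_zero_iff)
qed

lemma bj_symbol_continuous:
  fixes \<phi> :: "real^'d::finite \<Rightarrow> complex"
  assumes s: "s > 0" "\<sigma> > 0" and cl: "osc_class s \<sigma> t \<phi> \<C>" and u: "u \<in> \<C>"
  shows "continuous_on UNIV (bj_symbol t \<phi> u)"
proof (rule continuous_if_partials_bounded[OF bj_symbol_has_dd[OF s cl u]])
  fix X :: "(real^'d) \<times> (real^'d)"
  have one: "\<exists>K. \<forall>Z. norm (Z - X) \<le> real DIM((real^'d) \<times> (real^'d)) \<longrightarrow> cmod (bj_symbol t \<phi> v Z) \<le> K" if v: "v \<in> \<C>" for v
  proof -
    obtain H r M where H: "osc_admissible s \<sigma> t \<phi> H r" "symb_bound s \<sigma> H r M v" using cl v unfolding osc_class_def by blast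
    obtain A \<rho> K where A: "window s \<sigma> A \<rho> K \<phi>" "gap CARD('d) s \<sigma> (1 + \<bar>t\<bar>) A \<rho> H (r * cst s \<sigma>)" "H > 0" "r > 0"
      by (rule osc_admissibleE[OF s H(1)])
    obtain C where C: "C \<ge> 0" "\<And>Z. cmod (bj_symbol t \<phi> v Z) \<le> C * M * weight s \<sigma> (r * cst s \<sigma>) Z" using bj_symbol_bound[OF s H(1)] H(2) by blast
    define R where "R = norm X + real DIM((real^'d) \<times> (real^'d))"
    have "cmod (bj_symbol t \<phi> v Z) \<le> C * M * exp (r * cst s \<sigma> * (R powr (1 / s) + R powr (1 / \<sigma>)))"
      if "norm (Z - X) \<le> real DIM((real^'d) \<times> (real^'d))" for Z
    proof -
      have "norm Z \<le> R" unfolding R_def using that norm_triangle_ineq[of X "Z - X"] by simp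
      then have "norm (fst Z) \<le> R" "norm (snd Z) \<le> R"
        using norm_fst_le[of "fst Z" "snd Z"] norm_snd_le[of "snd Z" "fst Z"] by simp_all
      then have "weight s \<sigma> (r * cst s \<sigma>) Z \<le> exp (r * cst s \<sigma> * (R powr (1 / s) + R powr (1 / \<sigma>)))"
        unfolding weight_def using s A cst_ge1[OF s] by (auto intro!: mult_left_mono add_mono powr_mono2)
      then show ?thesis using C symb_bound_M_nonneg[OF H(2)] by (intro order_trans[OF C(2)] mult_left_mono) auto
    qed
    then show ?thesis by blast
  qed
  have "\<forall>b\<in>Basis. \<exists>K. \<forall>Z. norm (Z - X) \<le> real DIM((real^'d) \<times> (real^'d)) \<longrightarrow> cmod (bj_symbol t \<phi> (dir_deriv b u) Z) \<le> K"
    using one cl u unfolding osc_class_def by blast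
  then obtain K where K: "\<And>b Z. b \<in> Basis \<Longrightarrow> norm (Z - X) \<le> real DIM((real^'d) \<times> (real^'d)) \<Longrightarrow> cmod (bj_symbol t \<phi> (dir_deriv b u) Z) \<le> K b"
    by metis
  have "K b \<le> Max (K ` Basis)" if "b \<in> Basis" for b using that by (intro Max_ge) auto
  then show "\<exists>K. \<forall>b\<in>Basis. \<forall>Z. norm (Z - X) \<le> real DIM((real^'d) \<times> (real^'d)) \<longrightarrow> cmod (bj_symbol t \<phi> (dir_deriv b u) Z) \<le> K"
    using K by (meson order_trans)
qed

text \<open>The coinduction runs over the image of the whole class, which is closed under
  derivatives because \<open>bj_symbol\<close> commutes with them.\<close>

lemma bj_symbol_smooth:
  fixes \<phi> :: "real^'d::finite \<Rightarrow> complex"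
  assumes s: "s > 0" "\<sigma> > 0" and cl: "osc_class s \<sigma> t \<phi> \<C>" and u: "u \<in> \<C>"
  shows "smooth (bj_symbol t \<phi> u)" "mderiv \<alpha> \<beta> (bj_symbol t \<phi> u) = bj_symbol t \<phi> (mderiv \<alpha> \<beta> u)"
proof -
  show "smooth (bj_symbol t \<phi> u)"
  proof (rule smooth_coinduct[where \<C>="bj_symbol t \<phi> ` \<C>"])
    fix v and b :: "(real^'d) \<times> (real^'d)" assume "v \<in> bj_symbol t \<phi> ` \<C>" and b: "b \<in> Basis"
    then obtain w where w: "w \<in> \<C>" "v = bj_symbol t \<phi> w" by blast
    moreover have "dir_deriv b w \<in> \<C>" using cl w b unfolding osc_class_def by blast
    ultimately show "\<exists>u'\<in>bj_symbol t \<phi> ` \<C>. has_dd b v u'" using bj_symbol_has_dd[OF s cl w(1) b] by blast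
  qed (use u bj_symbol_continuous[OF s cl] in auto)
  have "foldr dir_deriv bs u \<in> \<C> \<and> foldr dir_deriv bs (bj_symbol t \<phi> u) = bj_symbol t \<phi> (foldr dir_deriv bs u)" if "set bs \<subseteq> Basis" for bs
    using that
  proof (induction bs)
    case (Cons b bs)
    then have IH: "foldr dir_deriv bs u \<in> \<C>" "foldr dir_deriv bs (bj_symbol t \<phi> u) = bj_symbol t \<phi> (foldr dir_deriv bs u)" and b: "b \<in> Basis" by auto
    have "dir_deriv b (foldr dir_deriv bs u) \<in> \<C>" using cl IH b unfolding osc_class_def by blast
    then show ?case using has_dd_dir_deriv[OF bj_symbol_has_dd[OF s cl IH(1) b]] IH(2) by simp
  qed (use u in simp)
  then show "mderiv \<alpha> \<beta> (bj_symbol t \<phi> u) = bj_symbol t \<phi> (mderiv \<alpha> \<beta> u)"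
    unfolding mderiv_eq_foldr using mderiv_dirs by blast
qed

text \<open>A derivative of the averaged symbol is the averaged symbol of a derivative, so the bound
  on values is applied to \<open>mderiv \<alpha> \<beta> u\<close>, whose constant already contains
  the required factorials.\<close>

lemma bj_symbol_bnd:
  fixes \<phi> :: "real^'d::finite \<Rightarrow> complex"
  assumes s: "s > 0" "\<sigma> > 0" and cl: "osc_class s \<sigma> t \<phi> \<C>" and u: "u \<in> \<C>"
    and b: "symb_bound s \<sigma> H r M u" and H: "H > 0" and t: "osc_admissible s \<sigma> t \<phi> (H * 2 powr (s + \<sigma>)) r"
  shows "\<exists>M'. symb_bound s \<sigma> (H * 2 powr (s + \<sigma>)) (r * cst s \<sigma>) M' (bj_symbol t \<phi> u)"
proof -
  let ?H = "H * 2 powr (s + \<sigma>)"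
  obtain C where C: "C \<ge> 0" "\<And>M u X. symb_bound s \<sigma> ?H r M u \<Longrightarrow> cmod (bj_symbol t \<phi> u X) \<le> C * M * weight s \<sigma> (r * cst s \<sigma>) X"
    using bj_symbol_bound[OF s t] by blast
  have "symb_bound s \<sigma> ?H (r * cst s \<sigma>) (C * M) (bj_symbol t \<phi> u)"
    unfolding symb_bound_def bj_symbol_smooth(2)[OF s cl u]
  proof (intro conjI allI bj_symbol_smooth(1)[OF s cl u])
    fix \<alpha> \<beta> z
    show "cmod (bj_symbol t \<phi> (mderiv \<alpha> \<beta> u) z) \<le> C * M * (?H ^ (mabs \<alpha> + mabs \<beta>) * mfact \<alpha> powr \<sigma> * mfact \<beta> powr s * weight s \<sigma> (r * cst s \<sigma>) z)"
      using C(2)[OF symb_bound_mderiv[OF s H b], of \<alpha> \<beta> z] by (simp add: mult_ac)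
  qed
  then show ?thesis by blast
qed

section \<open>Entire functions with anisotropic decay and window functions\<close>

text \<open>The worst case is the real one, with the nonnegative numbers \<bar>b\<bar> and \<bar>a -
  b\<bar> added.\<close>

lemma norm_power_diff_le:
  fixes a b :: complex
  shows "cmod (a ^ n - b ^ n) \<le> (cmod b + cmod (a - b)) ^ n - cmod b ^ n"
proof (induction n)
  case (Suc n)
  let ?d = "cmod (a - b)"
  have "a ^ Suc n - b ^ Suc n = a * (a ^ n - b ^ n) + (a - b) * b ^ n" by (simp add: algebra_simps)
  then have "cmod (a ^ Suc n - b ^ Suc n) \<le> cmod a * cmod (a ^ n - b ^ n) + ?d * cmod b ^ n"
    by (metis norm_mult norm_power norm_triangle_ineq)
  also have "\<dots> \<le> (cmod b + ?d) * ((cmod b + ?d) ^ n - cmod b ^ n) + ?d * cmod b ^ n"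
    using norm_triangle_ineq[of b "a - b"] by (intro add_mono mult_mono Suc) auto
  finally show ?case by (simp add: algebra_simps)
qed simp

lemma abs_exp_minus_one_le: "\<bar>exp t - 1\<bar> \<le> exp \<bar>t\<bar> - (1::real)"
proof (cases "t \<ge> 0")
  case False
  have "2 \<le> exp t + exp (- t)"
    using exp_ge_add_one_self[of t] exp_ge_add_one_self[of "-t"] by linarith
  then show ?thesis using False by simp
qed simp

lemma sin_Complex_diff:
  "cmod (sin (Complex x y) - of_real (sin x)) \<le> exp \<bar>y\<bar> - 1"
proof -
  have z: "Complex x y = of_real x + \<i> * of_real y" by (simp add: complex_eq_iff)
  have e1: "exp (\<i> * Complex x y) = exp (\<i> * of_real x) * of_real (exp (- y))"
    and e2: "exp (- (\<i> * Complex x y)) = exp (- (\<i> * of_real x)) * of_real (exp y)"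
    unfolding z exp_of_real[symmetric] exp_add[symmetric] by (simp_all add: algebra_simps)
  have *: "sin (Complex x y) - of_real (sin x) =
     (exp (\<i> * of_real x) * of_real (exp (- y) - 1) - exp (- (\<i> * of_real x)) * of_real (exp y - 1)) / (2 * \<i>)"
    unfolding sin_of_real[symmetric] sin_exp_eq e1 e2 by (simp only: of_real_diff of_real_1) (simp add: field_simps)
  have "cmod (sin (Complex x y) - of_real (sin x)) \<le>
    (cmod (exp (\<i> * of_real x) * of_real (exp (- y) - 1)) + cmod (exp (- (\<i> * of_real x)) * of_real (exp y - 1))) / 2"
    unfolding * norm_divide by (simp add: norm_mult[of 2] divide_right_mono norm_triangle_ineq4)
  also have "\<dots> = (\<bar>exp (- y) - 1\<bar> + \<bar>exp y - 1\<bar>) / 2"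
    by (simp add: norm_mult norm_exp_eq_Re del: of_real_diff)
  also have "\<dots> \<le> exp \<bar>y\<bar> - 1"
    using abs_exp_minus_one_le[of y] abs_exp_minus_one_le[of "-y"] by simp
  finally show ?thesis .
qed

text \<open>\<open>sin_factor_bound\<close> subtracts \<open>u ^ n\<close> twice, so any factor
  below 2 leaves decay over; 3/2 leaves half of it.\<close>

lemma power_add_split:
  assumes "n > 0"
  shows "\<exists>c\<ge>0. \<forall>u\<ge>0. \<forall>k\<ge>0. (u + k) ^ n \<le> 3 / 2 * u ^ n + c * (k::real) ^ n"
proof -
  \<comment> \<open>With this \<open>d\<close> one has
    \<open>(1 + d) ^ n \<le> exp (1 / 3) \<le> 3 / 2\<close>. The case \<open>k \<le> d * u\<close>
    uses that factor, and in the other case \<open>k\<close> dominates up to a constant.\<close>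
  define d where "d = 1 / (3 * real n)"
  have d: "d > 0" using assms by (simp add: d_def)
  have "(1 + d) ^ n \<le> exp d ^ n" using d exp_ge_add_one_self[of d] by (intro power_mono) auto
  also have "\<dots> = exp (1 / 3)" using assms by (simp add: d_def flip: exp_of_nat_mult)
  also have "\<dots> \<le> 3 / 2"
  proof (rule power_le_imp_le_base)
    have "exp (1 / 3 :: real) ^ Suc 2 = exp 1" by (simp flip: exp_of_nat_mult)
    also have "\<dots> \<le> 3" by (rule exp_le)
    finally show "exp (1 / 3 :: real) ^ Suc 2 \<le> (3 / 2) ^ Suc 2" by (simp add: power3_eq_cube eval_nat_numeral)
  qed simp
  finally have dn: "(1 + d) ^ n \<le> 3 / 2" .
  define c where "c = (1 / d + 1) ^ n"
  have c: "c \<ge> 0" using d by (simp add: c_def)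
  have "(u + k) ^ n \<le> 3 / 2 * u ^ n + c * k ^ n" if "u \<ge> 0" "k \<ge> 0" for u k :: real
  proof (cases "k \<le> d * u")
    case True
    then have "(u + k) ^ n \<le> ((1 + d) * u) ^ n" using that by (intro power_mono) (auto simp: algebra_simps)
    also have "\<dots> \<le> 3 / 2 * u ^ n" using mult_right_mono[OF dn, of "u ^ n"] that by (simp add: power_mult_distrib)
    finally show ?thesis using c that by (simp add: add_increasing2)
  next
    case False
    then have "u \<le> k / d" using d by (simp add: field_simps)
    then have "(u + k) ^ n \<le> ((1 / d + 1) * k) ^ n" using that by (intro power_mono) (auto simp: algebra_simps)
    then show ?thesis using that by (simp add: power_mult_distrib c_def add_increasing)
  qed
  then show ?thesis using c by blast
qed

text \<open>On the real axis the factor is \<open>1 - \<bar>sin x\<bar> ^ n\<close>. Half of this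
  gain is kept and the other half pays for the displacement by \<open>y\<close>. The penalty of
  order \<open>n\<close> for small \<open>y\<close> is what makes the penalties of all factors
  summable; for large \<open>y\<close> only the exponential type counts.\<close>

lemma sin_factor_bound:
  assumes n: "even n" "n > 0"
  shows "\<exists>b\<ge>0. \<forall>x y. cmod (1 - sin (Complex x y) ^ n) \<le>
    exp (- (\<bar>sin x\<bar> ^ n) / 2 + b * (if \<bar>y\<bar> \<le> 1 then \<bar>y\<bar> ^ n else \<bar>y\<bar>))"
proof -
  obtain c where c: "c \<ge> 0" "\<And>u k. u \<ge> 0 \<Longrightarrow> k \<ge> 0 \<Longrightarrow> (u + k) ^ n \<le> 3 / 2 * u ^ n + c * (k::real) ^ n"
    using power_add_split[OF n(2)] by blast
  \<comment> \<open>\<open>c * 2 ^ n\<close> serves small \<open>y\<close>, where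
    \<open>exp \<bar>y\<bar> - 1 \<le> 2 * \<bar>y\<bar>\<close>. \<open>real n + 2\<close> serves
    \<open>\<bar>y\<bar> > 1\<close>: \<open>n\<close> for the power of the sine, 1 for a factor 2,
    and 1 for the term with \<open>u ^ n\<close>.\<close>
  define b where "b = c * 2 ^ n + (real n + 2)"
  have "cmod (1 - sin (Complex x y) ^ n) \<le> exp (- (\<bar>sin x\<bar> ^ n) / 2 + b * (if \<bar>y\<bar> \<le> 1 then \<bar>y\<bar> ^ n else \<bar>y\<bar>))" for x y
  proof -
    define u where "u = \<bar>sin x\<bar>"
    define k where "k = exp \<bar>y\<bar> - 1"
    have u: "u \<ge> 0" "u \<le> 1" by (simp_all add: u_def)
    have k: "k \<ge> 0" by (simp add: k_def)
    have un: "u ^ n = sin x ^ n" using n by (simp add: u_def power_even_abs)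
    have u1: "u ^ n \<le> 1" using u by (simp add: power_le_one)
    have "cmod (sin (Complex x y) ^ n - of_real (sin x) ^ n) \<le>
       (cmod (of_real (sin x)) + cmod (sin (Complex x y) - of_real (sin x))) ^ n - cmod (of_real (sin x)) ^ n"
      by (rule norm_power_diff_le)
    also have "\<dots> \<le> (u + k) ^ n - u ^ n"
      using sin_Complex_diff[of x y] by (auto simp: u_def k_def intro!: power_mono)
    finally have d: "cmod (sin (Complex x y) ^ n - of_real (sin x) ^ n) \<le> (u + k) ^ n - u ^ n" .
    have "1 - sin (Complex x y) ^ n = of_real (1 - u ^ n) - (sin (Complex x y) ^ n - of_real (sin x) ^ n)"
      by (simp add: un)
    then have "cmod (1 - sin (Complex x y) ^ n) \<le> cmod (of_real (1 - u ^ n)) + cmod (sin (Complex x y) ^ n - of_real (sin x) ^ n)"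
      by (metis norm_triangle_ineq4)
    also have "\<dots> \<le> (1 - u ^ n) + ((u + k) ^ n - u ^ n)"
      using d u1 unfolding norm_of_real by linarith
    finally have e: "cmod (1 - sin (Complex x y) ^ n) \<le> 1 - u ^ n + (u + k) ^ n - u ^ n" by linarith
    show ?thesis
    proof (cases "\<bar>y\<bar> \<le> 1")
      case True
      have "exp \<bar>y\<bar> \<le> 1 + \<bar>y\<bar> + \<bar>y\<bar>\<^sup>2" using True by (intro exp_bound) auto
      moreover have "\<bar>y\<bar>\<^sup>2 \<le> \<bar>y\<bar>" using True mult_left_mono[of "\<bar>y\<bar>" 1 "\<bar>y\<bar>"] by (simp add: power2_eq_square)
      ultimately have "k \<le> 2 * \<bar>y\<bar>" unfolding k_def by linarith
      then have "k ^ n \<le> 2 ^ n * \<bar>y\<bar> ^ n" using k power_mono[of k "2 * \<bar>y\<bar>" n] by (simp add: power_mult_distrib)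
      then have "c * k ^ n \<le> c * (2 ^ n * \<bar>y\<bar> ^ n)" using c by (intro mult_left_mono) auto
      moreover have "c * (2 ^ n * \<bar>y\<bar> ^ n) \<le> b * \<bar>y\<bar> ^ n"
        unfolding b_def by (simp add: distrib_right)
      ultimately have "cmod (1 - sin (Complex x y) ^ n) \<le> 1 + (- (u ^ n) / 2 + b * \<bar>y\<bar> ^ n)"
        using e c(2)[OF u(1) k] by linarith
      also have "\<dots> \<le> exp (- (u ^ n) / 2 + b * \<bar>y\<bar> ^ n)" by (rule exp_ge_add_one_self)
      finally show ?thesis using True by (simp add: u_def)
    next
      case False
      then have y: "\<bar>y\<bar> > 1" by simp
      have "u + k \<le> exp \<bar>y\<bar>" using u by (simp add: k_def)
      then have "(u + k) ^ n \<le> exp \<bar>y\<bar> ^ n" using u k by (intro power_mono) auto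
      also have "\<dots> = exp (real n * \<bar>y\<bar>)" by (simp flip: exp_of_nat_mult)
      finally have "cmod (1 - sin (Complex x y) ^ n) \<le> 1 + exp (real n * \<bar>y\<bar>)"
        using e zero_le_power[OF u(1), of n] by linarith
      also have "\<dots> \<le> 2 * exp (real n * \<bar>y\<bar>)" by simp
      also have "\<dots> \<le> exp \<bar>y\<bar> * exp (real n * \<bar>y\<bar>)"
      proof (rule mult_right_mono)
        show "2 \<le> exp \<bar>y\<bar>" using exp_ge_add_one_self[of "\<bar>y\<bar>"] y by linarith
      qed simp
      also have "\<dots> = exp ((real n + 1) * \<bar>y\<bar>)" unfolding exp_add[symmetric] by (simp add: algebra_simps)
      also have "\<dots> \<le> exp (- (u ^ n) / 2 + b * \<bar>y\<bar>)"
      proof -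
        have "(real n + 2) * \<bar>y\<bar> \<le> b * \<bar>y\<bar>" unfolding b_def using c by (intro mult_right_mono) auto
        then show ?thesis using u1 y by (simp add: algebra_simps)
      qed
      finally show ?thesis using False by (simp add: u_def)
    qed
  qed
  moreover have "b \<ge> 0" using c by (simp add: b_def)
  ultimately show ?thesis by blast
qed

section \<open>Sums that govern the infinite product\<close>

lemma sum_powr_minus_le:
  assumes g: "0 < \<gamma>" "\<gamma> < 1"
  shows "(\<Sum>k<N. real (Suc k) powr (- \<gamma>)) \<le> 1 / (1 - \<gamma>) * real N powr (1 - \<gamma>)"
proof (induction N)
  case (Suc N)
  have "real (Suc N) powr (- \<gamma>) \<le> 1 / (1 - \<gamma>) * (real (Suc N) powr (1 - \<gamma>) - real N powr (1 - \<gamma>))"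
  proof (cases "N = 0")
    case True
    then show ?thesis using g by (simp add: field_simps)
  next
    case False
    have "\<exists>z. real N < z \<and> z < real (Suc N) \<and> real (Suc N) powr (1 - \<gamma>) - real N powr (1 - \<gamma>) = (real (Suc N) - real N) * ((1 - \<gamma>) * z powr ((1 - \<gamma>) - 1))"
      by (rule MVT2) (use False in \<open>auto intro!: DERIV_fun_powr[where g="\<lambda>x. x", simplified] derivative_eq_intros\<close>)
    then obtain z where z: "real N < z" "z < real (Suc N)"
      "real (Suc N) powr (1 - \<gamma>) - real N powr (1 - \<gamma>) = (1 - \<gamma>) * z powr (- \<gamma>)" by auto
    have "real (Suc N) powr (- \<gamma>) \<le> z powr (- \<gamma>)" using z g False by (intro powr_mono2') auto
    then show ?thesis unfolding z(3) using g by simp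
  qed
  then show ?case using Suc by (simp add: algebra_simps)
qed simp

text \<open>Telescoping: 1 / a^2 is at most 2 / a - 2 / (a + 1) for a \<ge> 1.\<close>

lemma sum_inverse_square_tail:
  "(\<Sum>k\<in>{M..<N}. 1 / real (Suc k) ^ 2) \<le> 2 / real (Suc M)"
proof -
  have "(\<Sum>k\<in>{M..<N}. 1 / real (Suc k) ^ 2) \<le> 2 / real (Suc M) - 2 / real (Suc N)" if "M \<le> N"
    using that
  proof (induction N rule: dec_induct)
    case (step N)
    have "1 / real (Suc N) ^ 2 \<le> 2 / real (Suc N) - 2 / real (Suc (Suc N))"
    proof -
      define a where "a = real (Suc N)"
      have a: "a \<ge> 1" by (simp add: a_def)
      have "2 / a - 2 / (a + 1) = 2 / (a * (a + 1))" using a by (simp add: field_simps)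
      moreover have "1 / a ^ 2 = 2 / (a * (2 * a))" using a by (simp add: power2_eq_square)
      moreover have "2 / (a * (2 * a)) \<le> 2 / (a * (a + 1))"
        using a by (intro divide_left_mono mult_left_mono) auto
      ultimately have "1 / a ^ 2 \<le> 2 / a - 2 / (a + 1)" by linarith
      moreover have "real (Suc (Suc N)) = a + 1" by (simp add: a_def)
      ultimately show ?thesis by (simp only: a_def)
    qed
    then show ?case using step by simp
  qed simp
  moreover have "2 / real (Suc N) \<ge> 0" by simp
  ultimately show ?thesis by (cases "M \<le> N") (linarith, simp)
qed

text \<open>The argument Y / k^(1/p) crosses 1 at k = Y^p. Below, the linear penalties sum to about
  Y (Y^p)^(1 - 1/p) = Y^p. Above, n \<ge> 2 p bounds each term by Y^(2 p) / k^2, whose tail is again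
  of order Y^p.\<close>

lemma theta_sum_bound:
  assumes p: "p > 1" and n: "real n \<ge> 2 * p" and Y: "Y \<ge> 0"
  shows "(\<Sum>k<N. (let t = Y / real (Suc k) powr (1 / p) in if t \<le> 1 then t ^ n else t)) \<le> (1 / (1 - 1 / p) + 2) * Y powr p"
proof -
  define M where "M = nat \<lfloor>Y powr p\<rfloor>"
  have M: "real M \<le> Y powr p" "Y powr p < real (Suc M)" by (simp_all add: M_def) linarith
  let ?f = "\<lambda>k. (let t = Y / real (Suc k) powr (1 / p) in if t \<le> 1 then t ^ n else t)"
  have g: "0 < 1 / p" "1 / p < 1" using p by auto
  have Yp: "(Y powr p) powr (1 / p) = Y" using p Y by (simp add: powr_powr)
  have small: "?f k \<le> Y * real (Suc k) powr (- (1 / p))" for k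
  proof -
    let ?t = "Y / real (Suc k) powr (1 / p)"
    have "?t \<ge> 0" using Y by simp
    moreover have "n > 0" using n p by (cases n) auto
    ultimately have "?f k \<le> ?t" by (auto simp: Let_def power_le_one_iff intro: power_decreasing[of 1 n, simplified])
    then show ?thesis by (simp add: powr_minus divide_inverse)
  qed
  have large: "?f k \<le> Y powr (2 * p) * (1 / real (Suc k) ^ 2)" if "k \<ge> M" for k
  proof -
    let ?t = "Y / real (Suc k) powr (1 / p)"
    have "Y powr p \<le> real (Suc k)" using M that by linarith
    then have "(Y powr p) powr (1 / p) \<le> real (Suc k) powr (1 / p)" using g by (intro powr_mono2) auto
    then have t: "0 \<le> ?t" "?t \<le> 1" using Y by (auto simp: Yp)
    show ?thesis
    proof (cases "Y = 0")
      case True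
      have "n > 0" using n p by (cases n) auto
      then show ?thesis using True by (simp add: Let_def zero_power)
    next
      case False
      then have t0: "?t > 0" using Y by simp
      have "?t ^ n = ?t powr real n" using t0 by (simp add: powr_realpow)
      also have "\<dots> \<le> ?t powr (2 * p)" using t0 t n by (intro powr_mono') auto
      also have "\<dots> = Y powr (2 * p) / (real (Suc k) powr (1 / p)) powr (2 * p)" using Y by (simp add: powr_divide)
      also have "(real (Suc k) powr (1 / p)) powr (2 * p) = real (Suc k) powr 2" using p by (simp add: powr_powr)
      also have "\<dots> = real (Suc k) ^ 2" by (rule powr_numeral) simp
      finally show ?thesis using t by (simp add: Let_def)
    qed
  qed
  have "(\<Sum>k<N. ?f k) \<le> (\<Sum>k<min N M. ?f k) + (\<Sum>k\<in>{M..<N}. ?f k)"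
  proof -
    have "{..<N} = {..<min N M} \<union> {M..<N}" by auto
    moreover have "sum ?f ({..<min N M} \<union> {M..<N}) = sum ?f {..<min N M} + sum ?f {M..<N}"
      by (intro sum.union_disjoint) auto
    ultimately show ?thesis by simp
  qed
  also have "(\<Sum>k<min N M. ?f k) \<le> 1 / (1 - 1 / p) * Y powr p"
  proof -
    have "(\<Sum>k<min N M. ?f k) \<le> (\<Sum>k<min N M. Y * real (Suc k) powr (- (1 / p)))"
      by (intro sum_mono small)
    also have "\<dots> = Y * (\<Sum>k<min N M. real (Suc k) powr (- (1 / p)))" by (simp only: sum_distrib_left)
    also have "\<dots> \<le> Y * (1 / (1 - 1 / p) * real (min N M) powr (1 - 1 / p))"
      using Y by (intro mult_left_mono sum_powr_minus_le g) auto
    also have "real (min N M) powr (1 - 1 / p) \<le> (Y powr p) powr (1 - 1 / p)"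
      using M g by (intro powr_mono2) auto
    then have "Y * (1 / (1 - 1 / p) * real (min N M) powr (1 - 1 / p)) \<le> Y * (1 / (1 - 1 / p) * (Y powr p) powr (1 - 1 / p))"
      using Y g by (intro mult_left_mono) auto
    also have "\<dots> = 1 / (1 - 1 / p) * (Y * Y powr (p * (1 - 1 / p)))" by (simp add: powr_powr)
    also have "Y * Y powr (p * (1 - 1 / p)) = Y powr p"
    proof (cases "Y = 0")
      case False
      then have "Y * Y powr (p * (1 - 1 / p)) = Y powr (1 + p * (1 - 1 / p))" using Y by (simp add: powr_add)
      also have "1 + p * (1 - 1 / p) = p" using p by (simp add: field_simps)
      finally show ?thesis .
    qed (use p in simp)
    finally show ?thesis .
  qed
  also have "(\<Sum>k\<in>{M..<N}. ?f k) \<le> 2 * Y powr p"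
  proof -
    have "(\<Sum>k\<in>{M..<N}. ?f k) \<le> (\<Sum>k\<in>{M..<N}. Y powr (2 * p) * (1 / real (Suc k) ^ 2))"
      by (intro sum_mono large) auto
    also have "\<dots> = Y powr (2 * p) * (\<Sum>k\<in>{M..<N}. 1 / real (Suc k) ^ 2)" by (simp only: sum_distrib_left)
    also have "\<dots> \<le> Y powr (2 * p) * (2 / real (Suc M))"
      by (intro mult_left_mono sum_inverse_square_tail) auto
    also have "Y powr (2 * p) = Y powr p * Y powr p" unfolding powr_add[symmetric] by simp
    also have "Y powr p * Y powr p * (2 / real (Suc M)) \<le> Y powr p * real (Suc M) * (2 / real (Suc M))"
      using M by (intro mult_right_mono mult_left_mono) auto
    also have "\<dots> = 2 * Y powr p" by (simp add: field_simps del: of_nat_Suc)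
    finally show ?thesis .
  qed
  finally show ?thesis by (simp add: algebra_simps)
qed

text \<open>For \<open>real (Suc k)\<close> between \<bar>x\<bar>^p and 2^p \<bar>x\<bar>^p the
  argument has modulus between 1/2 and 1, so the sine has modulus at least \<open>sin (1/2)\<close>.
  Since 2^p \<ge> 2, there are at least \<bar>x\<bar>^p - 1 such indices.\<close>

lemma sin_sum_lower:
  assumes p: "p > 1" and N: "real N \<ge> 2 powr p * \<bar>x\<bar> powr p"
  shows "sin (1/2) ^ n * (\<bar>x\<bar> powr p - 1) \<le> (\<Sum>k<N. \<bar>sin (x / real (Suc k) powr (1 / p))\<bar> ^ n)"
proof -
  define X where "X = \<bar>x\<bar>"
  define S where "S = {k. X powr p < real (Suc k) \<and> real (Suc k) \<le> 2 powr p * X powr p}"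
  have c: "sin (1/2 :: real) \<ge> 0" by (intro sin_ge_zero) (use pi_gt3 in auto)
  have g: "0 < 1 / p" using p by simp
  have "S \<subseteq> {..<N}" using N unfolding S_def X_def by auto
  then have fin: "finite S" by (rule finite_subset) simp
  have card: "X powr p - 1 \<le> real (card S)"
  proof -
    define a where "a = nat \<lfloor>X powr p\<rfloor>"
    define b where "b = nat \<lfloor>2 powr p * X powr p\<rfloor>"
    have a: "real a \<le> X powr p" "X powr p < real a + 1" by (simp_all add: a_def) 
    have b: "real b \<le> 2 powr p * X powr p" "2 powr p * X powr p < real b + 1" by (simp_all add: b_def)
    have "{a..<b} \<subseteq> S" unfolding S_def
    proof safe
      fix k assume "k \<in> {a..<b}"
      then have "real a \<le> real k" "real (Suc k) \<le> real b" by auto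
      then show "X powr p < real (Suc k)" "real (Suc k) \<le> 2 powr p * X powr p" using a b by auto
    qed
    from card_mono[OF fin this] have "real (b - a) \<le> real (card S)" by simp
    moreover have "real b - real a \<le> real (b - a)" by simp
    moreover have "2 * X powr p \<le> 2 powr p * X powr p"
      using p powr_mono[of 1 p 2] by (intro mult_right_mono) auto
    ultimately show ?thesis using a b by linarith
  qed
  have "sin (1/2) ^ n * (X powr p - 1) \<le> sin (1/2) ^ n * real (card S)"
    using c card by (intro mult_left_mono) auto
  also have "\<dots> = (\<Sum>k\<in>S. sin (1/2) ^ n)" by simp
  also have "\<dots> \<le> (\<Sum>k\<in>S. \<bar>sin (x / real (Suc k) powr (1 / p))\<bar> ^ n)"
  proof (intro sum_mono power_mono c)
    fix k assume k: "k \<in> S"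
    let ?m = "real (Suc k) powr (1 / p)"
    have X0: "X \<ge> 0" by (simp add: X_def)
    have m: "?m > 0" by simp
    have "(X powr p) powr (1 / p) \<le> ?m" using k g by (intro powr_mono2) (auto simp: S_def)
    moreover have "(X powr p) powr (1 / p) = X" using X0 p by (simp add: powr_powr)
    ultimately have 1: "X / ?m \<le> 1" using m by simp
    have "?m \<le> (2 powr p * X powr p) powr (1 / p)" using k g by (intro powr_mono2) (auto simp: S_def)
    also have "\<dots> = 2 * X" using X0 p by (simp add: powr_mult powr_powr)
    finally have 2: "1 / 2 \<le> X / ?m" using m by (simp add: field_simps)
    have "sin (1 / 2) \<le> sin (X / ?m)"
      by (rule sin_monotone_2pi_le; use 1 2 pi_gt3 in linarith)
    also have "\<dots> \<le> \<bar>sin (x / ?m)\<bar>"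
      by (cases "x \<ge> 0") (auto simp: X_def)
    finally show "sin (1 / 2) \<le> \<bar>sin (x / ?m)\<bar>" .
  qed
  also have "\<dots> \<le> (\<Sum>k<N. \<bar>sin (x / real (Suc k) powr (1 / p))\<bar> ^ n)"
    using \<open>S \<subseteq> {..<N}\<close> by (intro sum_mono2) auto
  finally show ?thesis by (simp add: X_def)
qed

text \<open>The factors \<open>1 - sin\<^sup>n(z / k\<^sup>1\<^sup>/\<^sup>p)\<close> are at most 1 on the real axis and contract by a fixed amount when
  \<open>x \<approx> k\<^sup>1\<^sup>/\<^sup>p\<close>; about \<open>\<bar>x\<bar>\<^sup>p\<close> of them do, and off the axis their growth sums up to \<open>O(\<bar>y\<bar>\<^sup>p)\<close>.\<close>

theorem entire_window:
  fixes p :: real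
  assumes p: "p > 1"
  shows "\<exists>f C a b. f holomorphic_on UNIV \<and> a > 0 \<and> b > 0 \<and> f 0 = 1 \<and> (\<forall>x. \<exists>r\<ge>0. f (of_real x) = of_real r) \<and>
    (\<forall>x y. cmod (f (Complex x y)) \<le> C * exp (- a * \<bar>x\<bar> powr p + b * \<bar>y\<bar> powr p))"
proof -
  \<comment> \<open>Even, so that all factors lie between 0 and 1 on the real axis; at least
    \<open>2 * p\<close>, so that the penalties and the product converge.\<close>
  define n where "n = 2 * nat \<lceil>p\<rceil>"
  have n: "even n" "n > 0" "real n \<ge> 2 * p" using p by (auto simp: n_def)
  obtain b where b: "b \<ge> 0" "\<And>x y. cmod (1 - sin (Complex x y) ^ n) \<le>
    exp (- (\<bar>sin x\<bar> ^ n) / 2 + b * (if \<bar>y\<bar> \<le> 1 then \<bar>y\<bar> ^ n else \<bar>y\<bar>))"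
    using sin_factor_bound[OF n(1,2)] by blast
  define m where "m k = real (Suc k) powr (1 / p)" for k
  have m: "m k > 0" "m k \<ge> 1" for k using p by (auto simp: m_def ge_one_powr_ge_zero)
  define F where "F k z = 1 - sin (z / of_real (m k)) ^ n" for k and z :: complex
  define P where "P N z = (\<Prod>k<N. F k z)" for N z
  have holF: "F k holomorphic_on UNIV" for k
    unfolding F_def using m(1)[of k] by (intro holomorphic_intros) auto
  have holP: "P N holomorphic_on UNIV" for N
    unfolding P_def by (intro holomorphic_on_prod holF)
  have Pb: "cmod (P N (Complex x y)) \<le> exp (- (\<Sum>k<N. \<bar>sin (x / m k)\<bar> ^ n) / 2 + b * ((1 / (1 - 1 / p) + 2) * \<bar>y\<bar> powr p))" for N x y
  proof -
    let ?\<theta> = "\<lambda>k. (let t = \<bar>y\<bar> / m k in if t \<le> 1 then t ^ n else t)"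
    have "Complex x y / of_real (m k) = Complex (x / m k) (y / m k)" for k
      by (simp add: complex_eq_iff)
    then have "cmod (F k (Complex x y)) \<le> exp (- (\<bar>sin (x / m k)\<bar> ^ n) / 2 + b * ?\<theta> k)" for k
      unfolding F_def using b(2)[of "x / m k" "y / m k"] m(1)[of k] by (simp only: abs_divide abs_of_pos Let_def)
    then have "cmod (P N (Complex x y)) \<le> (\<Prod>k<N. exp (- (\<bar>sin (x / m k)\<bar> ^ n) / 2 + b * ?\<theta> k))"
      unfolding P_def prod_norm[symmetric] by (intro prod_mono) auto
    also have "\<dots> = exp (- (\<Sum>k<N. \<bar>sin (x / m k)\<bar> ^ n) / 2 + b * (\<Sum>k<N. ?\<theta> k))"
      by (simp add: sum.distrib sum_subtractf sum_divide_distrib sum_negf sum_distrib_left flip: exp_sum)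
    also have "\<dots> \<le> exp (- (\<Sum>k<N. \<bar>sin (x / m k)\<bar> ^ n) / 2 + b * ((1 / (1 - 1 / p) + 2) * \<bar>y\<bar> powr p))"
      using mult_left_mono[OF theta_sum_bound[OF p n(3), of "\<bar>y\<bar>" N] b(1)] unfolding m_def by simp
    finally show ?thesis .
  qed
  \<comment> \<open>On a bounded set \<bar>sin v\<bar> is at most a constant times \<bar>v\<bar>,
    and \<open>m k ^ n \<ge> real (Suc k) ^ 2\<close> because \<open>n \<ge> 2 * p\<close>; this
    gives a summable majorant for \<open>F k z - 1\<close>.\<close>
  have "uniformly_convergent_on (cball 0 R) P" for R
  proof -
    define R' where "R' = \<bar>R\<bar> + 1"
    have R': "R' > 0" by (simp add: R'_def)
    have Fb: "norm (norm (F k z - 1)) \<le> (exp R' * R') ^ n * (1 / real (Suc k) ^ 2)" if z: "z \<in> cball 0 R" for k z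
    proof -
      let ?w = "z / of_real (m k)"
      have zR: "cmod z \<le> R'" using z by (simp add: R'_def)
      have w: "cmod ?w = cmod z / m k" using m(1)[of k] by (simp add: norm_divide)
      then have w1: "cmod ?w \<le> R'" using zR m[of k] by (simp add: divide_le_eq order_trans[OF _ mult_left_mono[of 1]] mult_le_cancel_left1 R' less_imp_le)
      have ex: "cmod (exp (\<i> * v) - 1) \<le> exp (cmod v) * cmod v" for v
        using Taylor_exp_field[of "\<i> * v" 0] by (simp add: norm_mult)
      have "sin ?w = ((exp (\<i> * ?w) - 1) - (exp (\<i> * (- ?w)) - 1)) / (2 * \<i>)"
        unfolding sin_exp_eq by (simp add: diff_divide_distrib)
      then have "cmod (sin ?w) \<le> (cmod (exp (\<i> * ?w) - 1) + cmod (exp (\<i> * (- ?w)) - 1)) / 2"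
        by (simp only: norm_divide norm_mult norm_numeral norm_ii mult_1_right divide_right_mono norm_triangle_ineq4 zero_le_numeral)
      also have "\<dots> \<le> exp (cmod ?w) * cmod ?w" using ex[of ?w] ex[of "- ?w"] by simp
      also have "\<dots> \<le> exp R' * (R' / m k)" using w1 w zR m(1)[of k] by (intro mult_mono) (auto simp: divide_right_mono)
      finally have "cmod (sin ?w) ^ n \<le> (exp R' * (R' / m k)) ^ n" by (intro power_mono) auto
      also have "\<dots> = (exp R' * R') ^ n * (1 / m k ^ n)" by (simp add: power_mult_distrib power_divide)
      also have "\<dots> \<le> (exp R' * R') ^ n * (1 / real (Suc k) ^ 2)"
      proof (intro mult_left_mono divide_left_mono)
        have "real (Suc k) ^ 2 = real (Suc k) powr 2" by (rule powr_numeral[symmetric]) simp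
        also have "\<dots> \<le> real (Suc k) powr (1 / p * real n)" using n p by (intro powr_mono) (auto simp: field_simps)
        also have "\<dots> = m k powr real n" unfolding m_def by (simp only: powr_powr)
        also have "\<dots> = m k ^ n" using m(1)[of k] by (rule powr_realpow)
        finally show "real (Suc k) ^ 2 \<le> m k ^ n" .
      qed (use m(1)[of k] R' in auto)
      finally show ?thesis by (simp add: F_def norm_power)
    qed
    have "summable (\<lambda>k. 1 / real (Suc k) ^ 2)"
      using inverse_power_summable[of 2, where 'a=real] summable_Suc_iff[of "\<lambda>k. 1 / real k ^ 2"] by (simp add: inverse_eq_divide)
    then have "summable (\<lambda>k. (exp R' * R') ^ n * (1 / real (Suc k) ^ 2))" by (rule summable_mult)
    from Weierstrass_m_test[OF Fb this]
    have "uniformly_convergent_on (cball 0 R) (\<lambda>N z. \<Sum>k<N. norm (F k z - 1))"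
      by (rule uniformly_convergentI)
    then show ?thesis unfolding P_def
      by (intro uniformly_convergent_on_prod' holomorphic_on_imp_continuous_on holomorphic_on_subset[OF holF]) auto
  qed
  then have unif: "uniform_limit (cball 0 R) P (\<lambda>z. lim (\<lambda>N. P N z)) sequentially" for R
    by (simp add: uniformly_convergent_uniform_limit_iff)
  define f where "f z = lim (\<lambda>N. P N z)" for z
  have lim: "(\<lambda>N. P N z) \<longlonglongrightarrow> f z" for z
    using tendsto_uniform_limitI[OF unif, of z "norm z"] by (simp add: f_def)
  have holf: "f holomorphic_on UNIV"
  proof (rule holomorphic_uniform_sequence[OF open_UNIV holP])
    fix x :: complex
    have "cball x 1 \<subseteq> cball 0 (norm x + 1)"
    proof
      fix y assume "y \<in> cball x 1"
      then show "y \<in> cball 0 (norm x + 1)" using norm_triangle_sub[of y x] by (simp add: dist_norm norm_minus_commute)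
    qed
    from uniform_limit_on_subset[OF unif this]
    show "\<exists>d>0. cball x d \<subseteq> UNIV \<and> uniform_limit (cball x d) P f sequentially"
      unfolding f_def by (intro exI[of _ 1]) auto
  qed
  \<comment> \<open>Half of the constant in \<open>sin_sum_lower\<close>, since the exponent in
    \<open>Pb\<close> carries half of the sum; the \<open>- 1\<close> there turns into the prefactor
    \<open>exp c\<close>. The added 1 in \<open>B\<close> below keeps it positive.\<close>
  define c where "c = sin (1/2 :: real) ^ n / 2"
  have c: "c > 0" unfolding c_def using sin_gt_zero[of "1/2"] pi_gt3 by simp
  define B where "B = b * (1 / (1 - 1 / p) + 2) + 1"
  have "1 / (1 - 1 / p) > 0" using p by simp
  then have B: "B > 0" unfolding B_def using b(1) by (intro add_nonneg_pos mult_nonneg_nonneg) auto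
  have fb: "cmod (f (Complex x y)) \<le> exp c * exp (- c * \<bar>x\<bar> powr p + B * \<bar>y\<bar> powr p)" for x y
  proof (rule tendsto_upperbound[OF tendsto_norm[OF lim]])
    obtain N0 where N0: "real N0 \<ge> 2 powr p * \<bar>x\<bar> powr p" using real_arch_simple by blast
    show "\<forall>\<^sub>F N in sequentially. cmod (P N (Complex x y)) \<le> exp c * exp (- c * \<bar>x\<bar> powr p + B * \<bar>y\<bar> powr p)"
      unfolding eventually_sequentially
    proof (intro exI[of _ N0] allI impI)
      fix N assume "N0 \<le> N"
      then have "real N \<ge> 2 powr p * \<bar>x\<bar> powr p" using N0 by simp
      from sin_sum_lower[OF p this, of n]
      have "c * (\<bar>x\<bar> powr p - 1) \<le> (\<Sum>k<N. \<bar>sin (x / m k)\<bar> ^ n) / 2" unfolding c_def m_def by simp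
      moreover have "b * ((1 / (1 - 1 / p) + 2) * \<bar>y\<bar> powr p) \<le> B * \<bar>y\<bar> powr p"
        unfolding B_def by (simp add: distrib_right mult.assoc)
      ultimately have "- (\<Sum>k<N. \<bar>sin (x / m k)\<bar> ^ n) / 2 + b * ((1 / (1 - 1 / p) + 2) * \<bar>y\<bar> powr p) \<le> c + (- c * \<bar>x\<bar> powr p + B * \<bar>y\<bar> powr p)"
        by (simp add: algebra_simps)
      then show "cmod (P N (Complex x y)) \<le> exp c * exp (- c * \<bar>x\<bar> powr p + B * \<bar>y\<bar> powr p)"
        using Pb[of N x y] unfolding exp_add[symmetric] by (meson exp_le_cancel_iff order_trans)
    qed
  qed simp
  have "f 0 = 1"
  proof -
    have "P N 0 = 1" for N using n by (simp add: P_def F_def zero_power)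
    then show ?thesis using lim[of 0] LIMSEQ_unique[OF _ tendsto_const] by simp
  qed
  \<comment> \<open>Nonnegativity on the real axis, together with \<open>f 0 = 1\<close>, will make
    the integral of \<open>f\<close> over the line nonzero, so that the window can be
    normalised.\<close>
  moreover have "\<exists>r\<ge>0. f (of_real x) = of_real r" for x
  proof -
    define r where "r N = (\<Prod>k<N. 1 - sin (x / m k) ^ n)" for N
    have "F k (of_real x) = of_real (1 - sin (x / m k) ^ n)" for k
      unfolding F_def by (simp flip: of_real_divide sin_of_real)
    then have Pr: "P N (of_real x) = of_real (r N)" for N unfolding P_def r_def by simp
    have "sin (x / m k) ^ n \<le> 1" for k
      using n power_le_one[of "\<bar>sin (x / m k)\<bar>" n] by (simp add: power_even_abs)
    then have r0: "r N \<ge> 0" for N unfolding r_def by (intro prod_nonneg) auto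
    have "(\<lambda>N. Re (P N (of_real x))) \<longlonglongrightarrow> Re (f (of_real x))" "(\<lambda>N. Im (P N (of_real x))) \<longlonglongrightarrow> Im (f (of_real x))"
      by (intro tendsto_intros lim)+
    then have l: "r \<longlonglongrightarrow> Re (f (of_real x))" "(\<lambda>N. 0) \<longlonglongrightarrow> Im (f (of_real x))" unfolding Pr by simp_all
    have "Re (f (of_real x)) \<ge> 0" by (rule LIMSEQ_le_const[OF l(1)]) (use r0 in auto)
    moreover have "Im (f (of_real x)) = 0" using LIMSEQ_unique[OF l(2) tendsto_const] by simp
    ultimately show ?thesis by (intro exI[of _ "Re (f (of_real x))"]) (auto simp: complex_eq_iff)
  qed
  ultimately show ?thesis using holf fb c B by blast
qed

section \<open>From the entire function to windows\<close>

text \<open>The bound of a power over its factorial by the exponential, for a multiple of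
  \<open>x powr (1 / \<theta>)\<close>, raised to the power \<theta>.\<close>

lemma power_le_fact_powr:
  fixes x c \<theta> :: real
  assumes "x \<ge> 0" "c > 0" "\<theta> > 0"
  shows "x ^ l \<le> ((\<theta> / c) powr \<theta>) ^ l * fact l powr \<theta> * exp (c * x powr (1 / \<theta>))"
proof (cases "x = 0")
  case True
  then show ?thesis using assms by (cases l) auto
next
  case False
  then have x: "x > 0" using assms by simp
  define u where "u = x powr (1 / \<theta>)"
  have u: "u > 0" using x by (simp add: u_def)
  have xu: "x = u powr \<theta>" using x assms by (simp add: u_def powr_powr)
  have "(c * u / \<theta>) ^ l / fact l \<le> exp (c * u / \<theta>)" using u assms by (intro power_div_fact_le_exp) auto
  then have "u ^ l \<le> (\<theta> / c) ^ l * fact l * exp (c * u / \<theta>)"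
    using assms by (simp add: power_divide power_mult_distrib field_simps)
  then have "(u ^ l) powr \<theta> \<le> ((\<theta> / c) ^ l * fact l * exp (c * u / \<theta>)) powr \<theta>"
    using u assms by (intro powr_mono2) auto
  also have "\<dots> = ((\<theta> / c) ^ l) powr \<theta> * fact l powr \<theta> * exp (c * u / \<theta>) powr \<theta>"
    using assms by (simp add: powr_mult)
  also have "exp (c * u / \<theta>) powr \<theta> = exp (c * u)" using assms by (simp add: exp_powr_real)
  also have "((\<theta> / c) ^ l) powr \<theta> = ((\<theta> / c) powr \<theta>) ^ l"
    using assms by (simp add: powr_powr powr_realpow[symmetric] mult.commute)
  also have "(u ^ l) powr \<theta> = x ^ l"
    unfolding xu using u by (simp add: powr_powr powr_realpow[symmetric] mult.commute)
  finally show ?thesis by (simp add: u_def)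
qed

text \<open>Cauchy estimates on a circle of radius R with R^p = n + 1. Growth off the axis then
  costs only a geometric factor in n, while n! / R^n is at most n!^(1 - 1/p). Thus decay of order p
  and growth of the same order p produce regularity 1 - 1/p, the critical exponent.\<close>

lemma entire_window_derivatives:
  fixes p :: real
  assumes p: "p > 1" and hol: "f holomorphic_on UNIV" and a: "a > 0" and b: "b > 0"
    and fb: "\<And>x y. cmod (f (Complex x y)) \<le> C * exp (- a * \<bar>x\<bar> powr p + b * \<bar>y\<bar> powr p)"
  shows "\<exists>A>0. \<exists>\<rho>>0. \<exists>K. \<forall>l n x. cmod ((deriv ^^ n) (\<lambda>z. z ^ l * f z) (of_real x)) \<le>
     K * A ^ (l + n) * fact l powr (1 / p) * fact n powr (1 - 1 / p) * exp (- \<rho> * \<bar>x\<bar> powr p)"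
proof -
  \<comment> \<open>The constants are tied by \<open>c * 2 powr p = \<rho>\<close>. Moving from the
    circle to its centre leaves \<open>f\<close> the rate \<open>2 * \<rho>\<close>; the monomial
    takes half of it and \<rho> remains.\<close>
  define c where "c = a / (2 * (2 powr p * 2 powr p))"
  define D where "D = (1 / p / c) powr (1 / p)"
  define \<rho> where "\<rho> = a / (2 * 2 powr p)"
  define E where "E = a + b + c * 2 powr p"
  define A where "A = max D (exp E)"
  have c: "c > 0" and \<rho>: "\<rho> > 0" using a by (simp_all add: c_def \<rho>_def)
  have c2: "c * 2 powr p = \<rho>" by (simp add: c_def \<rho>_def)
  have E: "E > 0" unfolding E_def c2 using a b \<rho> by simp
  have A: "A > 0" by (simp add: A_def less_max_iff_disj)
  have D: "D \<ge> 0" by (simp add: D_def)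
  have C: "C \<ge> 0"
  proof -
    have "0 \<le> C * exp (- a * \<bar>0\<bar> powr p + b * \<bar>0\<bar> powr p)" using fb[of 0 0] norm_ge_zero order_trans by blast
    then show ?thesis by (simp add: zero_le_mult_iff)
  qed
  have main: "cmod ((deriv ^^ n) (\<lambda>z. z ^ l * f z) (of_real x)) \<le>
     (C * exp E) * A ^ (l + n) * fact l powr (1 / p) * fact n powr (1 - 1 / p) * exp (- \<rho> * \<bar>x\<bar> powr p)" for l n x
  proof -
    \<comment> \<open>\<open>Suc n\<close> keeps the radius positive for \<open>n = 0\<close>; the
      additional 1 in \<open>R powr p\<close> becomes the constant \<open>exp E\<close>.\<close>
    define R where "R = real (Suc n) powr (1 / p)"
    have R: "R > 0" by (simp add: R_def)
    have Rp: "R powr p = real n + 1" using p by (simp add: R_def powr_powr)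
    define B where "B = (D ^ l * fact l powr (1 / p)) * (C * exp (- \<rho> * \<bar>x\<bar> powr p + E * R powr p))"
    have pw: "(s + t) powr p \<le> 2 powr p * (s powr p + t powr p)" if "s \<ge> 0" "t \<ge> 0" for s t :: real
      using powr_norm_add[of p s t] that p by simp
    have bound: "cmod (z ^ l * f z) \<le> B" if z: "cmod (of_real x - z) = R" for z
    proof -
      define u v where "u = Re z" and "v = Im z"
      have zc: "z = Complex u v" by (simp add: u_def v_def)
      have "\<bar>x - u\<bar> \<le> R" "\<bar>v\<bar> \<le> R"
        using abs_Re_le_cmod[of "of_real x - z"] abs_Im_le_cmod[of "of_real x - z"] z by (simp_all add: u_def v_def)
      then have xu: "\<bar>x\<bar> \<le> \<bar>u\<bar> + R" and v: "\<bar>v\<bar> powr p \<le> R powr p" using p by (auto intro: powr_mono2)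
      have "\<bar>x\<bar> powr p \<le> (\<bar>u\<bar> + R) powr p" using xu p by (intro powr_mono2) auto
      also have "\<dots> \<le> 2 powr p * (\<bar>u\<bar> powr p + R powr p)" using R by (intro pw) auto
      finally have "2 * \<rho> * \<bar>x\<bar> powr p \<le> 2 * \<rho> * (2 powr p * (\<bar>u\<bar> powr p + R powr p))"
        using \<rho> by (intro mult_left_mono) auto
      also have "\<dots> = a * \<bar>u\<bar> powr p + a * R powr p" by (simp add: \<rho>_def field_simps)
      finally have u: "- a * \<bar>u\<bar> powr p \<le> - (2 * \<rho>) * \<bar>x\<bar> powr p + a * R powr p" by simp
      have "cmod (f z) \<le> C * exp (- (2 * \<rho>) * \<bar>x\<bar> powr p + (a + b) * R powr p)"
      proof -
        have "b * \<bar>v\<bar> powr p \<le> b * R powr p" using v b by simp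
        then have "- a * \<bar>u\<bar> powr p + b * \<bar>v\<bar> powr p \<le> - (2 * \<rho>) * \<bar>x\<bar> powr p + (a + b) * R powr p"
          using u unfolding distrib_right by linarith
        then show ?thesis unfolding zc using C by (intro order_trans[OF fb] mult_left_mono) auto
      qed
      moreover have "cmod z ^ l \<le> D ^ l * fact l powr (1 / p) * exp (\<rho> * \<bar>x\<bar> powr p + \<rho> * R powr p)"
      proof -
        have zz: "cmod z \<le> \<bar>x\<bar> + R" using norm_triangle_sub[of z "of_real x"] z by (simp add: norm_minus_commute)
        have "cmod z ^ l \<le> (\<bar>x\<bar> + R) ^ l" using zz by (intro power_mono) auto
        also have "\<dots> \<le> D ^ l * fact l powr (1 / p) * exp (c * (\<bar>x\<bar> + R) powr p)"
          using power_le_fact_powr[of "\<bar>x\<bar> + R" c "1 / p" l] R c p by (simp add: D_def)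
        also have "\<dots> \<le> D ^ l * fact l powr (1 / p) * exp (\<rho> * \<bar>x\<bar> powr p + \<rho> * R powr p)"
        proof (intro mult_left_mono)
          have "c * (\<bar>x\<bar> + R) powr p \<le> c * (2 powr p * (\<bar>x\<bar> powr p + R powr p))"
            using c R by (intro mult_left_mono pw) auto
          then show "exp (c * (\<bar>x\<bar> + R) powr p) \<le> exp (\<rho> * \<bar>x\<bar> powr p + \<rho> * R powr p)"
            by (simp add: c2[symmetric] algebra_simps)
        qed (use D in auto)
        finally show ?thesis .
      qed
      ultimately have "cmod (z ^ l * f z) \<le> (D ^ l * fact l powr (1 / p) * exp (\<rho> * \<bar>x\<bar> powr p + \<rho> * R powr p)) *
         (C * exp (- (2 * \<rho>) * \<bar>x\<bar> powr p + (a + b) * R powr p))"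
        unfolding norm_mult norm_power using D by (intro mult_mono) auto
      also have "\<dots> = B" unfolding B_def E_def c2 by (simp add: mult_ac exp_add[symmetric] algebra_simps)
      finally show ?thesis .
    qed
    have "cmod ((deriv ^^ n) (\<lambda>z. z ^ l * f z) (of_real x)) \<le> fact n * B / R ^ n"
      by (rule Cauchy_inequality) (use R bound in \<open>auto intro!: holomorphic_intros holomorphic_on_imp_continuous_on holomorphic_on_subset[OF hol]\<close>)
    also have "fact n * B / R ^ n = (fact n / R ^ n) * B" by simp
    also have "\<dots> \<le> fact n powr (1 - 1 / p) * B"
    proof (rule mult_right_mono)
      have "(fact n :: real) \<le> real n ^ n" by (metis fact_le_power of_nat_fact of_nat_le_iff of_nat_power order_refl)
      also have "\<dots> \<le> real (Suc n) ^ n" by (intro power_mono) auto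
      finally have "fact n powr (1 / p) \<le> (real (Suc n) ^ n) powr (1 / p)" using p by (intro powr_mono2) auto
      also have "\<dots> = R ^ n" by (simp add: R_def powr_powr powr_realpow[symmetric] mult.commute del: of_nat_Suc)
      finally have "fact n powr (1 / p) \<le> R ^ n" .
      then have "fact n / R ^ n \<le> fact n / fact n powr (1 / p)" using R by (intro divide_left_mono) auto
      also have "\<dots> = fact n powr (1 - 1 / p)" by (simp add: powr_diff)
      finally show "fact n / R ^ n \<le> fact n powr (1 - 1 / p)" .
      show "B \<ge> 0" unfolding B_def using C D by (intro mult_nonneg_nonneg) auto
    qed
    also have "B = (C * exp E) * (D ^ l * exp E ^ n) * fact l powr (1 / p) * exp (- \<rho> * \<bar>x\<bar> powr p)"
      unfolding B_def Rp exp_of_nat_mult[symmetric] by (simp add: exp_add[symmetric] algebra_simps mult_ac)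
    also have "fact n powr (1 - 1 / p) * \<dots> \<le> fact n powr (1 - 1 / p) * ((C * exp E) * (A ^ l * A ^ n) * fact l powr (1 / p) * exp (- \<rho> * \<bar>x\<bar> powr p))"
      using C D by (intro mult_left_mono mult_right_mono mult_mono power_mono) (auto simp: A_def)
    finally show ?thesis by (simp add: power_add mult_ac)
  qed
  show ?thesis using A \<rho> main by blast
qed

definition line_window :: "real \<Rightarrow> real \<Rightarrow> real \<Rightarrow> real \<Rightarrow> real \<Rightarrow> (nat \<Rightarrow> nat \<Rightarrow> real \<Rightarrow> complex) \<Rightarrow> bool" where
  "line_window s \<sigma> A \<rho> K \<psi> \<longleftrightarrow> (\<forall>l n x. continuous_on UNIV (\<psi> l n) \<and> (\<psi> l n has_vector_derivative \<psi> l (Suc n) x) (at x) \<and>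
     \<psi> (Suc l) 0 x = of_real x * \<psi> l 0 x \<and>
     cmod (\<psi> l n x) \<le> K * A ^ (l + n) * fact l powr \<sigma> * fact n powr s * exp (- \<rho> * \<bar>x\<bar> powr (1 / \<sigma>)))"

text \<open>The window on the critical line, with regularity \<open>1 - \<sigma>\<close> against
  decay \<sigma>; the windows for all other pairs are obtained by weakening its bounds.\<close>

lemma line_window_exists:
  assumes \<sigma>: "0 < \<sigma>" "\<sigma> < 1"
  shows "\<exists>\<psi> A \<rho> K. A > 0 \<and> \<rho> > 0 \<and> line_window (1 - \<sigma>) \<sigma> A \<rho> K \<psi> \<and> (LINT x|lborel. \<psi> 0 0 x) = 1"
proof -
  define p where "p = 1 / \<sigma>"
  have p: "p > 1" "1 / p = \<sigma>" using \<sigma> by (simp_all add: p_def)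
  obtain f C a b where f: "f holomorphic_on UNIV" "a > 0" "b > 0" "f 0 = 1" "\<And>x. \<exists>r\<ge>0. f (of_real x) = of_real r"
    "\<And>x y. cmod (f (Complex x y)) \<le> C * exp (- a * \<bar>x\<bar> powr p + b * \<bar>y\<bar> powr p)"
    using entire_window[OF p(1)] by blast
  obtain A \<rho> K where A: "A > 0" "\<rho> > 0" "\<And>l n x. cmod ((deriv ^^ n) (\<lambda>z. z ^ l * f z) (of_real x)) \<le>
     K * A ^ (l + n) * fact l powr (1 / p) * fact n powr (1 - 1 / p) * exp (- \<rho> * \<bar>x\<bar> powr p)"
    using entire_window_derivatives[OF p(1) f(1,2,3,6)] by blast
  obtain r where r: "\<And>x. r x \<ge> 0" "\<And>x. f (of_real x) = of_real (r x)" using f(5) by metis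
  have cf: "continuous_on UNIV f" using f(1) by (rule holomorphic_on_imp_continuous_on)
  have cr: "continuous_on UNIV r"
  proof -
    have "continuous_on UNIV (\<lambda>x. Re (f (complex_of_real x)))"
      by (intro continuous_intros continuous_on_compose2[OF cf]) auto
    then show ?thesis by (simp add: r(2))
  qed
  have intr: "integrable lborel r"
  proof (rule Bochner_Integration.integrable_bound)
    show "integrable lborel (\<lambda>x. K * exp (- \<rho> * \<bar>x\<bar> powr p))"
      using A(2) p by (intro integrable_mult_right integrable_exp_powr_real) auto
    show "AE x in lborel. norm (r x) \<le> norm (K * exp (- \<rho> * \<bar>x\<bar> powr p))"
    proof (rule AE_I2)
      fix x
      have "norm (r x) \<le> K * exp (- \<rho> * \<bar>x\<bar> powr p)" using A(3)[of 0 0 x] by (simp add: r(2))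
      then show "norm (r x) \<le> norm (K * exp (- \<rho> * \<bar>x\<bar> powr p))" by simp
    qed
  qed (use borel_measurable_continuous_onI[OF cr] in simp)
  define I where "I = (LINT x|lborel. r x)"
  \<comment> \<open>Otherwise the continuous nonnegative \<open>r\<close> would vanish almost
    everywhere, although the open set where it is nonzero contains 0.\<close>
  have "I \<noteq> 0"
  proof
    assume "I = 0"
    then have "AE x in lborel. r x = 0"
      unfolding I_def using integral_nonneg_eq_0_iff_AE[OF intr] r(1) by auto
    moreover have op: "open {x. r x \<noteq> 0}"
      using open_Collect_neq[OF cr continuous_on_const] by simp
    ultimately have "{x \<in> space lborel. \<not> r x = 0} \<in> null_sets lborel"
      by (subst AE_iff_null[symmetric]) auto
    then have "negligible {x. r x \<noteq> 0}"
      unfolding negligible_iff_null_sets by (auto intro: null_sets_completionI)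
    moreover have "0 \<in> {x. r x \<noteq> 0}" using r(2)[of 0] f(4) by (auto simp: complex_eq_iff)
    ultimately show False using open_not_negligible[OF op] by blast
  qed
  define \<psi> where "\<psi> l n x = inverse (of_real I) * (deriv ^^ n) (\<lambda>z. z ^ l * f z) (of_real x)" for l n x
  have hol: "(deriv ^^ n) (\<lambda>z. z ^ l * f z) holomorphic_on UNIV" for l n
    by (intro holomorphic_intros f(1) open_UNIV)
  have "line_window (1 - \<sigma>) \<sigma> A \<rho> (cmod (inverse (of_real I)) * K) \<psi>"
    unfolding line_window_def
  proof (intro allI conjI)
    fix l n x
    show "continuous_on UNIV (\<psi> l n)"
      unfolding \<psi>_def by (intro continuous_intros continuous_on_compose2[OF holomorphic_on_imp_continuous_on[OF hol]]) auto
    have "((deriv ^^ n) (\<lambda>z. z ^ l * f z) has_field_derivative (deriv ^^ Suc n) (\<lambda>z. z ^ l * f z) (of_real x)) (at (of_real x))"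
      using holomorphic_derivI[OF hol open_UNIV UNIV_I] by simp
    then have "((\<lambda>x. (deriv ^^ n) (\<lambda>z. z ^ l * f z) (of_real x)) has_vector_derivative (deriv ^^ Suc n) (\<lambda>z. z ^ l * f z) (of_real x)) (at x)"
      by (rule has_vector_derivative_real_field)
    then show "(\<psi> l n has_vector_derivative \<psi> l (Suc n) x) (at x)"
      unfolding \<psi>_def by (rule has_vector_derivative_mult_right)
    show "\<psi> (Suc l) 0 x = of_real x * \<psi> l 0 x" by (simp add: \<psi>_def)
    have "cmod (\<psi> l n x) \<le> cmod (inverse (of_real I)) * (K * A ^ (l + n) * fact l powr (1 / p) * fact n powr (1 - 1 / p) * exp (- \<rho> * \<bar>x\<bar> powr p))"
      unfolding \<psi>_def norm_mult by (intro mult_left_mono A) auto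
    then show "cmod (\<psi> l n x) \<le> cmod (inverse (of_real I)) * K * A ^ (l + n) * fact l powr \<sigma> * fact n powr (1 - \<sigma>) * exp (- \<rho> * \<bar>x\<bar> powr (1 / \<sigma>))"
      unfolding p(2) by (simp only: p_def mult.assoc)
  qed
  moreover have "(LINT x|lborel. \<psi> 0 0 x) = 1"
  proof -
    have "(LINT x|lborel. \<psi> 0 0 x) = inverse (of_real I) * of_real I"
      unfolding \<psi>_def I_def by (simp add: r(2))
    then show ?thesis using \<open>I \<noteq> 0\<close> by simp
  qed
  ultimately show ?thesis using A(1,2) by blast
qed

lemma powr_le_powr_plus_one:
  fixes x p q :: real
  assumes "x \<ge> 0" "0 < p" "p \<le> q"
  shows "x powr p \<le> x powr q + 1"
proof (cases "x \<le> 1")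
  case True
  then have "x powr p \<le> 1" using assms by (simp add: powr_le1)
  then show ?thesis using powr_ge_zero[of x q] by linarith
next
  case False
  then have "x powr p \<le> x powr q" using assms by (intro powr_mono) auto
  then show ?thesis by simp
qed

lemma line_window_K_nonneg:
  assumes "line_window s \<sigma> A \<rho> K \<psi>"
  shows "K \<ge> 0"
proof -
  have "0 \<le> cmod (\<psi> 0 0 0)" by simp
  also have "\<dots> \<le> K" using assms[unfolded line_window_def, rule_format, of 0 0 0] by simp
  finally show ?thesis .
qed

lemma line_window_weaken:
  assumes win: "line_window s' \<sigma>' A \<rho> K \<psi>" and \<sigma>: "0 < \<sigma>'" "\<sigma>' \<le> \<sigma>" and s: "s' \<le> s" and A: "A > 0" "\<rho> > 0"
  shows "line_window s \<sigma> A \<rho> (K * exp \<rho>) \<psi>"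
  unfolding line_window_def
proof (intro allI conjI)
  fix l n x
  note w = win[unfolded line_window_def, rule_format, of l n x]
  show "continuous_on UNIV (\<psi> l n)" "(\<psi> l n has_vector_derivative \<psi> l (Suc n) x) (at x)"
    "\<psi> (Suc l) 0 x = of_real x * \<psi> l 0 x" using w by auto
  have K: "K \<ge> 0" by (rule line_window_K_nonneg[OF win])
  have "cmod (\<psi> l n x) \<le> K * A ^ (l + n) * fact l powr \<sigma>' * fact n powr s' * exp (- \<rho> * \<bar>x\<bar> powr (1 / \<sigma>'))"
    using w by auto
  also have "\<dots> \<le> K * A ^ (l + n) * fact l powr \<sigma> * fact n powr s * (exp \<rho> * exp (- \<rho> * \<bar>x\<bar> powr (1 / \<sigma>)))"
  proof (intro mult_mono mult_nonneg_nonneg)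
    have "\<bar>x\<bar> powr (1 / \<sigma>) \<le> \<bar>x\<bar> powr (1 / \<sigma>') + 1"
      using \<sigma> by (intro powr_le_powr_plus_one) (auto intro!: divide_left_mono)
    then have "\<rho> * \<bar>x\<bar> powr (1 / \<sigma>) \<le> \<rho> * (\<bar>x\<bar> powr (1 / \<sigma>') + 1)" using A by (intro mult_left_mono) auto
    then show "exp (- \<rho> * \<bar>x\<bar> powr (1 / \<sigma>')) \<le> exp \<rho> * exp (- \<rho> * \<bar>x\<bar> powr (1 / \<sigma>))"
      unfolding exp_add[symmetric] by (simp add: algebra_simps)
  qed (use K A \<sigma> s in \<open>auto intro!: powr_mono\<close>)
  finally show "cmod (\<psi> l n x) \<le> K * exp \<rho> * A ^ (l + n) * fact l powr \<sigma> * fact n powr s * exp (- \<rho> * \<bar>x\<bar> powr (1 / \<sigma>))"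
    by (simp only: mult_ac)
qed

text \<open>A geometric factor of any size is absorbed by an arbitrarily small power of the
  factorial. Room in the exponents therefore makes every scale available.\<close>

lemma power_fact_trade:
  fixes A0 A :: real
  assumes "A0 > 0" "A > 0" "\<delta> > 0"
  shows "A0 ^ l \<le> exp (\<delta> * (A0 / A) powr (1 / \<delta>)) * A ^ l * fact l powr \<delta>"
proof -
  have "(A0 / A) ^ l \<le> ((\<delta> / \<delta>) powr \<delta>) ^ l * fact l powr \<delta> * exp (\<delta> * (A0 / A) powr (1 / \<delta>))"
    using assms by (intro power_le_fact_powr) auto
  then show ?thesis using assms by (simp add: power_divide field_simps)
qed

text \<open>When both exponents exceed those of the given window, the surplus buys every scale and
  every decay rate at the price of the constant.\<close>

lemma line_window_strict:
  assumes win: "line_window s' \<sigma>' A0 \<rho>0 K0 \<psi>" and \<sigma>: "0 < \<sigma>'" "\<sigma>' < \<sigma>" and s: "s' < s"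
    and A0: "A0 > 0" "\<rho>0 > 0" and A: "A > 0" "\<rho> > 0"
  shows "\<exists>K. line_window s \<sigma> A \<rho> K \<psi>"
proof -
  define C1 where "C1 = exp ((\<sigma> - \<sigma>') * (A0 / A) powr (1 / (\<sigma> - \<sigma>')))"
  define C2 where "C2 = exp ((s - s') * (A0 / A) powr (1 / (s - s')))"
  have lt: "1 / \<sigma> < 1 / \<sigma>'" using \<sigma> by (simp add: frac_less2)
  \<comment> \<open>Beyond \<open>X\<close> the higher power with rate \<open>\<rho>0\<close> beats
    the lower power with rate \<rho>; on \<open>\<bar>x\<bar> \<le> X\<close> the constant
    \<open>C3\<close> pays.\<close>
  define X where "X = (\<rho> / \<rho>0) powr (1 / (1 / \<sigma>' - 1 / \<sigma>))"
  define C3 where "C3 = exp (\<rho> * X powr (1 / \<sigma>))"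
  have K0: "K0 \<ge> 0" by (rule line_window_K_nonneg[OF win])
  have decay: "exp (- \<rho>0 * \<bar>x\<bar> powr (1 / \<sigma>')) \<le> C3 * exp (- \<rho> * \<bar>x\<bar> powr (1 / \<sigma>))" for x :: real
  proof (cases "\<bar>x\<bar> \<le> X")
    case True
    then have "\<rho> * \<bar>x\<bar> powr (1 / \<sigma>) \<le> \<rho> * X powr (1 / \<sigma>)" using A \<sigma> by (intro mult_left_mono powr_mono2) auto
    moreover have "\<rho>0 * \<bar>x\<bar> powr (1 / \<sigma>') \<ge> 0" using A0 by simp
    ultimately have "- \<rho>0 * \<bar>x\<bar> powr (1 / \<sigma>') \<le> \<rho> * X powr (1 / \<sigma>) + - \<rho> * \<bar>x\<bar> powr (1 / \<sigma>)" by linarith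
    then show ?thesis unfolding C3_def exp_add[symmetric] by simp
  next
    case False
    have X: "X > 0" unfolding X_def using A A0 by simp
    then have x: "\<bar>x\<bar> > 0" using False by simp
    have "\<rho> / \<rho>0 = X powr (1 / \<sigma>' - 1 / \<sigma>)" 
    proof -
      define \<delta> where "\<delta> = 1 / \<sigma>' - 1 / \<sigma>"
      have "\<delta> > 0" using lt by (simp add: \<delta>_def)
      then show ?thesis unfolding X_def \<delta>_def[symmetric] using A A0 by (simp add: powr_powr)
    qed
    also have "\<dots> \<le> \<bar>x\<bar> powr (1 / \<sigma>' - 1 / \<sigma>)" using False X lt by (intro powr_mono2) auto
    finally have "\<rho> \<le> \<rho>0 * \<bar>x\<bar> powr (1 / \<sigma>' - 1 / \<sigma>)" using A0 by (simp add: field_simps)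
    then have "\<rho> * \<bar>x\<bar> powr (1 / \<sigma>) \<le> \<rho>0 * \<bar>x\<bar> powr (1 / \<sigma>' - 1 / \<sigma>) * \<bar>x\<bar> powr (1 / \<sigma>)" by (intro mult_right_mono) auto
    also have "\<dots> = \<rho>0 * \<bar>x\<bar> powr (1 / \<sigma>')" using x by (simp add: mult.assoc flip: powr_add)
    finally have "exp (- \<rho>0 * \<bar>x\<bar> powr (1 / \<sigma>')) \<le> exp (- \<rho> * \<bar>x\<bar> powr (1 / \<sigma>))" by simp
    moreover have "1 \<le> C3" unfolding C3_def using A by simp
    ultimately show ?thesis by (meson exp_ge_zero mult_le_cancel_right1 order_trans not_le)
  qed
  have "line_window s \<sigma> A \<rho> (K0 * C1 * C2 * C3) \<psi>"
    unfolding line_window_def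
  proof (intro allI conjI)
    fix l n x
    note w = win[unfolded line_window_def, rule_format, of l n x]
    show "continuous_on UNIV (\<psi> l n)" "(\<psi> l n has_vector_derivative \<psi> l (Suc n) x) (at x)"
      "\<psi> (Suc l) 0 x = of_real x * \<psi> l 0 x" using w by auto
    have "cmod (\<psi> l n x) \<le> K0 * (A0 ^ l * A0 ^ n) * fact l powr \<sigma>' * fact n powr s' * exp (- \<rho>0 * \<bar>x\<bar> powr (1 / \<sigma>'))"
      using w by (auto simp: power_add)
    also have "\<dots> \<le> K0 * ((C1 * A ^ l * fact l powr (\<sigma> - \<sigma>')) * (C2 * A ^ n * fact n powr (s - s'))) * fact l powr \<sigma>' * fact n powr s' * (C3 * exp (- \<rho> * \<bar>x\<bar> powr (1 / \<sigma>)))"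
      unfolding C1_def C2_def using K0 A0 A \<sigma> s
      by (intro mult_mono mult_left_mono mult_right_mono power_fact_trade decay mult_nonneg_nonneg) auto
    also have "\<dots> = K0 * C1 * C2 * C3 * (A ^ l * A ^ n) * (fact l powr (\<sigma> - \<sigma>') * fact l powr \<sigma>') * (fact n powr (s - s') * fact n powr s') * exp (- \<rho> * \<bar>x\<bar> powr (1 / \<sigma>))"
      by (simp only: mult_ac)
    also have "\<dots> = K0 * C1 * C2 * C3 * A ^ (l + n) * fact l powr \<sigma> * fact n powr s * exp (- \<rho> * \<bar>x\<bar> powr (1 / \<sigma>))"
      by (simp add: power_add flip: powr_add)
    finally show "cmod (\<psi> l n x) \<le> K0 * C1 * C2 * C3 * A ^ (l + n) * fact l powr \<sigma> * fact n powr s * exp (- \<rho> * \<bar>x\<bar> powr (1 / \<sigma>))" .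
  qed
  then show ?thesis by blast
qed

text \<open>Multiplication by \<eta>_j affects the factor \<open>j\<close> and differentiation along
  \<open>i\<close> the factor \<open>i\<close>, so the geometric and factorial terms occur once and
  not once per coordinate. The loss in the decay rate comes from bounding the norm by its largest
  coordinate.\<close>

lemma window_product:
  fixes \<psi> :: "nat \<Rightarrow> nat \<Rightarrow> real \<Rightarrow> complex"
  assumes win: "line_window s \<sigma> A \<rho> K \<psi>" and \<sigma>: "\<sigma> > 0" and \<rho>: "\<rho> > 0"
  shows "window s \<sigma> A (\<rho> / real CARD('d) powr (1 / \<sigma>)) (K ^ CARD('d)) (\<lambda>\<eta>::real^'d::finite. \<Prod>k\<in>UNIV. \<psi> 0 0 (\<eta> $ k))"
  unfolding window_def
proof (intro allI)
  fix i j :: 'd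
  let ?l = "\<lambda>l k. if k = j then l else (0::nat)" and ?n = "\<lambda>n k. if k = i then n else (0::nat)"
  define \<Phi> where "\<Phi> l n \<eta> = (\<Prod>k\<in>UNIV. \<psi> (?l l k) (?n n k) (\<eta> $ k))" for l n and \<eta> :: "real^'d"
  note w = win[unfolded line_window_def, rule_format]
  have c\<psi>: "continuous_on UNIV (\<psi> l n)" for l n using w by blast
  show "\<exists>\<Phi>. \<Phi> 0 0 = (\<lambda>\<eta>. \<Prod>k\<in>UNIV. \<psi> 0 0 (\<eta> $ k)) \<and> (\<forall>l. \<Phi> (Suc l) 0 = (\<lambda>\<eta>. of_real (\<eta> $ j) * \<Phi> l 0 \<eta>)) \<and>
     (\<forall>l n. continuous_on UNIV (\<Phi> l n) \<and> has_dd (axis i 1) (\<Phi> l n) (\<Phi> l (Suc n)) \<and>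
       (\<forall>\<eta>. cmod (\<Phi> l n \<eta>) \<le> K ^ CARD('d) * A ^ (l + n) * fact l powr \<sigma> * fact n powr s * exp (- (\<rho> / real CARD('d) powr (1 / \<sigma>)) * norm \<eta> powr (1 / \<sigma>))))"
  proof (intro exI[of _ \<Phi>] conjI allI)
    show "\<Phi> 0 0 = (\<lambda>\<eta>. \<Prod>k\<in>UNIV. \<psi> 0 0 (\<eta> $ k))" by (simp add: \<Phi>_def fun_eq_iff cong: if_cong)
    fix l n
    show "\<Phi> (Suc l) 0 = (\<lambda>\<eta>. of_real (\<eta> $ j) * \<Phi> l 0 \<eta>)"
    proof
      fix \<eta>
      have "\<Phi> (Suc l) 0 \<eta> = \<psi> (Suc l) 0 (\<eta> $ j) * (\<Prod>k\<in>UNIV - {j}. \<psi> 0 0 (\<eta> $ k))"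
        unfolding \<Phi>_def by (subst prod.remove[of _ j]) (auto intro!: prod.cong)
      also have "\<psi> (Suc l) 0 (\<eta> $ j) = of_real (\<eta> $ j) * \<psi> l 0 (\<eta> $ j)" using w by blast
      also have "of_real (\<eta> $ j) * \<psi> l 0 (\<eta> $ j) * (\<Prod>k\<in>UNIV - {j}. \<psi> 0 0 (\<eta> $ k)) = of_real (\<eta> $ j) * \<Phi> l 0 \<eta>"
        unfolding \<Phi>_def by (subst prod.remove[of UNIV j]) (auto simp: mult.assoc intro!: prod.cong)
      finally show "\<Phi> (Suc l) 0 \<eta> = of_real (\<eta> $ j) * \<Phi> l 0 \<eta>" .
    qed
    show "continuous_on UNIV (\<Phi> l n)"
      unfolding \<Phi>_def by (intro continuous_on_prod continuous_on_compose2[OF c\<psi>] continuous_intros) auto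
    show "has_dd (axis i 1) (\<Phi> l n) (\<Phi> l (Suc n))"
      unfolding has_dd_def
    proof
      fix x :: "real^'d"
      define Q where "Q = (\<Prod>k\<in>UNIV - {i}. \<psi> (?l l k) 0 (x $ k))"
      have e: "\<Phi> l m (x + \<tau> *\<^sub>R axis i 1) = Q * \<psi> (?l l i) m (x $ i + \<tau>)" for m \<tau>
      proof -
        have "(x + \<tau> *\<^sub>R axis i 1) $ k = (if k = i then x $ i + \<tau> else x $ k)" for k by (simp add: axis_def)
        then have "\<Phi> l m (x + \<tau> *\<^sub>R axis i 1) = (\<Prod>k\<in>UNIV. \<psi> (?l l k) (?n m k) (if k = i then x $ i + \<tau> else x $ k))"
          unfolding \<Phi>_def by simp
        also have "\<dots> = \<psi> (?l l i) m (x $ i + \<tau>) * (\<Prod>k\<in>UNIV - {i}. \<psi> (?l l k) (?n m k) (if k = i then x $ i + \<tau> else x $ k))"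
          by (subst prod.remove[of _ i]) auto
        also have "(\<Prod>k\<in>UNIV - {i}. \<psi> (?l l k) (?n m k) (if k = i then x $ i + \<tau> else x $ k)) = Q"
          unfolding Q_def by (intro prod.cong) auto
        finally show ?thesis by (simp add: mult.commute)
      qed
      have "(\<psi> (?l l i) n has_vector_derivative \<psi> (?l l i) (Suc n) (x $ i)) (at (x $ i + 0))" using w by simp
      moreover have "((\<lambda>\<tau>. x $ i + \<tau>) has_vector_derivative 1) (at 0)" by (auto intro!: derivative_eq_intros)
      ultimately have "((\<psi> (?l l i) n) \<circ> (\<lambda>\<tau>. x $ i + \<tau>) has_vector_derivative 1 *\<^sub>R \<psi> (?l l i) (Suc n) (x $ i)) (at 0)"
        using vector_diff_chain_at by blast
      then have "((\<lambda>\<tau>. Q * \<psi> (?l l i) n (x $ i + \<tau>)) has_vector_derivative Q * \<psi> (?l l i) (Suc n) (x $ i)) (at 0)"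
        unfolding o_def by (intro has_vector_derivative_mult_right) simp
      then show "((\<lambda>\<tau>. \<Phi> l n (x + \<tau> *\<^sub>R axis i 1)) has_vector_derivative \<Phi> l (Suc n) x) (at 0)"
        unfolding e using e[of "Suc n" 0] by simp
    qed
    fix \<eta> :: "real^'d"
    have "cmod (\<Phi> l n \<eta>) = (\<Prod>k\<in>UNIV. cmod (\<psi> (?l l k) (?n n k) (\<eta> $ k)))"
      unfolding \<Phi>_def by (simp add: prod_norm)
    also have "\<dots> \<le> (\<Prod>k\<in>UNIV. K * A ^ (?l l k + ?n n k) * fact (?l l k) powr \<sigma> * fact (?n n k) powr s * exp (- \<rho> * \<bar>\<eta> $ k\<bar> powr (1 / \<sigma>)))"
      using w by (intro prod_mono conjI norm_ge_zero) blast
    also have "\<dots> = K ^ CARD('d) * A ^ (l + n) * fact l powr \<sigma> * fact n powr s * exp (- \<rho> * (\<Sum>k\<in>UNIV. \<bar>\<eta> $ k\<bar> powr (1 / \<sigma>)))"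
    proof -
      have "(\<Prod>k\<in>UNIV. A ^ (?l l k + ?n n k)) = A ^ (l + n)"
        unfolding power_sum[symmetric] by (simp add: sum.distrib)
      moreover have "(\<Prod>k\<in>UNIV. fact (?l l k) powr \<sigma>) = fact l powr \<sigma>"
      proof -
        have "(\<Prod>k\<in>UNIV. fact (?l l k) powr \<sigma>) = (\<Prod>k\<in>UNIV. if k = j then fact l powr \<sigma> else 1)" by (intro prod.cong) auto
        then show ?thesis by simp
      qed
      moreover have "(\<Prod>k\<in>UNIV. fact (?n n k) powr s) = fact n powr s"
      proof -
        have "(\<Prod>k\<in>UNIV. fact (?n n k) powr s) = (\<Prod>k\<in>UNIV. if k = i then fact n powr s else 1)" by (intro prod.cong) auto
        then show ?thesis by simp
      qed
      moreover have "(\<Prod>k\<in>UNIV. exp (- \<rho> * \<bar>\<eta> $ k\<bar> powr (1 / \<sigma>))) = exp (- \<rho> * (\<Sum>k\<in>UNIV. \<bar>\<eta> $ k\<bar> powr (1 / \<sigma>)))"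
        by (simp add: sum_distrib_left sum_negf flip: exp_sum)
      ultimately show ?thesis unfolding prod.distrib by simp
    qed
    also have "\<dots> \<le> K ^ CARD('d) * A ^ (l + n) * fact l powr \<sigma> * fact n powr s * exp (- (\<rho> / real CARD('d) powr (1 / \<sigma>)) * norm \<eta> powr (1 / \<sigma>))"
    proof (rule mult_left_mono)
      have "\<exists>k. norm \<eta> \<le> real CARD('d) * \<bar>\<eta> $ k\<bar>"
      proof (rule ccontr)
        assume "\<nexists>k. norm \<eta> \<le> real CARD('d) * \<bar>\<eta> $ k\<bar>"
        then have *: "\<bar>\<eta> $ k\<bar> < norm \<eta> / real CARD('d)" for k by (auto simp: not_le field_simps)
        have "(\<Sum>k\<in>UNIV. \<bar>\<eta> $ k\<bar>) < (\<Sum>k\<in>(UNIV::'d set). norm \<eta> / real CARD('d))"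
          by (intro sum_strict_mono *) auto
        then show False using norm_le_l1_cart[of \<eta>] by simp
      qed
      then obtain k where k: "norm \<eta> \<le> real CARD('d) * \<bar>\<eta> $ k\<bar>" ..
      have "norm \<eta> powr (1 / \<sigma>) \<le> (real CARD('d) * \<bar>\<eta> $ k\<bar>) powr (1 / \<sigma>)" using k \<sigma> by (intro powr_mono2) auto
      also have "\<dots> = real CARD('d) powr (1 / \<sigma>) * \<bar>\<eta> $ k\<bar> powr (1 / \<sigma>)" by (simp add: powr_mult)
      also have "\<dots> \<le> real CARD('d) powr (1 / \<sigma>) * (\<Sum>k\<in>UNIV. \<bar>\<eta> $ k\<bar> powr (1 / \<sigma>))"
        by (intro mult_left_mono member_le_sum) auto
      finally have "norm \<eta> powr (1 / \<sigma>) / real CARD('d) powr (1 / \<sigma>) \<le> (\<Sum>k\<in>UNIV. \<bar>\<eta> $ k\<bar> powr (1 / \<sigma>))"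
        by (simp add: divide_le_eq mult.commute)
      from mult_left_mono[OF this, of \<rho>] \<rho>
      show "exp (- \<rho> * (\<Sum>k\<in>UNIV. \<bar>\<eta> $ k\<bar> powr (1 / \<sigma>))) \<le> exp (- (\<rho> / real CARD('d) powr (1 / \<sigma>)) * norm \<eta> powr (1 / \<sigma>))" by simp
      \<comment> \<open>The sign of \<open>K * A\<close> is read off from the bound itself at
        \<open>l = 1\<close>, \<open>n = 0\<close>, \<open>x = 0\<close>.\<close>
      have "0 \<le> K * A ^ 1 * fact 1 powr \<sigma> * fact 0 powr s * exp (- \<rho> * \<bar>0\<bar> powr (1 / \<sigma>))"
        using w[of 1 0 0] norm_ge_zero[of "\<psi> 1 0 0"] by (metis add.right_neutral order_trans)
      then have "0 \<le> K * A" by simp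
      then have "0 \<le> K ^ CARD('d) * A ^ (l + n)"
        using line_window_K_nonneg[OF win] by (cases "K = 0") (auto simp: zero_le_mult_iff zero_power)
      then show "0 \<le> K ^ CARD('d) * A ^ (l + n) * fact l powr \<sigma> * fact n powr s" by simp
    qed
    finally show "cmod (\<Phi> l n \<eta>) \<le> K ^ CARD('d) * A ^ (l + n) * fact l powr \<sigma> * fact n powr s * exp (- (\<rho> / real CARD('d) powr (1 / \<sigma>)) * norm \<eta> powr (1 / \<sigma>))" .
  qed
qed

lemma line_window_integrable:
  assumes win: "line_window s \<sigma> A \<rho> K \<psi>" and "\<sigma> > 0" "\<rho> > 0"
  shows "integrable lborel (\<psi> 0 0)"
proof (rule integrable_bound)
  show "integrable lborel (\<lambda>x. K * exp (- \<rho> * \<bar>x\<bar> powr (1 / \<sigma>)))"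
    using assms by (intro integrable_mult_right integrable_exp_powr_real) auto
  show "\<psi> 0 0 \<in> borel_measurable borel"
    using win unfolding line_window_def by (intro borel_measurable_continuous_onI) blast
  show "cmod (\<psi> 0 0 x) \<le> K * exp (- \<rho> * \<bar>x\<bar> powr (1 / \<sigma>))" for x
    using win[unfolded line_window_def, rule_format, of 0 0 x] by simp
qed

theorem window_exists:
  fixes s \<sigma> :: real
  assumes s: "s > 0" "\<sigma> > 0" "s + \<sigma> \<ge> 1"
  shows "\<exists>\<phi> :: real^'d::finite \<Rightarrow> complex. (LINT \<eta>|lborel. \<phi> \<eta>) = 1 \<and>
    (\<exists>A>0. \<exists>\<rho>>0. \<exists>K. window s \<sigma> A \<rho> K \<phi>) \<and>
    (s + \<sigma> > 1 \<longrightarrow> (\<forall>A>0. \<forall>\<rho>>0. \<exists>K. window s \<sigma> A \<rho> K \<phi>))"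
proof -
  \<comment> \<open>Dividing both indices by \<open>s + \<sigma>\<close> lands on the critical line;
    the results are at most the given indices, and strictly smaller if
    \<open>s + \<sigma> > 1\<close>.\<close>
  define \<sigma>' where "\<sigma>' = \<sigma> / (s + \<sigma>)"
  have \<sigma>': "0 < \<sigma>'" "\<sigma>' < 1" "1 - \<sigma>' = s / (s + \<sigma>)" using s by (simp_all add: \<sigma>'_def field_simps)
  have le: "\<sigma>' \<le> \<sigma>" "1 - \<sigma>' \<le> s" unfolding \<sigma>'(3) using s by (simp_all add: \<sigma>'_def divide_le_eq mult_le_cancel_left1)
  have lt: "\<sigma>' < \<sigma>" "1 - \<sigma>' < s" if "s + \<sigma> > 1" unfolding \<sigma>'(3) using s that by (simp_all add: \<sigma>'_def divide_less_eq)
  obtain \<psi> A \<rho> K where \<psi>: "A > 0" "\<rho> > 0" "line_window (1 - \<sigma>') \<sigma>' A \<rho> K \<psi>" "(LINT x|lborel. \<psi> 0 0 x) = 1"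
    using line_window_exists[OF \<sigma>'(1,2)] by blast
  define \<phi> where "\<phi> \<eta> = (\<Prod>k\<in>UNIV. \<psi> 0 0 (\<eta> $ k))" for \<eta> :: "real^'d"
  have d: "real CARD('d) powr (1 / \<sigma>) > 0" by simp
  have "(LINT \<eta>|lborel. \<phi> \<eta>) = 1"
    unfolding \<phi>_def by (subst integral_vec_prod) (use line_window_integrable[OF \<psi>(3) \<sigma>'(1) \<psi>(2)] \<psi>(4) in auto)
  moreover have "\<exists>A>0. \<exists>\<rho>>0. \<exists>K. window s \<sigma> A \<rho> K \<phi>"
  proof (rule exI[of _ A], rule conjI[OF \<psi>(1)], rule exI[of _ "\<rho> / real CARD('d) powr (1 / \<sigma>)"], rule conjI)
    show "\<rho> / real CARD('d) powr (1 / \<sigma>) > 0" using \<psi>(2) d by simp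
    show "\<exists>K. window s \<sigma> A (\<rho> / real CARD('d) powr (1 / \<sigma>)) K \<phi>"
      using window_product[OF line_window_weaken[OF \<psi>(3) \<sigma>'(1) le \<psi>(1,2)] s(2) \<psi>(2), where 'd='d]
      unfolding \<phi>_def by blast
  qed
  moreover have "\<exists>K. window s \<sigma> A' \<rho>' K \<phi>" if lts: "s + \<sigma> > 1" "A' > 0" "\<rho>' > 0" for A' \<rho>'
  proof -
    have "\<rho>' * real CARD('d) powr (1 / \<sigma>) > 0" using lts d by simp
    then obtain K' where "line_window s \<sigma> A' (\<rho>' * real CARD('d) powr (1 / \<sigma>)) K' \<psi>"
      using line_window_strict[OF \<psi>(3) \<sigma>'(1) lt[OF lts(1)] \<psi>(1,2) lts(2)] by blast
    from window_product[OF this s(2), where 'd='d] lts d show ?thesis unfolding \<phi>_def by auto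
  qed
  ultimately show ?thesis by blast
qed

section \<open>Wigner distributions\<close>

definition Wk :: "real \<Rightarrow> (real^'d::finite \<Rightarrow> complex) \<Rightarrow> (real^'d \<Rightarrow> complex) \<Rightarrow> real^'d \<Rightarrow> real^'d \<Rightarrow> complex" where
  "Wk \<tau> f g x y = f (x + \<tau> *\<^sub>R y) * cnj (g (x - (1 - \<tau>) *\<^sub>R y))"

lemma wigner_eq: "wigner \<tau> f g (x, \<xi>) = of_real ((2 * pi) powr (- (real CARD('d) / 2))) * (LINT y|lborel. Wk \<tau> f g x y * kern y \<xi>)"
  for f g :: "real^'d::finite \<Rightarrow> complex"
  unfolding wigner_def Wk_def by simp

definition wigner_bounds :: "real \<Rightarrow> real \<Rightarrow> real \<Rightarrow> real \<Rightarrow> real \<Rightarrow> (real^'d::finite \<Rightarrow> complex) \<Rightarrow> (real^'d \<Rightarrow> complex) \<Rightarrow> bool" where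
  "wigner_bounds s \<sigma> L \<rho> K f g \<longleftrightarrow> continuous_on UNIV f \<and> continuous_on UNIV g \<and> (\<forall>\<tau> x y. \<bar>\<tau>\<bar> \<le> L \<longrightarrow>
     cmod (Wk \<tau> f g x y) \<le> K * exp (- \<rho> * norm x powr (1 / s)) * exp (- \<rho> * norm y powr (1 / s)) \<and>
     cmod (wigner \<tau> f g (x, y)) \<le> K * exp (- \<rho> * norm x powr (1 / s)) * exp (- \<rho> * norm y powr (1 / \<sigma>)))"

text \<open>The part of the Gelfand-Shilov estimates needed for Wigner distributions: pure
  derivatives along one axis, with the bounds for all powers of \<open>x\<close> already optimised
  into exponential decay.\<close>

definition gs_decay :: "real \<Rightarrow> real \<Rightarrow> real \<Rightarrow> real \<Rightarrow> (real^'d::finite \<Rightarrow> complex) \<Rightarrow> bool" where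
  "gs_decay s \<sigma> h C f \<longleftrightarrow> smooth f \<and> (\<forall>j n x. cmod ((dir_deriv (axis j 1) ^^ n) f x) \<le>
     C * h ^ n * fact n powr \<sigma> * exp (- rate CARD('d) s h * norm x powr (1 / s)))"

lemma gs_decay_C_nonneg:
  fixes f :: "real^'d::finite \<Rightarrow> complex"
  assumes "gs_decay s \<sigma> h C f" shows "C \<ge> 0"
proof -
  have "cmod (f 0) \<le> C * exp (- rate CARD('d) s h * norm (0::real^'d) powr (1 / s))"
    using assms[unfolded gs_decay_def, THEN conjunct2, rule_format, of 0 undefined 0] by simp
  then have "0 \<le> C * exp (- rate CARD('d) s h * norm (0::real^'d) powr (1 / s))"
    using norm_ge_zero order_trans by blast
  then show ?thesis by (simp add: zero_le_mult_iff)
qed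

lemma gs_decay_mono: "gs_decay s \<sigma> h C f \<Longrightarrow> C \<le> C' \<Longrightarrow> h > 0 \<Longrightarrow> gs_decay s \<sigma> h C' f"
  unfolding gs_decay_def by (meson mult_right_mono order_trans zero_le_power less_imp_le powr_ge_zero exp_ge_zero)

lemma axis_Basis: "axis j (1::real) \<in> Basis"
  by (simp add: axis_in_Basis_iff)

lemma has_dd_line_map:
  fixes f :: "real^'d::finite \<Rightarrow> complex"
  assumes "smooth f"
  shows "has_dd (axis j 1) (\<lambda>y. f (x + c *\<^sub>R y)) (\<lambda>y. of_real c * dir_deriv (axis j 1) f (x + c *\<^sub>R y))"
proof -
  have "has_dd (axis j 1) (\<lambda>y. f (x + c *\<^sub>R y)) (\<lambda>y. c *\<^sub>R dir_deriv (axis j 1) f (x + c *\<^sub>R y))"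
    by (rule has_dd_scale[OF smooth_has_dd[OF assms axis_Basis[of j]], of "\<lambda>y. x + c *\<^sub>R y"])
      (auto simp: scaleR_add_right mult.commute)
  then show ?thesis by (simp add: scaleR_conv_of_real)
qed

text \<open>The arguments a = x + \<tau> y and b = x - (1 - \<tau>) y determine x = (1 - \<tau>) a +
  \<tau> b and y = a - b with coefficients bounded for bounded \<tau>, so decay in \<open>a\<close>
  and \<open>b\<close> is decay in \<open>x\<close> and \<open>y\<close>. Decay in the frequency is
  \<open>fourier_decay\<close> in \<open>y\<close>. Uniformity over \<bar>\<tau>\<bar> \<le> L
  serves the average over \<tau>.\<close>

lemma wigner_decay:
  fixes f g :: "real^'d::finite \<Rightarrow> complex"
  assumes s: "s > 0" "\<sigma> > 0" and h: "h > 0" and L: "L \<ge> 1" and f: "gs_decay s \<sigma> h C f" and g: "gs_decay s \<sigma> h C g"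
  defines "\<rho> \<equiv> min (rate CARD('d) s h / (2 * (2 + 2 * L) powr (1 / s))) (rate CARD('d) \<sigma> (2 * ((1 + L) * h)))"
  shows "\<exists>K\<ge>0. wigner_bounds s \<sigma> L \<rho> K f g"
proof -
  define R where "R = rate CARD('d) s h"
  have R: "R > 0" unfolding R_def using h by (intro rate_pos) auto
  define \<rho>1 where "\<rho>1 = R / (2 * (2 + 2 * L) powr (1 / s))"
  define \<rho>2 where "\<rho>2 = rate CARD('d) \<sigma> (2 * ((1 + L) * h))"
  have \<rho>: "\<rho> \<le> \<rho>1" "\<rho> \<le> \<rho>2" unfolding \<rho>_def \<rho>1_def \<rho>2_def R_def by auto
  have \<rho>1: "\<rho>1 > 0" unfolding \<rho>1_def using R L by simp
  have C: "C \<ge> 0" by (rule gs_decay_C_nonneg[OF f])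
  have sm: "smooth f" "smooth g" using f g by (auto simp: gs_decay_def)
  define c where "c = (2 * pi) powr (- (real CARD('d) / 2))"
  define \<Omega> where "\<Omega> = (LINT y|lborel. exp (- \<rho>1 * norm (y::real^'d) powr (1 / s)))"
  have \<Omega>: "\<Omega> \<ge> 0" by (simp add: \<Omega>_def)
  have intw: "integrable lborel (\<lambda>y::real^'d. exp (- \<rho>1 * norm y powr (1 / s)))"
    using \<rho>1 s by (intro integrable_exp_powr) auto
  define K where "K = max (C * C) (c * (exp 1 * (C * C * \<Omega>)))"
  \<comment> \<open>Both \<open>norm x\<close> and \<open>norm y\<close> are at most
    \<open>2 + 2 * L\<close> times the larger of \<open>norm a\<close> and \<open>norm b\<close>;
    the further factor 2 in \<open>\<rho>1\<close> shares one rate between the two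
    exponentials.\<close>
  have decay: "exp (- R * norm (x + \<tau> *\<^sub>R y) powr (1 / s)) * exp (- R * norm (x - (1 - \<tau>) *\<^sub>R y) powr (1 / s)) \<le>
     exp (- \<rho>1 * norm x powr (1 / s)) * exp (- \<rho>1 * norm y powr (1 / s))" if \<tau>: "\<bar>\<tau>\<bar> \<le> L" for \<tau> and x y :: "real^'d"
  proof -
    define a b where "a = x + \<tau> *\<^sub>R y" and "b = x - (1 - \<tau>) *\<^sub>R y"
    define m where "m = max (norm a) (norm b)"
    have m0: "m \<ge> 0" by (simp add: m_def max.coboundedI1)
    have x: "x = (1 - \<tau>) *\<^sub>R a + \<tau> *\<^sub>R b" by (simp add: a_def b_def algebra_simps)
    have y: "y = a - b" by (simp add: a_def b_def algebra_simps)
    have "norm x \<le> \<bar>1 - \<tau>\<bar> * norm a + \<bar>\<tau>\<bar> * norm b" unfolding x by (rule order_trans[OF norm_triangle_ineq]) simp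
    also have "\<dots> \<le> (1 + L) * m + L * m"
      using \<tau> m0 by (intro add_mono mult_mono) (auto simp: m_def)
    also have "\<dots> \<le> (2 + 2 * L) * m" using m0 by (simp add: algebra_simps)
    finally have nx: "norm x powr (1 / s) \<le> ((2 + 2 * L) * m) powr (1 / s)" using s by (intro powr_mono2) auto
    have "norm y \<le> norm a + norm b" unfolding y by (rule norm_triangle_ineq4)
    also have "\<dots> \<le> 2 * m" by (simp add: m_def)
    also have "\<dots> \<le> (2 + 2 * L) * m" using m0 L by (intro mult_right_mono) auto
    finally have ny: "norm y powr (1 / s) \<le> ((2 + 2 * L) * m) powr (1 / s)" using s by (intro powr_mono2) auto
    have "norm x powr (1 / s) + norm y powr (1 / s) \<le> 2 * ((2 + 2 * L) * m) powr (1 / s)" using nx ny by simp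
    also have "\<dots> = 2 * (2 + 2 * L) powr (1 / s) * m powr (1 / s)" using L m0 by (simp add: powr_mult)
    also have "m powr (1 / s) \<le> norm a powr (1 / s) + norm b powr (1 / s)" by (simp add: m_def max_def)
    finally have "norm x powr (1 / s) + norm y powr (1 / s) \<le> 2 * (2 + 2 * L) powr (1 / s) * (norm a powr (1 / s) + norm b powr (1 / s))"
      using L by (simp add: mult_left_mono)
    then have "\<rho>1 * (norm x powr (1 / s) + norm y powr (1 / s)) \<le> \<rho>1 * (2 * (2 + 2 * L) powr (1 / s) * (norm a powr (1 / s) + norm b powr (1 / s)))"
      using \<rho>1 by (intro mult_left_mono) auto
    also have "\<dots> = R * (norm a powr (1 / s) + norm b powr (1 / s))" unfolding \<rho>1_def using L by simp
    finally show ?thesis unfolding exp_add[symmetric] a_def b_def by (simp add: algebra_simps)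
  qed
  \<comment> \<open>Each derivative in \<open>y\<close> brings out \<tau> or
    \<open>- (1 - \<tau>)\<close>, both of modulus at most \<open>1 + L\<close>; hence the scale
    \<open>(1 + L) * h\<close>.\<close>
  have prod: "cmod (of_real \<tau> ^ n * (dir_deriv (axis j 1) ^^ n) f (x + \<tau> *\<^sub>R y) *
      (of_real (- (1 - \<tau>)) ^ m * cnj ((dir_deriv (axis j 1) ^^ m) g (x + (- (1 - \<tau>)) *\<^sub>R y)))) \<le>
      (C * C * exp (- \<rho>1 * norm x powr (1 / s))) * ((1 + L) * h) ^ (n + m) * fact n powr \<sigma> * fact m powr \<sigma> * exp (- \<rho>1 * norm y powr (1 / s))"
    if \<tau>: "\<bar>\<tau>\<bar> \<le> L" for \<tau> j n m and x y :: "real^'d"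
  proof -
    let ?a = "x + \<tau> *\<^sub>R y" and ?b = "x - (1 - \<tau>) *\<^sub>R y"
    have "cmod (of_real \<tau> ^ n * (dir_deriv (axis j 1) ^^ n) f ?a *
      (of_real (- (1 - \<tau>)) ^ m * cnj ((dir_deriv (axis j 1) ^^ m) g (x + (- (1 - \<tau>)) *\<^sub>R y)))) =
      \<bar>\<tau>\<bar> ^ n * cmod ((dir_deriv (axis j 1) ^^ n) f ?a) * (\<bar>1 - \<tau>\<bar> ^ m * cmod ((dir_deriv (axis j 1) ^^ m) g ?b))"
      unfolding norm_mult norm_power norm_of_real complex_mod_cnj abs_minus_cancel scaleR_minus_left diff_conv_add_uminus[symmetric] ..
    also have "\<dots> \<le> (1 + L) ^ n * (C * h ^ n * fact n powr \<sigma> * exp (- R * norm ?a powr (1 / s))) *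
        ((1 + L) ^ m * (C * h ^ m * fact m powr \<sigma> * exp (- R * norm ?b powr (1 / s))))"
      using \<tau> f g C h unfolding gs_decay_def R_def
      by (intro mult_mono power_mono mult_nonneg_nonneg) auto
    also have "\<dots> = C * C * ((1 + L) ^ n * h ^ n * ((1 + L) ^ m * h ^ m)) * fact n powr \<sigma> * fact m powr \<sigma> *
        (exp (- R * norm ?a powr (1 / s)) * exp (- R * norm ?b powr (1 / s)))"
      by (simp only: mult_ac)
    also have "\<dots> \<le> C * C * ((1 + L) ^ n * h ^ n * ((1 + L) ^ m * h ^ m)) * fact n powr \<sigma> * fact m powr \<sigma> *
        (exp (- \<rho>1 * norm x powr (1 / s)) * exp (- \<rho>1 * norm y powr (1 / s)))"
      using C h L by (intro mult_left_mono decay \<tau>) auto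
    also have "\<dots> = (C * C * exp (- \<rho>1 * norm x powr (1 / s))) * ((1 + L) * h) ^ (n + m) * fact n powr \<sigma> * fact m powr \<sigma> * exp (- \<rho>1 * norm y powr (1 / s))"
      by (simp only: power_mult_distrib power_add mult_ac)
    finally show ?thesis .
  qed
  have shift: "x - (1 - \<tau>) *\<^sub>R y = x + (\<tau> - 1) *\<^sub>R y" for \<tau> and x y :: "real^'d"
    by (simp add: algebra_simps)
  have weaken: "exp (- \<rho>' * norm z powr q) \<le> exp (- \<rho> * norm z powr q)" if "\<rho> \<le> \<rho>'" for \<rho>' q and z :: "real^'d"
    using that by (simp add: mult_right_mono)
  have "wigner_bounds s \<sigma> L \<rho> K f g"
    unfolding wigner_bounds_def
  proof (intro conjI allI impI)
    show "continuous_on UNIV f" "continuous_on UNIV g" by (intro smooth_continuous sm)+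
    fix \<tau> and x y :: "real^'d" assume \<tau>: "\<bar>\<tau>\<bar> \<le> L"
    have "cmod (Wk \<tau> f g x y) \<le> (C * C * exp (- \<rho>1 * norm x powr (1 / s))) * exp (- \<rho>1 * norm y powr (1 / s))"
      using prod[OF \<tau>, where n=0 and m=0 and x=x and y=y] unfolding Wk_def shift by simp
    also have "\<dots> \<le> (K * exp (- \<rho> * norm x powr (1 / s))) * exp (- \<rho> * norm y powr (1 / s))"
      using C by (intro mult_mono weaken \<rho> mult_nonneg_nonneg) (auto simp: K_def max.coboundedI1)
    finally show "cmod (Wk \<tau> f g x y) \<le> K * exp (- \<rho> * norm x powr (1 / s)) * exp (- \<rho> * norm y powr (1 / s))" .
    have main: "\<bar>y $ j\<bar> ^ k * cmod (LINT z|lborel. Wk \<tau> f g x z * kern y z) \<le> ((C * C * exp (- \<rho>1 * norm x powr (1 / s))) * \<Omega>) * (2 * ((1 + L) * h)) ^ k * fact k powr \<sigma>" for j k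
    proof -
      define F where "F n z = of_real \<tau> ^ n * (dir_deriv (axis j 1) ^^ n) f (x + \<tau> *\<^sub>R z)" for n z
      define G where "G m z = of_real (- (1 - \<tau>)) ^ m * cnj ((dir_deriv (axis j 1) ^^ m) g (x + (- (1 - \<tau>)) *\<^sub>R z))" for m z
      have smD: "smooth ((dir_deriv (axis j 1) ^^ n) f)" "smooth ((dir_deriv (axis j 1) ^^ n) g)" for n
        by (intro smooth_funpow sm axis_Basis)+
      have F: "has_dd (axis j 1) (F n) (F (Suc n))" "continuous_on UNIV (F n)" for n
        using has_dd_cmult[OF has_dd_line_map[OF smD(1)[of n], of j x \<tau>], of "of_real \<tau> ^ n"]
        unfolding F_def by (auto simp: mult_ac intro!: continuous_intros continuous_on_smooth_comp[OF smD(1)])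
      have G: "has_dd (axis j 1) (G n) (G (Suc n))" "continuous_on UNIV (G n)" for n
        using has_dd_cmult[OF has_dd_cnj[OF has_dd_line_map[OF smD(2)[of n], of j x "- (1 - \<tau>)"]], of "of_real (- (1 - \<tau>)) ^ n"]
        unfolding G_def by (auto simp: mult_ac intro!: continuous_intros continuous_on_smooth_comp[OF smD(2)])
      have FG: "cmod (F n z * G m z) \<le> (C * C * exp (- \<rho>1 * norm x powr (1 / s))) * ((1 + L) * h) ^ (n + m) * fact n powr \<sigma> * fact m powr \<sigma> * exp (- \<rho>1 * norm z powr (1 / s))" for n m z
        unfolding F_def G_def by (rule prod[OF \<tau>])
      have "\<bar>y $ j\<bar> ^ k * cmod (LINT z|lborel. F 0 z * G 0 z * kern y z) \<le> ((C * C * exp (- \<rho>1 * norm x powr (1 / s))) * \<Omega>) * (2 * ((1 + L) * h)) ^ k * fact k powr \<sigma>"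
        unfolding \<Omega>_def
        by (rule fourier_decay[OF F(1) F(2) G(1) G(2) FG intw]) (use C h L s in auto)
      then show ?thesis unfolding F_def G_def Wk_def shift by simp
    qed
    have kc: "kern y z = kern z y" for z by (simp add: inner_commute)
    have "cmod (LINT z|lborel. Wk \<tau> f g x z * kern y z) \<le> exp 1 * ((C * C * exp (- \<rho>1 * norm x powr (1 / s))) * \<Omega>) * exp (- \<rho>2 * norm y powr (1 / \<sigma>))"
      unfolding \<rho>2_def by (rule coordinate_decay[OF main]) (use h L s C \<Omega> in auto)
    then have "cmod (wigner \<tau> f g (x, y)) \<le> c * (exp 1 * ((C * C * exp (- \<rho>1 * norm x powr (1 / s))) * \<Omega>) * exp (- \<rho>2 * norm y powr (1 / \<sigma>)))"
      unfolding wigner_eq norm_mult kc c_def by (simp add: mult_left_mono)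
    also have "\<dots> = c * (exp 1 * (C * C * \<Omega>)) * exp (- \<rho>1 * norm x powr (1 / s)) * exp (- \<rho>2 * norm y powr (1 / \<sigma>))"
      by (simp only: mult_ac)
    also have "\<dots> \<le> K * exp (- \<rho> * norm x powr (1 / s)) * exp (- \<rho> * norm y powr (1 / \<sigma>))"
      using C \<Omega> by (intro mult_mono weaken \<rho> mult_nonneg_nonneg) (auto simp: K_def c_def max.coboundedI1)
    finally show "cmod (wigner \<tau> f g (x, y)) \<le> K * exp (- \<rho> * norm x powr (1 / s)) * exp (- \<rho> * norm y powr (1 / \<sigma>))" .
  qed
  moreover have "K \<ge> 0" using C by (simp add: K_def max.coboundedI1)
  ultimately show ?thesis by blast
qed

lemma continuous_on_Wk:
  fixes f g :: "real^'d::finite \<Rightarrow> complex"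
  assumes "continuous_on UNIV f" "continuous_on UNIV g" "continuous_on S \<tau>" "continuous_on S x" "continuous_on S y"
  shows "continuous_on S (\<lambda>q. Wk (\<tau> q) f g (x q) (y q))"
  unfolding Wk_def
  by (intro continuous_intros assms continuous_on_compose2[OF assms(1)] continuous_on_compose2[OF assms(2)]) auto

lemma wigner_measurable:
  fixes f g :: "real^'d::finite \<Rightarrow> complex" and x :: "'q::euclidean_space \<Rightarrow> real^'d"
  assumes "continuous_on UNIV f" "continuous_on UNIV g" "continuous_on UNIV \<tau>" "continuous_on UNIV x" "continuous_on UNIV \<xi>"
  shows "(\<lambda>q. wigner (\<tau> q) f g (x q, \<xi> q)) \<in> borel_measurable borel"
proof -
  have comp: "continuous_on UNIV (\<lambda>q::'q \<times> (real^'d). h (fst q))" if "continuous_on UNIV h" for h :: "'q \<Rightarrow> 'b::topological_space"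
    by (rule continuous_on_compose2[OF that]) (auto intro: continuous_intros)
  show ?thesis
    unfolding wigner_eq
    by (intro borel_measurable_times borel_measurable_const borel_measurable_LINT borel_measurable_continuous_onI
        continuous_on_mult continuous_on_Wk continuous_on_kern comp assms continuous_on_snd continuous_on_id)
qed

section \<open>Transfer of the multiplier to the Wigner distribution\<close>

lemma inn_translate: "inn \<phi> (\<lambda>z. a ((x, \<xi>) + z)) p w y = inn \<phi> a (x + p) (\<xi> + w) y"
  unfolding inn_def by (simp add: add.assoc)

lemma inn_measurable':
  fixes a :: "(real^'d::finite) \<times> (real^'d) \<Rightarrow> complex" and p :: "'q::euclidean_space \<Rightarrow> real^'d"
  assumes "continuous_on UNIV a" "continuous_on UNIV \<phi>" "continuous_on UNIV p" "continuous_on UNIV w" "continuous_on UNIV y"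
  shows "(\<lambda>q. inn \<phi> a (p q) (w q) (y q)) \<in> borel_measurable borel"
  using inn_measurable[OF assms(1,2) continuous_on_const assms(3,4,5), of 0] by simp

text \<open>Trades decay around \<xi> for slower decay around 0 and growth in \<xi>, so that
  majorants in Fubini arguments become products.\<close>

lemma exp_decay_shift:
  fixes w \<xi> :: "'a::real_normed_vector"
  assumes q: "q > 0" and \<epsilon>: "\<epsilon> \<ge> 0"
  shows "exp (- \<epsilon> * norm (w - \<xi>) powr q) \<le> exp (\<epsilon> * norm \<xi> powr q) * exp (- (\<epsilon> / 2 powr q) * norm w powr q)"
proof -
  have "norm w powr q \<le> 2 powr q * (norm (w - \<xi>) powr q + norm \<xi> powr q)"
    using powr_norm_add[OF q, of "w - \<xi>" \<xi>] by simp
  then have "(\<epsilon> / 2 powr q) * norm w powr q \<le> (\<epsilon> / 2 powr q) * (2 powr q * (norm (w - \<xi>) powr q + norm \<xi> powr q))"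
    using \<epsilon> by (intro mult_left_mono) auto
  also have "\<dots> = \<epsilon> * norm (w - \<xi>) powr q + \<epsilon> * norm \<xi> powr q" by (simp add: distrib_left)
  finally show ?thesis unfolding exp_add[symmetric] by simp
qed

lemma integrable_exp_powr_prod:
  fixes e1 e2 p q :: real
  assumes "e1 > 0" "e2 > 0" "p > 0" "q > 0"
  shows "integrable lborel (\<lambda>X::(real^'a::finite) \<times> (real^'b::finite). exp (- e1 * norm (fst X) powr p) * exp (- e2 * norm (snd X) powr q))"
proof -
  let ?f = "\<lambda>x::real^'a. exp (- e1 * norm x powr p)" and ?g = "\<lambda>y::real^'b. exp (- e2 * norm y powr q)"
  have "integrable lborel (\<lambda>X. complex_of_real (?f (fst X)) * complex_of_real (?g (snd X)))"
  proof (rule fubini_dominated(1)[of "\<lambda>x y. complex_of_real (?f x) * complex_of_real (?g y)" ?f ?g])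
    show "(\<lambda>z. complex_of_real (?f (fst z)) * complex_of_real (?g (snd z))) \<in> borel_measurable (borel :: ((real^'a) \<times> (real^'b)) measure)"
    proof -
      have f: "(\<lambda>x. complex_of_real (?f x)) \<in> borel_measurable borel" and g: "(\<lambda>y. complex_of_real (?g y)) \<in> borel_measurable borel"
        by measurable
      show ?thesis
        by (intro borel_measurable_times measurable_compose[OF _ f] measurable_compose[OF _ g] borel_measurable_continuous_onI
            continuous_on_fst continuous_on_snd continuous_on_id)
    qed
  qed (simp_all only: norm_mult norm_of_real abs_exp_cancel order_refl integrable_exp_powr assms)
  then have "integrable lborel (\<lambda>X. Re (complex_of_real (?f (fst X)) * complex_of_real (?g (snd X))))"
    by (rule integrable_Re)
  then show ?thesis by simp
qed

text \<open>The window makes every integral absolutely convergent for fixed \<open>w\<close>, so Fubini reduces the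
  claim to Fourier inversion for \<open>y \<mapsto> Wk t g f x y\<close>, and \<open>w\<close> is integrated out at the end.\<close>

lemma osc_duality:
  fixes a :: "(real^'d::finite) \<times> (real^'d) \<Rightarrow> complex" and \<phi> g f :: "real^'d \<Rightarrow> complex"
  assumes s: "s > 0" "\<sigma> > 0" and win: "window s \<sigma> A \<rho>w Kw \<phi>" and \<phi>1: "(LINT \<eta>|lborel. \<phi> \<eta>) = 1"
    and gap: "gap CARD('d) s \<sigma> \<Lambda> A \<rho>w H (r * cst s \<sigma>)" and \<mu>: "\<bar>\<mu>\<bar> \<le> \<Lambda>"
    and a: "symb_bound s \<sigma> H r M a" and H: "H > 0" "r > 0"
    and wigner_bounds: "wigner_bounds s \<sigma> \<Lambda> \<rho> K g f" and \<rho>: "\<rho> > 0" "r * cst s \<sigma> \<le> \<rho> / 4"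
    and t: "\<bar>t\<bar> \<le> \<Lambda>" "\<bar>t + \<mu>\<bar> \<le> \<Lambda>"
  shows "(LINT X|lborel. osc \<mu> \<phi> (\<lambda>z. a (X + z)) * cnj (wigner t g f X)) = (LINT X|lborel. a X * cnj (wigner (t + \<mu>) g f X))"
proof -
  define rc where "rc = r * cst s \<sigma>"
  define c where "c = (2 * pi) powr (- (real CARD('d) / 2))"
  define cd where "cd = inverse ((2 * pi) ^ CARD('d))"
  have c0: "c > 0" by (simp add: c_def)
  have cd: "complex_of_real cd * of_real ((2 * pi) ^ CARD('d)) = 1"
  proof -
    have "cd * (2 * pi) ^ CARD('d) = 1" unfolding cd_def by (rule left_inverse) simp
    then show ?thesis by (simp only: of_real_mult[symmetric] of_real_1)
  qed
  have cst1: "cst s \<sigma> \<ge> 1" by (rule cst_ge1[OF s])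
  have rc: "rc > 0" "rc \<le> \<rho> / 4" "r \<le> rc" using H \<rho> cst1 by (simp_all add: rc_def)
  have gp: "A > 0" "\<rho>w > 0" "\<Lambda> \<ge> 1" "rc * cst s \<sigma> \<le> \<rho>w / 2" using gap by (auto simp: gap_def rc_def)
  define R1 where "R1 = rate CARD('d) s (2 * max H A)"
  define R2 where "R2 = rate CARD('d) \<sigma> ((\<Lambda> + 1) * max H A)"
  have R: "R1 > 0" "R2 > 0" unfolding R1_def R2_def using gp by (intro rate_pos; simp add: less_max_iff_disj)+
  have M: "M \<ge> 0" by (rule symb_bound_M_nonneg[OF a])
  have Kw: "Kw \<ge> 0" by (rule window_bounds(2)[OF win])
  have sa: "smooth a" using a by (simp add: symb_bound_def)
  have ca: "continuous_on UNIV a" by (rule smooth_continuous[OF sa])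
  have c\<phi>: "continuous_on UNIV \<phi>" by (rule window_bounds(1)[OF win])
  have cg: "continuous_on UNIV g" "continuous_on UNIV f" using wigner_bounds by (auto simp: wigner_bounds_def)
  define p q where "p = 1 / s" and "q = 1 / \<sigma>"
  have pq: "p > 0" "q > 0" using s by (auto simp: p_def q_def)
  define E where "E \<epsilon> b x = exp (- \<epsilon> * norm (x::real^'d) powr b)" for \<epsilon> b x
  have intE: "integrable lborel (E \<epsilon> b)" if "\<epsilon> > 0" "b > 0" for \<epsilon> b
    unfolding E_def[abs_def] by (rule integrable_exp_powr[OF that])
  have E0: "E \<epsilon> b x > 0" "E \<epsilon> b x \<ge> 0" for \<epsilon> b x by (simp_all add: E_def)
  have W\<^sub>k: "cmod (Wk \<tau> g f x y) \<le> K * E \<rho> p x * E \<rho> p y" and W\<^sub>w: "cmod (wigner \<tau> g f (x, \<xi>)) \<le> K * E \<rho> p x * E \<rho> q \<xi>"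
    if "\<bar>\<tau>\<bar> \<le> \<Lambda>" for \<tau> x y \<xi>
    using wigner_bounds that unfolding wigner_bounds_def p_def q_def E_def by auto
  have K: "K \<ge> 0"
  proof -
    have "0 \<le> K * E \<rho> p 0 * E \<rho> p 0" using W\<^sub>k[OF t(1), of 0 0] norm_ge_zero order_trans by blast
    then show ?thesis using E0(1)[of \<rho> p 0] by (simp add: zero_le_mult_iff)
  qed
  have slice_bound: "slice_bound s \<sigma> H rc (M * weight s \<sigma> rc X) (\<lambda>z. a (X + z))" for X
    unfolding rc_def by (rule slice_bound_translate[OF s a H])
  note gap' = gap[folded rc_def]
  have wtE: "weight s \<sigma> e (x, \<xi>) = E (- e) p x * E (- e) q \<xi>" for e x \<xi>
    unfolding weight_def E_def p_def q_def exp_add[symmetric] by (simp add: distrib_left)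
  have EE: "E e1 b x * E e2 b x = E (e1 + e2) b x" for e1 e2 b x
    unfolding E_def exp_add[symmetric] by (simp add: algebra_simps)
  have Emono: "E e1 b x \<le> E e2 b x" if "e2 \<le> e1" for e1 e2 b x
    using that unfolding E_def by (simp add: mult_right_mono)
  have compf: "continuous_on UNIV (\<lambda>z. h (fst z))" if "continuous_on UNIV h" for h :: "'e::topological_space \<Rightarrow> 'f::topological_space" and z :: "'e \<times> 'g::topological_space"
    by (rule continuous_on_compose2[OF that]) (auto intro: continuous_intros)

  \<comment> \<open>The centre of the window is made absolute by replacing \<open>w\<close> with
    \<open>w - \<xi>\<close>. After this the factor \<open>inn\<close> no longer contains \<xi>,
    which survives only in the kernel, where Fourier inversion can act on it.\<close>
  define N where "N x \<xi> w = (LINT y|lborel. inn \<phi> a (x + \<mu> *\<^sub>R y) w y * kern y (w - \<xi>))" for x \<xi> w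
  define D1 where "D1 = exp 1 * exp 1 * Kw * (LINT \<eta>|lborel. exp (- (\<rho>w / 2) * norm (\<eta>::real^'d) powr (1 / \<sigma>))) *
     (LINT y|lborel. exp (- (R1 / 2) * norm (y::real^'d) powr (1 / s))) * M"
  have D1: "D1 \<ge> 0" unfolding D1_def using Kw M by (intro mult_nonneg_nonneg) auto
  have Nb: "cmod (N x \<xi> w) \<le> D1 * weight s \<sigma> rc (x, \<xi>) * E (R2 / 2) q (w - \<xi>)" for x \<xi> w
  proof -
    have "cmod (N x \<xi> w) = cmod (LINT y|lborel. inn \<phi> (\<lambda>z. a ((x, \<xi>) + z)) (\<mu> *\<^sub>R y) (w - \<xi>) y * kern y (w - \<xi>))"
      unfolding N_def inn_translate by simp
    also have "\<dots> \<le> exp 1 * exp 1 * (M * weight s \<sigma> rc (x, \<xi>)) * Kw * (LINT \<eta>|lborel. exp (- (\<rho>w / 2) * norm (\<eta>::real^'d) powr (1 / \<sigma>))) *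
     (LINT y|lborel. exp (- (R1 / 2) * norm (y::real^'d) powr (1 / s))) * exp (- (R2 / 2) * norm (w - \<xi>) powr (1 / \<sigma>))"
      unfolding R1_def R2_def by (rule osc_middle_bound(2)[OF s slice_bound win gap' \<mu>])
    also have "\<dots> = D1 * weight s \<sigma> rc (x, \<xi>) * E (R2 / 2) q (w - \<xi>)"
      unfolding D1_def E_def q_def by (simp only: mult_ac)
    finally show ?thesis .
  qed
  have Nm: "(\<lambda>z. N (x z) (\<xi> z) (w z)) \<in> borel_measurable borel"
    if "continuous_on UNIV x" "continuous_on UNIV \<xi>" "continuous_on UNIV w" for x \<xi> w :: "'q::euclidean_space \<Rightarrow> real^'d"
    unfolding N_def
    by (rule borel_measurable_LINT, rule borel_measurable_times)
      (intro inn_measurable' ca c\<phi> borel_measurable_continuous_onI continuous_on_kern continuous_on_add continuous_on_diff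
        continuous_on_scaleR continuous_on_const continuous_on_snd continuous_on_id compf that)+
  have osc_N: "osc \<mu> \<phi> (\<lambda>z. a ((x, \<xi>) + z)) = of_real cd * (LINT w|lborel. N x \<xi> w)" for x \<xi>
  proof -
    have "osc \<mu> \<phi> (\<lambda>z. a ((x, \<xi>) + z)) = of_real cd * (LINT w|lborel. N x \<xi> (\<xi> + w))"
      unfolding osc_def inn_translate N_def cd_def by simp
    also have "(LINT w|lborel. N x \<xi> (\<xi> + w)) = (LINT w|lborel. N x \<xi> w)"
      by (rule integral_translate) (intro Nm continuous_on_const continuous_on_id)
    finally show ?thesis .
  qed

  \<comment> \<open>Three demands: the decay of \<open>N\<close> in \<open>w - \<xi>\<close> is at
    least \<epsilon>, the Wigner distribution can pay the growth of rate \<epsilon> in \<xi>, and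
    the window can pay the same growth in \<eta> at the end.\<close>
  define \<epsilon> where "\<epsilon> = min (min (R2 / 2) (\<rho> / 4)) (\<rho>w / 4)"
  have \<epsilon>: "\<epsilon> > 0" "\<epsilon> \<le> R2 / 2" "\<epsilon> \<le> \<rho> / 4" "\<epsilon> \<le> \<rho>w / 4" using R \<rho> gp by (auto simp: \<epsilon>_def)
  define \<epsilon>' where "\<epsilon>' = \<epsilon> / 2 powr q"
  have \<epsilon>': "\<epsilon>' > 0" using \<epsilon> by (simp add: \<epsilon>'_def)
  have Esh: "E \<epsilon> q (w - \<xi>) \<le> E (- \<epsilon>) q \<xi> * E \<epsilon>' q w" for w \<xi>
    using exp_decay_shift[OF pq(2), of \<epsilon> w \<xi>] \<epsilon> unfolding E_def \<epsilon>'_def by simp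
  have NW: "cmod (N x \<xi> w * cnj (wigner t g f (x, \<xi>))) \<le> (D1 * K * (E (\<rho> / 2) p x * E (\<rho> / 2) q \<xi>)) * E \<epsilon>' q w" for x \<xi> w
  proof -
    have "cmod (N x \<xi> w * cnj (wigner t g f (x, \<xi>))) \<le> (D1 * weight s \<sigma> rc (x, \<xi>) * E (R2 / 2) q (w - \<xi>)) * (K * E \<rho> p x * E \<rho> q \<xi>)"
      unfolding norm_mult complex_mod_cnj using D1 E0 weight_pos(2)[of s \<sigma> rc "(x, \<xi>)"] by (intro mult_mono Nb W\<^sub>w t) auto
    also have "E (R2 / 2) q (w - \<xi>) \<le> E (- \<epsilon>) q \<xi> * E \<epsilon>' q w"
      using Emono[OF \<epsilon>(2)] Esh by (rule order_trans)
    then have "(D1 * weight s \<sigma> rc (x, \<xi>) * E (R2 / 2) q (w - \<xi>)) * (K * E \<rho> p x * E \<rho> q \<xi>) \<le>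
       (D1 * weight s \<sigma> rc (x, \<xi>) * (E (- \<epsilon>) q \<xi> * E \<epsilon>' q w)) * (K * E \<rho> p x * E \<rho> q \<xi>)"
      using D1 K E0 weight_pos(2)[of s \<sigma> rc "(x, \<xi>)"] by (intro mult_right_mono mult_left_mono mult_nonneg_nonneg) auto
    also have "\<dots> = (D1 * K * ((E (- rc) p x * E \<rho> p x) * (E (- rc) q \<xi> * E (- \<epsilon>) q \<xi> * E \<rho> q \<xi>))) * E \<epsilon>' q w"
      unfolding wtE by (simp only: mult_ac)
    also have "\<dots> \<le> (D1 * K * (E (\<rho> / 2) p x * E (\<rho> / 2) q \<xi>)) * E \<epsilon>' q w"
      unfolding EE using D1 K E0 rc \<epsilon> by (intro mult_right_mono mult_left_mono mult_mono Emono mult_nonneg_nonneg) auto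
    finally show ?thesis .
  qed
  have int_prod: "integrable lborel (\<lambda>X::(real^'d) \<times> (real^'d). k * (E e1 p (fst X) * E e2 q (snd X)))" if "e1 > 0" "e2 > 0" for e1 e2 k
    unfolding E_def using that pq by (intro integrable_mult_right integrable_exp_powr_prod)
  have Wm: "(\<lambda>z. wigner \<tau> g f (x z, \<xi> z)) \<in> borel_measurable borel"
    if "continuous_on UNIV x" "continuous_on UNIV \<xi>" for \<tau> and x \<xi> :: "'q::euclidean_space \<Rightarrow> real^'d"
    by (rule wigner_measurable[OF cg continuous_on_const that])
  have cnjm: "(\<lambda>z. cnj (h z)) \<in> borel_measurable borel" if "h \<in> borel_measurable borel" for h :: "'q::euclidean_space \<Rightarrow> complex"
    using that by (rule measurable_compose) (intro borel_measurable_continuous_onI continuous_intros)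
  have step1: "(LINT X|lborel. osc \<mu> \<phi> (\<lambda>z. a (X + z)) * cnj (wigner t g f X)) =
     of_real cd * (LINT w|lborel. LINT X|lborel. N (fst X) (snd X) w * cnj (wigner t g f X))"
  proof -
    have "(LINT X|lborel. osc \<mu> \<phi> (\<lambda>z. a (X + z)) * cnj (wigner t g f X)) =
      (LINT X|lborel. of_real cd * (LINT w|lborel. N (fst X) (snd X) w * cnj (wigner t g f X)))"
      using osc_N[of "fst X" "snd X" for X] by (simp add: mult.assoc)
    also have "\<dots> = of_real cd * (LINT X|lborel. LINT w|lborel. N (fst X) (snd X) w * cnj (wigner t g f X))"
      by (rule integral_mult_right_zero)
    also have "(LINT X|lborel. LINT w|lborel. N (fst X) (snd X) w * cnj (wigner t g f X)) =
      (LINT w|lborel. LINT X|lborel. N (fst X) (snd X) w * cnj (wigner t g f X))"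
    proof (rule fubini_dominated(3)[where g="\<lambda>X. (D1 * K) * (E (\<rho> / 2) p (fst X) * E (\<rho> / 2) q (snd X))" and h="E \<epsilon>' q"])
      show "(\<lambda>z. N (fst (fst z)) (snd (fst z)) (snd z) * cnj (wigner t g f (fst z))) \<in> borel_measurable borel"
      proof -
        have "(\<lambda>z::((real^'d) \<times> (real^'d)) \<times> (real^'d). wigner t g f (fst (fst z), snd (fst z))) \<in> borel_measurable borel"
          by (intro Wm continuous_on_fst continuous_on_snd continuous_on_id)
        then show ?thesis unfolding prod.collapse
          by (intro borel_measurable_times Nm cnjm continuous_on_fst continuous_on_snd continuous_on_id)
      qed
      show "norm (N (fst X) (snd X) w * cnj (wigner t g f X)) \<le> (D1 * K) * (E (\<rho> / 2) p (fst X) * E (\<rho> / 2) q (snd X)) * E \<epsilon>' q w" for X w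
        using NW[of "fst X" "snd X" w] by simp
    qed (rule int_prod intE; use \<rho> \<epsilon>' pq in simp)+
    finally show ?thesis .
  qed

  define B where "B x y = cnj (Wk t g f x (- y))" for x y
  have cB: "continuous_on UNIV (\<lambda>z. B (x z) (y z))" if "continuous_on UNIV x" "continuous_on UNIV y" for x y :: "'q::topological_space \<Rightarrow> real^'d"
    unfolding B_def by (intro continuous_intros continuous_on_Wk cg that)
  have Bb: "cmod (B x y) \<le> K * E \<rho> p x * E \<rho> p y" for x y
    using W\<^sub>k[OF t(1), of x "- y"] by (simp add: B_def E_def)
  \<comment> \<open>Undoes the Fourier transform in the Wigner distribution: at fixed
    \<open>x\<close> the frequency integral returns the correlation \<open>Wk t g f x\<close> at
    \<open>- y\<close>, conjugated.\<close>
  have inv: "(LINT \<xi>|lborel. cnj (kern y \<xi>) * cnj (wigner t g f (x, \<xi>))) = of_real (c * (2 * pi) ^ CARD('d)) * B x y" for x y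
  proof -
    have "(LINT \<xi>|lborel. kern y \<xi> * (LINT z|lborel. Wk t g f x z * kern z \<xi>)) = of_real ((2 * pi) ^ CARD('d)) * Wk t g f x (- y)"
    proof (rule fourier_inversion[where K="K * E \<rho> p x"])
      show c1: "continuous_on UNIV (Wk t g f x)" by (intro continuous_on_Wk cg continuous_on_const continuous_on_id)
      show "cmod (Wk t g f x y) \<le> K * E \<rho> p x" for y
      proof -
        have "E \<rho> p y \<le> 1" unfolding E_def using \<rho> by simp
        then show ?thesis using W\<^sub>k[OF t(1), of x y] mult_left_mono[of "E \<rho> p y" 1 "K * E \<rho> p x"] K E0(2)[of \<rho> p x] by simp
      qed
      show "integrable lborel (Wk t g f x)"
        by (rule integrable_bound[OF integrable_mult_right[OF intE[OF \<rho>(1) pq(1)]] borel_measurable_continuous_onI[OF c1] W\<^sub>k[OF t(1)]])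
      have "integrable lborel (\<lambda>\<xi>. wigner t g f (x, \<xi>))"
        by (rule integrable_bound[OF integrable_mult_right[OF intE[OF \<rho>(1) pq(2)]] Wm W\<^sub>w[OF t(1)]]) (intro continuous_on_const continuous_on_id)+
      then have "integrable lborel (\<lambda>\<xi>. of_real (inverse c) * wigner t g f (x, \<xi>))"
        by (rule integrable_mult_right)
      moreover have "complex_of_real (inverse c) * of_real c = 1" using c0 by simp
      ultimately show "integrable lborel (\<lambda>\<xi>. LINT y|lborel. Wk t g f x y * kern y \<xi>)"
        unfolding wigner_eq c_def[symmetric] by (simp only: mult.assoc[symmetric] mult_1_left)
    qed
    then have "(LINT \<xi>|lborel. kern y \<xi> * wigner t g f (x, \<xi>)) = of_real (c * (2 * pi) ^ CARD('d)) * Wk t g f x (- y)"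
      unfolding wigner_eq c_def[symmetric] by (simp add: mult.left_commute[of _ "of_real c"] mult.assoc)
    then have "cnj (LINT \<xi>|lborel. kern y \<xi> * wigner t g f (x, \<xi>)) = of_real (c * (2 * pi) ^ CARD('d)) * B x y"
      by (simp add: B_def)
    then show ?thesis unfolding Bochner_Integration.integral_cnj[symmetric] complex_cnj_mult .
  qed

  define F where "F x \<xi> = a (x, \<xi>) * cnj (wigner (t + \<mu>) g f (x, \<xi>))" for x \<xi>
  have main: "(LINT X|lborel. N (fst X) (snd X) w * cnj (wigner t g f X)) =
     of_real ((2 * pi) ^ CARD('d)) * (LINT x|lborel. LINT \<eta>|lborel. F x (w + \<eta>) * \<phi> \<eta>)" for w
  proof -
    text \<open>Bounds for \<open>inn \<phi> a (x + \<mu> y) w y\<close> come from translating the symbol by \<open>(x, 0)\<close>.\<close>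
    define D2 where "D2 = exp 1 * M * Kw * (LINT \<eta>|lborel. exp (- (\<rho>w / 2) * norm (\<eta>::real^'d) powr (1 / \<sigma>))) *
        exp (rc * cst s \<sigma> * norm w powr (1 / \<sigma>))"
    have D2: "D2 \<ge> 0" unfolding D2_def using Kw M by (intro mult_nonneg_nonneg) auto
    have ib: "cmod (inn \<phi> a (x + \<mu> *\<^sub>R y) w y * kern y w) \<le> D2 * E (- rc) p x * E (R1 / 2) p y" for x y
    proof -
      have "cmod (inn \<phi> a (x + \<mu> *\<^sub>R y) w y * kern y w) = cmod (inn \<phi> (\<lambda>z. a ((x, 0) + z)) (\<mu> *\<^sub>R y) w y * kern y w)"
        unfolding inn_translate by simp
      also have "\<dots> \<le> exp 1 * (M * weight s \<sigma> rc (x, 0)) * Kw * (LINT \<eta>|lborel. exp (- (\<rho>w / 2) * norm (\<eta>::real^'d) powr (1 / \<sigma>))) *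
        exp (rc * cst s \<sigma> * norm w powr (1 / \<sigma>)) * exp (- (R1 / 2) * norm y powr (1 / s))"
        unfolding R1_def by (rule osc_middle_bound(1)[OF s slice_bound win gap' \<mu>])
      also have "\<dots> = D2 * E (- rc) p x * E (R1 / 2) p y"
        unfolding D2_def wtE by (simp add: E_def p_def mult_ac)
      finally show ?thesis .
    qed
    have kk: "kern y (w - \<xi>) = kern y w * cnj (kern y \<xi>)" for y \<xi>
      by (simp add: inner_diff_right exp_add[symmetric] exp_cnj algebra_simps)
    have im: "(\<lambda>z. inn \<phi> a (x z + \<mu> *\<^sub>R y z) w (y z) * kern (y z) w) \<in> borel_measurable borel"
      if "continuous_on UNIV x" "continuous_on UNIV y" for x y :: "'q::euclidean_space \<Rightarrow> real^'d"
      by (intro borel_measurable_times inn_measurable' ca c\<phi> borel_measurable_continuous_onI continuous_on_kern continuous_on_add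
        continuous_on_scaleR continuous_on_const that)
    have "(LINT X|lborel. N (fst X) (snd X) w * cnj (wigner t g f X)) = (LINT x|lborel. LINT \<xi>|lborel. N x \<xi> w * cnj (wigner t g f (x, \<xi>)))"
    proof -
      have "(LINT X|lborel. N (fst X) (snd X) w * cnj (wigner t g f X)) = (LINT X|lborel. N (fst X) (snd X) w * cnj (wigner t g f (fst X, snd X)))"
        by simp
      also have "\<dots> = (LINT x|lborel. LINT \<xi>|lborel. N x \<xi> w * cnj (wigner t g f (x, \<xi>)))"
      proof (rule fubini_dominated(2)[where g="\<lambda>x. (D1 * K * E \<epsilon>' q w) * E (\<rho> / 2) p x" and h="E (\<rho> / 2) q"])
        show "(\<lambda>z. N (fst z) (snd z) w * cnj (wigner t g f (fst z, snd z))) \<in> borel_measurable borel"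
          by (intro borel_measurable_times Nm cnjm Wm continuous_on_fst continuous_on_snd continuous_on_id continuous_on_const)
        show "norm (N x \<xi> w * cnj (wigner t g f (x, \<xi>))) \<le> D1 * K * E \<epsilon>' q w * E (\<rho> / 2) p x * E (\<rho> / 2) q \<xi>" for x \<xi>
          using NW[of x \<xi> w] by (simp only: mult_ac)
      qed (use \<rho> pq in \<open>auto intro!: intE\<close>)
      finally show ?thesis .
    qed
    also have "\<dots> = (LINT x|lborel. LINT y|lborel. (inn \<phi> a (x + \<mu> *\<^sub>R y) w y * kern y w) * (of_real (c * (2 * pi) ^ CARD('d)) * B x y))"
    proof (rule Bochner_Integration.integral_cong[OF refl])
      fix x :: "real^'d"
      have "(LINT \<xi>|lborel. N x \<xi> w * cnj (wigner t g f (x, \<xi>))) =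
        (LINT \<xi>|lborel. LINT y|lborel. (inn \<phi> a (x + \<mu> *\<^sub>R y) w y * kern y w) * (cnj (kern y \<xi>) * cnj (wigner t g f (x, \<xi>))))"
        unfolding N_def kk by (simp add: mult_ac flip: integral_mult_left_zero)
      also have "\<dots> = (LINT y|lborel. LINT \<xi>|lborel. (inn \<phi> a (x + \<mu> *\<^sub>R y) w y * kern y w) * (cnj (kern y \<xi>) * cnj (wigner t g f (x, \<xi>))))"
      proof (rule fubini_dominated(3)[where g="\<lambda>\<xi>. (D2 * E (- rc) p x * (K * E \<rho> p x)) * E \<rho> q \<xi>" and h="E (R1 / 2) p"])
        show "(\<lambda>z. (inn \<phi> a (x + \<mu> *\<^sub>R snd z) w (snd z) * kern (snd z) w) * (cnj (kern (snd z) (fst z)) * cnj (wigner t g f (x, fst z)))) \<in> borel_measurable borel"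
          by (intro borel_measurable_times[of "\<lambda>z. inn \<phi> a (x + \<mu> *\<^sub>R snd z) w (snd z) * kern (snd z) w"] im)
            (intro borel_measurable_times cnjm Wm borel_measurable_continuous_onI continuous_on_kern continuous_on_fst continuous_on_snd continuous_on_id continuous_on_const)+
        show "norm ((inn \<phi> a (x + \<mu> *\<^sub>R y) w y * kern y w) * (cnj (kern y \<xi>) * cnj (wigner t g f (x, \<xi>)))) \<le>
          (D2 * E (- rc) p x * (K * E \<rho> p x)) * E \<rho> q \<xi> * E (R1 / 2) p y" for \<xi> y
        proof -
          have "norm ((inn \<phi> a (x + \<mu> *\<^sub>R y) w y * kern y w) * (cnj (kern y \<xi>) * cnj (wigner t g f (x, \<xi>)))) =
             cmod (inn \<phi> a (x + \<mu> *\<^sub>R y) w y * kern y w) * cmod (wigner t g f (x, \<xi>))"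
            by (simp only: norm_mult complex_mod_cnj norm_kern mult_1_left)
          also have "\<dots> \<le> (D2 * E (- rc) p x * E (R1 / 2) p y) * (K * E \<rho> p x * E \<rho> q \<xi>)"
            using D2 E0 by (intro mult_mono ib W\<^sub>w t) auto
          finally show ?thesis by (simp only: mult_ac)
        qed
      qed (use \<rho> pq R in \<open>auto intro!: intE\<close>)
      also have "\<dots> = (LINT y|lborel. (inn \<phi> a (x + \<mu> *\<^sub>R y) w y * kern y w) * (of_real (c * (2 * pi) ^ CARD('d)) * B x y))"
        unfolding integral_mult_right_zero inv ..
      finally show "(LINT \<xi>|lborel. N x \<xi> w * cnj (wigner t g f (x, \<xi>))) =
        (LINT y|lborel. (inn \<phi> a (x + \<mu> *\<^sub>R y) w y * kern y w) * (of_real (c * (2 * pi) ^ CARD('d)) * B x y))" .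
    qed
    also have "\<dots> = of_real (c * (2 * pi) ^ CARD('d)) * (LINT x|lborel. LINT y|lborel. (inn \<phi> a (x + \<mu> *\<^sub>R y) w y * kern y w) * B x y)"
      by (simp only: mult.left_commute[of _ "of_real (c * (2 * pi) ^ CARD('d))"] integral_mult_right_zero)
    also have "(LINT x|lborel. LINT y|lborel. (inn \<phi> a (x + \<mu> *\<^sub>R y) w y * kern y w) * B x y) =
       (LINT y|lborel. LINT x|lborel. (inn \<phi> a (x + \<mu> *\<^sub>R y) w y * kern y w) * B x y)"
    proof (rule fubini_dominated(3)[where g="\<lambda>x. (D2 * K) * E (\<rho> / 2) p x" and h="E (R1 / 2) p"])
      show "(\<lambda>z. (inn \<phi> a (fst z + \<mu> *\<^sub>R snd z) w (snd z) * kern (snd z) w) * B (fst z) (snd z)) \<in> borel_measurable borel"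
        by (rule borel_measurable_times[OF im borel_measurable_continuous_onI[OF cB]])
          (intro continuous_on_fst continuous_on_snd continuous_on_id)+
      show "norm ((inn \<phi> a (x + \<mu> *\<^sub>R y) w y * kern y w) * B x y) \<le> (D2 * K) * E (\<rho> / 2) p x * E (R1 / 2) p y" for x y
      proof -
        have "E \<rho> p y \<le> 1" unfolding E_def using \<rho> by simp
        then have "K * E \<rho> p x * E \<rho> p y \<le> K * E \<rho> p x" using K E0(2)[of \<rho> p x] mult_left_mono[of "E \<rho> p y" 1 "K * E \<rho> p x"] by simp
        then have "cmod (B x y) \<le> K * E \<rho> p x" using Bb[of x y] by linarith
        then have "norm ((inn \<phi> a (x + \<mu> *\<^sub>R y) w y * kern y w) * B x y) \<le> (D2 * E (- rc) p x * E (R1 / 2) p y) * (K * E \<rho> p x)"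
          unfolding norm_mult[of "inn _ _ _ _ _ * _"] using D2 E0 by (intro mult_mono ib) auto
        also have "\<dots> = (D2 * K) * (E (- rc) p x * E \<rho> p x) * E (R1 / 2) p y" by (simp only: mult_ac)
        also have "\<dots> \<le> (D2 * K) * E (\<rho> / 2) p x * E (R1 / 2) p y"
          unfolding EE using D2 K E0 rc by (intro mult_right_mono mult_left_mono Emono mult_nonneg_nonneg) auto
        finally show ?thesis .
      qed
    qed (use \<rho> pq R in \<open>auto intro!: intE\<close>)
    \<comment> \<open>The substitution that changes the quantisation: moving \<open>x\<close> by
      \<open>\<mu> *\<^sub>R y\<close> clears the shift from the symbol, and the correlation for
      \<open>t\<close> at \<open>(x, - y)\<close> is the one for \<open>t + \<mu>\<close> at
      \<open>(x + \<mu> *\<^sub>R y, - y)\<close>.\<close>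
    also have "\<dots> = (LINT y|lborel. LINT x|lborel. (inn \<phi> a x w y * kern y w) * cnj (Wk (t + \<mu>) g f x (- y)))"
    proof (rule Bochner_Integration.integral_cong[OF refl])
      fix y :: "real^'d"
      have sh: "B x y = cnj (Wk (t + \<mu>) g f (\<mu> *\<^sub>R y + x) (- y))" for x
        unfolding B_def Wk_def by (simp add: algebra_simps)
      have "(LINT x|lborel. (inn \<phi> a (\<mu> *\<^sub>R y + x) w y * kern y w) * cnj (Wk (t + \<mu>) g f (\<mu> *\<^sub>R y + x) (- y))) =
         (LINT x|lborel. (inn \<phi> a x w y * kern y w) * cnj (Wk (t + \<mu>) g f x (- y)))"
        by (rule integral_translate)
          (intro borel_measurable_times inn_measurable' ca c\<phi> cnjm borel_measurable_continuous_onI continuous_on_Wk cg continuous_on_const continuous_on_id)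
      then show "(LINT x|lborel. (inn \<phi> a (x + \<mu> *\<^sub>R y) w y * kern y w) * B x y) =
         (LINT x|lborel. (inn \<phi> a x w y * kern y w) * cnj (Wk (t + \<mu>) g f x (- y)))"
        unfolding sh by (simp add: add.commute)
    qed
    also have "\<dots> = (LINT x|lborel. LINT y|lborel. (inn \<phi> a x w y * kern y w) * cnj (Wk (t + \<mu>) g f x (- y)))"
    proof -
      define D3 where "D3 = M * Kw * exp (rc * cst s \<sigma> * norm w powr (1 / \<sigma>)) * (LINT \<eta>|lborel. E (\<rho>w / 2) q \<eta>)"
      have adm0: "slice_bound s \<sigma> H rc M a" using slice_bound[of 0] by (simp add: weight_def)
      have D3: "D3 \<ge> 0" unfolding D3_def using M Kw E0 by (intro mult_nonneg_nonneg) auto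
      have b3: "cmod (inn \<phi> a x w y) \<le> D3 * E (- rc) p x" for x y
      proof -
        have "cmod (inn \<phi> a x w y) \<le> (LINT \<eta>|lborel. (M * Kw * exp (rc * norm x powr (1 / s)) * exp (rc * cst s \<sigma> * norm w powr (1 / \<sigma>))) * E (\<rho>w / 2) q \<eta>)"
          unfolding inn_def
        proof (rule norm_integral_bound)
          show "(\<lambda>\<eta>. a (x, w + \<eta>) * \<phi> \<eta> * kern y \<eta>) \<in> borel_measurable borel"
            by (intro borel_measurable_continuous_onI continuous_intros continuous_on_compose2[OF ca] c\<phi>) auto
          show "cmod (a (x, w + \<eta>) * \<phi> \<eta> * kern y \<eta>) \<le> M * Kw * exp (rc * norm x powr (1 / s)) * exp (rc * cst s \<sigma> * norm w powr (1 / \<sigma>)) * E (\<rho>w / 2) q \<eta>" for \<eta>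
            using inn_integrand_bound[OF s adm0 win gap', where m=0 and l=0 and p=x and w=w and \<eta>=\<eta> and y=y] unfolding E_def q_def by simp
        qed (use gp pq in \<open>intro integrable_mult_right intE; simp\<close>)
        also have "\<dots> = D3 * E (- rc) p x" unfolding integral_mult_right_zero D3_def by (simp add: E_def[abs_def] p_def mult_ac)
        finally show ?thesis .
      qed
      show ?thesis
      proof (rule fubini_dominated(3)[symmetric, where g="\<lambda>x. (D3 * K) * E (\<rho> / 2) p x" and h="E \<rho> p"])
        show "(\<lambda>z. inn \<phi> a (fst z) w (snd z) * kern (snd z) w * cnj (Wk (t + \<mu>) g f (fst z) (- snd z))) \<in> borel_measurable borel"
          by (intro borel_measurable_times inn_measurable' ca c\<phi> cnjm borel_measurable_continuous_onI continuous_on_Wk continuous_on_kern cg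
            continuous_on_minus continuous_on_fst continuous_on_snd continuous_on_const continuous_on_id)
        show "norm (inn \<phi> a x w y * kern y w * cnj (Wk (t + \<mu>) g f x (- y))) \<le> (D3 * K) * E (\<rho> / 2) p x * E \<rho> p y" for x y
        proof -
          have "cmod (Wk (t + \<mu>) g f x (- y)) \<le> K * E \<rho> p x * E \<rho> p y" using W\<^sub>k[OF t(2), of x "- y"] by (simp add: E_def)
          then have "norm (inn \<phi> a x w y * kern y w * cnj (Wk (t + \<mu>) g f x (- y))) \<le> (D3 * E (- rc) p x) * (K * E \<rho> p x * E \<rho> p y)"
            unfolding norm_mult complex_mod_cnj norm_kern mult_1_right using D3 E0 by (intro mult_mono b3) auto
          also have "\<dots> = (D3 * K) * (E (- rc) p x * E \<rho> p x) * E \<rho> p y" by (simp only: mult_ac)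
          also have "\<dots> \<le> (D3 * K) * E (\<rho> / 2) p x * E \<rho> p y"
            unfolding EE using D3 K E0 rc by (intro mult_right_mono mult_left_mono Emono mult_nonneg_nonneg) auto
          finally show ?thesis .
        qed
      qed (use \<rho> pq in \<open>auto intro!: intE\<close>)
    qed
    \<comment> \<open>The kernels at \<eta> and \<open>w\<close> merge into one at
      \<open>w + \<eta>\<close>, so integrating \<open>y\<close> first rebuilds the Wigner
      distribution for \<open>t + \<mu>\<close> at that frequency.\<close>
    also have "\<dots> = (LINT x|lborel. of_real (inverse c) * (LINT \<eta>|lborel. F x (w + \<eta>) * \<phi> \<eta>))"
    proof (rule Bochner_Integration.integral_cong[OF refl])
      fix x :: "real^'d"
      have adm0: "slice_bound s \<sigma> H rc M a" using slice_bound[of 0] by (simp add: weight_def)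
      define D4 where "D4 = M * Kw * exp (rc * norm x powr (1 / s)) * exp (rc * cst s \<sigma> * norm w powr (1 / \<sigma>))"
      have D4: "D4 \<ge> 0" unfolding D4_def using M Kw by simp
      let ?G = "\<lambda>y \<eta>. (a (x, w + \<eta>) * \<phi> \<eta>) * (kern y (w + \<eta>) * cnj (Wk (t + \<mu>) g f x (- y)))"
      have wi: "(LINT y|lborel. kern y (w + \<eta>) * cnj (Wk (t + \<mu>) g f x (- y))) = of_real (inverse c) * cnj (wigner (t + \<mu>) g f (x, w + \<eta>))" for \<eta>
      proof -
        have "(LINT y|lborel. kern (- (- y)) (w + \<eta>) * cnj (Wk (t + \<mu>) g f x (- y))) = (LINT y|lborel. kern (- y) (w + \<eta>) * cnj (Wk (t + \<mu>) g f x y))"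
          by (rule integral_uminus) (intro borel_measurable_continuous_onI continuous_intros continuous_on_Wk cg)
        also have "\<dots> = cnj (LINT y|lborel. Wk (t + \<mu>) g f x y * kern y (w + \<eta>))"
          unfolding Bochner_Integration.integral_cnj[symmetric] by (simp add: exp_cnj mult.commute)
        finally show ?thesis unfolding wigner_eq c_def[symmetric] using c0 by simp
      qed
      have "(LINT y|lborel. (inn \<phi> a x w y * kern y w) * cnj (Wk (t + \<mu>) g f x (- y))) = (LINT y|lborel. LINT \<eta>|lborel. ?G y \<eta>)"
      proof (rule Bochner_Integration.integral_cong[OF refl])
        fix y :: "real^'d"
        have "(inn \<phi> a x w y * kern y w) * cnj (Wk (t + \<mu>) g f x (- y)) =
          (LINT \<eta>|lborel. (a (x, w + \<eta>) * \<phi> \<eta> * kern y \<eta>) * (kern y w * cnj (Wk (t + \<mu>) g f x (- y))))"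
          unfolding inn_def integral_mult_left_zero by (simp only: mult.assoc)
        also have "\<dots> = (LINT \<eta>|lborel. ?G y \<eta>)"
          unfolding kern_add(2) by (simp only: mult_ac)
        finally show "(inn \<phi> a x w y * kern y w) * cnj (Wk (t + \<mu>) g f x (- y)) = (LINT \<eta>|lborel. ?G y \<eta>)" .
      qed
      also have "\<dots> = (LINT \<eta>|lborel. LINT y|lborel. ?G y \<eta>)"
      proof (rule fubini_dominated(3)[where g="\<lambda>y. (D4 * (K * E \<rho> p x)) * E \<rho> p y" and h="E (\<rho>w / 2) q"])
        show "(\<lambda>z. ?G (fst z) (snd z)) \<in> borel_measurable borel"
          by (intro borel_measurable_continuous_onI continuous_intros continuous_on_Wk continuous_on_compose2[OF ca] continuous_on_compose2[OF c\<phi>] cg) auto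
        show "norm (?G y \<eta>) \<le> (D4 * (K * E \<rho> p x)) * E \<rho> p y * E (\<rho>w / 2) q \<eta>" for y \<eta>
        proof -
          have "cmod (a (x, w + \<eta>) * \<phi> \<eta>) \<le> D4 * E (\<rho>w / 2) q \<eta>"
            using inn_integrand_bound[OF s adm0 win gap', where m=0 and l=0 and p=x and w=w and \<eta>=\<eta> and y=0] unfolding E_def q_def D4_def by simp
          moreover have "cmod (Wk (t + \<mu>) g f x (- y)) \<le> K * E \<rho> p x * E \<rho> p y" using W\<^sub>k[OF t(2), of x "- y"] by (simp add: E_def)
          ultimately have "cmod (a (x, w + \<eta>) * \<phi> \<eta>) * cmod (Wk (t + \<mu>) g f x (- y)) \<le> (D4 * E (\<rho>w / 2) q \<eta>) * (K * E \<rho> p x * E \<rho> p y)"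
            using D4 E0 by (intro mult_mono) auto
          moreover have "norm (?G y \<eta>) = cmod (a (x, w + \<eta>) * \<phi> \<eta>) * cmod (Wk (t + \<mu>) g f x (- y))"
            by (simp only: norm_mult complex_mod_cnj norm_kern mult_1_left)
          ultimately show ?thesis by (simp only: mult_ac)
        qed
      qed (use \<rho> pq gp in \<open>auto intro!: intE\<close>)
      also have "\<dots> = (LINT \<eta>|lborel. (a (x, w + \<eta>) * \<phi> \<eta>) * (LINT y|lborel. kern y (w + \<eta>) * cnj (Wk (t + \<mu>) g f x (- y))))"
        by (simp only: integral_mult_right_zero)
      also have "\<dots> = (LINT \<eta>|lborel. (a (x, w + \<eta>) * \<phi> \<eta>) * (of_real (inverse c) * cnj (wigner (t + \<mu>) g f (x, w + \<eta>))))"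
        unfolding wi ..
      finally show "(LINT y|lborel. (inn \<phi> a x w y * kern y w) * cnj (Wk (t + \<mu>) g f x (- y))) = of_real (inverse c) * (LINT \<eta>|lborel. F x (w + \<eta>) * \<phi> \<eta>)"
        unfolding F_def by (simp add: mult_ac flip: integral_mult_right_zero)
    qed
    also have "\<dots> = of_real (inverse c) * (LINT x|lborel. LINT \<eta>|lborel. F x (w + \<eta>) * \<phi> \<eta>)"
      by (rule integral_mult_right_zero)
    finally show ?thesis using c0 by simp
  qed

  have Fm: "(\<lambda>z. F (x z) (\<xi> z)) \<in> borel_measurable borel"
    if "continuous_on UNIV x" "continuous_on UNIV \<xi>" for x \<xi> :: "'q::euclidean_space \<Rightarrow> real^'d"
    unfolding F_def
    by (intro borel_measurable_times cnjm Wm that borel_measurable_continuous_onI continuous_on_smooth_comp[OF sa] continuous_on_Pair)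
  have Fb: "cmod (F x \<xi>) \<le> (M * K) * E (\<rho> / 2) p x * E \<epsilon> q \<xi>" for x \<xi>
  proof -
    have "cmod (a (x, \<xi>)) \<le> M * weight s \<sigma> r (x, \<xi>)"
      using a[unfolded symb_bound_def, THEN conjunct2, rule_format, where \<alpha>="\<lambda>_. 0" and \<beta>="\<lambda>_. 0" and z="(x, \<xi>)"]
      by (simp add: mabs_0 mfact_0 mderiv_0)
    also have "\<dots> \<le> M * weight s \<sigma> rc (x, \<xi>)" using M rc by (intro mult_left_mono weight_mono) auto
    finally have "cmod (F x \<xi>) \<le> (M * weight s \<sigma> rc (x, \<xi>)) * (K * E \<rho> p x * E \<rho> q \<xi>)"
      unfolding F_def norm_mult complex_mod_cnj using M weight_pos(2)[of s \<sigma> rc "(x, \<xi>)"] by (intro mult_mono W\<^sub>w t) auto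
    also have "\<dots> = (M * K) * (E (- rc) p x * E \<rho> p x) * (E (- rc) q \<xi> * E \<rho> q \<xi>)"
      unfolding wtE by (simp only: mult_ac)
    also have "\<dots> \<le> (M * K) * E (\<rho> / 2) p x * E \<epsilon> q \<xi>"
      unfolding EE using M K E0 rc \<epsilon> \<rho> by (intro mult_mono mult_left_mono Emono mult_nonneg_nonneg) auto
    finally show ?thesis .
  qed
  have \<phi>b: "cmod (\<phi> \<eta>) \<le> Kw * E \<rho>w q \<eta>" for \<eta>
    using window_bounds(3)[OF win, of \<eta> undefined 0] by (simp add: E_def q_def)
  have F\<phi>: "cmod (F x (w + \<eta>) * \<phi> \<eta>) \<le> (M * K * Kw) * E (\<rho> / 2) p x * E \<epsilon>' q w * E (\<rho>w / 2) q \<eta>" for x w \<eta>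
  proof -
    have "E \<epsilon> q (w + \<eta>) \<le> E (- \<epsilon>) q \<eta> * E \<epsilon>' q w" using Esh[of w "- \<eta>"] by (simp add: E_def)
    then have "(M * K) * E (\<rho> / 2) p x * E \<epsilon> q (w + \<eta>) \<le> (M * K) * E (\<rho> / 2) p x * (E (- \<epsilon>) q \<eta> * E \<epsilon>' q w)"
      using M K E0 by (intro mult_left_mono mult_nonneg_nonneg) auto
    then have "cmod (F x (w + \<eta>)) \<le> (M * K) * E (\<rho> / 2) p x * (E (- \<epsilon>) q \<eta> * E \<epsilon>' q w)" using Fb[of x "w + \<eta>"] by linarith
    then have "cmod (F x (w + \<eta>) * \<phi> \<eta>) \<le> ((M * K) * E (\<rho> / 2) p x * (E (- \<epsilon>) q \<eta> * E \<epsilon>' q w)) * (Kw * E \<rho>w q \<eta>)"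
      unfolding norm_mult using M K E0 by (intro mult_mono \<phi>b mult_nonneg_nonneg) auto
    also have "\<dots> = (M * K * Kw) * E (\<rho> / 2) p x * E \<epsilon>' q w * (E (- \<epsilon>) q \<eta> * E \<rho>w q \<eta>)" by (simp only: mult_ac)
    also have "\<dots> \<le> (M * K * Kw) * E (\<rho> / 2) p x * E \<epsilon>' q w * E (\<rho>w / 2) q \<eta>"
      unfolding EE using M K Kw E0 \<epsilon> gp by (intro mult_left_mono Emono mult_nonneg_nonneg) auto
    finally show ?thesis .
  qed
  have F\<phi>m: "(\<lambda>z. F (x z) (w z + \<eta> z) * \<phi> (\<eta> z)) \<in> borel_measurable borel"
    if "continuous_on UNIV x" "continuous_on UNIV w" "continuous_on UNIV \<eta>" for x w \<eta> :: "'q::euclidean_space \<Rightarrow> real^'d"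
    by (rule borel_measurable_times[OF Fm borel_measurable_continuous_onI])
      (auto intro!: continuous_intros that continuous_on_compose2[OF c\<phi>])
  have "(LINT X|lborel. osc \<mu> \<phi> (\<lambda>z. a (X + z)) * cnj (wigner t g f X)) = (LINT w|lborel. LINT x|lborel. LINT \<eta>|lborel. F x (w + \<eta>) * \<phi> \<eta>)"
    unfolding step1 main integral_mult_right_zero mult.assoc[symmetric] cd by simp
  also have "\<dots> = (LINT x|lborel. LINT w|lborel. LINT \<eta>|lborel. F x (w + \<eta>) * \<phi> \<eta>)"
  proof (rule fubini_dominated(3)[where g="E \<epsilon>' q" and h="\<lambda>x. (M * K * Kw * (LINT \<eta>|lborel. E (\<rho>w / 2) q \<eta>)) * E (\<rho> / 2) p x"])
    show "(\<lambda>z. LINT \<eta>|lborel. F (snd z) (fst z + \<eta>) * \<phi> \<eta>) \<in> borel_measurable borel"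
      by (intro borel_measurable_LINT F\<phi>m continuous_intros)
    show "norm (LINT \<eta>|lborel. F x (w + \<eta>) * \<phi> \<eta>) \<le> E \<epsilon>' q w * ((M * K * Kw * (LINT \<eta>|lborel. E (\<rho>w / 2) q \<eta>)) * E (\<rho> / 2) p x)" for w x
    proof -
      have "norm (LINT \<eta>|lborel. F x (w + \<eta>) * \<phi> \<eta>) \<le> (LINT \<eta>|lborel. ((M * K * Kw) * E (\<rho> / 2) p x * E \<epsilon>' q w) * E (\<rho>w / 2) q \<eta>)"
        by (rule norm_integral_bound[OF _ _ F\<phi>]) (use gp pq in \<open>auto intro!: integrable_mult_right intE F\<phi>m continuous_intros\<close>)
      then show ?thesis unfolding integral_mult_right_zero by (simp only: mult_ac)
    qed
  qed (use \<epsilon>' \<rho> pq in \<open>auto intro!: intE\<close>)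
  also have "\<dots> = (LINT x|lborel. LINT \<xi>|lborel. F x \<xi>)"
  proof (rule Bochner_Integration.integral_cong[OF refl])
    fix x :: "real^'d"
    have "(LINT w|lborel. LINT \<eta>|lborel. F x (w + \<eta>) * \<phi> \<eta>) = (LINT \<eta>|lborel. LINT w|lborel. F x (w + \<eta>) * \<phi> \<eta>)"
    proof (rule fubini_dominated(3)[where g="\<lambda>w. ((M * K * Kw) * E (\<rho> / 2) p x) * E \<epsilon>' q w" and h="E (\<rho>w / 2) q"])
      show "(\<lambda>z. F x (fst z + snd z) * \<phi> (snd z)) \<in> borel_measurable borel"
        by (intro F\<phi>m continuous_intros)
      show "norm (F x (w + \<eta>) * \<phi> \<eta>) \<le> ((M * K * Kw) * E (\<rho> / 2) p x) * E \<epsilon>' q w * E (\<rho>w / 2) q \<eta>" for w \<eta>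
        using F\<phi>[of x w \<eta>] by simp
    qed (use \<epsilon>' pq gp in \<open>auto intro!: intE\<close>)
    \<comment> \<open>By translation invariance the \<open>w\<close>-integral does not depend on
      \<eta>, so the window contributes only its integral, which is 1.\<close>
    also have "\<dots> = (LINT \<eta>|lborel. (LINT \<xi>|lborel. F x \<xi>) * \<phi> \<eta>)"
    proof (rule Bochner_Integration.integral_cong[OF refl])
      fix \<eta> :: "real^'d"
      have "(LINT w|lborel. F x (\<eta> + w)) = (LINT \<xi>|lborel. F x \<xi>)"
        by (rule integral_translate) (intro Fm continuous_on_const continuous_on_id)
      then show "(LINT w|lborel. F x (w + \<eta>) * \<phi> \<eta>) = (LINT \<xi>|lborel. F x \<xi>) * \<phi> \<eta>"
        by (simp add: add.commute)
    qed
    also have "\<dots> = (LINT \<xi>|lborel. F x \<xi>)" using \<phi>1 by simp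
    finally show "(LINT w|lborel. LINT \<eta>|lborel. F x (w + \<eta>) * \<phi> \<eta>) = (LINT \<xi>|lborel. F x \<xi>)" .
  qed
  also have "\<dots> = (LINT X|lborel. F (fst X) (snd X))"
    by (rule fubini_dominated(2)[symmetric, OF _ Fb]) (use \<rho> \<epsilon> pq in \<open>auto intro!: intE integrable_mult_right Fm continuous_intros\<close>)
  also have "\<dots> = (LINT X|lborel. a X * cnj (wigner (t + \<mu>) g f X))"
    unfolding F_def by simp
  finally show ?thesis .
qed

section \<open>Gelfand--Shilov spaces and symbol classes\<close>

lemma SUP_ennreal_finite_iff:
  fixes F :: "'a \<Rightarrow> real"
  assumes "\<And>x. F x \<ge> 0"
  shows "(SUP x. ennreal (F x)) < \<infinity> \<longleftrightarrow> (\<exists>M. \<forall>x. F x \<le> M)"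
proof
  assume fin: "(SUP x. ennreal (F x)) < \<infinity>"
  have "F x \<le> enn2real (SUP x. ennreal (F x))" for x
  proof -
    have "ennreal (F x) \<le> (SUP x. ennreal (F x))" by (rule SUP_upper) simp
    also have "\<dots> = ennreal (enn2real (SUP x. ennreal (F x)))" using fin by simp
    finally show ?thesis by (subst (asm) ennreal_le_iff) auto
  qed
  then show "\<exists>M. \<forall>x. F x \<le> M" by blast
next
  assume "\<exists>M. \<forall>x. F x \<le> M"
  then obtain M where "\<And>x. F x \<le> M" by blast
  then have "(SUP x. ennreal (F x)) \<le> ennreal M" by (intro SUP_least ennreal_leI)
  also have "\<dots> < \<infinity>" by simp
  finally show "(SUP x. ennreal (F x)) < \<infinity>" .
qed

lemma symb_norm_finite_iff:
  fixes f :: "(real^'d::finite) \<times> (real^'d) \<Rightarrow> complex"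
  assumes "h > 0" "smooth f"
  shows "symb_norm s \<sigma> h r f < \<infinity> \<longleftrightarrow> (\<exists>M. symb_bound s \<sigma> h r M f)"
proof -
  let ?D = "\<lambda>\<alpha> \<beta> z. h ^ (mabs \<alpha> + mabs \<beta>) * mfact \<alpha> powr \<sigma> * mfact \<beta> powr s * weight s \<sigma> r z"
  let ?F = "\<lambda>p. cmod (mderiv (fst p) (fst (snd p)) f (snd (snd p))) / ?D (fst p) (fst (snd p)) (snd (snd p))"
  have D: "?D \<alpha> \<beta> z > 0" for \<alpha> \<beta> z using assms(1) mfact_pos[of \<alpha>] mfact_pos[of \<beta>] weight_pos(1)[of s \<sigma> r z] by simp
  have "symb_norm s \<sigma> h r f = (SUP p. ennreal (?F p))"
    unfolding symb_norm_def case_prod_unfold weight_def prod.collapse ..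
  moreover have "(SUP p. ennreal (?F p)) < \<infinity> \<longleftrightarrow> (\<exists>M. \<forall>p. ?F p \<le> M)"
    using D by (intro SUP_ennreal_finite_iff divide_nonneg_nonneg less_imp_le[OF D]) simp
  moreover have "?F (\<alpha>, \<beta>, z) \<le> M \<longleftrightarrow> cmod (mderiv \<alpha> \<beta> f z) \<le> M * ?D \<alpha> \<beta> z" for \<alpha> \<beta> z M
    using D[of \<alpha> \<beta> z] by (simp add: pos_divide_le_eq)
  ultimately show ?thesis using assms(2) unfolding symb_bound_def split_paired_All by simp
qed

lemma gs_norm_bound:
  fixes f :: "real^'d::finite \<Rightarrow> complex"
  assumes f: "smooth f" "gs_norm s \<sigma> h f < \<infinity>" and h: "h > 0" "h \<le> h'"
  shows "\<exists>C\<ge>0. \<forall>i j m n x. \<bar>x $ i\<bar> ^ m * cmod ((dir_deriv (axis j 1) ^^ n) f x) \<le>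
    C * h' ^ (m + n) * fact m powr s * fact n powr \<sigma>"
proof -
  let ?D = "\<lambda>\<alpha> \<beta>. h ^ (mabs \<alpha> + mabs \<beta>) * mfact \<alpha> powr s * mfact \<beta> powr \<sigma>"
  let ?F = "\<lambda>p. cmod (of_real (mpow (snd (snd p)) (fst p)) * pderivs (fst (snd p)) f (snd (snd p))) / ?D (fst p) (fst (snd p))"
  have D: "?D \<alpha> \<beta> > 0" for \<alpha> \<beta> :: "'d \<Rightarrow> nat" using h mfact_pos[of \<alpha>] mfact_pos[of \<beta>] by simp
  have "gs_norm s \<sigma> h f = (SUP p. ennreal (?F p))"
    unfolding gs_norm_def case_prod_unfold ..
  moreover have "(SUP p. ennreal (?F p)) < \<infinity> \<longleftrightarrow> (\<exists>M. \<forall>p. ?F p \<le> M)"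
    using D by (intro SUP_ennreal_finite_iff divide_nonneg_nonneg less_imp_le[OF D]) simp
  ultimately obtain M where "\<And>p. ?F p \<le> M" using f by auto
  then have FM: "?F (\<alpha>, \<beta>, x) \<le> M" for \<alpha> \<beta> x .
  have M: "cmod (of_real (mpow x \<alpha>) * pderivs \<beta> f x) \<le> M * ?D \<alpha> \<beta>" for \<alpha> \<beta> x
    using FM[of \<alpha> \<beta> x] D[of \<alpha> \<beta>] by (simp add: pos_divide_le_eq)
  define C where "C = max M 0"
  have "\<bar>x $ i\<bar> ^ m * cmod ((dir_deriv (axis j 1) ^^ n) f x) \<le> C * h' ^ (m + n) * fact m powr s * fact n powr \<sigma>" for i j m n and x :: "real^'d"
  proof -
    let ?\<alpha> = "(\<lambda>_. 0)(i := m)" and ?\<beta> = "(\<lambda>_. 0)(j := n)"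
    have "(\<Prod>k\<in>UNIV. (x $ k) ^ ?\<alpha> k) = (\<Prod>k\<in>UNIV. if k = i then (x $ k) ^ m else 1)"
      by (intro prod.cong) auto
    then have p: "mpow x ?\<alpha> = (x $ i) ^ m" by (simp add: mpow_def)
    have "mset (dirs (\<lambda>k::'d. axis k 1 :: real^'d) ?\<beta>) = mset (replicate n (axis j 1))"
      using mset_dirs_upd[of "\<lambda>k. axis k 1 :: real^'d" "\<lambda>_. 0" j n] by (simp add: dirs_0)
    moreover have "set (dirs (\<lambda>k::'d. axis k 1 :: real^'d) ?\<beta>) \<subseteq> Basis"
      using set_dirs[of "\<lambda>k. axis k 1 :: real^'d" ?\<beta>] axis_Basis by blast
    ultimately have d: "pderivs ?\<beta> f = (dir_deriv (axis j 1) ^^ n) f"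
      unfolding pderivs_def multi_deriv_eq_foldr foldr_replicate_dir_deriv[symmetric] by (intro foldr_dir_deriv_mset_cong f)
    have "\<bar>x $ i\<bar> ^ m * cmod ((dir_deriv (axis j 1) ^^ n) f x) \<le> M * (h ^ (m + n) * fact m powr s * fact n powr \<sigma>)"
      using M[of x ?\<alpha> ?\<beta>] by (simp add: p d norm_mult norm_power mabs_mfact_upd power_abs)
    also have "\<dots> \<le> C * (h' ^ (m + n) * fact m powr s * fact n powr \<sigma>)"
      using h by (intro mult_mono mult_right_mono power_mono) (auto simp: C_def)
    finally show ?thesis by (simp only: mult.assoc)
  qed
  moreover have "C \<ge> 0" by (simp add: C_def)
  ultimately show ?thesis by blast
qed

lemma gs_norm_tb:
  fixes f :: "real^'d::finite \<Rightarrow> complex"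
  assumes f: "smooth f" "gs_norm s \<sigma> h f < \<infinity>" and h: "h > 0" "h \<le> h'" and s: "s > 0"
  shows "\<exists>C. gs_decay s \<sigma> h' C f"
proof -
  obtain C where C: "C \<ge> 0" "\<And>i j m n x. \<bar>x $ i\<bar> ^ m * cmod ((dir_deriv (axis j 1) ^^ n) f x) \<le>
    C * h' ^ (m + n) * fact m powr s * fact n powr \<sigma>"
    using gs_norm_bound[OF f h] by blast
  have "gs_decay s \<sigma> h' (exp 1 * C) f"
    unfolding gs_decay_def
  proof (intro conjI allI f)
    fix j n and x :: "real^'d"
    have *: "\<bar>x $ i\<bar> ^ k * cmod ((dir_deriv (axis j 1) ^^ n) f x) \<le> (C * h' ^ n * fact n powr \<sigma>) * h' ^ k * fact k powr s" for i k
      using C(2)[where x=x and i=i and m=k and j=j and n=n] by (simp add: power_add mult_ac)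
    have "cmod ((dir_deriv (axis j 1) ^^ n) f x) \<le> exp 1 * (C * h' ^ n * fact n powr \<sigma>) * exp (- rate CARD('d) s h' * norm x powr (1 / s))"
      by (rule coordinate_decay[OF *]) (use h s C in auto)
    then show "cmod ((dir_deriv (axis j 1) ^^ n) f x) \<le> exp 1 * C * h' ^ n * fact n powr \<sigma> * exp (- rate CARD('d) s h' * norm x powr (1 / s))"
      by (simp only: mult.assoc)
  qed
  then show ?thesis by blast
qed

section \<open>Choice of parameters for the two kinds of classes\<close>

text \<open>For classes with arbitrarily small growth rate: window and scale are fixed, and each
  entry of \<open>r0\<close> solves one of the three inequalities in \<open>gap\<close>.\<close>

lemma gap_small_rate:
  assumes "s > 0" "\<sigma> > 0" "A > 0" "\<rho> > 0" "H > 0" "\<Lambda> \<ge> 1" "d > 0"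
  shows "\<exists>r0>0. \<forall>r. 0 < r \<and> r \<le> r0 \<longrightarrow> gap d s \<sigma> \<Lambda> A \<rho> H (r * cst s \<sigma>)"
proof -
  let ?c = "cst s \<sigma>" and ?R1 = "rate d s (2 * max H A) / 2" and ?R2 = "rate d \<sigma> ((\<Lambda> + 1) * max H A) / 2"
  have c: "?c > 0" using cst_ge1[OF assms(1,2)] by linarith
  have R: "?R1 > 0" "?R2 > 0" using assms by (auto intro!: rate_pos mult_pos_pos simp: less_max_iff_disj)
  define r0 where "r0 = min (\<rho> / 2 / (?c * ?c)) (min (?R1 / (?c * \<Lambda> powr (1 / s))) (?R2 / (?c * ?c)))"
  have "r0 > 0" using c R assms by (simp add: r0_def)
  moreover have "gap d s \<sigma> \<Lambda> A \<rho> H (r * ?c)" if "0 < r \<and> r \<le> r0" for r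
  proof -
    have "r \<le> \<rho> / 2 / (?c * ?c)" "r \<le> ?R1 / (?c * \<Lambda> powr (1 / s))" "r \<le> ?R2 / (?c * ?c)" using that by (auto simp: r0_def)
    then have "r * (?c * ?c) \<le> \<rho> / 2" "r * (?c * \<Lambda> powr (1 / s)) \<le> ?R1" "r * (?c * ?c) \<le> ?R2"
      using c assms by (simp_all add: pos_le_divide_eq)
    then show ?thesis using that assms c unfolding gap_def by (simp add: mult.assoc)
  qed
  ultimately show ?thesis by blast
qed

text \<open>For classes with a fixed growth rate: scales are taken so small that the decay rates
  exceed what \<open>r\<close> demands, and the decay of the window is set to exactly twice the
  growth. For \<open>H \<le> A\<close> the maximum in \<open>gap\<close> is \<open>A\<close>, so one
  choice serves all such \<open>H\<close>.\<close>

lemma gap_small_scale: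
  assumes "s > 0" "\<sigma> > 0" "r > 0" "\<Lambda> \<ge> 1" "d > 0"
  shows "\<exists>A>0. \<exists>\<rho>>0. \<forall>H. 0 < H \<and> H \<le> A \<longrightarrow> gap d s \<sigma> \<Lambda> A \<rho> H r"
proof -
  obtain B1 where B1: "B1 > 0" "\<And>B. 0 < B \<Longrightarrow> B \<le> B1 \<Longrightarrow> rate d s B \<ge> 2 * (r * \<Lambda> powr (1 / s))"
    using rate_unbounded[OF assms(5,1)] by blast
  obtain B2 where B2: "B2 > 0" "\<And>B. 0 < B \<Longrightarrow> B \<le> B2 \<Longrightarrow> rate d \<sigma> B \<ge> 2 * (r * cst s \<sigma>)"
    using rate_unbounded[OF assms(5,2)] by blast
  define A where "A = min (B1 / 2) (B2 / (\<Lambda> + 1))"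
  have A: "A > 0" using B1 B2 assms by (simp add: A_def)
  have "A \<le> B1 / 2" "A \<le> B2 / (\<Lambda> + 1)" unfolding A_def by (rule min.cobounded1, rule min.cobounded2)
  then have "2 * A \<le> B1" "(\<Lambda> + 1) * A \<le> B2" using assms by (auto simp: field_simps)
  then have "2 * (r * \<Lambda> powr (1 / s)) \<le> rate d s (2 * A)" "2 * (r * cst s \<sigma>) \<le> rate d \<sigma> ((\<Lambda> + 1) * A)"
    using A assms by (auto intro!: B1 B2)
  moreover have "2 * (r * cst s \<sigma>) > 0" using cst_ge1[OF assms(1,2)] assms by simp
  ultimately have "\<forall>H. 0 < H \<and> H \<le> A \<longrightarrow> gap d s \<sigma> \<Lambda> A (2 * (r * cst s \<sigma>)) H r"
    using A assms by (auto simp: gap_def max_absorb2)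
  with A \<open>2 * (r * cst s \<sigma>) > 0\<close> show ?thesis by blast
qed

lemma symb_bound_mono:
  fixes u :: "(real^'d::finite) \<times> (real^'d) \<Rightarrow> complex"
  assumes u: "symb_bound s \<sigma> H r M u" and "H > 0" "H \<le> H'" "r \<le> r'"
  shows "symb_bound s \<sigma> H' r' M u"
  unfolding symb_bound_def
proof (intro conjI allI)
  show "smooth u" using u by (simp add: symb_bound_def)
  fix \<alpha> \<beta> z
  have "cmod (mderiv \<alpha> \<beta> u z) \<le> M * (H ^ (mabs \<alpha> + mabs \<beta>) * mfact \<alpha> powr \<sigma> * mfact \<beta> powr s * weight s \<sigma> r z)"
    by (rule u[unfolded symb_bound_def, THEN conjunct2, rule_format])
  also have "\<dots> \<le> M * (H' ^ (mabs \<alpha> + mabs \<beta>) * mfact \<alpha> powr \<sigma> * mfact \<beta> powr s * weight s \<sigma> r' z)"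
    using assms symb_bound_M_nonneg[OF u] weight_pos(2)[of s \<sigma> r z]
    by (intro mult_left_mono mult_mono mult_right_mono power_mono weight_mono mult_nonneg_nonneg) auto
  finally show "cmod (mderiv \<alpha> \<beta> u z) \<le> M * (H' ^ (mabs \<alpha> + mabs \<beta>) * mfact \<alpha> powr \<sigma> * mfact \<beta> powr s * weight s \<sigma> r' z)" .
qed

lemma osc_class_small_rate:
  fixes \<phi> :: "real^'d::finite \<Rightarrow> complex"
  assumes s: "s > 0" "\<sigma> > 0" and win: "window s \<sigma> A \<rho> K \<phi>" and A: "A > 0" "\<rho> > 0"
  shows "osc_class s \<sigma> t \<phi> {u. \<exists>H>0. \<forall>r>0. \<exists>M. symb_bound s \<sigma> H r M u}"
  unfolding osc_class_def
proof (intro ballI conjI)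
  fix u :: "(real^'d) \<times> (real^'d) \<Rightarrow> complex" assume "u \<in> {u. \<exists>H>0. \<forall>r>0. \<exists>M. symb_bound s \<sigma> H r M u}"
  then obtain H where H: "H > 0" "\<And>r. r > 0 \<Longrightarrow> \<exists>M. symb_bound s \<sigma> H r M u" by blast
  have sm: "smooth u" using H(2)[of 1] by (auto simp: symb_bound_def)
  {
    fix e :: "(real^'d) \<times> (real^'d)" assume "e \<in> Basis"
    from sm this obtain \<alpha> \<beta> where "dir_deriv e u = mderiv \<alpha> \<beta> u" by (rule dir_deriv_eq_mderiv)
    then have "\<forall>r>0. \<exists>M. symb_bound s \<sigma> (H * 2 powr (s + \<sigma>)) r M (dir_deriv e u)"
      using H(2) symb_bound_mderiv[OF s H(1)] by metis
    moreover have "H * 2 powr (s + \<sigma>) > 0" using H by simp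
    ultimately show "dir_deriv e u \<in> {u. \<exists>H>0. \<forall>r>0. \<exists>M. symb_bound s \<sigma> H r M u}" by blast
  }
  obtain r where "r > 0" "gap CARD('d) s \<sigma> (1 + \<bar>t\<bar>) A \<rho> H (r * cst s \<sigma>)"
    using gap_small_rate[OF s A H(1), of "1 + \<bar>t\<bar>" "CARD('d)"] by auto
  with win H(2)[of r] show "\<exists>H r M. osc_admissible s \<sigma> t \<phi> H r \<and> symb_bound s \<sigma> H r M u" unfolding osc_admissible_def by blast
qed

lemma bj_symbol_bnd_small_rate:
  fixes \<phi> :: "real^'d::finite \<Rightarrow> complex"
  assumes s: "s > 0" "\<sigma> > 0" and win: "window s \<sigma> A \<rho> K \<phi>" and A: "A > 0" "\<rho> > 0"
    and H: "H > 0" and a: "\<And>r. r > 0 \<Longrightarrow> \<exists>M. symb_bound s \<sigma> H r M a" and r: "r > 0"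
  shows "\<exists>M. symb_bound s \<sigma> (H * 2 powr (s + \<sigma>)) r M (bj_symbol t \<phi> a)"
proof -
  have H': "H * 2 powr (s + \<sigma>) > 0" using H by simp
  obtain r0 where r0: "r0 > 0" "\<And>r. 0 < r \<and> r \<le> r0 \<Longrightarrow> gap CARD('d) s \<sigma> (1 + \<bar>t\<bar>) A \<rho> (H * 2 powr (s + \<sigma>)) (r * cst s \<sigma>)"
    using gap_small_rate[OF s A H', of "1 + \<bar>t\<bar>" "CARD('d)"] by auto
  have c: "cst s \<sigma> > 0" using cst_ge1[OF s] by linarith
  \<comment> \<open>Besides satisfying \<open>gap\<close>, the rate must leave room for the factor
    \<open>cst s \<sigma>\<close> by which the averaged symbol grows faster.\<close>
  define r' where "r' = min r0 (r / cst s \<sigma>)"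
  have r': "r' > 0" "r' \<le> r0" using r0 r c by (auto simp: r'_def)
  have "r' \<le> r / cst s \<sigma>" by (simp add: r'_def)
  then have rc: "r' * cst s \<sigma> \<le> r" using c by (simp add: pos_le_divide_eq)
  obtain M where M: "symb_bound s \<sigma> H r' M a" using a r' by blast
  have "osc_admissible s \<sigma> t \<phi> (H * 2 powr (s + \<sigma>)) r'" unfolding osc_admissible_def using win r0(2) r' by blast
  from bj_symbol_bnd[OF s osc_class_small_rate[OF s win A] _ M H this]
  obtain M' where "symb_bound s \<sigma> (H * 2 powr (s + \<sigma>)) (r' * cst s \<sigma>) M' (bj_symbol t \<phi> a)" using H a by blast
  from symb_bound_mono[OF this H' order_refl rc] show ?thesis by blast
qed

lemma osc_class_small_scale:
  fixes \<phi> :: "real^'d::finite \<Rightarrow> complex"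
  assumes s: "s > 0" "\<sigma> > 0" and win: "\<And>A \<rho>. A > 0 \<Longrightarrow> \<rho> > 0 \<Longrightarrow> \<exists>K. window s \<sigma> A \<rho> K \<phi>"
  shows "osc_class s \<sigma> t \<phi> {u. \<exists>r>0. \<forall>H>0. \<exists>M. symb_bound s \<sigma> H r M u}"
  unfolding osc_class_def
proof (intro ballI conjI)
  fix u :: "(real^'d) \<times> (real^'d) \<Rightarrow> complex" assume "u \<in> {u. \<exists>r>0. \<forall>H>0. \<exists>M. symb_bound s \<sigma> H r M u}"
  then obtain r where r: "r > 0" "\<And>H. H > 0 \<Longrightarrow> \<exists>M. symb_bound s \<sigma> H r M u" by blast
  have sm: "smooth u" using r(2)[of 1] by (auto simp: symb_bound_def)
  {
    fix e :: "(real^'d) \<times> (real^'d)" assume "e \<in> Basis"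
    from sm this obtain \<alpha> \<beta> where d: "dir_deriv e u = mderiv \<alpha> \<beta> u" by (rule dir_deriv_eq_mderiv)
    have "\<exists>M. symb_bound s \<sigma> H r M (dir_deriv e u)" if "H > 0" for H
    proof -
      have H: "H / 2 powr (s + \<sigma>) > 0" using that by simp
      then obtain M where "symb_bound s \<sigma> (H / 2 powr (s + \<sigma>)) r M u" using r(2) by blast
      from symb_bound_mderiv[OF s H this, of \<alpha> \<beta>] show ?thesis unfolding d by auto
    qed
    with r(1) show "dir_deriv e u \<in> {u. \<exists>r>0. \<forall>H>0. \<exists>M. symb_bound s \<sigma> H r M u}" by blast
  }
  have "r * cst s \<sigma> > 0" using r cst_ge1[OF s] by simp
  then obtain A \<rho> where A: "A > 0" "\<rho> > 0" "gap CARD('d) s \<sigma> (1 + \<bar>t\<bar>) A \<rho> A (r * cst s \<sigma>)"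
    using gap_small_scale[OF s, of "r * cst s \<sigma>" "1 + \<bar>t\<bar>" "CARD('d)"] by auto
  with win r(2)[OF A(1)] show "\<exists>H r M. osc_admissible s \<sigma> t \<phi> H r \<and> symb_bound s \<sigma> H r M u" unfolding osc_admissible_def by blast
qed

lemma bj_symbol_bnd_small_scale:
  fixes \<phi> :: "real^'d::finite \<Rightarrow> complex"
  assumes s: "s > 0" "\<sigma> > 0" and win: "\<And>A \<rho>. A > 0 \<Longrightarrow> \<rho> > 0 \<Longrightarrow> \<exists>K. window s \<sigma> A \<rho> K \<phi>"
    and r: "r > 0" and a: "\<And>H. H > 0 \<Longrightarrow> \<exists>M. symb_bound s \<sigma> H r M a" and H: "H > 0"
  shows "\<exists>M. symb_bound s \<sigma> H (r * cst s \<sigma>) M (bj_symbol t \<phi> a)"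
proof -
  have "r * cst s \<sigma> > 0" using r cst_ge1[OF s] by simp
  then obtain A \<rho> where A: "A > 0" "\<rho> > 0" "\<And>H. 0 < H \<and> H \<le> A \<Longrightarrow> gap CARD('d) s \<sigma> (1 + \<bar>t\<bar>) A \<rho> H (r * cst s \<sigma>)"
    using gap_small_scale[OF s, of "r * cst s \<sigma>" "1 + \<bar>t\<bar>" "CARD('d)"] by auto
  define H' where "H' = min H A"
  have H': "H' > 0" "H' \<le> H" "H' \<le> A" using H A by (auto simp: H'_def)
  \<comment> \<open>The scale of the input is reduced in advance by the factor that estimating
    derivatives costs.\<close>
  let ?h = "H' / 2 powr (s + \<sigma>)"
  have h: "?h > 0" using H' by simp
  obtain M where M: "symb_bound s \<sigma> ?h r M a" using a h by blast
  have "osc_admissible s \<sigma> t \<phi> (?h * 2 powr (s + \<sigma>)) r" 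
    unfolding osc_admissible_def using win[OF A(1,2)] A(3)[of H'] H' by auto
  from bj_symbol_bnd[OF s osc_class_small_scale[OF s win] _ M h this]
  obtain M' where "symb_bound s \<sigma> H' (r * cst s \<sigma>) M' (bj_symbol t \<phi> a)" using r a by auto
  from symb_bound_mono[OF this H'(1,2) order_refl] show ?thesis by blast
qed

lemma Gamma_lower_iff:
  fixes u :: "(real^'d::finite) \<times> (real^'d) \<Rightarrow> complex"
  shows "u \<in> Gamma_lower s \<sigma> \<longleftrightarrow> (\<exists>H>0. \<forall>r>0. \<exists>M. symb_bound s \<sigma> H r M u)"
proof -
  have "smooth u" if "\<exists>H>0. \<forall>r>0. \<exists>M. symb_bound s \<sigma> H r M u"
    using that zero_less_one[where 'a=real] unfolding symb_bound_def by blast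
  then show ?thesis unfolding Gamma_lower_def using symb_norm_finite_iff[of _ u s \<sigma>] by blast
qed

lemma Gamma_upper_iff:
  fixes u :: "(real^'d::finite) \<times> (real^'d) \<Rightarrow> complex"
  shows "u \<in> Gamma_upper s \<sigma> \<longleftrightarrow> (\<exists>r>0. \<forall>H>0. \<exists>M. symb_bound s \<sigma> H r M u)"
proof -
  have "smooth u" if "\<exists>r>0. \<forall>H>0. \<exists>M. symb_bound s \<sigma> H r M u"
    using that zero_less_one[where 'a=real] unfolding symb_bound_def by blast
  then show ?thesis unfolding Gamma_upper_def using symb_norm_finite_iff[of _ u s \<sigma>] by blast
qed

lemma Gamma_both_iff:
  fixes u :: "(real^'d::finite) \<times> (real^'d) \<Rightarrow> complex"
  shows "u \<in> Gamma_both s \<sigma> \<longleftrightarrow> (\<forall>H>0. \<forall>r>0. \<exists>M. symb_bound s \<sigma> H r M u)"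
proof -
  have "smooth u" if "\<forall>H>0. \<forall>r>0. \<exists>M. symb_bound s \<sigma> H r M u"
    using that zero_less_one[where 'a=real] unfolding symb_bound_def by blast
  then show ?thesis unfolding Gamma_both_def using symb_norm_finite_iff[of _ u s \<sigma>] by blast
qed

text \<open>\<open>osc_duality\<close> with \<open>\<mu> = \<tau> - t\<close>, averaged over \<tau>.
  Fubini is used on both sides: to take the average out of the symbol, and to put it into the Wigner
  distribution.\<close>

lemma wigner_BJ_duality:
  fixes a :: "(real^'d::finite) \<times> (real^'d) \<Rightarrow> complex" and \<phi> g f :: "real^'d \<Rightarrow> complex"
  assumes s: "s > 0" "\<sigma> > 0" and win: "window s \<sigma> A \<rho>w Kw \<phi>" and \<phi>1: "(LINT \<eta>|lborel. \<phi> \<eta>) = 1"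
    and gap: "gap CARD('d) s \<sigma> (1 + \<bar>t\<bar>) A \<rho>w H (r * cst s \<sigma>)"
    and a: "symb_bound s \<sigma> H r M a" and H: "H > 0" "r > 0"
    and wigner_bounds: "wigner_bounds s \<sigma> (1 + \<bar>t\<bar>) \<rho> K g f" and \<rho>: "\<rho> > 0" "r * cst s \<sigma> \<le> \<rho> / 4"
  shows "distribution_of a (wigner_BJ g f) = distribution_of (bj_symbol t \<phi> a) (wigner t g f)"
proof -
  define rc where "rc = r * cst s \<sigma>"
  have rc: "r \<le> rc" "rc \<le> \<rho> / 4" using H \<rho> cst_ge1[OF s] by (simp_all add: rc_def)
  define e where "e X = exp (- (\<rho> / 2) * norm (fst X) powr (1 / s)) * exp (- (\<rho> / 2) * norm (snd X) powr (1 / \<sigma>))" for X :: "(real^'d) \<times> (real^'d)"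
  have int_e: "integrable lborel e" unfolding e_def[abs_def] using \<rho> s by (intro integrable_exp_powr_prod) auto
  have int_i: "integrable lborel (indicat_real {0..1::real})" by (rule integrable_real_indicator) auto
  obtain C where C: "C \<ge> 0" "\<And>\<mu> M v. \<bar>\<mu>\<bar> \<le> 1 + \<bar>t\<bar> \<Longrightarrow> slice_bound s \<sigma> H rc M v \<Longrightarrow> cmod (osc \<mu> \<phi> v) \<le> C * M"
    using osc_bound[OF s win gap] unfolding rc_def by blast
  have M: "M \<ge> 0" by (rule symb_bound_M_nonneg[OF a])
  have ca: "continuous_on UNIV a" using a by (auto simp: symb_bound_def intro: smooth_continuous)
  have c\<phi>: "continuous_on UNIV \<phi>" by (rule window_bounds(1)[OF win])
  have cg: "continuous_on UNIV g" "continuous_on UNIV f" using wigner_bounds by (auto simp: wigner_bounds_def)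
  have wb: "cmod (wigner \<tau> g f (x, \<xi>)) \<le> K * exp (- \<rho> * norm x powr (1 / s)) * exp (- \<rho> * norm \<xi> powr (1 / \<sigma>))"
    if "\<bar>\<tau>\<bar> \<le> 1 + \<bar>t\<bar>" for \<tau> x \<xi>
    using wigner_bounds that unfolding wigner_bounds_def by blast
  have K: "K \<ge> 0"
  proof -
    have "0 \<le> K * exp (- \<rho> * norm (0::real^'d) powr (1 / s)) * exp (- \<rho> * norm (0::real^'d) powr (1 / \<sigma>))"
      using wb[of 0 0 0] norm_ge_zero[of "wigner 0 g f (0, 0)"] by linarith
    then show ?thesis by (simp add: zero_le_mult_iff)
  qed
  \<comment> \<open>Growth of rate at most \<rho> / 4 against decay of rate \<rho> leaves at least
    \<rho> / 2, in both variables at once.\<close>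
  have prod: "b * weight s \<sigma> rc X * cmod (wigner \<tau> g f X) \<le> b * K * e X" if "\<bar>\<tau>\<bar> \<le> 1 + \<bar>t\<bar>" "b \<ge> 0" for b \<tau> X
  proof -
    obtain x \<xi> where X: "X = (x, \<xi>)" by (cases X)
    have "b * weight s \<sigma> rc X * cmod (wigner \<tau> g f X) \<le>
      b * weight s \<sigma> (\<rho> / 4) X * (K * exp (- \<rho> * norm x powr (1 / s)) * exp (- \<rho> * norm \<xi> powr (1 / \<sigma>)))"
      unfolding X using that(2) rc weight_pos(2) by (intro mult_mono wb that weight_mono mult_nonneg_nonneg) auto
    also have "\<dots> = b * K * (weight s \<sigma> (\<rho> / 4) X * (exp (- \<rho> * norm x powr (1 / s)) * exp (- \<rho> * norm \<xi> powr (1 / \<sigma>))))"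
      by (simp only: mult_ac)
    also have "\<dots> \<le> b * K * e X"
    proof (rule mult_left_mono)
      have "(\<rho> / 4) * norm x powr (1 / s) \<le> (\<rho> / 2) * norm x powr (1 / s)" "(\<rho> / 4) * norm \<xi> powr (1 / \<sigma>) \<le> (\<rho> / 2) * norm \<xi> powr (1 / \<sigma>)"
        using \<rho> by (auto intro!: mult_right_mono)
      then show "weight s \<sigma> (\<rho> / 4) X * (exp (- \<rho> * norm x powr (1 / s)) * exp (- \<rho> * norm \<xi> powr (1 / \<sigma>))) \<le> e X"
        unfolding weight_def e_def exp_add[symmetric] X by (simp add: algebra_simps)
    qed (use that K in simp)
    finally show ?thesis .
  qed
  have ob: "cmod (osc \<mu> \<phi> (\<lambda>z. a (X + z))) \<le> C * M * weight s \<sigma> rc X" if "\<bar>\<mu>\<bar> \<le> 1 + \<bar>t\<bar>" for \<mu> X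
    using C(2)[OF that slice_bound_translate[OF s a H, of X, folded rc_def]] by (simp only: mult.assoc)
  have ab: "cmod (a X) \<le> M * weight s \<sigma> rc X" for X
  proof -
    have "cmod (a X) \<le> M * weight s \<sigma> r X"
      using a[unfolded symb_bound_def, THEN conjunct2, rule_format, where \<alpha>="\<lambda>_. 0" and \<beta>="\<lambda>_. 0" and z=X]
      by (simp add: mabs_0 mfact_0 mderiv_0)
    also have "\<dots> \<le> M * weight s \<sigma> rc X" using M rc by (intro mult_left_mono weight_mono)
    finally show ?thesis .
  qed
  have cnjm: "(\<lambda>z. cnj (h z)) \<in> borel_measurable borel" if "h \<in> borel_measurable borel" for h :: "'q::euclidean_space \<Rightarrow> complex"
    using that by (rule measurable_compose) (intro borel_measurable_continuous_onI continuous_intros)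
  have Wm: "(\<lambda>q. wigner (\<tau> q) g f (X q)) \<in> borel_measurable borel"
    if "continuous_on UNIV \<tau>" "continuous_on UNIV X" for \<tau> and X :: "'q::euclidean_space \<Rightarrow> (real^'d) \<times> (real^'d)"
    using wigner_measurable[OF cg that(1) continuous_on_fst[OF that(2)] continuous_on_snd[OF that(2)]] by simp
  have im: "(\<lambda>q. complex_of_real (indicator {0..1} (snd q))) \<in> borel_measurable (borel :: (((real^'d) \<times> (real^'d)) \<times> real) measure)"
  proof -
    have "(\<lambda>\<tau>::real. complex_of_real (indicator {0..1} \<tau>)) \<in> borel_measurable borel" by measurable
    then show ?thesis
      by (rule measurable_compose[rotated]) (intro borel_measurable_continuous_onI continuous_on_snd continuous_on_id)
  qed
  let ?i = "\<lambda>\<tau>::real. complex_of_real (indicator {0..1} \<tau>)"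
  have "distribution_of (bj_symbol t \<phi> a) (wigner t g f) =
     (LINT X|lborel. LINT \<tau>|lborel. ?i \<tau> * (osc (\<tau> - t) \<phi> (\<lambda>z. a (X + z)) * cnj (wigner t g f X)))"
    unfolding distribution_of_def bj_symbol_def set_lebesgue_integral_def integral_mult_left_zero[symmetric]
    by (simp only: scaleR_conv_of_real mult.assoc)
  also have "\<dots> = (LINT \<tau>|lborel. LINT X|lborel. ?i \<tau> * (osc (\<tau> - t) \<phi> (\<lambda>z. a (X + z)) * cnj (wigner t g f X)))"
  proof (rule fubini_dominated(3)[OF _ _ integrable_mult_right[OF int_e] int_i])
    show "(\<lambda>z. ?i (snd z) * (osc (snd z - t) \<phi> (\<lambda>y. a (fst z + y)) * cnj (wigner t g f (fst z)))) \<in> borel_measurable borel"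
      by (intro borel_measurable_times im osc_measurable(2) ca c\<phi> cnjm Wm continuous_on_diff continuous_on_fst continuous_on_snd
        continuous_on_const continuous_on_id)
    show "norm (?i \<tau> * (osc (\<tau> - t) \<phi> (\<lambda>y. a (X + y)) * cnj (wigner t g f X))) \<le> (C * M) * K * e X * indicator {0..1} \<tau>" for X \<tau>
    proof (cases "\<tau> \<in> {0..1}")
      case True
      have "cmod (osc (\<tau> - t) \<phi> (\<lambda>y. a (X + y))) * cmod (wigner t g f X) \<le> C * M * weight s \<sigma> rc X * cmod (wigner t g f X)"
        using True by (intro mult_right_mono ob) auto
      also have "\<dots> \<le> (C * M) * K * e X" using C M by (intro prod) auto
      finally show ?thesis using True by (simp add: norm_mult)
    qed simp
  qed
  also have "\<dots> = (LINT \<tau>|lborel. LINT X|lborel. ?i \<tau> * (a X * cnj (wigner \<tau> g f X)))"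
  proof (rule Bochner_Integration.integral_cong[OF refl])
    fix \<tau> :: real
    have "(LINT X|lborel. osc (\<tau> - t) \<phi> (\<lambda>z. a (X + z)) * cnj (wigner t g f X)) = (LINT X|lborel. a X * cnj (wigner \<tau> g f X))" if "\<tau> \<in> {0..1}"
    proof -
      have "\<bar>\<tau> - t\<bar> \<le> 1 + \<bar>t\<bar>" "\<bar>t\<bar> \<le> 1 + \<bar>t\<bar>" "\<bar>t + (\<tau> - t)\<bar> \<le> 1 + \<bar>t\<bar>" using that by auto
      from osc_duality[OF s win \<phi>1 gap this(1) a H wigner_bounds \<rho> this(2,3)] show ?thesis by simp
    qed
    then show "(LINT X|lborel. ?i \<tau> * (osc (\<tau> - t) \<phi> (\<lambda>z. a (X + z)) * cnj (wigner t g f X))) = (LINT X|lborel. ?i \<tau> * (a X * cnj (wigner \<tau> g f X)))"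
      unfolding integral_mult_right_zero by (auto simp: indicator_def)
  qed
  also have "\<dots> = (LINT X|lborel. LINT \<tau>|lborel. ?i \<tau> * (a X * cnj (wigner \<tau> g f X)))"
  proof (rule fubini_dominated(3)[symmetric, OF _ _ integrable_mult_right[OF int_e] int_i])
    show "(\<lambda>z. ?i (snd z) * (a (fst z) * cnj (wigner (snd z) g f (fst z)))) \<in> borel_measurable borel"
      by (intro borel_measurable_times im cnjm Wm borel_measurable_continuous_onI continuous_on_compose2[OF ca] continuous_on_fst continuous_on_snd
        continuous_on_const continuous_on_id subset_UNIV)
    show "norm (?i \<tau> * (a X * cnj (wigner \<tau> g f X))) \<le> M * K * e X * indicator {0..1} \<tau>" for X \<tau>
    proof (cases "\<tau> \<in> {0..1}")
      case True
      have "cmod (a X) * cmod (wigner \<tau> g f X) \<le> M * weight s \<sigma> rc X * cmod (wigner \<tau> g f X)"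
        by (intro mult_right_mono ab) auto
      also have "\<dots> \<le> M * K * e X" using True M by (intro prod) auto
      finally show ?thesis using True by (simp add: norm_mult)
    qed simp
  qed
  also have "\<dots> = distribution_of a (wigner_BJ g f)"
    unfolding distribution_of_def wigner_BJ_def set_lebesgue_integral_def Bochner_Integration.integral_cnj[symmetric]
      integral_mult_right_zero[symmetric] scaleR_conv_of_real
    by (simp add: mult_ac)
  finally show ?thesis ..
qed

lemma GS_Sigma_subset: "GS_Sigma s \<sigma> \<subseteq> GS_S s \<sigma>"
  using zero_less_one[where 'a=real] unfolding GS_Sigma_def GS_S_def by blast

text \<open>Taylor expansion of \<open>f\<close> around a point at distance \<open>R\<close> from \<open>x0\<close> in direction \<open>j\<close>, with the terms
  controlled by \<open>x\<^sub>j\<^sup>k\<^sup>+\<^sup>1 \<partial>\<^sub>j\<^sup>k f\<close>, bounds \<open>R \<bar>f x0\<bar>\<close> independently of \<open>R\<close>.\<close>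

lemma GS_Sigma_trivial:
  fixes f :: "real^'d::finite \<Rightarrow> complex"
  assumes s: "s > 0" "\<sigma> > 0" "s + \<sigma> = 1" and f: "f \<in> GS_Sigma s \<sigma>"
  shows "f x0 = 0"
proof (rule ccontr)
  assume nz: "f x0 \<noteq> 0"
  define j :: 'd where "j = undefined"
  let ?v = "axis j 1 :: real^'d"
  define D where "D n = (dir_deriv ?v ^^ n) f" for n
  \<comment> \<open>At scale 1/4 the Taylor coefficients of order \<open>m\<close> carry (1/4)^(2
    m), which survives a factor 2^m from comparing \<open>R\<close> with the coordinate and another
    2^m that bounds (m + 1)^s.\<close>
  have sm: "smooth f" and fin: "gs_norm s \<sigma> (1/4) f < \<infinity>" using f by (auto simp: GS_Sigma_def)
  obtain C where C: "C \<ge> 0" "\<And>i j m n x. \<bar>x $ i\<bar> ^ m * cmod ((dir_deriv (axis j 1) ^^ n) f x) \<le>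
    C * (1/4) ^ (m + n) * fact m powr s * fact n powr \<sigma>"
    using gs_norm_bound[OF sm fin, of "1/4"] by auto
  have Dd: "has_dd ?v (D n) (D (Suc n))" for n
    unfolding D_def using smooth_has_dd[OF smooth_funpow[OF sm axis_Basis] axis_Basis] by simp
  \<comment> \<open>Multiplying by the conjugate of \<open>f x0\<close> and taking real parts makes
    the real Maclaurin theorem applicable and turns the value at \<open>x0\<close> into its squared
    modulus.\<close>
  define c where "c = cnj (f x0)"
  \<comment> \<open>The first entry forces \<bar>X_j\<bar> \<ge> R / 2, so that powers of
    \<open>R\<close> are controlled by powers of the coordinate; the second contradicts the final
    bound on \<open>R\<close> times the modulus of \<open>f x0\<close>.\<close>
  define R where "R = max (2 * \<bar>x0 $ j\<bar>) ((C + 1) / cmod (f x0)) + 1"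
  have R: "R > 0" "R > 2 * \<bar>x0 $ j\<bar>" "R > (C + 1) / cmod (f x0)" by (auto simp: R_def max_def)
  define X where "X = x0 + R *\<^sub>R ?v"
  have Xj: "R \<le> 2 * \<bar>X $ j\<bar>" unfolding X_def using R by (simp add: axis_def)
  define diff where "diff n \<tau> = Re (c * D n (X + \<tau> *\<^sub>R ?v))" for n \<tau>
  have der: "DERIV (diff n) \<tau> :> diff (Suc n) \<tau>" for n \<tau>
  proof -
    have "((\<lambda>\<tau>. D n (X + \<tau> *\<^sub>R ?v)) has_vector_derivative D (Suc n) (X + \<tau> *\<^sub>R ?v)) (at \<tau>)"
      by (rule has_dd_line[OF Dd])
    from bounded_linear.has_vector_derivative[OF bounded_linear_Re has_vector_derivative_mult_right[OF this, of c]]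
    show ?thesis unfolding diff_def has_real_derivative_iff_has_vector_derivative by simp
  qed
  have fact_le: "fact n powr \<sigma> * fact n powr s = fact n" for n
    using s by (simp add: powr_add[symmetric] add.commute)
  have term_bd: "\<bar>diff m 0 / fact m * (- R) ^ m\<bar> * R \<le> cmod c * C / 2 * (1/4) ^ m" for m
  proof -
    have "R ^ Suc m \<le> (2 * \<bar>X $ j\<bar>) ^ Suc m" using R Xj by (intro power_mono) auto
    then have "R ^ Suc m * cmod (D m X) \<le> 2 ^ Suc m * (\<bar>X $ j\<bar> ^ Suc m * cmod (D m X))"
      by (simp add: mult_right_mono power_mult_distrib mult.assoc[symmetric] del: power_Suc)
    also have "\<dots> \<le> 2 ^ Suc m * (C * (1/4) ^ (Suc m + m) * fact (Suc m) powr s * fact m powr \<sigma>)"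
      unfolding D_def by (intro mult_left_mono C(2)) auto
    also have "\<dots> = 2 ^ Suc m * (C * (1/4) ^ (Suc m + m) * (real (Suc m) powr s * fact m powr s) * fact m powr \<sigma>)"
      by (simp add: powr_mult del: of_nat_Suc power_Suc)
    also have "\<dots> = 2 ^ Suc m * C * (1/4) ^ (Suc m + m) * real (Suc m) powr s * (fact m powr \<sigma> * fact m powr s)"
      by (simp only: mult_ac)
    also have "\<dots> = 2 ^ Suc m * C * (1/4) ^ (Suc m + m) * real (Suc m) powr s * fact m" unfolding fact_le ..
    also have "\<dots> \<le> 2 ^ Suc m * C * (1/4) ^ (Suc m + m) * 2 ^ m * fact m"
    proof -
      have "real (Suc m) powr s \<le> real (Suc m) powr 1" using s by (intro powr_mono) auto
      also have "\<dots> = real (Suc m)" by simp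
      also have "\<dots> \<le> real (2 ^ m)" unfolding of_nat_le_iff by (rule Suc_leI[OF less_exp])
      finally show ?thesis using C(1) by (intro mult_right_mono mult_left_mono) auto
    qed
    also have "\<dots> = C / 2 * (2 ^ m * 2 ^ m * (1/4) ^ m * (1/4) ^ m) * fact m" by (simp add: power_add)
    also have "2 ^ m * 2 ^ m * (1/4) ^ m * (1/4) ^ m = ((1/4)::real) ^ m" by (simp flip: power_mult_distrib)
    finally have *: "R ^ Suc m * cmod (D m X) \<le> C / 2 * (1/4) ^ m * fact m" .
    have "\<bar>diff m 0 / fact m * (- R) ^ m\<bar> * R = \<bar>diff m 0\<bar> * R ^ Suc m / fact m"
      using R by (simp add: abs_mult power_abs)
    also have "\<dots> \<le> (cmod c * cmod (D m X)) * R ^ Suc m / fact m"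
      using R abs_Re_le_cmod[of "c * D m X"] by (intro divide_right_mono mult_right_mono) (auto simp: diff_def norm_mult)
    also have "\<dots> = cmod c * (R ^ Suc m * cmod (D m X)) / fact m" by (simp only: mult_ac)
    also have "\<dots> \<le> cmod c * (C / 2 * (1/4) ^ m * fact m) / fact m"
      by (intro divide_right_mono mult_left_mono *) auto
    finally show ?thesis by simp
  qed
  \<comment> \<open>For the remainder \<open>R\<close> is fixed: \<open>R ^ n\<close> is at most a
    constant times \<open>fact n powr s\<close>, which with the derivative bound cancels
    \<open>fact n\<close>, and (1/4)^n makes the rest small uniformly in \<tau>. No power of the
    coordinate is needed here.\<close>
  have "\<exists>n. \<forall>\<tau>. \<bar>diff n \<tau> / fact n * (- R) ^ n\<bar> * R \<le> cmod c"
  proof -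
    define y where "y = R powr (1 / s)"
    have y: "y \<ge> 0" by (simp add: y_def)
    have "(\<lambda>n. (exp y powr s * C * R) * (1/4) ^ n) \<longlonglongrightarrow> (exp y powr s * C * R) * 0"
      by (intro tendsto_mult_left LIMSEQ_realpow_zero) auto
    then have "eventually (\<lambda>n. (exp y powr s * C * R) * (1/4) ^ n < 1) sequentially"
      by (intro order_tendstoD(2)) auto
    then obtain n where n: "(exp y powr s * C * R) * (1/4) ^ n < 1" by (auto simp: eventually_sequentially)
    have "\<bar>diff n \<tau> / fact n * (- R) ^ n\<bar> * R \<le> cmod c" for \<tau>
    proof -
      let ?Y = "X + \<tau> *\<^sub>R ?v"
      have "(y ^ n / fact n) powr s \<le> exp y powr s"
        using s y by (intro powr_mono2 power_div_fact_le_exp) auto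
      also have "(y ^ n / fact n) powr s = R ^ n / fact n powr s"
      proof -
        have y0: "y > 0" using R by (simp add: y_def)
        have "(y ^ n) powr s = (y powr real n) powr s" using y0 by (simp add: powr_realpow)
        also have "\<dots> = (y powr s) powr real n" by (simp only: powr_powr mult.commute)
        also have "\<dots> = (y powr s) ^ n" using y0 by (intro powr_realpow) simp
        finally show ?thesis using R s y by (simp add: powr_divide y_def powr_powr)
      qed
      finally have Rn: "R ^ n \<le> exp y powr s * fact n powr s" by (simp add: pos_divide_le_eq)
      have Dn: "cmod (D n ?Y) \<le> C * (1/4) ^ n * fact n powr \<sigma>"
        using C(2)[where x="?Y" and i=j and m=0 and j=j and n=n] unfolding D_def by simp
      have "\<bar>diff n \<tau> / fact n * (- R) ^ n\<bar> * R = \<bar>diff n \<tau>\<bar> * R ^ n * R / fact n"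
        using R by (simp add: abs_mult power_abs)
      also have "\<dots> \<le> (cmod c * (C * (1/4) ^ n * fact n powr \<sigma>)) * (exp y powr s * fact n powr s) * R / fact n"
      proof (intro divide_right_mono mult_mono Rn mult_nonneg_nonneg)
        have "\<bar>diff n \<tau>\<bar> \<le> cmod c * cmod (D n ?Y)"
          using abs_Re_le_cmod[of "c * D n ?Y"] by (simp add: diff_def norm_mult)
        also have "\<dots> \<le> cmod c * (C * (1/4) ^ n * fact n powr \<sigma>)" by (intro mult_left_mono Dn) auto
        finally show "\<bar>diff n \<tau>\<bar> \<le> cmod c * (C * (1/4) ^ n * fact n powr \<sigma>)" .
      qed (use R C in auto)
      also have "\<dots> = cmod c * ((exp y powr s * C * R) * (1/4) ^ n) * (fact n powr \<sigma> * fact n powr s) / fact n"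
        by (simp only: mult_ac)
      also have "\<dots> = cmod c * ((exp y powr s * C * R) * (1/4) ^ n)" unfolding fact_le by simp
      also have "\<dots> \<le> cmod c * 1" using n by (intro mult_left_mono) auto
      finally show ?thesis by simp
    qed
    then show ?thesis by blast
  qed
  then obtain n where n: "\<And>\<tau>. \<bar>diff n \<tau> / fact n * (- R) ^ n\<bar> * R \<le> cmod c" by blast
  obtain \<tau> where \<tau>: "diff 0 (- R) = (\<Sum>m<n. diff m 0 / fact m * (- R) ^ m) + diff n \<tau> / fact n * (- R) ^ n"
    using Maclaurin_all_le[of diff "diff 0" "- R" n] der by auto
  have "diff 0 (- R) = (cmod (f x0))\<^sup>2"
    unfolding diff_def c_def D_def X_def cmod_power2 by (simp add: power2_eq_square)
  then have "(cmod (f x0))\<^sup>2 * R = ((\<Sum>m<n. diff m 0 / fact m * (- R) ^ m) + diff n \<tau> / fact n * (- R) ^ n) * R"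
    using \<tau> by simp
  also have "\<dots> \<le> (\<Sum>m<n. \<bar>diff m 0 / fact m * (- R) ^ m\<bar> * R) + \<bar>diff n \<tau> / fact n * (- R) ^ n\<bar> * R"
    unfolding distrib_right sum_distrib_right by (intro add_mono sum_mono mult_right_mono abs_ge_self) (use R in auto)
  also have "\<dots> \<le> (\<Sum>m<n. cmod c * C / 2 * (1/4) ^ m) + cmod c"
    by (intro add_mono sum_mono term_bd n)
  also have "(\<Sum>m<n. cmod c * C / 2 * (1/4) ^ m) = cmod c * C / 2 * (\<Sum>m<n. (1/4) ^ m)"
    by (simp add: sum_distrib_left)
  also have "\<dots> \<le> cmod c * C / 2 * 2"
  proof (intro mult_left_mono)
    show "(\<Sum>m<n. (1/4) ^ m) \<le> (2::real)" by (subst sum_gp_strict) (simp add: field_simps)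
  qed (use C in simp)
  finally have "cmod (f x0) * (cmod (f x0) * R) \<le> cmod (f x0) * (C + 1)"
    by (simp add: c_def power2_eq_square algebra_simps)
  then have "cmod (f x0) * R \<le> C + 1" using nz by simp
  moreover have "C + 1 < cmod (f x0) * R" using R(3) nz by (simp add: pos_divide_less_eq mult.commute)
  ultimately show False by simp
qed

lemma Op_BJ_eq_OpI:
  assumes "\<And>f g. f \<in> V \<Longrightarrow> g \<in> V \<Longrightarrow> u (wigner_BJ g f) = v (wigner t g f)"
  shows "Op_BJ V u = Op V t v"
  unfolding Op_BJ_def Op_def by (intro restrict_ext) (simp add: assms)

text \<open>The test functions come first: their scale fixes the decay rate of all Wigner
  distributions involved, and the growth rate of the symbol, which is at disposal, is chosen below
  it and small enough for \<open>gap\<close>.\<close>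

lemma BJ_lower:
  fixes a :: "(real^'d::finite) \<times> (real^'d) \<Rightarrow> complex"
  assumes s: "s > 0" "\<sigma> > 0" and win: "window s \<sigma> A \<rho> K \<phi>" and A: "A > 0" "\<rho> > 0" and \<phi>: "(LINT \<eta>|lborel. \<phi> \<eta>) = 1"
    and H: "H > 0" and a: "\<And>r. r > 0 \<Longrightarrow> \<exists>M. symb_bound s \<sigma> H r M a" and fg: "f \<in> GS_S s \<sigma>" "g \<in> GS_S s \<sigma>"
  shows "distribution_of a (wigner_BJ g f) = distribution_of (bj_symbol t \<phi> a) (wigner t g f)"
proof -
  obtain h1 h2 where h: "h1 > 0" "h2 > 0" and fin: "gs_norm s \<sigma> h1 f < \<infinity>" "gs_norm s \<sigma> h2 g < \<infinity>" and sm: "smooth f" "smooth g"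
    using fg unfolding GS_S_def by blast
  define h where "h = max h1 h2"
  have hh: "h > 0" "h1 \<le> h" "h2 \<le> h" using h by (auto simp: h_def)
  obtain C1 C2 where "gs_decay s \<sigma> h C1 f" "gs_decay s \<sigma> h C2 g"
    using gs_norm_tb[OF sm(1) fin(1) h(1) hh(2) s(1)] gs_norm_tb[OF sm(2) fin(2) h(2) hh(3) s(1)] by blast
  then have gs_decay: "gs_decay s \<sigma> h (max C1 C2) f" "gs_decay s \<sigma> h (max C1 C2) g" using hh by (auto elim!: gs_decay_mono)
  define \<rho>' where "\<rho>' = min (rate CARD('d) s h / (2 * (2 + 2 * (1 + \<bar>t\<bar>)) powr (1 / s))) (rate CARD('d) \<sigma> (2 * ((1 + (1 + \<bar>t\<bar>)) * h)))"
  have \<rho>': "\<rho>' > 0" unfolding \<rho>'_def using hh by (auto intro!: rate_pos divide_pos_pos mult_pos_pos)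
  obtain K' where wigner_bounds: "wigner_bounds s \<sigma> (1 + \<bar>t\<bar>) \<rho>' K' g f"
    using wigner_decay[OF s hh(1) _ gs_decay(2,1), of "1 + \<bar>t\<bar>"] unfolding \<rho>'_def by auto
  obtain r0 where r0: "r0 > 0" "\<And>r. 0 < r \<and> r \<le> r0 \<Longrightarrow> gap CARD('d) s \<sigma> (1 + \<bar>t\<bar>) A \<rho> H (r * cst s \<sigma>)"
    using gap_small_rate[OF s A H, of "1 + \<bar>t\<bar>" "CARD('d)"] by auto
  have c: "cst s \<sigma> > 0" using cst_ge1[OF s] by linarith
  define r where "r = min r0 (\<rho>' / 4 / cst s \<sigma>)"
  have r: "r > 0" "r \<le> r0" using r0 c \<rho>' by (auto simp: r_def)
  have "r \<le> \<rho>' / 4 / cst s \<sigma>" by (simp add: r_def)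
  then have rc: "r * cst s \<sigma> \<le> \<rho>' / 4" using c by (simp only: pos_le_divide_eq)
  obtain M where M: "symb_bound s \<sigma> H r M a" using a r by blast
  show ?thesis using r by (intro wigner_BJ_duality[OF s win \<phi> r0(2) M H r(1) wigner_bounds \<rho>' rc]) auto
qed

text \<open>Here the growth rate \<open>r\<close> is given, and the test functions satisfy their
  bounds at every scale. The scale \<open>h\<close> is taken small enough that both Wigner rates
  reach \<open>4 * (r * cst s \<sigma>)\<close>; window and symbol scale are adapted to
  \<open>r\<close> by \<open>gap_small_scale\<close>.\<close>

lemma BJ_upper:
  fixes a :: "(real^'d::finite) \<times> (real^'d) \<Rightarrow> complex"
  assumes s: "s > 0" "\<sigma> > 0" and win: "\<And>A \<rho>. A > 0 \<Longrightarrow> \<rho> > 0 \<Longrightarrow> \<exists>K. window s \<sigma> A \<rho> K \<phi>" and \<phi>: "(LINT \<eta>|lborel. \<phi> \<eta>) = 1"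
    and r: "r > 0" and a: "\<And>H. H > 0 \<Longrightarrow> \<exists>M. symb_bound s \<sigma> H r M a" and fg: "f \<in> GS_Sigma s \<sigma>" "g \<in> GS_Sigma s \<sigma>"
  shows "distribution_of a (wigner_BJ g f) = distribution_of (bj_symbol t \<phi> a) (wigner t g f)"
proof -
  let ?L = "1 + \<bar>t\<bar>"
  let ?c = "2 * (2 + 2 * ?L) powr (1 / s)" and ?R = "4 * (r * cst s \<sigma>)"
  have R: "r * cst s \<sigma> > 0" using r cst_ge1[OF s] by simp
  have c: "?c > 0" by simp
  obtain B1 where B1: "B1 > 0" "\<And>B. 0 < B \<Longrightarrow> B \<le> B1 \<Longrightarrow> rate CARD('d) s B \<ge> ?R * ?c"
    using rate_unbounded[of "CARD('d)" s "?R * ?c"] s by auto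
  obtain B2 where B2: "B2 > 0" "\<And>B. 0 < B \<Longrightarrow> B \<le> B2 \<Longrightarrow> rate CARD('d) \<sigma> B \<ge> ?R"
    using rate_unbounded[of "CARD('d)" \<sigma> ?R] s by auto
  define h where "h = min B1 (B2 / (2 * (1 + ?L)))"
  have h: "h > 0" "h \<le> B1" using B1 B2 by (auto simp: h_def intro!: divide_pos_pos)
  have "h \<le> B2 / (2 * (1 + ?L))" by (simp add: h_def)
  then have h2: "2 * ((1 + ?L) * h) \<le> B2" by (subst (asm) pos_le_divide_eq) (auto simp: mult_ac)
  have h3: "2 * ((1 + ?L) * h) > 0" using h by simp
  define \<rho> where "\<rho> = min (rate CARD('d) s h / ?c) (rate CARD('d) \<sigma> (2 * ((1 + ?L) * h)))"
  have \<rho>: "?R \<le> \<rho>" unfolding \<rho>_def using B1(2)[OF h] B2(2)[OF h3 h2] c by (simp only: min.bounded_iff pos_le_divide_eq)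
  have fin: "gs_norm s \<sigma> h f < \<infinity>" "gs_norm s \<sigma> h g < \<infinity>" and sm: "smooth f" "smooth g"
    using fg h unfolding GS_Sigma_def by blast+
  obtain C1 C2 where "gs_decay s \<sigma> h C1 f" "gs_decay s \<sigma> h C2 g"
    using gs_norm_tb[OF sm(1) fin(1) h(1) order_refl s(1)] gs_norm_tb[OF sm(2) fin(2) h(1) order_refl s(1)] by blast
  then have gs_decay: "gs_decay s \<sigma> h (max C1 C2) f" "gs_decay s \<sigma> h (max C1 C2) g" using h by (auto elim!: gs_decay_mono)
  obtain K where wigner_bounds: "wigner_bounds s \<sigma> ?L \<rho> K g f"
    using wigner_decay[OF s h(1) _ gs_decay(2,1), of ?L] unfolding \<rho>_def by auto
  obtain A \<rho>w where A: "A > 0" "\<rho>w > 0" "gap CARD('d) s \<sigma> ?L A \<rho>w A (r * cst s \<sigma>)"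
    using gap_small_scale[OF s R, of ?L "CARD('d)"] by auto
  obtain Kw where Kw: "window s \<sigma> A \<rho>w Kw \<phi>" using win A by blast
  obtain M where M: "symb_bound s \<sigma> A r M a" using a A by blast
  show ?thesis using \<rho> R by (intro wigner_BJ_duality[OF s Kw \<phi> A(3) M A(1) r wigner_bounds]) auto
qed

theorem theorem6p3:
  fixes s \<sigma> t :: real
  assumes "s > 0" and "\<sigma> > 0" and "s + \<sigma> \<ge> 1"
  shows "(\<forall>a \<in> (Gamma_lower s \<sigma> :: ((real ^ 'd::finite) \<times> (real ^ 'd) \<Rightarrow> complex) set).
            \<exists>b \<in> Gamma_lower s \<sigma>.
              Op_BJ (GS_S s \<sigma>) (distribution_of a) = Op (GS_S s \<sigma>) t (distribution_of b)) \<and>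
         ((s, \<sigma>) \<noteq> (1/2, 1/2) \<longrightarrow>
           (\<forall>a \<in> (Gamma_upper s \<sigma> :: ((real ^ 'd) \<times> (real ^ 'd) \<Rightarrow> complex) set).
              \<exists>b \<in> Gamma_upper s \<sigma>.
                Op_BJ (GS_Sigma s \<sigma>) (distribution_of a) = Op (GS_Sigma s \<sigma>) t (distribution_of b)) \<and>
           (\<forall>a \<in> (Gamma_both s \<sigma> :: ((real ^ 'd) \<times> (real ^ 'd) \<Rightarrow> complex) set).
              \<exists>b \<in> Gamma_both s \<sigma>.
                Op_BJ (GS_S s \<sigma>) (distribution_of a) = Op (GS_S s \<sigma>) t (distribution_of b) \<and>
                Op_BJ (GS_Sigma s \<sigma>) (distribution_of a) = Op (GS_Sigma s \<sigma>) t (distribution_of b)))"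
proof -
  note s = assms(1,2)
  obtain \<phi> :: "real^'d \<Rightarrow> complex" where \<phi>: "(LINT \<eta>|lborel. \<phi> \<eta>) = 1" and "\<exists>A>0. \<exists>\<rho>>0. \<exists>K. window s \<sigma> A \<rho> K \<phi>"
    and win': "s + \<sigma> > 1 \<longrightarrow> (\<forall>A>0. \<forall>\<rho>>0. \<exists>K. window s \<sigma> A \<rho> K \<phi>)"
    using window_exists[OF assms] by blast
  then obtain A \<rho> K where A: "A > 0" "\<rho> > 0" and win: "window s \<sigma> A \<rho> K \<phi>" by blast
  let ?k = "2 powr (s + \<sigma>)"
  have lower: "\<exists>b \<in> Gamma_lower s \<sigma>. Op_BJ (GS_S s \<sigma>) (distribution_of a) = Op (GS_S s \<sigma>) t (distribution_of b)"
    if "a \<in> Gamma_lower s \<sigma>" for a :: "(real^'d) \<times> (real^'d) \<Rightarrow> complex"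
  proof
    obtain H where H: "H > 0" "\<And>r. r > 0 \<Longrightarrow> \<exists>M. symb_bound s \<sigma> H r M a" using \<open>a \<in> _\<close> unfolding Gamma_lower_iff by blast
    have "H * ?k > 0" using H by simp
    then show "bj_symbol t \<phi> a \<in> Gamma_lower s \<sigma>"
      unfolding Gamma_lower_iff using bj_symbol_bnd_small_rate[OF s win A H(1) H(2)] by blast
    show "Op_BJ (GS_S s \<sigma>) (distribution_of a) = Op (GS_S s \<sigma>) t (distribution_of (bj_symbol t \<phi> a))"
      by (rule Op_BJ_eq_OpI) (rule BJ_lower[OF s win A \<phi> H])
  qed
  have both: "\<exists>b \<in> Gamma_both s \<sigma>. Op_BJ (GS_S s \<sigma>) (distribution_of a) = Op (GS_S s \<sigma>) t (distribution_of b) \<and>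
      Op_BJ (GS_Sigma s \<sigma>) (distribution_of a) = Op (GS_Sigma s \<sigma>) t (distribution_of b)"
    if "a \<in> Gamma_both s \<sigma>" for a :: "(real^'d) \<times> (real^'d) \<Rightarrow> complex"
  proof (intro bexI conjI)
    have a: "\<exists>M. symb_bound s \<sigma> H r M a" if "H > 0" "r > 0" for H r using \<open>a \<in> _\<close> that unfolding Gamma_both_iff by blast
    have "\<exists>M. symb_bound s \<sigma> H r M (bj_symbol t \<phi> a)" if "H > 0" "r > 0" for H r
    proof -
      \<comment> \<open>Starting from the scale \<open>H / ?k\<close> makes the loss in
        \<open>bj_symbol_bnd_small_rate\<close> end exactly at \<open>H\<close>.\<close>
      have H: "H / ?k > 0" using that by simp
      from bj_symbol_bnd_small_rate[OF s win A H a[OF H] that(2)] show ?thesis by simp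
    qed
    then show "bj_symbol t \<phi> a \<in> Gamma_both s \<sigma>" unfolding Gamma_both_iff by blast
    \<comment> \<open>The duality needs one scale that is valid for all growth rates; here any scale
      qualifies, and 1 is taken. The identity on the larger test space restricts to the smaller
      one.\<close>
    note eq = BJ_lower[OF s win A \<phi> zero_less_one a[OF zero_less_one]]
    show "Op_BJ (GS_S s \<sigma>) (distribution_of a) = Op (GS_S s \<sigma>) t (distribution_of (bj_symbol t \<phi> a))"
      by (rule Op_BJ_eq_OpI) (rule eq)
    show "Op_BJ (GS_Sigma s \<sigma>) (distribution_of a) = Op (GS_Sigma s \<sigma>) t (distribution_of (bj_symbol t \<phi> a))"
      by (rule Op_BJ_eq_OpI) (use GS_Sigma_subset in \<open>blast intro: eq\<close>)
  qed
  have upper: "\<exists>b \<in> Gamma_upper s \<sigma>. Op_BJ (GS_Sigma s \<sigma>) (distribution_of a) = Op (GS_Sigma s \<sigma>) t (distribution_of b)"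
    if "a \<in> Gamma_upper s \<sigma>" for a :: "(real^'d) \<times> (real^'d) \<Rightarrow> complex"
  proof (cases "s + \<sigma> = 1")
    case True
    have "Op_BJ (GS_Sigma s \<sigma>) (distribution_of a) = Op (GS_Sigma s \<sigma>) t (distribution_of a)"
    proof (rule Op_BJ_eq_OpI)
      fix f g :: "real^'d \<Rightarrow> complex" assume "f \<in> GS_Sigma s \<sigma>"
      then have "f = (\<lambda>_. 0)" using GS_Sigma_trivial[OF s True] by blast
      then have W: "wigner \<tau> g f = (\<lambda>_. 0)" for \<tau> by (simp add: wigner_def fun_eq_iff)
      then have "wigner_BJ g f = (\<lambda>_. 0)" by (simp add: wigner_BJ_def set_lebesgue_integral_def)
      with W show "distribution_of a (wigner_BJ g f) = distribution_of a (wigner t g f)" by simp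
    qed
    with that show ?thesis by blast
  next
    case False
    then have W: "\<exists>K. window s \<sigma> A \<rho> K \<phi>" if "A > 0" "\<rho> > 0" for A \<rho> using win' assms(3) that by auto
    obtain r where r: "r > 0" "\<And>H. H > 0 \<Longrightarrow> \<exists>M. symb_bound s \<sigma> H r M a" using \<open>a \<in> _\<close> unfolding Gamma_upper_iff by blast
    have "r * cst s \<sigma> > 0" using r(1) cst_ge1[OF s] by simp
    then have "bj_symbol t \<phi> a \<in> Gamma_upper s \<sigma>"
      unfolding Gamma_upper_iff using bj_symbol_bnd_small_scale[OF s W r] by blast
    moreover have "Op_BJ (GS_Sigma s \<sigma>) (distribution_of a) = Op (GS_Sigma s \<sigma>) t (distribution_of (bj_symbol t \<phi> a))"
      by (rule Op_BJ_eq_OpI) (rule BJ_upper[OF s W \<phi> r])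
    ultimately show ?thesis by blast
  qed
  from lower upper both show ?thesis by blast
qed

end
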